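(* Let $\mathfrak{g}$ be a symmetrizable Kac--Moody Lie algebra, let $\lambda,\mu,\nu\in P^+$ and $w\in W$. Let $$\mathcal{D}_{\lambda\mu}^{\nu}=\{v\in V(\mu)_{\nu-\lambda}:\ e_i^{\langle\lambda,\alpha_i^\vee\rangle+1}v=0\ \text{ for } i=1,\dots,n\},$$ and let $\pi_w:V(\mu)\twoheadrightarrow V_w(\mu)$ be the orthogonal projection onto the Demazure module $V_w(\mu)$ with respect to the Shapovalov form on $V(\mu)$. Then $\mathcal{D}_{\lambda\mu}^{\nu}(w):=\pi_w(\mathcal{D}_{\lambda\mu}^{\nu})$ satisfies $$\dim \mathcal{D}_{\lambda\mu}^{\nu}(w)=c_{\lambda\mu}^{\nu}(w),$$ where $c_{\lambda\mu}^{\nu}(w)$ is the multiplicity of $V(\nu)$ in the Kostant--Kumar module $K(\lambda,w,\mu)$.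
   Context: Base field $\mathbb{C}$. $\mathfrak{g}=\mathfrak{n}^-\oplus\mathfrak{h}\oplus\mathfrak{n}^+$ is the triangular decomposition, $\mathfrak{b}=\mathfrak{h}\oplus\mathfrak{n}^+$; $\alpha_i$, $\alpha_i^\vee$, $e_i,f_i$ ($i=1,\dots,n$) are the simple roots, simple coroots and Chevalley generators; $W$ is the Weyl group; $P=\{\lambda\in\mathfrak{h}_{\mathbb{R}}^*:\langle\lambda,\alpha_i^\vee\rangle\in\mathbb{Z}\ \forall i\}$ and $P^+$ is its subset of dominant weights; $U\mathfrak{g},U\mathfrak{b}$ are enveloping algebras. For $\lambda\in P^+$, $V(\lambda)$ is the irreducible integrable highest weight module of highest weight $\lambda$, $V(\lambda)_\gamma$ is its $\gamma$-weight space, and for $\sigma\in W$, $v_{\sigma\lambda}$ is a nonzero vector of weight $\sigma\lambda$ in $V(\lambda)$ (unique up to scalar). Shapovalov form: the positive definite Hermitian form on $V(\mu)$ (unique up to positive scaling) with $\langle e_iv,v'\rangle=\langle v,f_iv'\rangle$ for all $i$ and $\langle hv,v'\rangle=\langle v,hv'\rangle$ for $h\in\mathfrak{h}_{\mathbb{R}}$. Demazure module: $V_w(\mu)=U\mathfrak{b}\,v_{w\mu}\subseteq V(\mu)$. Kostant--Kumar module: $K(\lambda,w,\mu)=U\mathfrak{g}\,(v_\lambda\otimes v_{w\mu})\subseteq V(\lambda)\otimes V(\mu)$; it is a direct sum of modules $V(\nu)$, $\nu\in P^+$, and $c_{\lambda\mu}^\nu(w)$ is the multiplicity of $V(\nu)$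 in it. *)

theory Defs
  imports "HOL-Analysis.Analysis" "HOL-Library.Poly_Mapping"
begin

section \<open>Complex vector spaces\<close>

class complex_vector = ab_group_add +
  fixes scaleC :: "complex \<Rightarrow> 'a \<Rightarrow> 'a"  (infixr "*\<^sub>C" 75)
  assumes scaleC_add_right: "a *\<^sub>C (x + y) = a *\<^sub>C x + a *\<^sub>C y"
    and scaleC_add_left: "(a + b) *\<^sub>C x = a *\<^sub>C x + b *\<^sub>C x"
    and scaleC_scaleC: "a *\<^sub>C (b *\<^sub>C x) = (a * b) *\<^sub>C x"
    and scaleC_one: "1 *\<^sub>C x = x"

global_interpretation complex_vector:
  vector_space "scaleC :: complex \<Rightarrow> 'a \<Rightarrow> 'a::complex_vector"
  defines csubspace = complex_vector.subspace
    and cspan = complex_vector.span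
    and cdependent = complex_vector.dependent
    and cextend_basis = complex_vector.extend_basis
    and cdim = complex_vector.dim
  by unfold_locales (rule scaleC_add_right scaleC_add_left scaleC_scaleC scaleC_one)+

instantiation complex :: complex_vector
begin
definition scaleC_complex :: "complex \<Rightarrow> complex \<Rightarrow> complex" where "scaleC_complex = (*)"
instance by standard (simp_all add: scaleC_complex_def algebra_simps)
end

abbreviation clinear :: "('a::complex_vector \<Rightarrow> 'b::complex_vector) \<Rightarrow> bool" where
  "clinear \<equiv> Vector_Spaces.linear scaleC scaleC"

definition fin_dim :: "'a::complex_vector set \<Rightarrow> bool" where
  "fin_dim S \<longleftrightarrow> (\<exists>B. finite B \<and> S \<subseteq> cspan B)"


section \<open>The tensor product of two complex vector spaces\<close>

text \<open>
  The free vector space on \<open>'v \<times> 'w\<close> modulo the bilinearity relations.  Since the relations carry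
  an arbitrary coefficient \<open>c\<close>, closing them under addition already gives a subspace.
\<close>

inductive_set tensor_rel :: "(('v::complex_vector \<times> 'w::complex_vector) \<Rightarrow>\<^sub>0 complex) set" where
  zero: "0 \<in> tensor_rel"
| add: "p \<in> tensor_rel \<Longrightarrow> q \<in> tensor_rel \<Longrightarrow> p + q \<in> tensor_rel"
| add_left: "Poly_Mapping.single (v + v', w) c
     - (Poly_Mapping.single (v, w) c + Poly_Mapping.single (v', w) c) \<in> tensor_rel"
| add_right: "Poly_Mapping.single (v, w + w') c
     - (Poly_Mapping.single (v, w) c + Poly_Mapping.single (v, w') c) \<in> tensor_rel"
| scale_left: "Poly_Mapping.single (a *\<^sub>C v, w) c - Poly_Mapping.single (v, w) (a * c) \<in> tensor_rel"
| scale_right: "Poly_Mapping.single (v, a *\<^sub>C w) c - Poly_Mapping.single (v, w) (a * c) \<in> tensor_rel"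

definition free_scale :: "complex \<Rightarrow> ('k \<Rightarrow>\<^sub>0 complex) \<Rightarrow> ('k \<Rightarrow>\<^sub>0 complex)" where
  "free_scale a = Poly_Mapping.map ((*) a)"

lemma lookup_free_scale: "Poly_Mapping.lookup (free_scale a p) k = a * Poly_Mapping.lookup p k"
  by (simp add: free_scale_def map.rep_eq when_def)

lemma free_scale_single:
  "free_scale a (Poly_Mapping.single k c) = Poly_Mapping.single k (a * c)"
  by (rule poly_mapping_eqI) (simp add: lookup_free_scale lookup_single when_def)

lemma free_scale_add: "free_scale a (p + q) = free_scale a p + free_scale a q"
  by (rule poly_mapping_eqI) (simp add: lookup_free_scale lookup_add algebra_simps)

lemma free_scale_diff: "free_scale a (p - q) = free_scale a p - free_scale a q"
  by (rule poly_mapping_eqI) (simp add: lookup_free_scale lookup_minus algebra_simps)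

lemma free_scale_add_left: "free_scale (a + b) p = free_scale a p + free_scale b p"
  by (rule poly_mapping_eqI) (simp add: lookup_free_scale lookup_add algebra_simps)

lemma free_scale_free_scale: "free_scale a (free_scale b p) = free_scale (a * b) p"
  by (rule poly_mapping_eqI) (simp add: lookup_free_scale)

lemma free_scale_one: "free_scale 1 p = p"
  by (rule poly_mapping_eqI) (simp add: lookup_free_scale)

lemma tensor_rel_scale: "p \<in> tensor_rel \<Longrightarrow> free_scale a p \<in> tensor_rel"
proof (induction rule: tensor_rel.induct)
  case zero
  have "free_scale a 0 = (0 :: 'a \<times> 'b \<Rightarrow>\<^sub>0 complex)"
    by (rule poly_mapping_eqI) (simp add: lookup_free_scale)
  then show ?case by (simp add: tensor_rel.zero)
next
  case (scale_left b v w c)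
  then show ?case
    using tensor_rel.scale_left[of b v w "a * c"]
    by (simp add: free_scale_diff free_scale_single mult.left_commute)
next
  case (scale_right v b w c)
  then show ?case
    using tensor_rel.scale_right[of v b w "a * c"]
    by (simp add: free_scale_diff free_scale_single mult.left_commute)
qed (simp_all add: free_scale_add free_scale_diff free_scale_single tensor_rel.intros)

lemma tensor_rel_uminus: "p \<in> tensor_rel \<Longrightarrow> - p \<in> tensor_rel"
proof -
  have "free_scale (- 1) p = - p"
    by (rule poly_mapping_eqI) (simp add: lookup_free_scale)
  then show "p \<in> tensor_rel \<Longrightarrow> - p \<in> tensor_rel"
    using tensor_rel_scale[of p "- 1"] by simp
qed

quotient_type (overloaded) ('v, 'w) tensor = "('v::complex_vector \<times> 'w::complex_vector) \<Rightarrow>\<^sub>0 complex" /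
  "\<lambda>p q. p - q \<in> tensor_rel"
proof (rule equivpI)
  show "reflp (\<lambda>p q. p - q \<in> (tensor_rel :: ('v \<times> 'w \<Rightarrow>\<^sub>0 complex) set))"
    by (simp add: reflp_def tensor_rel.zero)
  show "symp (\<lambda>p q. p - q \<in> (tensor_rel :: ('v \<times> 'w \<Rightarrow>\<^sub>0 complex) set))"
  proof (rule sympI)
    fix p q :: "'v \<times> 'w \<Rightarrow>\<^sub>0 complex"
    assume "p - q \<in> tensor_rel"
    then have "- (p - q) \<in> tensor_rel" by (rule tensor_rel_uminus)
    then show "q - p \<in> tensor_rel" by simp
  qed
  show "transp (\<lambda>p q. p - q \<in> (tensor_rel :: ('v \<times> 'w \<Rightarrow>\<^sub>0 complex) set))"
  proof (rule transpI)
    fix p q r :: "'v \<times> 'w \<Rightarrow>\<^sub>0 complex"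
    assume "p - q \<in> tensor_rel" "q - r \<in> tensor_rel"
    then have "(p - q) + (q - r) \<in> tensor_rel" by (rule tensor_rel.add)
    then show "p - r \<in> tensor_rel" by simp
  qed
qed

lift_definition pure_tensor :: "'v::complex_vector \<Rightarrow> 'w::complex_vector \<Rightarrow> ('v, 'w) tensor"
  is "\<lambda>v w. Poly_Mapping.single (v, w) 1" .

instantiation tensor :: (complex_vector, complex_vector) complex_vector
begin

lift_definition zero_tensor :: "('a, 'b) tensor" is 0 .

lift_definition plus_tensor :: "('a, 'b) tensor \<Rightarrow> ('a, 'b) tensor \<Rightarrow> ('a, 'b) tensor" is "(+)"
proof -
  fix p p' q q' :: "'a \<times> 'b \<Rightarrow>\<^sub>0 complex"
  assume "p - p' \<in> tensor_rel" "q - q' \<in> tensor_rel"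
  then have "(p - p') + (q - q') \<in> tensor_rel" by (rule tensor_rel.add)
  then show "p + q - (p' + q') \<in> tensor_rel" by (simp add: add_diff_add)
qed

lift_definition uminus_tensor :: "('a, 'b) tensor \<Rightarrow> ('a, 'b) tensor" is uminus
proof -
  fix p p' :: "'a \<times> 'b \<Rightarrow>\<^sub>0 complex"
  assume "p - p' \<in> tensor_rel"
  then have "- (p - p') \<in> tensor_rel" by (rule tensor_rel_uminus)
  then show "- p - - p' \<in> tensor_rel" by simp
qed

lift_definition minus_tensor :: "('a, 'b) tensor \<Rightarrow> ('a, 'b) tensor \<Rightarrow> ('a, 'b) tensor" is "(-)"
proof -
  fix p p' q q' :: "'a \<times> 'b \<Rightarrow>\<^sub>0 complex"
  assume "p - p' \<in> tensor_rel" "q - q' \<in> tensor_rel"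
  then have "(p - p') + - (q - q') \<in> tensor_rel"
    by (intro tensor_rel.add tensor_rel_uminus)
  then show "p - q - (p' - q') \<in> tensor_rel"
    by (simp add: algebra_simps)
qed

lift_definition scaleC_tensor :: "complex \<Rightarrow> ('a, 'b) tensor \<Rightarrow> ('a, 'b) tensor" is free_scale
  by (simp add: free_scale_diff [symmetric] tensor_rel_scale)

instance
proof
  fix a b :: complex and x y z :: "('a, 'b) tensor"
  show "x + y + z = x + (y + z)"
    by transfer (simp add: algebra_simps tensor_rel.zero)
  show "x + y = y + x"
    by transfer (simp add: algebra_simps tensor_rel.zero)
  show "0 + x = x"
    by transfer (simp add: tensor_rel.zero)
  show "- x + x = 0"
    by transfer (simp add: tensor_rel.zero)
  show "x - y = x + - y"
    by transfer (simp add: tensor_rel.zero)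
  show "a *\<^sub>C (x + y) = a *\<^sub>C x + a *\<^sub>C y"
    by transfer (simp add: free_scale_add tensor_rel.zero)
  show "(a + b) *\<^sub>C x = a *\<^sub>C x + b *\<^sub>C x"
    by transfer (simp add: free_scale_add_left tensor_rel.zero)
  show "a *\<^sub>C b *\<^sub>C x = (a * b) *\<^sub>C x"
    by transfer (simp add: free_scale_free_scale tensor_rel.zero)
  show "1 *\<^sub>C x = x"
    by transfer (simp add: free_scale_one tensor_rel.zero)
qed

end


section \<open>Kac--Moody algebras\<close>

text \<open>
  \<open>'i\<close> indexes the simple roots, \<open>'h\<close> is the Cartan subalgebra and \<open>'g\<close> the Lie algebra;
  \<open>cartan\<close> is the inclusion of \<open>'h\<close> into \<open>'g\<close>, and \<open>real_form\<close> is the real form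
  \<open>h_R\<close> of \<open>'h\<close>, on which weights take real values.
\<close>

record ('i, 'h, 'g) km_data =
  gcm :: "'i \<Rightarrow> 'i \<Rightarrow> int"
  simple_root :: "'i \<Rightarrow> 'h \<Rightarrow> complex"
  simple_coroot :: "'i \<Rightarrow> 'h"
  real_form :: "'h set"
  bracket :: "'g \<Rightarrow> 'g \<Rightarrow> 'g"
  cartan :: "'h \<Rightarrow> 'g"
  chev_e :: "'i \<Rightarrow> 'g"
  chev_f :: "'i \<Rightarrow> 'g"

definition is_gcm :: "('i \<Rightarrow> 'i \<Rightarrow> int) \<Rightarrow> bool" where
  "is_gcm A \<longleftrightarrow> (\<forall>i. A i i = 2) \<and> (\<forall>i j. i \<noteq> j \<longrightarrow> A i j \<le> 0)
     \<and> (\<forall>i j. A i j = 0 \<longrightarrow> A j i = 0)"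

text \<open>\<open>A\<close> is the product of an invertible diagonal matrix and a symmetric one.\<close>

definition symmetrizable :: "('i \<Rightarrow> 'i \<Rightarrow> int) \<Rightarrow> bool" where
  "symmetrizable A \<longleftrightarrow> (\<exists>(d :: 'i \<Rightarrow> complex) B. (\<forall>i. d i \<noteq> 0) \<and> (\<forall>i j. B i j = B j i)
     \<and> (\<forall>i j. of_int (A i j) = d i * B i j))"

text \<open>
  In the dimension clause, \<open>cdim\<close> of an infinite-dimensional space is 0; as the rank is at most
  \<open>CARD('i)\<close>, the clause also forces \<open>'h\<close> to be finite-dimensional.
\<close>

definition realization :: "('i::finite, 'h::complex_vector, 'g) km_data \<Rightarrow> bool" where
  "realization D \<longleftrightarrow>
     (\<forall>i. clinear (simple_root D i))
   \<and> (\<forall>i j. simple_root D j (simple_coroot D i) = of_int (gcm D i j))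
   \<and> (\<forall>c. (\<forall>h. (\<Sum>i\<in>UNIV. c i * simple_root D i h) = 0) \<longrightarrow> (\<forall>i. c i = 0))
   \<and> (\<forall>c. (\<Sum>i\<in>UNIV. c i *\<^sub>C simple_coroot D i) = 0 \<longrightarrow> (\<forall>i. c i = 0))
   \<and> cdim (UNIV :: 'h set) + rank (\<chi> i j. of_int (gcm D i j) :: complex^'i^'i) = 2 * CARD('i)"

definition is_real_form :: "('i, 'h::complex_vector, 'g) km_data \<Rightarrow> bool" where
  "is_real_form D \<longleftrightarrow>
     0 \<in> real_form D
   \<and> (\<forall>x\<in>real_form D. \<forall>y\<in>real_form D. x + y \<in> real_form D)
   \<and> (\<forall>r :: real. \<forall>x\<in>real_form D. of_real r *\<^sub>C x \<in> real_form D)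
   \<and> (\<forall>h. \<exists>!p. fst p \<in> real_form D \<and> snd p \<in> real_form D \<and> h = fst p + \<i> *\<^sub>C snd p)
   \<and> (\<forall>i. simple_coroot D i \<in> real_form D)
   \<and> (\<forall>i. \<forall>h\<in>real_form D. simple_root D i h \<in> \<real>)"

definition lie_algebra :: "('g::complex_vector \<Rightarrow> 'g \<Rightarrow> 'g) \<Rightarrow> bool" where
  "lie_algebra br \<longleftrightarrow>
     (\<forall>x. clinear (br x)) \<and> (\<forall>y. clinear (\<lambda>x. br x y))
   \<and> (\<forall>x. br x x = 0)
   \<and> (\<forall>x y z. br x (br y z) + br y (br z x) + br z (br x y) = 0)"

text \<open>
  Kac's definition: \<open>g(A)\<close> is the quotient, by the largest ideal meeting \<open>h\<close> trivially, of
  the Lie algebra \<open>g~(A)\<close> with generators \<open>e_i\<close>, \<open>f_i\<close>, \<open>h\<close> and relations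
  \<open>[e_i, f_j] = \<delta>_ij \<alpha>_i^\<or>\<close>, \<open>[h, h'] = 0\<close>, \<open>[h, e_i] = \<alpha>_i(h) e_i\<close>,
  \<open>[h, f_i] = - \<alpha>_i(h) f_i\<close>.  The algebra \<open>g~(A)\<close> is represented by formal Lie expressions
  in the generators modulo the congruence \<open>km_eq\<close> generated by the vector space axioms, the
  Lie algebra axioms, linearity of the generators in \<open>h\<close>, and these relations.
\<close>

datatype ('i, 'h) lie_term =
    GenE 'i | GenF 'i | GenH 'h
  | TZero
  | TPlus "('i, 'h) lie_term" "('i, 'h) lie_term"
  | TScale complex "('i, 'h) lie_term"
  | TBr "('i, 'h) lie_term" "('i, 'h) lie_term"

inductive km_eq :: "('i, 'h::complex_vector, 'g) km_data \<Rightarrow>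
    ('i, 'h) lie_term \<Rightarrow> ('i, 'h) lie_term \<Rightarrow> bool" for D where
  refl: "km_eq D t t"
| sym: "km_eq D s t \<Longrightarrow> km_eq D t s"
| trans: "km_eq D s t \<Longrightarrow> km_eq D t u \<Longrightarrow> km_eq D s u"
| cong_plus: "km_eq D s s' \<Longrightarrow> km_eq D t t' \<Longrightarrow> km_eq D (TPlus s t) (TPlus s' t')"
| cong_scale: "km_eq D t t' \<Longrightarrow> km_eq D (TScale a t) (TScale a t')"
| cong_br: "km_eq D s s' \<Longrightarrow> km_eq D t t' \<Longrightarrow> km_eq D (TBr s t) (TBr s' t')"
| plus_assoc: "km_eq D (TPlus (TPlus s t) u) (TPlus s (TPlus t u))"
| plus_comm: "km_eq D (TPlus s t) (TPlus t s)"
| plus_zero: "km_eq D (TPlus TZero t) t"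
| plus_neg: "km_eq D (TPlus t (TScale (- 1) t)) TZero"
| scale_plus: "km_eq D (TScale a (TPlus s t)) (TPlus (TScale a s) (TScale a t))"
| plus_scale: "km_eq D (TScale (a + b) t) (TPlus (TScale a t) (TScale b t))"
| scale_scale: "km_eq D (TScale a (TScale b t)) (TScale (a * b) t)"
| scale_one: "km_eq D (TScale 1 t) t"
| br_plus_left: "km_eq D (TBr (TPlus s t) u) (TPlus (TBr s u) (TBr t u))"
| br_plus_right: "km_eq D (TBr s (TPlus t u)) (TPlus (TBr s t) (TBr s u))"
| br_scale_left: "km_eq D (TBr (TScale a s) t) (TScale a (TBr s t))"
| br_scale_right: "km_eq D (TBr s (TScale a t)) (TScale a (TBr s t))"
| br_self: "km_eq D (TBr t t) TZero"
| jacobi: "km_eq D (TPlus (TBr s (TBr t u)) (TPlus (TBr t (TBr u s)) (TBr u (TBr s t)))) TZero"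
| h_plus: "km_eq D (GenH (h + h')) (TPlus (GenH h) (GenH h'))"
| h_scale: "km_eq D (GenH (a *\<^sub>C h)) (TScale a (GenH h))"
| rel_hh: "km_eq D (TBr (GenH h) (GenH h')) TZero"
| rel_he: "km_eq D (TBr (GenH h) (GenE i)) (TScale (simple_root D i h) (GenE i))"
| rel_hf: "km_eq D (TBr (GenH h) (GenF i)) (TScale (- simple_root D i h) (GenF i))"
| rel_ef: "km_eq D (TBr (GenE i) (GenF i)) (GenH (simple_coroot D i))"
| rel_ef_neq: "i \<noteq> j \<Longrightarrow> km_eq D (TBr (GenE i) (GenF j)) TZero"

definition km_ideal :: "('i, 'h::complex_vector, 'g) km_data \<Rightarrow> ('i, 'h) lie_term set \<Rightarrow> bool" where
  "km_ideal D I \<longleftrightarrow>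
     (\<forall>s t. s \<in> I \<and> km_eq D s t \<longrightarrow> t \<in> I)
   \<and> TZero \<in> I \<and> (\<forall>s\<in>I. \<forall>t\<in>I. TPlus s t \<in> I) \<and> (\<forall>a. \<forall>t\<in>I. TScale a t \<in> I)
   \<and> (\<forall>s. \<forall>t\<in>I. TBr s t \<in> I)"

text \<open>
  The largest ideal meeting \<open>h\<close> trivially, obtained as the union of all such ideals.
\<close>

definition km_radical :: "('i, 'h::complex_vector, 'g) km_data \<Rightarrow> ('i, 'h) lie_term set" where
  "km_radical D = \<Union> {I. km_ideal D I \<and> (\<forall>h. GenH h \<in> I \<longrightarrow> km_eq D (GenH h) TZero)}"

fun lie_eval :: "('i, 'h, 'g::complex_vector) km_data \<Rightarrow> ('i, 'h) lie_term \<Rightarrow> 'g" where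
  "lie_eval D (GenE i) = chev_e D i"
| "lie_eval D (GenF i) = chev_f D i"
| "lie_eval D (GenH h) = cartan D h"
| "lie_eval D TZero = 0"
| "lie_eval D (TPlus s t) = lie_eval D s + lie_eval D t"
| "lie_eval D (TScale a t) = a *\<^sub>C lie_eval D t"
| "lie_eval D (TBr s t) = bracket D (lie_eval D s) (lie_eval D t)"

text \<open>
  The last two clauses say that \<open>lie_eval\<close> induces an isomorphism of \<open>g~(A) / km_radical\<close>
  onto \<open>'g\<close>.
\<close>

definition kac_moody :: "('i::finite, 'h::complex_vector, 'g::complex_vector) km_data \<Rightarrow> bool" where
  "kac_moody D \<longleftrightarrow> is_gcm (gcm D) \<and> realization D \<and> is_real_form D
     \<and> lie_algebra (bracket D)
     \<and> surj (lie_eval D) \<and> (\<forall>t. lie_eval D t = 0 \<longleftrightarrow> t \<in> km_radical D)"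

definition lie_generated :: "('g::complex_vector \<Rightarrow> 'g \<Rightarrow> 'g) \<Rightarrow> 'g set \<Rightarrow> 'g set" where
  "lie_generated br X = \<Inter> {L. csubspace L \<and> (\<forall>x\<in>L. \<forall>y\<in>L. br x y \<in> L) \<and> X \<subseteq> L}"

definition n_plus :: "('i, 'h, 'g::complex_vector) km_data \<Rightarrow> 'g set" where
  "n_plus D = lie_generated (bracket D) (range (chev_e D))"

definition borel_sub :: "('i, 'h, 'g::complex_vector) km_data \<Rightarrow> 'g set" where
  "borel_sub D = {cartan D h + x | h x. x \<in> n_plus D}"

definition weight_lattice :: "('i, 'h::complex_vector, 'g) km_data \<Rightarrow> ('h \<Rightarrow> complex) set" where
  "weight_lattice D = {\<gamma>. clinear \<gamma> \<and> (\<forall>h\<in>real_form D. \<gamma> h \<in> \<real>) \<and> (\<forall>i. \<gamma> (simple_coroot D i) \<in> \<int>)}"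

definition dominant_weights :: "('i, 'h::complex_vector, 'g) km_data \<Rightarrow> ('h \<Rightarrow> complex) set" where
  "dominant_weights D = {\<gamma> \<in> weight_lattice D. \<forall>i. 0 \<le> Re (\<gamma> (simple_coroot D i))}"

definition simple_reflection ::
    "('i, 'h, 'g) km_data \<Rightarrow> 'i \<Rightarrow> ('h \<Rightarrow> complex) \<Rightarrow> ('h \<Rightarrow> complex)" where
  "simple_reflection D i \<gamma> = (\<lambda>h. \<gamma> h - \<gamma> (simple_coroot D i) * simple_root D i h)"

text \<open>The simple reflections are involutions on linear functionals, so products suffice.\<close>

inductive_set weyl_group :: "('i, 'h, 'g) km_data \<Rightarrow> (('h \<Rightarrow> complex) \<Rightarrow> ('h \<Rightarrow> complex)) set"
  for D where
  id: "id \<in> weyl_group D"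
| mult: "w \<in> weyl_group D \<Longrightarrow> simple_reflection D i \<circ> w \<in> weyl_group D"


section \<open>Representations\<close>

text \<open>
  A representation lives on a subspace \<open>rep_space\<close> of the ambient type; the values of
  \<open>rep_act\<close> outside of it are irrelevant.
\<close>

record ('g, 'v) rep =
  rep_space :: "'v set"
  rep_act :: "'g \<Rightarrow> 'v \<Rightarrow> 'v"

definition is_rep :: "('g::complex_vector \<Rightarrow> 'g \<Rightarrow> 'g) \<Rightarrow> ('g, 'v::complex_vector) rep \<Rightarrow> bool" where
  "is_rep br R \<longleftrightarrow> csubspace (rep_space R)
   \<and> (\<forall>x. \<forall>v\<in>rep_space R. rep_act R x v \<in> rep_space R)
   \<and> (\<forall>x. \<forall>v\<in>rep_space R. \<forall>v'\<in>rep_space R. rep_act R x (v + v') = rep_act R x v + rep_act R x v')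
   \<and> (\<forall>x a. \<forall>v\<in>rep_space R. rep_act R x (a *\<^sub>C v) = a *\<^sub>C rep_act R x v)
   \<and> (\<forall>x y. \<forall>v\<in>rep_space R. rep_act R (x + y) v = rep_act R x v + rep_act R y v)
   \<and> (\<forall>x a. \<forall>v\<in>rep_space R. rep_act R (a *\<^sub>C x) v = a *\<^sub>C rep_act R x v)
   \<and> (\<forall>x y. \<forall>v\<in>rep_space R.
        rep_act R (br x y) v = rep_act R x (rep_act R y v) - rep_act R y (rep_act R x v))"

definition submodule :: "('g, 'v::complex_vector) rep \<Rightarrow> 'v set \<Rightarrow> bool" where
  "submodule R M \<longleftrightarrow> csubspace M \<and> M \<subseteq> rep_space R \<and> (\<forall>x. \<forall>v\<in>M. rep_act R x v \<in> M)"

definition irreducible_rep :: "('g, 'v::complex_vector) rep \<Rightarrow> bool" where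
  "irreducible_rep R \<longleftrightarrow> rep_space R \<noteq> {0} \<and> (\<forall>M. submodule R M \<longrightarrow> M = {0} \<or> M = rep_space R)"

definition rep_iso :: "('g, 'v::complex_vector) rep \<Rightarrow> ('g, 'w::complex_vector) rep \<Rightarrow> bool" where
  "rep_iso R S \<longleftrightarrow> (\<exists>\<phi>. bij_betw \<phi> (rep_space R) (rep_space S)
   \<and> (\<forall>v\<in>rep_space R. \<forall>v'\<in>rep_space R. \<phi> (v + v') = \<phi> v + \<phi> v')
   \<and> (\<forall>a. \<forall>v\<in>rep_space R. \<phi> (a *\<^sub>C v) = a *\<^sub>C \<phi> v)
   \<and> (\<forall>x. \<forall>v\<in>rep_space R. \<phi> (rep_act R x v) = rep_act S x (\<phi> v)))"

text \<open>
  For a Lie subalgebra \<open>S\<close>, this is \<open>U(S) v\<close>: the enveloping algebra of \<open>S\<close> is spanned by the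
  products of elements of \<open>S\<close>.
\<close>

definition env_orbit :: "('g, 'v::complex_vector) rep \<Rightarrow> 'g set \<Rightarrow> 'v \<Rightarrow> 'v set" where
  "env_orbit R S v = cspan {foldr (rep_act R) xs v | xs. set xs \<subseteq> S}"

definition weight_space ::
    "('i, 'h, 'g) km_data \<Rightarrow> ('g, 'v::complex_vector) rep \<Rightarrow> ('h \<Rightarrow> complex) \<Rightarrow> 'v set" where
  "weight_space D R \<gamma> = {v \<in> rep_space R. \<forall>h. rep_act R (cartan D h) v = \<gamma> h *\<^sub>C v}"

definition integrable_rep :: "('i, 'h::complex_vector, 'g) km_data \<Rightarrow> ('g, 'v::complex_vector) rep \<Rightarrow> bool" where
  "integrable_rep D R \<longleftrightarrow>
     cspan (\<Union>\<gamma>\<in>{\<gamma>. clinear \<gamma>}. weight_space D R \<gamma>) = rep_space R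
   \<and> (\<forall>i. \<forall>v\<in>rep_space R. \<exists>k. (rep_act R (chev_e D i) ^^ k) v = 0)
   \<and> (\<forall>i. \<forall>v\<in>rep_space R. \<exists>k. (rep_act R (chev_f D i) ^^ k) v = 0)"

definition highest_weight_rep ::
    "('i, 'h, 'g::complex_vector) km_data \<Rightarrow> ('h \<Rightarrow> complex) \<Rightarrow> ('g, 'v::complex_vector) rep \<Rightarrow> bool" where
  "highest_weight_rep D \<gamma> R \<longleftrightarrow> (\<exists>v\<in>weight_space D R \<gamma>. v \<noteq> 0
     \<and> (\<forall>x\<in>n_plus D. rep_act R x v = 0) \<and> env_orbit R UNIV v = rep_space R)"

text \<open>\<open>R\<close> is (a model of) the module \<open>V(\<gamma>)\<close>.\<close>

definition irr_integrable_hw ::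
    "('i, 'h::complex_vector, 'g::complex_vector) km_data \<Rightarrow> ('h \<Rightarrow> complex) \<Rightarrow>
     ('g, 'v::complex_vector) rep \<Rightarrow> bool" where
  "irr_integrable_hw D \<gamma> R \<longleftrightarrow> is_rep (bracket D) R \<and> irreducible_rep R
     \<and> integrable_rep D R \<and> highest_weight_rep D \<gamma> R"

definition shapovalov_form ::
    "('i, 'h::complex_vector, 'g) km_data \<Rightarrow> ('g, 'v::complex_vector) rep \<Rightarrow>
     ('v \<Rightarrow> 'v \<Rightarrow> complex) \<Rightarrow> bool" where
  "shapovalov_form D R B \<longleftrightarrow>
     (\<forall>u\<in>rep_space R. \<forall>v\<in>rep_space R. \<forall>v'\<in>rep_space R. B (u + v) v' = B u v' + B v v')
   \<and> (\<forall>a. \<forall>v\<in>rep_space R. \<forall>v'\<in>rep_space R. B (a *\<^sub>C v) v' = a * B v v')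
   \<and> (\<forall>v\<in>rep_space R. \<forall>v'\<in>rep_space R. B v' v = cnj (B v v'))
   \<and> (\<forall>v\<in>rep_space R. v \<noteq> 0 \<longrightarrow> 0 < Re (B v v))
   \<and> (\<forall>i. \<forall>v\<in>rep_space R. \<forall>v'\<in>rep_space R.
        B (rep_act R (chev_e D i) v) v' = B v (rep_act R (chev_f D i) v'))
   \<and> (\<forall>h\<in>real_form D. \<forall>v\<in>rep_space R. \<forall>v'\<in>rep_space R.
        B (rep_act R (cartan D h) v) v' = B v (rep_act R (cartan D h) v'))"

definition orth_proj :: "('v \<Rightarrow> 'v \<Rightarrow> complex) \<Rightarrow> 'v set \<Rightarrow> 'v::complex_vector \<Rightarrow> 'v" where
  "orth_proj B S v = (THE u. u \<in> S \<and> (\<forall>s\<in>S. B (v - u) s = 0))"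

text \<open>
  The action on \<open>R \<otimes> S\<close> with \<open>x (v \<otimes> w) = x v \<otimes> w + v \<otimes> x w\<close>, computed from any expression of
  the argument as a sum of pure tensors of elements of the two representation spaces.
\<close>

definition tensor_rep ::
    "('g, 'v::complex_vector) rep \<Rightarrow> ('g, 'w::complex_vector) rep \<Rightarrow> ('g, ('v, 'w) tensor) rep" where
  "tensor_rep R S =
     \<lparr> rep_space = cspan {pure_tensor v w | v w. v \<in> rep_space R \<and> w \<in> rep_space S},
       rep_act = (\<lambda>x t. THE u. \<exists>ps. set ps \<subseteq> rep_space R \<times> rep_space S
         \<and> t = (\<Sum>(v, w)\<leftarrow>ps. pure_tensor v w)
         \<and> u = (\<Sum>(v, w)\<leftarrow>ps. pure_tensor (rep_act R x v) w + pure_tensor v (rep_act S x w))) \<rparr>"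


section \<open>Demazure modules, Kostant--Kumar modules, multiplicities\<close>

text \<open>\<open>V_w(\<mu>)\<close>, where \<open>v\<close> is the extremal weight vector of weight \<open>w \<mu>\<close>.\<close>

definition demazure ::
    "('i, 'h, 'g::complex_vector) km_data \<Rightarrow> ('g, 'v::complex_vector) rep \<Rightarrow> 'v \<Rightarrow> 'v set" where
  "demazure D R v = env_orbit R (borel_sub D) v"

definition kostant_kumar ::
    "('g::complex_vector, 'v::complex_vector) rep \<Rightarrow> ('g, 'w::complex_vector) rep \<Rightarrow> 'v \<Rightarrow> 'w \<Rightarrow>
     ('g, ('v, 'w) tensor) rep" where
  "kostant_kumar R S v w =
     (tensor_rep R S) \<lparr> rep_space := env_orbit (tensor_rep R S) UNIV (pure_tensor v w) \<rparr>"

text \<open>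
  \<open>V\<close> is a family of models of the modules \<open>V(\<gamma>)\<close>, indexed by the dominant weights;
  \<open>hw_decomposition D V R \<S>\<close> says that \<open>R\<close> is the (internal) direct sum of the submodules in
  \<open>\<S>\<close>, each isomorphic to some \<open>V(\<gamma>)\<close>.
\<close>

definition hw_decomposition ::
    "('i, 'h::complex_vector, 'g) km_data \<Rightarrow> (('h \<Rightarrow> complex) \<Rightarrow> ('g, 'v::complex_vector) rep) \<Rightarrow>
     ('g, 'w::complex_vector) rep \<Rightarrow> 'w set set \<Rightarrow> bool" where
  "hw_decomposition D V R \<S> \<longleftrightarrow>
     (\<forall>M\<in>\<S>. submodule R M \<and> (\<exists>\<gamma>\<in>dominant_weights D. rep_iso (R \<lparr> rep_space := M \<rparr>) (V \<gamma>)))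
   \<and> cspan (\<Union>\<S>) = rep_space R
   \<and> (\<forall>M\<in>\<S>. M \<inter> cspan (\<Union>(\<S> - {M})) = {0})"

definition rep_multiplicity ::
    "('i, 'h::complex_vector, 'g) km_data \<Rightarrow> (('h \<Rightarrow> complex) \<Rightarrow> ('g, 'v::complex_vector) rep) \<Rightarrow>
     ('g, 'w::complex_vector) rep \<Rightarrow> ('h \<Rightarrow> complex) \<Rightarrow> nat" where
  "rep_multiplicity D V R \<nu> = (THE c. \<exists>\<S>. hw_decomposition D V R \<S>
     \<and> finite {M \<in> \<S>. rep_iso (R \<lparr> rep_space := M \<rparr>) (V \<nu>)}
     \<and> card {M \<in> \<S>. rep_iso (R \<lparr> rep_space := M \<rparr>) (V \<nu>)} = c)"

text \<open>\<open>R\<close> plays the role of \<open>V(\<mu>)\<close>; for dominant \<open>lam\<close> there is exactly one \<open>m\<close> for each \<open>i\<close>.\<close>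

definition D_space ::
    "('i, 'h, 'g) km_data \<Rightarrow> ('g, 'v::complex_vector) rep \<Rightarrow>
     ('h \<Rightarrow> complex) \<Rightarrow> ('h \<Rightarrow> complex) \<Rightarrow> 'v set" where
  "D_space D R lam nu = {v \<in> weight_space D R (\<lambda>h. nu h - lam h).
     \<forall>i. \<forall>m::nat. lam (simple_coroot D i) = of_nat m \<longrightarrow> (rep_act R (chev_e D i) ^^ (m + 1)) v = 0}"

text \<open>\<open>B\<close> is the Shapovalov form on \<open>R\<close>, and \<open>v\<close> the extremal weight vector generating the Demazure module.\<close>

definition D_space_w ::
    "('i, 'h, 'g::complex_vector) km_data \<Rightarrow> ('g, 'v::complex_vector) rep \<Rightarrow> ('v \<Rightarrow> 'v \<Rightarrow> complex) \<Rightarrow>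
     'v \<Rightarrow> ('h \<Rightarrow> complex) \<Rightarrow> ('h \<Rightarrow> complex) \<Rightarrow> 'v set" where
  "D_space_w D R B v lam nu = orth_proj B (demazure D R v) ` D_space D R lam nu"

end

theory Submission
  imports Defs
begin

text \<open>
  The multiplicity of \<open>V(\<nu>)\<close> in a submodule \<open>X\<close> of \<open>T = V(\<lambda>) \<otimes> V(\<mu>)\<close> is the dimension of the space of
  singular vectors of weight \<open>\<nu>\<close> in \<open>X\<close>, because the product of the Shapovalov forms is a positive
  definite contravariant form on \<open>T\<close>.  Contracting the first factor with \<open>v_\<lambda>\<close> gives
  \<open>\<phi> : T \<rightarrow> V(\<mu>)\<close>, \<open>x \<otimes> y \<mapsto> \<langle>x, v_\<lambda>\<rangle> y\<close>, which is adjoint to \<open>z \<mapsto> v_\<lambda> \<otimes> z\<close>.  It maps the singular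
  vectors of weight \<open>\<nu>\<close> onto \<open>\<D>\<close>: from \<open>y \<in> \<D>\<close> one defines a functional on \<open>T\<close> that kills the images
  of the \<open>f_i\<close>, and the vector representing it is singular.  The functional is well defined because
  the annihilator of \<open>v_\<lambda>\<close> is generated by the powers \<open>f_i^(\<langle>\<lambda>, \<alpha>_i^\<or>\<rangle> + 1)\<close>; this is where the Casimir
  operator, hence symmetrizability, enters.

  A singular vector \<open>s\<close> is orthogonal to the Kostant--Kumar module \<open>K\<close> if and only if \<open>\<phi> s\<close> is
  orthogonal to the Demazure module, since \<open>K\<close> is spanned by the products of \<open>f_i\<close>'s applied to
  \<open>v_\<lambda> \<otimes> V_w(\<mu>)\<close>.  Hence \<open>\<pi>_w \<circ> \<phi>\<close> is injective on the singular vectors in \<open>K\<close> and annihilates those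
  orthogonal to \<open>K\<close>, so that it maps the former isomorphically onto \<open>\<pi>_w(\<D>)\<close>.
\<close>

subsection \<open>Linear algebra\<close>

text \<open>The algebra is given only as Lie terms modulo the largest ideal meeting the Cartan
  subalgebra trivially. To show that something vanishes, one therefore places it in an ideal without
  nonzero Cartan elements; the Serre elements and the radical of the invariant pairing are handled
  this way. Enveloping algebras are replaced by words in the \<open>f_i\<close>, and by the free
  Verma module on these words, on which the Lie terms act although the algebra itself need not.

  The obstacle is that the annihilator of \<open>v_\<lambda>\<close> is known only as the kernel of
  the map \<open>ev\<close> from words to vectors. Instead of presenting it by generators directly,
  one takes a functional \<open>\<eta>\<close> on words that kills the powers in question and
  divides the free Verma module by the submodule \<open>N\<close> on which \<open>ev\<close> and all
  translates of \<open>\<eta>\<close> vanish. The quotient is an integrable module of the algebra;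
  the Casimir operator shows that it is irreducible, so \<open>N\<close> is the whole kernel of
  \<open>ev\<close>, and \<open>\<eta>\<close> vanishes there. Complete reducibility of the tensor
  product rests instead on positive definite contravariant forms.\<close>

lemma clinearI:
  fixes f :: "'a::complex_vector \<Rightarrow> 'b::complex_vector"
  assumes "\<And>x y. f (x + y) = f x + f y" and "\<And>c x. f (c *\<^sub>C x) = c *\<^sub>C f x"
  shows "clinear f"
  using assms by (unfold_locales) (auto simp: algebra_simps)

lemma clinear_iff:
  "clinear f \<longleftrightarrow> (\<forall>x y. f (x + y) = f x + f y) \<and> (\<forall>c x. f (c *\<^sub>C x) = c *\<^sub>C f x)"
  for f :: "'a::complex_vector \<Rightarrow> 'b::complex_vector"
  by (intro iffI clinearI) (blast dest: Vector_Spaces.linear_iff[THEN iffD1])+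

lemma clinear_add: "clinear f \<Longrightarrow> f (x + y) = f x + f y"
  and clinear_scale: "clinear f \<Longrightarrow> f (c *\<^sub>C x) = c *\<^sub>C f x"
  for f :: "'a::complex_vector \<Rightarrow> 'b::complex_vector"
  by (auto simp: clinear_iff)

lemma scaleC_complex [simp]: "(a::complex) *\<^sub>C b = a * b"
  by (simp add: scaleC_complex_def)

lemma scaleC_zero_left [simp]: "0 *\<^sub>C x = 0"
  and scaleC_zero_right [simp]: "a *\<^sub>C 0 = 0"
  and scaleC_minus_left [simp]: "(- a) *\<^sub>C x = - (a *\<^sub>C x)"
  and scaleC_minus_right [simp]: "a *\<^sub>C (- x) = - (a *\<^sub>C x)"
  and scaleC_diff_right: "a *\<^sub>C (x - y) = a *\<^sub>C x - a *\<^sub>C y"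
  and scaleC_diff_left: "(a - b) *\<^sub>C x = a *\<^sub>C x - b *\<^sub>C x"
  and scaleC_sum_right: "a *\<^sub>C sum g A = (\<Sum>i\<in>A. a *\<^sub>C g i)"
  and scaleC_eq_0_iff [simp]: "a *\<^sub>C x = 0 \<longleftrightarrow> a = 0 \<or> x = 0"
  for x :: "'a::complex_vector"
  by (simp_all add: complex_vector.scale_minus_left complex_vector.scale_minus_right
      complex_vector.scale_right_diff_distrib complex_vector.scale_left_diff_distrib
      complex_vector.scale_sum_right)

declare scaleC_one [simp] scaleC_scaleC [simp]

lemmas scaleC_distribs = scaleC_add_right scaleC_add_left scaleC_diff_right scaleC_diff_left

lemma clinear_0: "clinear f \<Longrightarrow> f 0 = 0"
  for f :: "'a::complex_vector \<Rightarrow> 'b::complex_vector"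
  using clinear_scale[of f 0 0] by simp

lemma clinear_minus: "clinear f \<Longrightarrow> f (- x) = - f x"
  for f :: "'a::complex_vector \<Rightarrow> 'b::complex_vector"
  using clinear_scale[of f "- 1" x] by simp

lemma clinear_diff: "clinear f \<Longrightarrow> f (x - y) = f x - f y"
  for f :: "'a::complex_vector \<Rightarrow> 'b::complex_vector"
  using clinear_add[of f x "- y"] by (simp add: clinear_minus)

lemma clinear_sum: "clinear f \<Longrightarrow> f (sum g A) = (\<Sum>x\<in>A. f (g x))"
  for f :: "'a::complex_vector \<Rightarrow> 'b::complex_vector"
  by (induction A rule: infinite_finite_induct) (simp_all add: clinear_add clinear_0)

lemma clinear_compose: "clinear f \<Longrightarrow> clinear g \<Longrightarrow> clinear (\<lambda>x. f (g x))"
  for f :: "'b::complex_vector \<Rightarrow> 'c::complex_vector" and g :: "'a::complex_vector \<Rightarrow> 'b"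
  by (simp add: clinear_iff)

lemma csubspaceI:
  "0 \<in> S \<Longrightarrow> (\<And>x y. x \<in> S \<Longrightarrow> y \<in> S \<Longrightarrow> x + y \<in> S) \<Longrightarrow> (\<And>c x. x \<in> S \<Longrightarrow> c *\<^sub>C x \<in> S)
    \<Longrightarrow> csubspace S"
  by (rule complex_vector.subspaceI)

lemmas csubspace_0 = complex_vector.subspace_0
  and csubspace_add = complex_vector.subspace_add
  and csubspace_scale = complex_vector.subspace_scale
  and csubspace_neg = complex_vector.subspace_neg
  and csubspace_diff = complex_vector.subspace_diff
  and csubspace_sum = complex_vector.subspace_sum
  and csubspace_cspan = complex_vector.subspace_span
  and cspan_base = complex_vector.span_base
  and cspan_minimal = complex_vector.span_minimal

lemma cspan_image_sum:
  assumes "x \<in> cspan (g ` A)"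
  obtains F c where "finite F" "F \<subseteq> A" "x = (\<Sum>a\<in>F. c a *\<^sub>C g a)"
proof -
  from assms have "\<exists>F c. finite F \<and> F \<subseteq> A \<and> x = (\<Sum>a\<in>F. c a *\<^sub>C g a)"
  proof (induction rule: complex_vector.span_induct_alt)
    case base
    show ?case by (rule exI[of _ "{}"]) simp
  next
    case (step k y z)
    then obtain a F c where *: "a \<in> A" "y = g a" "finite F" "F \<subseteq> A" "z = (\<Sum>a\<in>F. c a *\<^sub>C g a)"
      by blast
    \<comment> \<open>Two summands, since \<open>a\<close> may already belong to
      \<open>F\<close>.\<close>
    let ?c = "\<lambda>b. (if b = a then k else 0) + (if b \<in> F then c b else 0)"
    have "(\<Sum>b\<in>insert a F. ?c b *\<^sub>C g b)
        = (\<Sum>b\<in>insert a F. (if b = a then k *\<^sub>C g b else 0)) + (\<Sum>b\<in>insert a F. (if b \<in> F then c b *\<^sub>C g b else 0))"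
      unfolding sum.distrib[symmetric] by (rule sum.cong) (auto simp: scaleC_add_left)
    also have "(\<Sum>b\<in>insert a F. (if b = a then k *\<^sub>C g b else 0)) = k *\<^sub>C y"
      using * by simp
    also have "(\<Sum>b\<in>insert a F. (if b \<in> F then c b *\<^sub>C g b else 0)) = z"
      unfolding *(5) by (rule sum.mono_neutral_cong_right) (use * in auto)
    finally have "k *\<^sub>C y + z = (\<Sum>b\<in>insert a F. ?c b *\<^sub>C g b)" ..
    with * show ?case by (intro exI[of _ "insert a F"] exI[of _ ?c]) auto
  qed
  with that show ?thesis by blast
qed

lemma clinear_eq_on_cspan:
  fixes f g :: "'a::complex_vector \<Rightarrow> 'b::complex_vector"
  assumes "clinear f" "clinear g" "\<And>x. x \<in> A \<Longrightarrow> f x = g x" "x \<in> cspan A"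
  shows "f x = g x"
  using assms(4)
  by (induction rule: complex_vector.span_induct_alt)
    (simp_all add: assms(1-3) clinear_0 clinear_add clinear_scale)

lemma csubspace_Collect_linear_eq0:
  fixes f :: "'a::complex_vector \<Rightarrow> 'b::complex_vector"
  shows "clinear f \<Longrightarrow> csubspace {x. f x = 0}"
  by (rule csubspaceI) (simp_all add: clinear_0 clinear_add clinear_scale)

text \<open>A representation lives on a subspace of its type, so its maps are linear only there.
  Precomposing with such a projection turns them into linear maps of the whole type; applied to
  \<open>N\<close> it also yields a complement that models a quotient.\<close>

lemma csubspace_projection:
  assumes "csubspace S"
  obtains p :: "'a::complex_vector \<Rightarrow> 'a" where "clinear p" "\<And>v. p v \<in> S" "\<And>v. v \<in> S \<Longrightarrow> p v = v"
proof -
  interpret vector_space_pair "scaleC :: complex \<Rightarrow> 'a \<Rightarrow> 'a" "scaleC :: complex \<Rightarrow> 'a \<Rightarrow> 'a" ..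
  have "clinear (\<lambda>x::'a. x)" by (rule clinearI) auto
  from linear_exists_left_inverse_on[OF this assms[unfolded csubspace_def]]
  obtain p where "range p \<subseteq> S" "clinear p" "\<forall>v\<in>S. p v = v" by auto
  then show ?thesis by (intro that[of p]) auto
qed

lemma fin_dim_basis:
  assumes "csubspace F" "fin_dim F"
  obtains X where "finite X" "X \<subseteq> F" "\<not> cdependent X" "cspan X = F"
proof -
  obtain C where C: "finite C" "F \<subseteq> cspan C"
    using assms(2) by (auto simp: fin_dim_def)
  obtain X where X: "X \<subseteq> F" "\<not> cdependent X" "F \<subseteq> cspan X"
    by (rule complex_vector.basis_exists[of F]) blast
  have "finite X"
    using complex_vector.independent_span_bound[of C X] C X by auto
  moreover have "cspan X = F"
    using X assms(1) by (simp add: complex_vector.span_subspace)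
  ultimately show ?thesis using that X by blast
qed

lemma fin_dim_subset: "fin_dim G \<Longrightarrow> F \<subseteq> G \<Longrightarrow> fin_dim F"
  by (auto simp: fin_dim_def)

text \<open>The inductive step is Gram--Schmidt for a pairing.\<close>

lemma dual_family_exists:
  fixes p :: "'i \<Rightarrow> 'b::complex_vector \<Rightarrow> complex"
  assumes "finite I" and "csubspace B" and "\<And>i. i \<in> I \<Longrightarrow> clinear (p i)"
    and "\<And>c i. (\<And>b. b \<in> B \<Longrightarrow> (\<Sum>i\<in>I. c i * p i b) = 0) \<Longrightarrow> i \<in> I \<Longrightarrow> c i = 0"
  shows "\<exists>b. \<forall>j\<in>I. b j \<in> B \<and> (\<forall>i\<in>I. p i (b j) = (if i = j then 1 else 0))"
  using assms(1,3,4)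
proof (induction I)
  case empty
  then show ?case by simp
next
  case (insert k I)
  \<comment> \<open>Independence restricts to \<open>I\<close>: extend the coefficients by 0 at
    \<open>k\<close>.\<close>
  have indep: "c i = 0" if c: "\<And>b. b \<in> B \<Longrightarrow> (\<Sum>i\<in>I. c i * p i b) = 0" and i: "i \<in> I" for c i
  proof -
    have "(\<Sum>j\<in>insert k I. (c(k := 0)) j * p j b) = (\<Sum>j\<in>I. c j * p j b)" for b
      using insert.hyps by (simp add: sum.insert_if) (rule sum.cong; auto)
    with c have "(c(k := 0)) i = 0"
      by (intro insert.prems(2)[of "c(k := 0)" i]) (simp_all add: i)
    moreover have "i \<noteq> k" using i insert.hyps by blast
    ultimately show ?thesis by simp
  qed
  have "\<exists>b. \<forall>j\<in>I. b j \<in> B \<and> (\<forall>i\<in>I. p i (b j) = (if i = j then 1 else 0))"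
    by (rule insert.IH) (use insert.prems(1) indep in blast)+
  then obtain b where b: "\<And>j. j \<in> I \<Longrightarrow> b j \<in> B"
      "\<And>i j. j \<in> I \<Longrightarrow> i \<in> I \<Longrightarrow> p i (b j) = (if i = j then 1 else 0)"
    by blast
  have lin: "clinear (p i)" if "i \<in> insert k I" for i using insert.prems(1) that .
  \<comment> \<open>The functional \<open>p k\<close> minus the combination of the
    \<open>p i\<close> that agrees with it on every \<open>b i\<close>; independence makes it
    nonzero at some \<open>a\<close>.\<close>
  let ?c = "\<lambda>i. if i = k then 1 else - p k (b i)"
  have "\<exists>a\<in>B. (\<Sum>i\<in>insert k I. ?c i * p i a) \<noteq> 0"
  proof (rule ccontr)
    assume "\<not> ?thesis"
    then have "?c k = 0" by (intro insert.prems(2)[of ?c k]) simp_all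
    then show False by simp
  qed
  then obtain a where a: "a \<in> B" "(\<Sum>i\<in>insert k I. ?c i * p i a) \<noteq> 0" by blast
  have "(\<Sum>i\<in>insert k I. ?c i * p i a) = p k a + (\<Sum>i\<in>I. ?c i * p i a)"
    using insert.hyps by simp
  also have "(\<Sum>i\<in>I. ?c i * p i a) = (\<Sum>i\<in>I. - (p k (b i) * p i a))"
    using insert.hyps by (intro sum.cong) auto
  finally have nz: "p k a - (\<Sum>i\<in>I. p k (b i) * p i a) \<noteq> 0"
    using a by (simp add: sum_negf)
  \<comment> \<open>Removing the \<open>b i\<close> components from \<open>a\<close> leaves a vector
    killed by all \<open>p i\<close> with \<open>i\<close> in \<open>I\<close>, whose value under
    \<open>p k\<close> is that nonzero number.\<close>
  define d where "d = a - (\<Sum>i\<in>I. p i a *\<^sub>C b i)"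
  have dB: "d \<in> B"
    unfolding d_def using a b assms(2)
    by (intro csubspace_diff csubspace_sum csubspace_scale) auto
  have di: "p i d = 0" if "i \<in> I" for i
  proof -
    have "p i d = p i a - (\<Sum>j\<in>I. p j a * p i (b j))"
      using lin[of i] that by (simp add: d_def clinear_diff clinear_sum clinear_scale)
    also have "(\<Sum>j\<in>I. p j a * p i (b j)) = (\<Sum>j\<in>I. if j = i then p i a else 0)"
      using b that by (intro sum.cong) auto
    finally show ?thesis using that insert.hyps by simp
  qed
  have dk: "p k d \<noteq> 0"
    using nz lin[of k] by (simp add: d_def clinear_diff clinear_sum clinear_scale mult.commute)
  define e where "e = (1 / p k d) *\<^sub>C d"
  have e: "e \<in> B" "p k e = 1" "\<And>i. i \<in> I \<Longrightarrow> p i e = 0"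
    using dB assms(2) dk di lin by (auto simp: e_def clinear_scale csubspace_scale)
  let ?b = "\<lambda>j. if j = k then e else b j - p k (b j) *\<^sub>C e"
  show ?case
  proof (intro exI[of _ ?b] ballI conjI)
    fix j assume j: "j \<in> insert k I"
    show "?b j \<in> B"
      using j e b assms(2) by (auto intro!: csubspace_diff csubspace_scale)
    fix i assume i: "i \<in> insert k I"
    show "p i (?b j) = (if i = j then 1 else 0)"
      using i j e b lin[of i] insert.hyps by (auto simp: clinear_diff clinear_scale)
  qed
qed

section \<open>The free complex vector space on a set and linear extension\<close>

instantiation poly_mapping :: (type, complex_vector) complex_vector
begin

lift_definition scaleC_poly_mapping :: "complex \<Rightarrow> ('a \<Rightarrow>\<^sub>0 'b) \<Rightarrow> ('a \<Rightarrow>\<^sub>0 'b)"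
  is "\<lambda>c f k. c *\<^sub>C f k"
  by (rule finite_subset) auto

instance
  by (intro_classes; transfer) (auto simp: fun_eq_iff scaleC_distribs)

end

lemma lookup_scaleC [simp]: "Poly_Mapping.lookup (c *\<^sub>C p) k = c *\<^sub>C Poly_Mapping.lookup p k"
  by transfer simp

definition lin_ext :: "('k \<Rightarrow> 'b::complex_vector) \<Rightarrow> ('k \<Rightarrow>\<^sub>0 complex) \<Rightarrow> 'b" where
  "lin_ext f p = (\<Sum>k\<in>Poly_Mapping.keys p. Poly_Mapping.lookup p k *\<^sub>C f k)"

lemma lin_ext_superset:
  "finite A \<Longrightarrow> Poly_Mapping.keys p \<subseteq> A \<Longrightarrow> lin_ext f p = (\<Sum>k\<in>A. Poly_Mapping.lookup p k *\<^sub>C f k)"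
  unfolding lin_ext_def by (rule sum.mono_neutral_left) (auto simp: in_keys_iff)

lemma clinear_lin_ext: "clinear (lin_ext f)"
proof (rule clinearI)
  fix p q :: "'a \<Rightarrow>\<^sub>0 complex"
  let ?A = "Poly_Mapping.keys p \<union> Poly_Mapping.keys q"
  have "lin_ext f (p + q) = (\<Sum>k\<in>?A. Poly_Mapping.lookup (p + q) k *\<^sub>C f k)"
    using Poly_Mapping.keys_add[of p q] by (intro lin_ext_superset) auto
  moreover have "lin_ext f p = (\<Sum>k\<in>?A. Poly_Mapping.lookup p k *\<^sub>C f k)"
    "lin_ext f q = (\<Sum>k\<in>?A. Poly_Mapping.lookup q k *\<^sub>C f k)"
    by (auto intro: lin_ext_superset)
  ultimately show "lin_ext f (p + q) = lin_ext f p + lin_ext f q"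
    by (simp add: lookup_add scaleC_add_left sum.distrib)
next
  fix c and p :: "'a \<Rightarrow>\<^sub>0 complex"
  have "lin_ext f (c *\<^sub>C p) = (\<Sum>k\<in>Poly_Mapping.keys p. Poly_Mapping.lookup (c *\<^sub>C p) k *\<^sub>C f k)"
    by (intro lin_ext_superset) (auto simp: in_keys_iff)
  then show "lin_ext f (c *\<^sub>C p) = c *\<^sub>C lin_ext f p"
    by (simp add: lin_ext_def scaleC_sum_right)
qed

lemma lin_ext_single [simp]: "lin_ext f (Poly_Mapping.single k c) = c *\<^sub>C f k"
  using lin_ext_superset[of "{k}" "Poly_Mapping.single k c" f] by simp

lemmas lin_ext_add [simp] = clinear_add[OF clinear_lin_ext]
  and lin_ext_scale [simp] = clinear_scale[OF clinear_lin_ext]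
  and lin_ext_diff [simp] = clinear_diff[OF clinear_lin_ext]
  and lin_ext_minus [simp] = clinear_minus[OF clinear_lin_ext]
  and lin_ext_0 [simp] = clinear_0[OF clinear_lin_ext]

lemma lin_ext_id: "lin_ext (\<lambda>k. Poly_Mapping.single k 1) p = p"
proof (rule poly_mapping_eqI)
  fix k
  have "Poly_Mapping.lookup (lin_ext (\<lambda>k. Poly_Mapping.single k 1) p) k
      = (\<Sum>j\<in>Poly_Mapping.keys p. if j = k then Poly_Mapping.lookup p k else 0)"
    unfolding lin_ext_def lookup_sum by (rule sum.cong) (auto simp: lookup_single when_def)
  also have "\<dots> = Poly_Mapping.lookup p k"
    by (simp add: in_keys_iff)
  finally show "Poly_Mapping.lookup (lin_ext (\<lambda>k. Poly_Mapping.single k 1) p) k = Poly_Mapping.lookup p k" .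
qed

lemma clinear_lin_ext_eq:
  fixes F :: "('k \<Rightarrow>\<^sub>0 complex) \<Rightarrow> 'b::complex_vector"
  assumes "clinear F"
  shows "F p = lin_ext (\<lambda>k. F (Poly_Mapping.single k 1)) p"
proof -
  have "F p = F (lin_ext (\<lambda>k. Poly_Mapping.single k 1) p)" by (simp add: lin_ext_id)
  also have "\<dots> = lin_ext (\<lambda>k. F (Poly_Mapping.single k 1)) p"
    by (simp add: lin_ext_def clinear_sum[OF assms] clinear_scale[OF assms])
  finally show ?thesis .
qed

text \<open>Identities between operators on the free Verma module are checked on single words by
  this rule.\<close>

lemma clinear_poly_mapping_eqI:
  fixes F G :: "('k \<Rightarrow>\<^sub>0 complex) \<Rightarrow> 'b::complex_vector"
  assumes "clinear F" "clinear G" "\<And>k. F (Poly_Mapping.single k 1) = G (Poly_Mapping.single k 1)"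
  shows "F = G"
proof (rule ext)
  fix p
  have "F p = lin_ext (\<lambda>k. F (Poly_Mapping.single k 1)) p"
    by (rule clinear_lin_ext_eq[OF assms(1)])
  also have "\<dots> = G p"
    unfolding assms(3) by (rule clinear_lin_ext_eq[OF assms(2), symmetric])
  finally show "F p = G p" .
qed

lemma lin_ext_in_cspan: "lin_ext f p \<in> cspan (range f)"
  unfolding lin_ext_def
  by (intro complex_vector.span_sum complex_vector.span_scale cspan_base) auto

lemma cspan_range_lin_ext:
  assumes "x \<in> cspan (range f)"
  obtains p where "x = lin_ext f p"
proof -
  from assms have "\<exists>p. x = lin_ext f p"
  proof (induction rule: complex_vector.span_induct_alt)
    case base
    show ?case by (rule exI[of _ 0]) simp
  next
    case (step c y z)
    then obtain k p where "y = f k" "z = lin_ext f p" by blast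
    then show ?case
      by (intro exI[of _ "Poly_Mapping.single k c + p"]) simp
  qed
  with that show ?thesis by blast
qed

subsection \<open>Hermitian forms\<close>

locale hermitian =
  fixes S :: "'v::complex_vector set" and B :: "'v \<Rightarrow> 'v \<Rightarrow> complex"
  assumes S: "csubspace S"
    and add_left: "\<lbrakk>u \<in> S; v \<in> S; v' \<in> S\<rbrakk> \<Longrightarrow> B (u + v) v' = B u v' + B v v'"
    and scale_left: "\<lbrakk>v \<in> S; v' \<in> S\<rbrakk> \<Longrightarrow> B (a *\<^sub>C v) v' = a * B v v'"
    and cnj_sym: "\<lbrakk>v \<in> S; v' \<in> S\<rbrakk> \<Longrightarrow> B v' v = cnj (B v v')"
    and pos: "\<lbrakk>v \<in> S; v \<noteq> 0\<rbrakk> \<Longrightarrow> 0 < Re (B v v)"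
begin

lemma add_right: "\<lbrakk>u \<in> S; v \<in> S; v' \<in> S\<rbrakk> \<Longrightarrow> B v' (u + v) = B v' u + B v' v"
  using cnj_sym[of _ v'] by (simp add: add_left csubspace_add[OF S] cnj_sym[of _ v'])

lemma scale_right: "\<lbrakk>v \<in> S; v' \<in> S\<rbrakk> \<Longrightarrow> B v' (a *\<^sub>C v) = cnj a * B v' v"
  by (simp add: scale_left csubspace_scale[OF S] cnj_sym[of _ v'])

lemma zero_left: "v \<in> S \<Longrightarrow> B 0 v = 0"
  using scale_left[of 0 v 0] csubspace_0[OF S] by simp

lemma zero_right: "v \<in> S \<Longrightarrow> B v 0 = 0"
  using scale_right[of 0 v 0] csubspace_0[OF S] by simp

lemma diff_left: "\<lbrakk>u \<in> S; v \<in> S; v' \<in> S\<rbrakk> \<Longrightarrow> B (u - v) v' = B u v' - B v v'"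
  using add_left[of u "(- 1) *\<^sub>C v" v'] scale_left[of v v' "- 1"] csubspace_neg[OF S] by simp

lemma diff_right: "\<lbrakk>u \<in> S; v \<in> S; v' \<in> S\<rbrakk> \<Longrightarrow> B v' (u - v) = B v' u - B v' v"
  using add_right[of u "(- 1) *\<^sub>C v" v'] scale_right[of v v' "- 1"] csubspace_neg[OF S] by simp

lemma sum_left: "\<lbrakk>\<And>a. a \<in> A \<Longrightarrow> g a \<in> S; v \<in> S\<rbrakk> \<Longrightarrow> B (sum g A) v = (\<Sum>a\<in>A. B (g a) v)"
  by (induction A rule: infinite_finite_induct) (simp_all add: zero_left add_left csubspace_sum[OF S])

lemma sum_right: "\<lbrakk>\<And>a. a \<in> A \<Longrightarrow> g a \<in> S; v \<in> S\<rbrakk> \<Longrightarrow> B v (sum g A) = (\<Sum>a\<in>A. B v (g a))"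
  by (induction A rule: infinite_finite_induct) (simp_all add: zero_right add_right csubspace_sum[OF S])

lemma orth_sym: "\<lbrakk>v \<in> S; v' \<in> S\<rbrakk> \<Longrightarrow> B v v' = 0 \<longleftrightarrow> B v' v = 0"
  using cnj_sym[of v v'] by simp

lemma definite: "\<lbrakk>v \<in> S; B v v = 0\<rbrakk> \<Longrightarrow> v = 0"
  using pos[of v] by auto

lemma orth_cspan:
  assumes "X \<subseteq> S" "v \<in> S" "\<And>x. x \<in> X \<Longrightarrow> B v x = 0" "s \<in> cspan X"
  shows "B v s = 0"
proof -
  have "cspan X \<subseteq> {s \<in> S. B v s = 0}"
    by (rule cspan_minimal) (use assms S in \<open>auto intro!: csubspaceI
        simp: csubspace_0 csubspace_add csubspace_scale zero_right add_right scale_right\<close>)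
  with assms(4) show ?thesis by auto
qed

text \<open>The space itself may be infinite-dimensional and incomplete, so projections are built by
  Gram--Schmidt, and only onto finite spans.\<close>

lemma orth_complement_exists_cspan:
  assumes "finite X" "X \<subseteq> S" "x \<in> S"
  shows "\<exists>u\<in>cspan X. \<forall>s\<in>cspan X. B (x - u) s = 0"
  using assms
proof (induction X arbitrary: x)
  case empty
  then show ?case using csubspace_0[OF S] by (auto simp: zero_right)
next
  case (insert a X)
  have XS: "cspan X \<subseteq> S" using insert.prems S by (intro cspan_minimal) auto
  obtain b where b: "b \<in> cspan X" "\<forall>s\<in>cspan X. B (a - b) s = 0"
    using insert.IH[of a] insert.prems by auto
  obtain u where u: "u \<in> cspan X" "\<forall>s\<in>cspan X. B (x - u) s = 0"
    using insert.IH[of x] insert.prems by auto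
  define c where "c = a - b"
  have cS: "c \<in> S" unfolding c_def using insert.prems b XS by (intro csubspace_diff[OF S]) auto
  have xuS: "x - u \<in> S" using insert.prems u XS by (intro csubspace_diff[OF S]) auto
  have c_span: "c \<in> cspan (insert a X)"
    unfolding c_def using b(1) complex_vector.span_mono[OF subset_insertI, of X a]
    by (intro complex_vector.span_diff) (auto intro: cspan_base)
  have u_span: "u \<in> cspan (insert a X)"
    using u(1) complex_vector.span_mono[OF subset_insertI, of X a] by blast
  \<comment> \<open>The Fourier coefficient of \<open>x - u\<close> along \<open>c\<close>; for
    \<open>c = 0\<close> the vector \<open>a\<close> already lies in the span of \<open>X\<close>
    and any value would do.\<close>
  define k where "k = (if c = 0 then 0 else B (x - u) c / B c c)"
  have "B (x - (u + k *\<^sub>C c)) s = 0" if s: "s \<in> cspan (insert a X)" for s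
  proof -
    obtain r where "s - r *\<^sub>C a \<in> cspan X" using s complex_vector.span_breakdown_eq by blast
    then have t: "s - r *\<^sub>C c \<in> cspan X" 
      using b(1) complex_vector.span_add[of "s - r *\<^sub>C a" X "r *\<^sub>C b"] complex_vector.span_scale[of b X r]
      by (simp add: c_def scaleC_diff_right algebra_simps)
    define t where "t = s - r *\<^sub>C c"
    have s_eq: "s = t + r *\<^sub>C c" by (simp add: t_def)
    have tS: "t \<in> S" "t \<in> cspan X" using t XS by (auto simp: t_def)
    have sS: "s \<in> S" using tS cS s_eq csubspace_add[OF S] csubspace_scale[OF S] by auto
    have eq: "x - (u + k *\<^sub>C c) = (x - u) - k *\<^sub>C c" by simp
    have "B (x - (u + k *\<^sub>C c)) s = B (x - u) s - k * B c s"
      unfolding eq using xuS cS sS by (simp add: diff_left scale_left csubspace_scale[OF S])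
    also have "B (x - u) s = cnj r * B (x - u) c"
      unfolding s_eq using xuS cS tS u by (simp add: add_right scale_right csubspace_scale[OF S])
    also have "B c s = cnj r * B c c"
      unfolding s_eq using cS tS b c_def by (simp add: add_right scale_right csubspace_scale[OF S])
    also have "cnj r * B (x - u) c - k * (cnj r * B c c) = 0"
      using definite[OF cS] xuS by (auto simp: k_def zero_right)
    finally show ?thesis .
  qed
  then show ?case
    using c_span u_span
    by (intro bexI[of _ "u + k *\<^sub>C c"]) (auto intro: complex_vector.span_add complex_vector.span_scale)
qed

lemma orth_complement_exists:
  assumes "csubspace F" "fin_dim F" "F \<subseteq> S" "x \<in> S"
  obtains u where "u \<in> F" "\<And>s. s \<in> F \<Longrightarrow> B (x - u) s = 0"
proof -
  obtain X where X: "finite X" "X \<subseteq> F" "cspan X = F"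
    using fin_dim_basis[OF assms(1,2)] by metis
  have "\<exists>u\<in>cspan X. \<forall>s\<in>cspan X. B (x - u) s = 0"
    by (rule orth_complement_exists_cspan) (use X assms in auto)
  with X that show ?thesis by auto
qed

text \<open>Two candidates for the projection differ by a vector of \<open>F\<close> that is
  orthogonal to \<open>F\<close>, hence by 0; this evaluates the definite description in
  \<open>orth_proj\<close>.\<close>

lemma orth_proj_eqI:
  assumes "csubspace F" "F \<subseteq> S" "x \<in> S" "u \<in> F" "\<And>s. s \<in> F \<Longrightarrow> B (x - u) s = 0"
  shows "orth_proj B F x = u"
  unfolding orth_proj_def
proof (rule the_equality)
  show "u \<in> F \<and> (\<forall>s\<in>F. B (x - u) s = 0)" using assms by auto
next
  fix u' assume u': "u' \<in> F \<and> (\<forall>s\<in>F. B (x - u') s = 0)"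
  have d: "u - u' \<in> F" using assms u' by (auto intro: csubspace_diff)
  have "B (u - u') (u - u') = B ((x - u') - (x - u)) (u - u')" by simp
  also have "\<dots> = B (x - u') (u - u') - B (x - u) (u - u')"
    using assms u' d by (intro diff_left csubspace_diff[OF S]) auto
  also have "\<dots> = 0" using assms u' d by auto
  finally show "u' = u" using definite[of "u - u'"] d assms by auto
qed

text \<open>Riesz representation on a finite-dimensional subspace, by the same Gram--Schmidt
  induction.\<close>

lemma represent_functional:
  assumes "csubspace F" "fin_dim F" "F \<subseteq> S" "clinear L"
  obtains s where "s \<in> F" "\<And>t. t \<in> F \<Longrightarrow> L t = B t s"
proof -
  obtain X where "finite X" "X \<subseteq> F" and FX: "cspan X = F"
    using fin_dim_basis[OF assms(1,2)] by metis
  have "\<exists>s\<in>cspan X. \<forall>t\<in>cspan X. L t = B t s"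
    using \<open>finite X\<close> order_trans[OF \<open>X \<subseteq> F\<close> assms(3)]
  proof (induction X)
    case empty
    then show ?case using csubspace_0[OF S] by (auto simp: zero_right clinear_0[OF assms(4)])
  next
    case (insert a X)
    then obtain s where s: "s \<in> cspan X" "\<forall>t\<in>cspan X. L t = B t s" by auto
    have XS: "cspan X \<subseteq> S" using insert.prems S by (intro cspan_minimal) auto
    obtain b where b: "b \<in> cspan X" "\<forall>s\<in>cspan X. B (a - b) s = 0"
      using orth_complement_exists_cspan[of X a] insert by auto
    define c where "c = a - b"
    have cS: "c \<in> S" unfolding c_def using insert.prems b XS by (intro csubspace_diff[OF S]) auto
    have sS: "s \<in> S" using s XS by auto
    have c_span: "c \<in> cspan (insert a X)"
      unfolding c_def using b(1) complex_vector.span_mono[OF subset_insertI, of X a]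
      by (intro complex_vector.span_diff) (auto intro: cspan_base)
    have s_span: "s \<in> cspan (insert a X)"
      using s(1) complex_vector.span_mono[OF subset_insertI, of X a] by blast
    \<comment> \<open>Conjugated because the form is conjugate linear in its second
      argument.\<close>
    define k where "k = (if c = 0 then 0 else cnj (L c / B c c))"
    have "L t = B t (s + k *\<^sub>C c)" if t: "t \<in> cspan (insert a X)" for t
    proof -
      obtain r where "t - r *\<^sub>C a \<in> cspan X" using t complex_vector.span_breakdown_eq by blast
      then have "t - r *\<^sub>C c \<in> cspan X" 
        using b(1) complex_vector.span_add[of "t - r *\<^sub>C a" X "r *\<^sub>C b"] complex_vector.span_scale[of b X r]
        by (simp add: c_def scaleC_diff_right algebra_simps)
      then obtain q where q: "t = q + r *\<^sub>C c" "q \<in> cspan X" by (metis diff_add_cancel)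
      have qS: "q \<in> S" using q XS by auto
      have "B c s = 0" "B c q = 0" using b s q by (auto simp: c_def)
      then have "B q c = 0" using orth_sym qS cS by auto
      have "B t (s + k *\<^sub>C c) = B q s + r * (cnj k * B c c)"
        unfolding q(1) using qS cS sS \<open>B c s = 0\<close> \<open>B q c = 0\<close>
        by (simp add: add_left add_right scale_left scale_right csubspace_scale[OF S] csubspace_add[OF S]
            algebra_simps)
      also have "cnj k * B c c = L c"
        using definite[OF cS] by (auto simp: k_def clinear_0[OF assms(4)])
      also have "B q s + r * L c = L t"
        using s q by (simp add: clinear_add[OF assms(4)] clinear_scale[OF assms(4)])
      finally show ?thesis ..
    qed
    then show ?case
      using c_span s_span
      by (intro bexI[of _ "s + k *\<^sub>C c"]) (auto intro: complex_vector.span_add complex_vector.span_scale)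
  qed
  with FX that show ?thesis by auto
qed

end

subsection \<open>Lie terms modulo the defining relations\<close>

declare km_eq.trans [trans]

lemma km_scale_0: "km_eq D (TScale 0 t) TZero"
proof -
  have "km_eq D (TScale (1 + - 1) t) (TPlus (TScale 1 t) (TScale (- 1) t))" by (rule km_eq.plus_scale)
  also have "km_eq D \<dots> (TPlus t (TScale (- 1) t))" by (intro km_eq.cong_plus km_eq.scale_one km_eq.refl)
  also have "km_eq D \<dots> TZero" by (rule km_eq.plus_neg)
  finally show ?thesis by simp
qed

lemma km_scale_zero: "km_eq D (TScale a TZero) TZero"
proof -
  have "km_eq D (TScale a TZero) (TScale a (TScale 0 TZero))"
    by (intro km_eq.cong_scale km_eq.sym[OF km_scale_0])
  also have "km_eq D \<dots> (TScale (a * 0) TZero)" by (rule km_eq.scale_scale)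
  also have "km_eq D \<dots> TZero" by (simp add: km_scale_0)
  finally show ?thesis .
qed

lemma km_br_zero: "km_eq D (TBr s TZero) TZero"
proof -
  have "km_eq D (TBr s TZero) (TBr s (TScale 0 TZero))"
    by (intro km_eq.cong_br km_eq.refl km_eq.sym[OF km_scale_0])
  also have "km_eq D \<dots> (TScale 0 (TBr s TZero))" by (rule km_eq.br_scale_right)
  also have "km_eq D \<dots> TZero" by (rule km_scale_0)
  finally show ?thesis .
qed

lemma km_plus_zero_right: "km_eq D (TPlus t TZero) t"
  using km_eq.trans[OF km_eq.plus_comm km_eq.plus_zero] .

lemma km_plus_zero_iff: "km_eq D (TPlus s t) TZero \<Longrightarrow> km_eq D s (TScale (- 1) t)"
proof -
  assume *: "km_eq D (TPlus s t) TZero"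
  have "km_eq D s (TPlus s (TPlus t (TScale (- 1) t)))"
    by (rule km_eq.trans[OF km_eq.sym[OF km_plus_zero_right]])
      (intro km_eq.cong_plus km_eq.refl km_eq.sym[OF km_eq.plus_neg])
  also have "km_eq D \<dots> (TPlus (TPlus s t) (TScale (- 1) t))" by (rule km_eq.sym[OF km_eq.plus_assoc])
  also have "km_eq D \<dots> (TPlus TZero (TScale (- 1) t))" by (intro km_eq.cong_plus km_eq.refl *)
  also have "km_eq D \<dots> (TScale (- 1) t)" by (rule km_eq.plus_zero)
  finally show ?thesis .
qed

lemma km_br_anti: "km_eq D (TBr s t) (TScale (- 1) (TBr t s))"
proof (rule km_plus_zero_iff, rule km_eq.sym)
  have "km_eq D TZero (TBr (TPlus s t) (TPlus s t))" by (rule km_eq.sym[OF km_eq.br_self])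
  also have "km_eq D \<dots> (TPlus (TBr s (TPlus s t)) (TBr t (TPlus s t)))" by (rule km_eq.br_plus_left)
  also have "km_eq D \<dots> (TPlus (TPlus (TBr s s) (TBr s t)) (TPlus (TBr t s) (TBr t t)))"
    by (intro km_eq.cong_plus km_eq.br_plus_right)
  also have "km_eq D \<dots> (TPlus (TPlus TZero (TBr s t)) (TPlus (TBr t s) TZero))"
    by (intro km_eq.cong_plus km_eq.br_self km_eq.refl)
  also have "km_eq D \<dots> (TPlus (TBr s t) (TBr t s))"
    by (intro km_eq.cong_plus km_eq.plus_zero km_plus_zero_right)
  finally show "km_eq D TZero (TPlus (TBr s t) (TBr t s))" .
qed

text \<open>The derivation form of the Jacobi identity lets inductions move a bracket past one
  generator at a time.\<close>

lemma km_jacobi: "km_eq D (TBr s (TBr t u)) (TPlus (TBr (TBr s t) u) (TBr t (TBr s u)))"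
proof -
  have "km_eq D (TBr s (TBr t u)) (TScale (- 1) (TPlus (TBr t (TBr u s)) (TBr u (TBr s t))))"
    by (rule km_plus_zero_iff[OF km_eq.jacobi])
  also have "km_eq D \<dots> (TPlus (TScale (- 1) (TBr t (TBr u s))) (TScale (- 1) (TBr u (TBr s t))))"
    by (rule km_eq.scale_plus)
  also have "km_eq D \<dots> (TPlus (TBr t (TBr s u)) (TBr (TBr s t) u))"
  proof (intro km_eq.cong_plus)
    have "km_eq D (TScale (- 1) (TBr t (TBr u s))) (TBr t (TScale (- 1) (TBr u s)))"
      by (rule km_eq.sym[OF km_eq.br_scale_right])
    also have "km_eq D \<dots> (TBr t (TBr s u))"
      by (intro km_eq.cong_br km_eq.refl km_eq.sym[OF km_br_anti])
    finally show "km_eq D (TScale (- 1) (TBr t (TBr u s))) (TBr t (TBr s u))" .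
    show "km_eq D (TScale (- 1) (TBr u (TBr s t))) (TBr (TBr s t) u)"
      by (rule km_eq.sym[OF km_br_anti])
  qed
  also have "km_eq D \<dots> (TPlus (TBr (TBr s t) u) (TBr t (TBr s u)))" by (rule km_eq.plus_comm)
  finally show ?thesis .
qed

lemma km_h_zero: "km_eq D (GenH 0) TZero"
  using km_eq.trans[OF km_eq.h_scale[of D 0 0] km_scale_0] by simp

text \<open>With \<open>GenE\<close> or \<open>GenF\<close> for \<open>X\<close> these terms
  represent the two nilpotent halves before the radical is divided out. The only bracket rule has a
  generator on the left, so the halves appear as spans of right-normed brackets.\<close>

inductive_set half_terms :: "('i, 'h::complex_vector, 'g) km_data \<Rightarrow> ('i \<Rightarrow> ('i, 'h) lie_term) \<Rightarrow>
    ('i, 'h) lie_term set" for D X where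
  cong: "t \<in> half_terms D X \<Longrightarrow> km_eq D t s \<Longrightarrow> s \<in> half_terms D X"
| zero: "TZero \<in> half_terms D X"
| plus: "s \<in> half_terms D X \<Longrightarrow> t \<in> half_terms D X \<Longrightarrow> TPlus s t \<in> half_terms D X"
| scale: "t \<in> half_terms D X \<Longrightarrow> TScale a t \<in> half_terms D X"
| gen: "X i \<in> half_terms D X"
| br: "t \<in> half_terms D X \<Longrightarrow> TBr (X i) t \<in> half_terms D X"

lemma half_terms_cong': "km_eq D s t \<Longrightarrow> t \<in> half_terms D X \<Longrightarrow> s \<in> half_terms D X"
  by (rule half_terms.cong[OF _ km_eq.sym])

lemma half_terms_br_h:
  assumes "\<And>h i. km_eq D (TBr (GenH h) (X i)) (TScale (c h i) (X i))" and "t \<in> half_terms D X"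
  shows "TBr (GenH h) t \<in> half_terms D X"
  using assms(2)
proof (induction rule: half_terms.induct)
  case (cong t s)
  then show ?case by (meson half_terms.cong km_eq.cong_br km_eq.refl)
next
  case zero
  show ?case by (rule half_terms_cong'[OF km_br_zero half_terms.zero])
next
  case (plus s t)
  then show ?case by (meson half_terms_cong'[OF km_eq.br_plus_right] half_terms.plus)
next
  case (scale t a)
  then show ?case by (meson half_terms_cong'[OF km_eq.br_scale_right] half_terms.scale)
next
  case (gen i)
  show ?case by (rule half_terms_cong'[OF assms(1)]) (intro half_terms.scale half_terms.gen)
next
  case (br t i)
  have "TBr (TBr (GenH h) (X i)) t \<in> half_terms D X"
    by (rule half_terms_cong'[OF km_eq.trans[OF km_eq.cong_br[OF assms(1) km_eq.refl] km_eq.br_scale_left]])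
      (intro half_terms.scale half_terms.br br)
  from half_terms.plus[OF this half_terms.br[OF br.IH]] show ?case
    by (rule half_terms_cong'[OF km_jacobi])
qed

text \<open>A generator of one half meets a generator of the other half only in a Cartan element,
  and these act diagonally; so it preserves the other half up to a Cartan term. The parameters
  \<open>X\<close>, \<open>y\<close>, \<open>c\<close> and \<open>k\<close> cover both signs in a
  single proof.\<close>

lemma half_terms_br_opposite:
  assumes hX: "\<And>h i. km_eq D (TBr (GenH h) (X i)) (TScale (c h i) (X i))"
    and YX: "\<And>j. km_eq D (TBr y (X j)) (GenH (k j))" and "t \<in> half_terms D X"
  shows "\<exists>a\<in>half_terms D X. \<exists>h. km_eq D (TBr y t) (TPlus a (GenH h))"
  using assms(3)
proof (induction rule: half_terms.induct)
  case (cong t s)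
  then show ?case by (meson km_eq.trans km_eq.sym km_eq.cong_br km_eq.refl)
next
  case zero
  have "km_eq D (TBr y TZero) (TPlus TZero (GenH 0))"
    by (meson km_br_zero km_eq.trans km_eq.sym km_eq.plus_zero km_h_zero)
  then show ?case using half_terms.zero by blast
next
  case (plus s t)
  then obtain a h a' h' where *: "a \<in> half_terms D X" "km_eq D (TBr y s) (TPlus a (GenH h))"
    "a' \<in> half_terms D X" "km_eq D (TBr y t) (TPlus a' (GenH h'))" by blast
  have "km_eq D (TBr y (TPlus s t)) (TPlus (TBr y s) (TBr y t))" by (rule km_eq.br_plus_right)
  also have "km_eq D \<dots> (TPlus (TPlus a (GenH h)) (TPlus a' (GenH h')))"
    by (intro km_eq.cong_plus *)
  also have "km_eq D \<dots> (TPlus a (TPlus (GenH h) (TPlus a' (GenH h'))))" by (rule km_eq.plus_assoc)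
  also have "km_eq D \<dots> (TPlus a (TPlus (TPlus a' (GenH h')) (GenH h)))"
    by (intro km_eq.cong_plus km_eq.refl km_eq.plus_comm)
  also have "km_eq D \<dots> (TPlus a (TPlus a' (TPlus (GenH h') (GenH h))))"
    by (intro km_eq.cong_plus km_eq.refl km_eq.plus_assoc)
  also have "km_eq D \<dots> (TPlus (TPlus a a') (TPlus (GenH h') (GenH h)))"
    by (rule km_eq.sym[OF km_eq.plus_assoc])
  also have "km_eq D \<dots> (TPlus (TPlus a a') (GenH (h' + h)))"
    by (intro km_eq.cong_plus km_eq.refl km_eq.sym[OF km_eq.h_plus])
  finally show ?case using half_terms.plus[OF *(1,3)] by blast
next
  case (scale t r)
  then obtain a h where *: "a \<in> half_terms D X" "km_eq D (TBr y t) (TPlus a (GenH h))" by blast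
  have "km_eq D (TBr y (TScale r t)) (TScale r (TBr y t))" by (rule km_eq.br_scale_right)
  also have "km_eq D \<dots> (TScale r (TPlus a (GenH h)))" by (intro km_eq.cong_scale *)
  also have "km_eq D \<dots> (TPlus (TScale r a) (TScale r (GenH h)))" by (rule km_eq.scale_plus)
  also have "km_eq D \<dots> (TPlus (TScale r a) (GenH (r *\<^sub>C h)))"
    by (intro km_eq.cong_plus km_eq.refl km_eq.sym[OF km_eq.h_scale])
  finally show ?case using half_terms.scale[OF *(1)] by blast
next
  case (gen i)
  have "km_eq D (TBr y (X i)) (TPlus TZero (GenH (k i)))"
    by (meson YX km_eq.trans km_eq.sym km_eq.plus_zero)
  then show ?case using half_terms.zero by blast
next
  case (br t i)
  then obtain a h where *: "a \<in> half_terms D X" "km_eq D (TBr y t) (TPlus a (GenH h))" by blast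
  have 1: "TBr (TBr y (X i)) t \<in> half_terms D X"
    by (rule half_terms_cong'[OF km_eq.cong_br[OF YX km_eq.refl]]) (rule half_terms_br_h[OF hX br.hyps])
  have "TBr (X i) (GenH h) \<in> half_terms D X"
    by (rule half_terms_cong'[OF km_br_anti]) (intro half_terms.scale half_terms_br_h[OF hX] half_terms.gen)
  then have "TPlus (TBr (X i) a) (TBr (X i) (GenH h)) \<in> half_terms D X"
    by (rule half_terms.plus[OF half_terms.br[OF *(1)]])
  then have "TBr (X i) (TBr y t) \<in> half_terms D X"
    by (rule half_terms_cong'[OF km_eq.trans[OF km_eq.cong_br[OF km_eq.refl *(2)] km_eq.br_plus_right]])
  with 1 have 2: "TBr y (TBr (X i) t) \<in> half_terms D X"
    by (rule half_terms_cong'[OF km_jacobi half_terms.plus])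
  \<comment> \<open>Bracketing \<open>y\<close> with \<open>TBr (X i) t\<close> leaves no Cartan
    component, so the required one is 0.\<close>
  have "km_eq D (TBr y (TBr (X i) t)) (TPlus (TBr y (TBr (X i) t)) (GenH 0))"
    by (meson km_eq.trans km_eq.sym km_plus_zero_right km_eq.cong_plus km_eq.refl km_h_zero)
  with 2 show ?case by blast
qed

section \<open>Triangular decomposition of Lie terms\<close>

lemma km_rel_ef_all: "km_eq D (TBr (GenE i) (GenF j)) (GenH (if i = j then simple_coroot D i else 0))"
  using km_eq.rel_ef[of D i] km_eq.trans[OF km_eq.rel_ef_neq[of i j D] km_eq.sym[OF km_h_zero]] by auto

lemma km_rel_fe_all: "km_eq D (TBr (GenF i) (GenE j)) (GenH (if j = i then - simple_coroot D j else 0))"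
proof -
  have "km_eq D (TBr (GenF i) (GenE j)) (TScale (- 1) (TBr (GenE j) (GenF i)))" by (rule km_br_anti)
  also have "km_eq D \<dots> (TScale (- 1) (GenH (if j = i then simple_coroot D j else 0)))"
    by (intro km_eq.cong_scale km_rel_ef_all)
  also have "km_eq D \<dots> (GenH (- 1 *\<^sub>C (if j = i then simple_coroot D j else 0)))"
    by (rule km_eq.sym[OF km_eq.h_scale])
  finally show ?thesis by (simp split: if_splits)
qed

inductive_set tri_terms :: "('i, 'h::complex_vector, 'g) km_data \<Rightarrow> ('i, 'h) lie_term set" for D where
  cong: "t \<in> tri_terms D \<Longrightarrow> km_eq D t s \<Longrightarrow> s \<in> tri_terms D"
| minus: "t \<in> half_terms D GenF \<Longrightarrow> t \<in> tri_terms D"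
| cartan: "GenH h \<in> tri_terms D"
| plus: "t \<in> half_terms D GenE \<Longrightarrow> t \<in> tri_terms D"
| add: "s \<in> tri_terms D \<Longrightarrow> t \<in> tri_terms D \<Longrightarrow> TPlus s t \<in> tri_terms D"
| scale: "t \<in> tri_terms D \<Longrightarrow> TScale a t \<in> tri_terms D"

lemma tri_terms_cong': "km_eq D s t \<Longrightarrow> t \<in> tri_terms D \<Longrightarrow> s \<in> tri_terms D"
  by (rule tri_terms.cong[OF _ km_eq.sym])

lemma tri_terms_ad:
  assumes F: "\<And>t. t \<in> half_terms D GenF \<Longrightarrow> TBr x t \<in> tri_terms D"
    and E: "\<And>t. t \<in> half_terms D GenE \<Longrightarrow> TBr x t \<in> tri_terms D"
    and H: "\<And>h. TBr x (GenH h) \<in> tri_terms D"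
    and "t \<in> tri_terms D"
  shows "TBr x t \<in> tri_terms D"
  using assms(4)
proof (induction rule: tri_terms.induct)
  case (cong t s)
  then show ?case by (meson tri_terms.cong km_eq.cong_br km_eq.refl)
next
  case (add s t)
  then show ?case by (meson tri_terms_cong'[OF km_eq.br_plus_right] tri_terms.add)
next
  case (scale t a)
  then show ?case by (meson tri_terms_cong'[OF km_eq.br_scale_right] tri_terms.scale)
qed (use F E H in auto)

lemma tri_terms_ad_e: "t \<in> tri_terms D \<Longrightarrow> TBr (GenE i) t \<in> tri_terms D"
proof (rule tri_terms_ad)
  fix t assume "t \<in> half_terms D GenF"
  from half_terms_br_opposite[OF km_eq.rel_hf km_rel_ef_all this]
  show "TBr (GenE i) t \<in> tri_terms D"
    by (meson tri_terms_cong' tri_terms.intros)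
next
  fix h
  have "TBr (GenE i) (GenH h) \<in> half_terms D GenE"
    by (rule half_terms_cong'[OF km_br_anti]) (intro half_terms.scale half_terms_br_h[OF km_eq.rel_he] half_terms.gen)
  then show "TBr (GenE i) (GenH h) \<in> tri_terms D" by (rule tri_terms.plus)
qed (auto intro: tri_terms.plus half_terms.br)

lemma tri_terms_ad_f: "t \<in> tri_terms D \<Longrightarrow> TBr (GenF i) t \<in> tri_terms D"
proof (rule tri_terms_ad)
  fix t assume "t \<in> half_terms D GenE"
  from half_terms_br_opposite[OF km_eq.rel_he km_rel_fe_all this]
  show "TBr (GenF i) t \<in> tri_terms D"
    by (meson tri_terms_cong' tri_terms.intros)
next
  fix h
  have "TBr (GenF i) (GenH h) \<in> half_terms D GenF"
    by (rule half_terms_cong'[OF km_br_anti]) (intro half_terms.scale half_terms_br_h[OF km_eq.rel_hf] half_terms.gen)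
  then show "TBr (GenF i) (GenH h) \<in> tri_terms D" by (rule tri_terms.minus)
qed (auto intro: tri_terms.minus half_terms.br)

lemma tri_terms_ad_h: "t \<in> tri_terms D \<Longrightarrow> TBr (GenH h) t \<in> tri_terms D"
proof (rule tri_terms_ad)
  fix h'
  show "TBr (GenH h) (GenH h') \<in> tri_terms D"
    by (rule tri_terms_cong'[OF km_eq.rel_hh]) (intro tri_terms.minus half_terms.zero)
qed (auto intro: tri_terms.minus tri_terms.plus half_terms_br_h[OF km_eq.rel_hf] half_terms_br_h[OF km_eq.rel_he])

text \<open>The Jacobi identity reduces a bracket in the left argument to brackets with its two
  entries, so stability under the generators suffices.\<close>

lemma tri_terms_br: "t \<in> tri_terms D \<Longrightarrow> TBr s t \<in> tri_terms D"
proof (induction s arbitrary: t)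
  case TZero
  have "km_eq D (TBr TZero t) TZero"
    by (meson km_br_anti km_eq.trans km_eq.cong_scale km_br_zero km_scale_zero)
  then show ?case by (rule tri_terms_cong') (intro tri_terms.minus half_terms.zero)
next
  case (TPlus s s')
  then show ?case by (blast intro: tri_terms_cong'[OF km_eq.br_plus_left tri_terms.add])
next
  case (TScale a s)
  then show ?case by (blast intro: tri_terms_cong'[OF km_eq.br_scale_left tri_terms.scale])
next
  case (TBr s u)
  have "km_eq D (TPlus (TBr (TBr s u) t) (TBr u (TBr s t))) (TBr s (TBr u t))"
    by (rule km_eq.sym[OF km_jacobi])
  have "km_eq D (TBr (TBr s u) t) (TPlus (TBr (TBr s u) t) TZero)"
    by (rule km_eq.sym[OF km_plus_zero_right])
  also have "km_eq D \<dots> (TPlus (TBr (TBr s u) t) (TPlus (TBr u (TBr s t)) (TScale (- 1) (TBr u (TBr s t)))))"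
    by (intro km_eq.cong_plus km_eq.refl km_eq.sym[OF km_eq.plus_neg])
  also have "km_eq D \<dots> (TPlus (TPlus (TBr (TBr s u) t) (TBr u (TBr s t))) (TScale (- 1) (TBr u (TBr s t))))"
    by (rule km_eq.sym[OF km_eq.plus_assoc])
  also have "km_eq D \<dots> (TPlus (TBr s (TBr u t)) (TScale (- 1) (TBr u (TBr s t))))"
    by (intro km_eq.cong_plus km_eq.refl km_eq.sym[OF km_jacobi])
  finally show ?case
    by (rule tri_terms_cong') (intro tri_terms.add tri_terms.scale TBr)
qed (auto intro: tri_terms_ad_e tri_terms_ad_f tri_terms_ad_h)

lemma lie_term_in_tri_terms: "t \<in> tri_terms D"
proof (induction t)
  case TZero
  show ?case by (intro tri_terms.minus half_terms.zero)
next
  case (TBr s t)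
  then show ?case by (intro tri_terms_br)
qed (intro tri_terms.add tri_terms.scale tri_terms.cartan tri_terms.minus[OF half_terms.gen]
    tri_terms.plus[OF half_terms.gen]; assumption)+

subsection \<open>The free Verma module\<close>

text \<open>
  Kac's module over the algebra of Lie terms, realised on the free associative algebra on the
  letters \<open>f_i\<close>.
\<close>

definition wt :: "('i, 'h, 'g) km_data \<Rightarrow> 'i list \<Rightarrow> 'h \<Rightarrow> complex" where
  "wt D w h = (\<Sum>i\<leftarrow>w. simple_root D i h)"

lemma wt_Nil [simp]: "wt D [] h = 0" and wt_Cons [simp]: "wt D (i # w) h = simple_root D i h + wt D w h"
  by (simp_all add: wt_def)

type_synonym 'i verma = "'i list \<Rightarrow>\<^sub>0 complex"

abbreviation vw :: "'i list \<Rightarrow> 'i verma" where "vw w \<equiv> Poly_Mapping.single w 1"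

definition verma_f :: "'i \<Rightarrow> 'i verma \<Rightarrow> 'i verma" where
  "verma_f i = lin_ext (\<lambda>w. vw (i # w))"

definition verma_h :: "('i, 'h, 'g) km_data \<Rightarrow> ('h \<Rightarrow> complex) \<Rightarrow> 'h \<Rightarrow> 'i verma \<Rightarrow> 'i verma" where
  "verma_h D l h = lin_ext (\<lambda>w. (l h - wt D w h) *\<^sub>C vw w)"

text \<open>Obtained by commuting \<open>e_i\<close> to the right: past an equal letter it leaves
  the coroot, which acts on \<open>vw w\<close> by the scalar shown, and it kills the highest weight
  vector.\<close>

fun verma_e_word :: "('i, 'h, 'g) km_data \<Rightarrow> ('h \<Rightarrow> complex) \<Rightarrow> 'i \<Rightarrow> 'i list \<Rightarrow> 'i verma" where
  "verma_e_word D l i [] = 0"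
| "verma_e_word D l i (j # w) = (if i = j then (l (simple_coroot D i) - wt D w (simple_coroot D i)) *\<^sub>C vw w else 0)
     + verma_f j (verma_e_word D l i w)"

definition verma_e :: "('i, 'h, 'g) km_data \<Rightarrow> ('h \<Rightarrow> complex) \<Rightarrow> 'i \<Rightarrow> 'i verma \<Rightarrow> 'i verma" where
  "verma_e D l i = lin_ext (verma_e_word D l i)"

fun verma_act :: "('i, 'h, 'g) km_data \<Rightarrow> ('h \<Rightarrow> complex) \<Rightarrow> ('i, 'h) lie_term \<Rightarrow> 'i verma \<Rightarrow> 'i verma" where
  "verma_act D l (GenE i) = verma_e D l i"
| "verma_act D l (GenF i) = verma_f i"
| "verma_act D l (GenH h) = verma_h D l h"
| "verma_act D l TZero = (\<lambda>p. 0)"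
| "verma_act D l (TPlus s t) = (\<lambda>p. verma_act D l s p + verma_act D l t p)"
| "verma_act D l (TScale a t) = (\<lambda>p. a *\<^sub>C verma_act D l t p)"
| "verma_act D l (TBr s t) = (\<lambda>p. verma_act D l s (verma_act D l t p) - verma_act D l t (verma_act D l s p))"

lemma verma_f_single [simp]: "verma_f i (vw w) = vw (i # w)"
  by (simp add: verma_f_def)

lemma verma_h_single [simp]: "verma_h D l h (vw w) = (l h - wt D w h) *\<^sub>C vw w"
  by (simp add: verma_h_def del: scaleC_complex)

lemma verma_e_single [simp]: "verma_e D l i (vw w) = verma_e_word D l i w"
  by (simp add: verma_e_def)

lemma clinear_verma_e [simp]: "clinear (verma_e D l i)"
  and clinear_verma_f [simp]: "clinear (verma_f i)"
  and clinear_verma_h [simp]: "clinear (verma_h D l h)"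
  by (simp_all add: verma_e_def verma_f_def verma_h_def clinear_lin_ext)

lemmas verma_linear =
  clinear_verma_e[THEN clinear_add] clinear_verma_f[THEN clinear_add] clinear_verma_h[THEN clinear_add]
  clinear_verma_e[THEN clinear_scale] clinear_verma_f[THEN clinear_scale] clinear_verma_h[THEN clinear_scale]
  clinear_verma_e[THEN clinear_diff] clinear_verma_f[THEN clinear_diff] clinear_verma_h[THEN clinear_diff]
  clinear_verma_e[THEN clinear_0] clinear_verma_f[THEN clinear_0] clinear_verma_h[THEN clinear_0]

lemma clinear_verma_act [simp]: "clinear (verma_act D l t)"
proof (induction t)
  case (TBr s t)
  then show ?case by (intro clinearI) (simp_all add: clinear_add clinear_scale clinear_diff scaleC_distribs)
next
  case (TPlus s t)
  then show ?case by (intro clinearI) (simp_all add: clinear_add clinear_scale scaleC_distribs)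
next
  case (TScale a t)
  then show ?case by (intro clinearI) (simp_all add: clinear_add clinear_scale scaleC_distribs mult.commute)
next
  case TZero
  show ?case by (intro clinearI) simp_all
qed simp_all

lemma verma_e_f: "verma_e D l i (verma_f j p)
  = (if i = j then verma_h D l (simple_coroot D i) p else 0) + verma_f j (verma_e D l i p)"
proof -
  have "(\<lambda>p. verma_e D l i (verma_f j p))
    = (\<lambda>p. (if i = j then verma_h D l (simple_coroot D i) p else 0) + verma_f j (verma_e D l i p))"
    by (rule clinear_poly_mapping_eqI) (auto simp: clinear_iff verma_linear scaleC_add_right)
  then show ?thesis by (rule fun_cong)
qed

lemma verma_h_f: "verma_h D l h (verma_f i p)
  = verma_f i (verma_h D l h p) - simple_root D i h *\<^sub>C verma_f i p"
proof -
  have "(\<lambda>p. verma_h D l h (verma_f i p)) = (\<lambda>p. verma_f i (verma_h D l h p) - simple_root D i h *\<^sub>C verma_f i p)"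
    by (rule clinear_poly_mapping_eqI) (auto simp: clinear_iff verma_linear
        scaleC_distribs algebra_simps)
  then show ?thesis by (rule fun_cong)
qed

lemma verma_h_e_word: "verma_h D l h (verma_e_word D l i w)
  = (l h - wt D w h + simple_root D i h) *\<^sub>C verma_e_word D l i w"
proof (induction w)
  case (Cons j w)
  show ?case
    by (simp add: Cons.IH verma_linear verma_h_f scaleC_distribs algebra_simps)
qed (simp add: verma_linear)

lemma verma_h_e: "verma_h D l h (verma_e D l i p) - verma_e D l i (verma_h D l h p)
  = simple_root D i h *\<^sub>C verma_e D l i p"
proof -
  have "(\<lambda>p. verma_h D l h (verma_e D l i p) - verma_e D l i (verma_h D l h p))
    = (\<lambda>p. simple_root D i h *\<^sub>C verma_e D l i p)"
    by (rule clinear_poly_mapping_eqI) (auto simp: clinear_iff verma_linear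
        verma_h_e_word scaleC_distribs algebra_simps)
  then show ?thesis by (rule fun_cong)
qed

lemma verma_h_h: "verma_h D l h (verma_h D l h' p) = verma_h D l h' (verma_h D l h p)"
proof -
  have "(\<lambda>p. verma_h D l h (verma_h D l h' p)) = (\<lambda>p. verma_h D l h' (verma_h D l h p))"
    by (rule clinear_poly_mapping_eqI) (auto simp: clinear_iff verma_linear
        mult.commute)
  then show ?thesis by (rule fun_cong)
qed

lemma verma_h_add_scale:
  assumes "\<And>i. clinear (simple_root D i)" "clinear l"
  shows "verma_h D l (h + h') p = verma_h D l h p + verma_h D l h' p"
    and "verma_h D l (a *\<^sub>C h) p = a *\<^sub>C verma_h D l h p"
proof -
  have wt: "wt D w (h + h') = wt D w h + wt D w h'" "wt D w (a *\<^sub>C h) = a * wt D w h" for w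
    using assms(1) by (induction w) (simp_all add: verma_linear clinear_add clinear_scale algebra_simps)
  have "verma_h D l (h + h') = (\<lambda>p. verma_h D l h p + verma_h D l h' p)"
    by (rule clinear_poly_mapping_eqI) (auto simp: clinear_iff verma_linear wt assms(2) clinear_add[OF assms(2)]
        scaleC_distribs)
  then show "verma_h D l (h + h') p = verma_h D l h p + verma_h D l h' p" by (rule fun_cong)
  have "verma_h D l (a *\<^sub>C h) = (\<lambda>p. a *\<^sub>C verma_h D l h p)"
    by (rule clinear_poly_mapping_eqI) (auto simp: clinear_iff verma_linear wt assms(2) clinear_scale[OF assms(2)]
        scaleC_distribs algebra_simps)
  then show "verma_h D l (a *\<^sub>C h) p = a *\<^sub>C verma_h D l h p" by (rule fun_cong)
qed

text \<open>The action respects the defining relations, but it need not respect the radical: this is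
  a module of the Lie terms, and only suitable quotients of it are modules of the algebra.\<close>

lemma verma_act_km_eq:
  assumes "\<And>i. clinear (simple_root D i)" "clinear l" "km_eq D s t"
  shows "verma_act D l s p = verma_act D l t p"
  using assms(3)
proof (induction arbitrary: p rule: km_eq.induct)
  case (cong_br s s' t t')
  then show ?case by simp
next
  case (rel_ef i)
  then show ?case by (simp add: verma_e_f)
next
  case (rel_ef_neq i j)
  then show ?case by (simp add: verma_e_f)
next
  case (rel_hf h i)
  then show ?case by (simp add: verma_h_f)
qed (simp_all add: scaleC_distribs clinear_add[OF clinear_verma_act] clinear_diff[OF clinear_verma_act]
    clinear_scale[OF clinear_verma_act] verma_h_add_scale[OF assms(1,2)] verma_h_e verma_h_h algebra_simps)

subsection \<open>Structure of a Kac--Moody algebra\<close>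

text \<open>Right-normed brackets. The value 0 at the empty word makes the spans over all words and
  over nonempty words coincide.\<close>

fun nest :: "('g::zero \<Rightarrow> 'g \<Rightarrow> 'g) \<Rightarrow> ('i \<Rightarrow> 'g) \<Rightarrow> 'i list \<Rightarrow> 'g" where
  "nest b x [] = 0"
| "nest b x [i] = x i"
| "nest b x (i # j # w) = b (x i) (nest b x (j # w))"

lemma nest_Cons: "w \<noteq> [] \<Longrightarrow> nest b x (i # w) = b (x i) (nest b x w)"
  by (cases w) auto

text \<open>Makes weight spaces and highest weight vectors available for the algebra itself.\<close>

definition adj :: "('i, 'h, 'g) km_data \<Rightarrow> ('g, 'g) rep" where
  "adj D = \<lparr> rep_space = UNIV, rep_act = bracket D \<rparr>"

lemma adj_simps [simp]: "rep_space (adj D) = UNIV" "rep_act (adj D) = bracket D"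
  by (simp_all add: adj_def)

locale km_algebra =
  fixes D :: "('i::finite, 'h::complex_vector, 'g::complex_vector) km_data"
  assumes kac_moody: "kac_moody D"
begin

abbreviation "e \<equiv> chev_e D"
abbreviation "f \<equiv> chev_f D"
abbreviation "cart \<equiv> cartan D"
abbreviation "co \<equiv> simple_coroot D"
abbreviation "al \<equiv> simple_root D"
abbreviation "br \<equiv> bracket D"
abbreviation "A \<equiv> gcm D"

lemma gcm: "is_gcm A" and realization: "realization D" and real_form: "is_real_form D"
  and lie: "lie_algebra br" and surj_eval: "surj (lie_eval D)"
  and eval_0_iff: "lie_eval D t = 0 \<longleftrightarrow> t \<in> km_radical D"
  using kac_moody by (simp_all add: kac_moody_def)

lemma A_diag: "A i i = 2" and A_offdiag: "i \<noteq> j \<Longrightarrow> A i j \<le> 0" and A_zero: "A i j = 0 \<Longrightarrow> A j i = 0"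
  using gcm by (auto simp: is_gcm_def)

lemma al_linear [simp]: "clinear (al i)"
  and al_co [simp]: "al j (co i) = of_int (A i j)"
  and al_indep: "(\<And>h. (\<Sum>i\<in>UNIV. c i * al i h) = 0) \<Longrightarrow> c i = 0"
  and co_indep: "(\<Sum>i\<in>UNIV. c i *\<^sub>C co i) = 0 \<Longrightarrow> c i = 0"
  using realization by (auto simp: realization_def)

lemmas al_add [simp] = clinear_add[OF al_linear]
  and al_scale [simp] = clinear_scale[OF al_linear]
  and al_0 [simp] = clinear_0[OF al_linear]
  and al_minus [simp] = clinear_minus[OF al_linear]
  and al_diff [simp] = clinear_diff[OF al_linear]

lemma wt_add [simp]: "wt D w (h + h') = wt D w h + wt D w h'"
  and wt_scale [simp]: "wt D w (c *\<^sub>C h) = c * wt D w h"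
  by (induction w) (simp_all add: algebra_simps)

lemma wt_append [simp]: "wt D (w @ w') h = wt D w h + wt D w' h"
  by (simp add: wt_def)

lemma br_linear_right: "clinear (br x)" and br_linear_left: "clinear (\<lambda>x. br x y)"
  and br_self [simp]: "br x x = 0"
  and br_jacobi_cyclic: "br x (br y z) + br y (br z x) + br z (br x y) = 0"
  using lie by (auto simp: lie_algebra_def)

lemmas br_add_right = clinear_add[OF br_linear_right]
  and br_scale_right [simp] = clinear_scale[OF br_linear_right]
  and br_0_right [simp] = clinear_0[OF br_linear_right]
  and br_minus_right [simp] = clinear_minus[OF br_linear_right]
  and br_sum_right = clinear_sum[OF br_linear_right]
  and br_add_left = clinear_add[OF br_linear_left]
  and br_scale_left [simp] = clinear_scale[OF br_linear_left]
  and br_0_left [simp] = clinear_0[OF br_linear_left]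
  and br_minus_left [simp] = clinear_minus[OF br_linear_left]

lemma br_anti: "br x y = - br y x"
proof -
  have "br (x + y) (x + y) = br x y + br y x" unfolding br_add_left br_add_right by simp
  then have "br x y + br y x = 0" by (simp only: br_self)
  then show ?thesis by (simp add: eq_neg_iff_add_eq_0)
qed

lemma br_jacobi: "br (br x y) z = br x (br y z) - br y (br x z)"
proof -
  have "br x (br y z) + br y (br z x) + br z (br x y) = 0" by (rule br_jacobi_cyclic)
  moreover have "br z (br x y) = - br (br x y) z" by (rule br_anti)
  moreover have "br y (br z x) = - br y (br x z)" by (subst br_anti[of z x]) simp
  ultimately show ?thesis by (simp add: algebra_simps)
qed

lemma br_jacobi': "br x (br y z) = br (br x y) z + br y (br x z)"
  by (simp add: br_jacobi)

text \<open>The terms congruent to zero form one of the ideals whose union is the radical.\<close>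

lemma km_eq_zero_radical:
  assumes "km_eq D t TZero" shows "t \<in> km_radical D"
proof -
  have "km_ideal D {t. km_eq D t TZero}"
    unfolding km_ideal_def
  proof (intro conjI allI ballI impI; (elim conjE)?; unfold mem_Collect_eq)
    show "km_eq D TZero TZero" by (rule km_eq.refl)
    fix s t assume "km_eq D s TZero" "km_eq D s t"
    then show "km_eq D t TZero" by (meson km_eq.sym km_eq.trans)
  next
    fix s t assume "km_eq D s TZero" "km_eq D t TZero"
    then show "km_eq D (TPlus s t) TZero" by (meson km_eq.cong_plus km_eq.plus_zero km_eq.trans)
  next
    fix a t assume "km_eq D t TZero"
    then show "km_eq D (TScale a t) TZero" by (meson km_eq.cong_scale km_scale_zero km_eq.trans)
  next
    fix s t assume "km_eq D t TZero"
    then show "km_eq D (TBr s t) TZero" by (meson km_eq.cong_br km_br_zero km_eq.trans km_eq.refl)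
  qed
  with assms show ?thesis unfolding km_radical_def by blast
qed

lemma eval_km_eq: assumes "km_eq D s t" shows "lie_eval D s = lie_eval D t"
proof -
  have "km_eq D (TPlus s (TScale (- 1) t)) TZero"
    by (meson assms km_eq.trans km_eq.cong_plus km_eq.refl km_eq.plus_neg)
  then have "lie_eval D (TPlus s (TScale (- 1) t)) = 0"
    using eval_0_iff km_eq_zero_radical by blast
  then show ?thesis by simp
qed

lemma br_he [simp]: "br (cart h) (e i) = al i h *\<^sub>C e i"
  using eval_km_eq[OF km_eq.rel_he] by simp

lemma br_hf [simp]: "br (cart h) (f i) = - (al i h *\<^sub>C f i)"
  using eval_km_eq[OF km_eq.rel_hf] by simp

lemma br_hh [simp]: "br (cart h) (cart h') = 0"
  using eval_km_eq[OF km_eq.rel_hh] by simp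

lemma br_ef: "br (e i) (f j) = (if i = j then cart (co i) else 0)"
  using eval_km_eq[OF km_eq.rel_ef] eval_km_eq[OF km_eq.rel_ef_neq[of i j]] by simp

lemma br_fe: "br (f j) (e i) = (if i = j then - cart (co i) else 0)"
  by (subst br_anti) (simp add: br_ef)

lemma cart_linear: "clinear cart"
  using eval_km_eq[OF km_eq.h_plus] eval_km_eq[OF km_eq.h_scale] by (intro clinearI) simp_all

lemmas cart_add = clinear_add[OF cart_linear]
  and cart_scale [simp] = clinear_scale[OF cart_linear]
  and cart_0 [simp] = clinear_0[OF cart_linear]

text \<open>The radical is a union of ideals meeting the Cartan subalgebra trivially, so each of its
  elements lies in one of them.\<close>

lemma cart_0_km_eq: "cart h = 0 \<Longrightarrow> km_eq D (GenH h) TZero"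
  using eval_0_iff[of "GenH h"] by (auto simp: km_radical_def)

lemma functional_separates:
  assumes "(x::'h) \<noteq> 0"
  obtains l :: "'h \<Rightarrow> complex" where "clinear l" "l x \<noteq> 0"
proof -
  interpret vector_space_pair "scaleC :: complex \<Rightarrow> 'h \<Rightarrow> 'h" "scaleC :: complex \<Rightarrow> complex \<Rightarrow> complex" ..
  have "\<not> cdependent {x}" using assms by simp
  then obtain g :: "'h \<Rightarrow> complex" where "\<forall>y\<in>{x}. g y = 1" "clinear g"
    using linear_independent_extend[of "{x}" "\<lambda>_. 1"] unfolding cdependent_def by blast
  with that[of g] show ?thesis by auto
qed

text \<open>The free Verma modules of all highest weights together separate the points of the Cartan subalgebra.\<close>

lemma cart_inj: assumes "cart h = 0" shows "h = 0"
proof (rule ccontr)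
  assume "h \<noteq> 0"
  then obtain l :: "'h \<Rightarrow> complex" where l: "clinear l" "l h \<noteq> 0" by (rule functional_separates)
  have "verma_act D l (GenH h) (vw []) = verma_act D l TZero (vw [])"
    by (rule verma_act_km_eq[OF al_linear l(1) cart_0_km_eq[OF assms]])
  then have "l h *\<^sub>C vw ([] :: 'i list) = 0" by simp
  then have "Poly_Mapping.lookup (l h *\<^sub>C vw ([] :: 'i list)) [] = 0" by (simp only: lookup_zero)
  then show False using l(2) by simp
qed

lemma eval_induct [case_names add scale br e f h]:
  assumes "\<And>x y. P x \<Longrightarrow> P y \<Longrightarrow> P (x + y)" "\<And>a x. P x \<Longrightarrow> P (a *\<^sub>C x)"
    and "\<And>x y. P x \<Longrightarrow> P y \<Longrightarrow> P (br x y)" "\<And>i. P (e i)" "\<And>i. P (f i)" "\<And>h. P (cart h)"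
  shows "P x"
proof -
  have "P (lie_eval D t)" for t
  proof (induction t)
    case TZero
    show ?case using assms(6)[of 0] by simp
  qed (simp_all add: assms)
  then show ?thesis using surj_eval by (metis surj_def)
qed

text \<open>Pulled back to Lie terms, \<open>J\<close> becomes one of the ideals making up the
  radical, and the radical evaluates to zero. This is how the maximality of the radical is
  used.\<close>

lemma ideal_trivial:
  assumes J: "csubspace J"
    and e: "\<And>i x. x \<in> J \<Longrightarrow> br (e i) x \<in> J" and f: "\<And>i x. x \<in> J \<Longrightarrow> br (f i) x \<in> J"
    and h: "\<And>h x. x \<in> J \<Longrightarrow> br (cart h) x \<in> J"
    and cart: "\<And>h. cart h \<in> J \<Longrightarrow> h = 0" and "x \<in> J"
  shows "x = 0"
proof -
  have br: "br y z \<in> J" if "z \<in> J" for y z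
    using that
    by (induction y arbitrary: z rule: eval_induct)
      (simp_all add: br_add_left br_jacobi e f h J csubspace_add csubspace_scale csubspace_diff)
  let ?I = "{t. lie_eval D t \<in> J}"
  have "km_ideal D ?I"
    unfolding km_ideal_def using eval_km_eq
    by (auto simp: csubspace_0[OF J] csubspace_add[OF J] csubspace_scale[OF J] br)
  moreover have "km_eq D (GenH h) TZero" if "GenH h \<in> ?I" for h
    using cart[of h] that km_h_zero by auto
  ultimately have "?I \<subseteq> km_radical D" unfolding km_radical_def by blast
  moreover obtain t where t: "x = lie_eval D t" using surj_eval by (metis surj_def)
  ultimately show ?thesis using assms(6) eval_0_iff by auto
qed

definition coweight :: "'i \<Rightarrow> 'h" where
  "coweight = (SOME b. \<forall>j i. al i (b j) = (if i = j then 1 else 0))"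

lemma al_coweight: "al i (coweight j) = (if i = j then 1 else 0)"
proof -
  have "\<exists>b. \<forall>j\<in>UNIV. b j \<in> (UNIV :: 'h set) \<and> (\<forall>i\<in>UNIV. al i (b j) = (if i = j then 1 else 0))"
    by (rule dual_family_exists) (auto intro: al_indep)
  then have "\<exists>b. \<forall>j i. al i (b j) = (if i = j then 1 else 0)" by auto
  from someI_ex[OF this] show ?thesis unfolding coweight_def by blast
qed

lemma wt_coweight: "wt D w (coweight j) = of_nat (count_list w j)"
  by (induction w) (simp_all add: al_coweight)

text \<open>Every simple root takes the value 1 here, so this element measures heights: words of
  equal weight have equal length.\<close>

definition hgt :: 'h where "hgt = (\<Sum>j\<in>UNIV. coweight j)"

lemma al_hgt [simp]: "al i hgt = 1"
  by (simp add: hgt_def clinear_sum[OF al_linear] al_coweight)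

lemma wt_hgt [simp]: "wt D w hgt = of_nat (length w)"
  by (induction w) simp_all

lemma wt_eq_length: "wt D w = wt D w' \<Longrightarrow> length w = length w'"
  using wt_hgt[of w] wt_hgt[of w'] by (metis of_nat_eq_iff)

lemma al_real: "h \<in> real_form D \<Longrightarrow> al i h \<in> \<real>"
  using real_form by (auto simp: is_real_form_def)

lemma real_form_decomp:
  obtains a b where "a \<in> real_form D" "b \<in> real_form D" "h = a + \<i> *\<^sub>C b"
  using real_form unfolding is_real_form_def by blast

lemma wt_real: "h \<in> real_form D \<Longrightarrow> wt D w h \<in> \<real>"
  by (induction w) (simp_all add: al_real)

end

subsection \<open>Representations\<close>

locale g_rep = km_algebra D for D :: "('i::finite, 'h::complex_vector, 'g::complex_vector) km_data" +
  fixes R :: "('g, 'v::complex_vector) rep"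
  assumes rep: "is_rep br R"
begin

abbreviation "S \<equiv> rep_space R"
abbreviation act :: "'g \<Rightarrow> 'v \<Rightarrow> 'v" (infixr "\<cdot>" 76) where "act \<equiv> rep_act R"

lemma S: "csubspace S"
  and act_in [simp]: "v \<in> S \<Longrightarrow> x \<cdot> v \<in> S"
  and act_add_right: "u \<in> S \<Longrightarrow> v \<in> S \<Longrightarrow> x \<cdot> (u + v) = x \<cdot> u + x \<cdot> v"
  and act_scale_right: "v \<in> S \<Longrightarrow> x \<cdot> (a *\<^sub>C v) = a *\<^sub>C x \<cdot> v"
  and act_add_left: "v \<in> S \<Longrightarrow> (x + y) \<cdot> v = x \<cdot> v + y \<cdot> v"
  and act_scale_left: "v \<in> S \<Longrightarrow> (a *\<^sub>C x) \<cdot> v = a *\<^sub>C x \<cdot> v"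
  and act_br: "v \<in> S \<Longrightarrow> br x y \<cdot> v = x \<cdot> y \<cdot> v - y \<cdot> x \<cdot> v"
  using rep by (auto simp: is_rep_def)

lemmas S_0 [simp] = csubspace_0[OF S]
  and S_add [simp] = csubspace_add[OF S]
  and S_scale [simp] = csubspace_scale[OF S]
  and S_neg [simp] = csubspace_neg[OF S]
  and S_diff [simp] = csubspace_diff[OF S]
  and S_sum = csubspace_sum[OF S]

lemma act_0_right [simp]: "x \<cdot> 0 = 0" using act_scale_right[of 0 x 0] by simp

lemma act_minus_right: "v \<in> S \<Longrightarrow> x \<cdot> (- v) = - (x \<cdot> v)" using act_scale_right[of v x "- 1"] by simp

lemma act_diff_right: "u \<in> S \<Longrightarrow> v \<in> S \<Longrightarrow> x \<cdot> (u - v) = x \<cdot> u - x \<cdot> v"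
  using act_add_right[of u "- v" x] by (simp add: act_minus_right)

lemma act_0_left [simp]: "v \<in> S \<Longrightarrow> 0 \<cdot> v = 0" using act_scale_left[of v 0 0] by simp

lemma act_minus_left: "v \<in> S \<Longrightarrow> (- x) \<cdot> v = - (x \<cdot> v)" using act_scale_left[of v "- 1" x] by simp

lemma act_sum_right: "(\<And>a. a \<in> K \<Longrightarrow> g a \<in> S) \<Longrightarrow> x \<cdot> sum g K = (\<Sum>a\<in>K. x \<cdot> g a)"
  by (induction K rule: infinite_finite_induct) (simp_all add: act_add_right S_sum)

lemma act_sum_left: "v \<in> S \<Longrightarrow> sum g K \<cdot> v = (\<Sum>a\<in>K. g a \<cdot> v)"
  by (induction K rule: infinite_finite_induct) (simp_all add: act_add_left)

lemma funpow_in [simp]: "v \<in> S \<Longrightarrow> (act x ^^ k) v \<in> S"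
  by (induction k) simp_all

lemma funpow_0: "(act x ^^ k) 0 = 0"
  by (induction k) simp_all

lemma funpow_add_right: "u \<in> S \<Longrightarrow> v \<in> S \<Longrightarrow> (act x ^^ k) (u + v) = (act x ^^ k) u + (act x ^^ k) v"
  and funpow_scale_right: "v \<in> S \<Longrightarrow> (act x ^^ k) (a *\<^sub>C v) = a *\<^sub>C (act x ^^ k) v"
  by (induction k) (simp_all add: act_add_right act_scale_right)

lemma funpow_mono_0: assumes "(act x ^^ k) v = 0" "k \<le> n" shows "(act x ^^ n) v = 0"
proof -
  have "(act x ^^ n) v = (act x ^^ (n - k)) ((act x ^^ k) v)"
    using assms(2) by (simp flip: funpow_add[THEN fun_cong, unfolded comp_def])
  then show ?thesis by (simp add: assms(1) funpow_0)
qed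

lemma foldr_in [simp]: "v \<in> S \<Longrightarrow> foldr (\<lambda>i. act (g i)) w v \<in> S"
  by (induction w) simp_all

lemma weight_spaceD: "v \<in> weight_space D R \<gamma> \<Longrightarrow> v \<in> S" "v \<in> weight_space D R \<gamma> \<Longrightarrow> cart h \<cdot> v = \<gamma> h *\<^sub>C v"
  by (auto simp: weight_space_def)

lemma weight_space_subspace: "csubspace (weight_space D R \<gamma>)"
  by (rule csubspaceI)
    (auto simp: weight_space_def act_add_right act_scale_right scaleC_distribs mult.commute)

lemma weight_space_e: "v \<in> weight_space D R \<gamma> \<Longrightarrow> e i \<cdot> v \<in> weight_space D R (\<lambda>h. \<gamma> h + al i h)"
proof -
  assume v: "v \<in> weight_space D R \<gamma>"
  have "cart h \<cdot> e i \<cdot> v = (\<gamma> h + al i h) *\<^sub>C e i \<cdot> v" for h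
    using act_br[of v "cart h" "e i"] weight_spaceD[OF v]
    by (simp add: act_scale_left act_scale_right scaleC_add_left algebra_simps)
  then show ?thesis using weight_spaceD(1)[OF v] by (simp add: weight_space_def)
qed

lemma weight_space_f: "v \<in> weight_space D R \<gamma> \<Longrightarrow> f i \<cdot> v \<in> weight_space D R (\<lambda>h. \<gamma> h - al i h)"
proof -
  assume v: "v \<in> weight_space D R \<gamma>"
  have "cart h \<cdot> f i \<cdot> v = (\<gamma> h - al i h) *\<^sub>C f i \<cdot> v" for h
    using act_br[of v "cart h" "f i"] weight_spaceD[OF v]
    by (simp add: act_scale_left act_scale_right act_minus_left scaleC_diff_left algebra_simps)
  then show ?thesis using weight_spaceD(1)[OF v] by (simp add: weight_space_def)
qed

lemma weight_space_fword: "v \<in> weight_space D R \<gamma> \<Longrightarrow>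
    foldr (\<lambda>i. act (f i)) w v \<in> weight_space D R (\<lambda>h. \<gamma> h - wt D w h)"
proof (induction w)
  case (Cons i w)
  from weight_space_f[OF Cons.IH[OF Cons.prems], of i] show ?case by (simp add: algebra_simps)
qed simp

text \<open>With \<open>h\<close> separating \<open>\<delta>\<close> from \<open>\<gamma>1\<close>,
  the operator \<open>cart h - \<gamma>1 h\<close> removes the summand of weight
  \<open>\<gamma>1\<close> and multiplies \<open>u0\<close> by a nonzero factor.\<close>

lemma weight_component:
  assumes N: "csubspace N" and stable: "\<And>h x. x \<in> N \<Longrightarrow> cart h \<cdot> x \<in> N"
    and "finite \<Gamma>" "\<delta> \<notin> \<Gamma>" "u0 \<in> weight_space D R \<delta>"
    and "\<And>\<gamma>. \<gamma> \<in> \<Gamma> \<Longrightarrow> u \<gamma> \<in> weight_space D R \<gamma>" and "u0 + (\<Sum>\<gamma>\<in>\<Gamma>. u \<gamma>) \<in> N"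
  shows "u0 \<in> N"
  using assms(3-)
proof (induction \<Gamma> arbitrary: u0 u)
  case (insert \<gamma>1 \<Gamma>)
  obtain h where h: "\<delta> h \<noteq> \<gamma>1 h" using insert.prems(1) by (metis ext insertI1)
  let ?x = "u0 + (\<Sum>\<gamma>\<in>insert \<gamma>1 \<Gamma>. u \<gamma>)"
  have uS: "u \<gamma> \<in> S" if "\<gamma> \<in> insert \<gamma>1 \<Gamma>" for \<gamma>
    using insert.prems(3)[OF that] weight_spaceD by blast
  have u0S: "u0 \<in> S" using insert.prems(2) weight_spaceD by blast
  have "cart h \<cdot> ?x = \<delta> h *\<^sub>C u0 + (\<Sum>\<gamma>\<in>insert \<gamma>1 \<Gamma>. \<gamma> h *\<^sub>C u \<gamma>)"
  proof -
    have "cart h \<cdot> ?x = cart h \<cdot> u0 + (\<Sum>\<gamma>\<in>insert \<gamma>1 \<Gamma>. cart h \<cdot> u \<gamma>)"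
      using u0S uS by (simp only: act_add_right[OF u0S S_sum] act_sum_right)
    also have "(\<Sum>\<gamma>\<in>insert \<gamma>1 \<Gamma>. cart h \<cdot> u \<gamma>) = (\<Sum>\<gamma>\<in>insert \<gamma>1 \<Gamma>. \<gamma> h *\<^sub>C u \<gamma>)"
      by (rule sum.cong) (auto simp: weight_spaceD(2)[OF insert.prems(3)])
    finally show ?thesis by (simp only: weight_spaceD(2)[OF insert.prems(2)])
  qed
  then have "cart h \<cdot> ?x - \<gamma>1 h *\<^sub>C ?x
      = (\<delta> h - \<gamma>1 h) *\<^sub>C u0 + (\<Sum>\<gamma>\<in>insert \<gamma>1 \<Gamma>. (\<gamma> h - \<gamma>1 h) *\<^sub>C u \<gamma>)"
    by (simp add: scaleC_distribs scaleC_sum_right sum_subtractf algebra_simps del: sum.insert)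
  also have "\<dots> = (\<delta> h - \<gamma>1 h) *\<^sub>C u0 + (\<Sum>\<gamma>\<in>\<Gamma>. (\<gamma> h - \<gamma>1 h) *\<^sub>C u \<gamma>)"
    using insert.hyps by simp
  finally have "(\<delta> h - \<gamma>1 h) *\<^sub>C u0 + (\<Sum>\<gamma>\<in>\<Gamma>. (\<gamma> h - \<gamma>1 h) *\<^sub>C u \<gamma>) \<in> N"
    using insert.prems(4) stable N by (metis csubspace_diff csubspace_scale)
  then have "(\<delta> h - \<gamma>1 h) *\<^sub>C u0 \<in> N"
    using insert.prems weight_space_subspace
    by (intro insert.IH[of "(\<delta> h - \<gamma>1 h) *\<^sub>C u0" "\<lambda>\<gamma>. (\<gamma> h - \<gamma>1 h) *\<^sub>C u \<gamma>"]) (auto intro: csubspace_scale)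
  then have "(1 / (\<delta> h - \<gamma>1 h)) *\<^sub>C (\<delta> h - \<gamma>1 h) *\<^sub>C u0 \<in> N" by (rule csubspace_scale[OF N])
  then show ?case using h by simp
qed simp

lemma weight_components:
  assumes N: "csubspace N" and stable: "\<And>h x. x \<in> N \<Longrightarrow> cart h \<cdot> x \<in> N"
    and "finite \<Gamma>" "\<And>\<gamma>. \<gamma> \<in> \<Gamma> \<Longrightarrow> u \<gamma> \<in> weight_space D R \<gamma>" "(\<Sum>\<gamma>\<in>\<Gamma>. u \<gamma>) \<in> N" "\<gamma> \<in> \<Gamma>"
  shows "u \<gamma> \<in> N"
proof -
  have "(\<Sum>\<gamma>\<in>\<Gamma>. u \<gamma>) = u \<gamma> + (\<Sum>\<gamma>\<in>\<Gamma> - {\<gamma>}. u \<gamma>)" using assms by (simp add: sum.remove)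
  then show ?thesis
    using weight_component[OF N stable, of "\<Gamma> - {\<gamma>}" \<gamma> "u \<gamma>" u] assms by auto
qed

lemma weight_decomposition:
  assumes "\<And>k. k \<in> K \<Longrightarrow> g k \<in> weight_space D R (W k)" "v \<in> cspan (g ` K)"
  obtains \<Gamma> u where "finite \<Gamma>" "\<Gamma> \<subseteq> W ` K" "\<And>\<gamma>. u \<gamma> \<in> cspan (g ` {k \<in> K. W k = \<gamma>})" "v = (\<Sum>\<gamma>\<in>\<Gamma>. u \<gamma>)"
proof -
  obtain F c where F: "finite F" "F \<subseteq> K" "v = (\<Sum>k\<in>F. c k *\<^sub>C g k)"
    using assms(2) by (rule cspan_image_sum)
  define u where "u \<gamma> = (\<Sum>k\<in>{k \<in> F. W k = \<gamma>}. c k *\<^sub>C g k)" for \<gamma>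
  have "v = (\<Sum>\<gamma>\<in>W ` F. u \<gamma>)"
    unfolding F(3) u_def by (rule sum.image_gen[OF F(1)])
  moreover have "u \<gamma> \<in> cspan (g ` {k \<in> K. W k = \<gamma>})" for \<gamma>
    unfolding u_def using F(2)
    by (intro complex_vector.span_sum complex_vector.span_scale cspan_base) auto
  ultimately show ?thesis using that[of "W ` F" u] F by auto
qed

lemma cspan_weight_space:
  assumes "\<And>k. k \<in> K \<Longrightarrow> g k \<in> weight_space D R (W k)"
  shows "cspan (g ` {k \<in> K. W k = \<gamma>}) \<subseteq> weight_space D R \<gamma>"
  by (rule cspan_minimal) (use assms weight_space_subspace in auto)

text \<open>Vectors of different weights are independent, so the components of the other weights
  cancel; this is \<open>weight_component\<close> for the zero subspace.\<close>

lemma weight_space_cspan: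
  assumes W: "\<And>k. k \<in> K \<Longrightarrow> g k \<in> weight_space D R (W k)" and v: "v \<in> cspan (g ` K)"
    and "v \<in> weight_space D R \<gamma>"
  shows "v \<in> cspan (g ` {k \<in> K. W k = \<gamma>})"
proof -
  obtain \<Gamma> u where *: "finite \<Gamma>" "\<Gamma> \<subseteq> W ` K" "\<And>\<gamma>. u \<gamma> \<in> cspan (g ` {k \<in> K. W k = \<gamma>})"
    "v = (\<Sum>\<gamma>\<in>\<Gamma>. u \<gamma>)"
    by (rule weight_decomposition[OF W v]) blast+
  have uw: "u \<delta> \<in> weight_space D R \<delta>" for \<delta> using *(3)[of \<delta>] cspan_weight_space[of K g W \<delta>, OF W] by (rule subsetD[rotated])
  define d where "d = (if \<gamma> \<in> \<Gamma> then u \<gamma> else 0) - v"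
  have dw: "d \<in> weight_space D R \<gamma>"
    unfolding d_def using uw[of \<gamma>] assms(3) csubspace_0[OF weight_space_subspace[of \<gamma>]]
    by (intro csubspace_diff[OF weight_space_subspace]) simp_all
  have d0: "d + (\<Sum>\<delta>\<in>\<Gamma> - {\<gamma>}. u \<delta>) = 0"
    unfolding d_def *(4) using *(1) by (simp add: sum.remove[of \<Gamma> \<gamma>])
  have "d \<in> {0}"
  proof (rule weight_component[where \<delta> = \<gamma>])
    show "d + (\<Sum>\<delta>\<in>\<Gamma> - {\<gamma>}. u \<delta>) \<in> {0}" using d0 by simp
    show "finite (\<Gamma> - {\<gamma>})" using *(1) by simp
    show "cart h \<cdot> x \<in> {0}" if "x \<in> {0}" for h x using that by simp
    show "d \<in> weight_space D R \<gamma>" by (rule dw)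
  qed (use uw in auto)
  then have "v = (if \<gamma> \<in> \<Gamma> then u \<gamma> else 0)" by (simp add: d_def)
  then show ?thesis using *(3)[of \<gamma>] complex_vector.span_zero by (metis (full_types))
qed

lemma submoduleI:
  assumes "csubspace M" "M \<subseteq> S" "\<And>i v. v \<in> M \<Longrightarrow> e i \<cdot> v \<in> M" "\<And>i v. v \<in> M \<Longrightarrow> f i \<cdot> v \<in> M"
    "\<And>h v. v \<in> M \<Longrightarrow> cart h \<cdot> v \<in> M"
  shows "submodule R M"
proof -
  have "x \<cdot> v \<in> M" if "v \<in> M" for x v
    using that
  proof (induction x arbitrary: v rule: eval_induct)
    case (br x y)
    have "v \<in> S" using br.prems assms(2) by blast
    then show ?case using br by (simp add: act_br csubspace_diff[OF assms(1)])
  next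
    case (add x y)
    have "v \<in> S" using add.prems assms(2) by blast
    then show ?case using add by (simp add: act_add_left csubspace_add[OF assms(1)])
  next
    case (scale a x)
    have "v \<in> S" using scale.prems assms(2) by blast
    then show ?case using scale by (simp add: act_scale_left csubspace_scale[OF assms(1)])
  qed (use assms in auto)
  with assms show ?thesis by (simp add: submodule_def)
qed

lemma env_orbit_in: assumes "v \<in> S" shows "env_orbit R X v \<subseteq> S"
  unfolding env_orbit_def by (rule cspan_minimal) (use assms S in auto)

lemma env_orbit_stable:
  assumes "v \<in> S" "x \<in> X" "u \<in> env_orbit R X v"
  shows "x \<cdot> u \<in> env_orbit R X v"
proof -
  let ?G = "{foldr act xs v |xs. set xs \<subseteq> X}"
  have GS: "cspan ?G \<subseteq> S" using env_orbit_in[OF assms(1), of X] by (simp add: env_orbit_def)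
  have "x \<cdot> y \<in> ?G" if y: "y \<in> ?G" for y
  proof -
    obtain xs where "set xs \<subseteq> X" "y = foldr act xs v" using y by auto
    then show ?thesis using assms(2) by (intro CollectI exI[of _ "x # xs"]) auto
  qed
  then have "cspan ?G \<subseteq> {u \<in> S. x \<cdot> u \<in> cspan ?G}"
  proof (intro cspan_minimal csubspaceI subsetI)
    fix y assume G: "\<And>y. y \<in> ?G \<Longrightarrow> x \<cdot> y \<in> ?G" and "y \<in> ?G"
    then show "y \<in> {u \<in> S. x \<cdot> u \<in> cspan ?G}"
      using G[OF \<open>y \<in> ?G\<close>] GS cspan_base[of _ ?G] by blast
  qed (auto simp: act_add_right act_scale_right complex_vector.span_zero complex_vector.span_add
        complex_vector.span_scale)
  then show ?thesis using assms(3) by (auto simp: env_orbit_def)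
qed

lemma env_orbit_base: "v \<in> env_orbit R X v"
  unfolding env_orbit_def by (rule cspan_base) (auto intro!: exI[of _ "[]"])

lemma env_orbit_subspace: "csubspace (env_orbit R X v)"
  by (simp add: env_orbit_def)

lemma env_orbit_minimal:
  assumes "csubspace M" "v \<in> M" "\<And>x u. x \<in> X \<Longrightarrow> u \<in> M \<Longrightarrow> x \<cdot> u \<in> M"
  shows "env_orbit R X v \<subseteq> M"
  unfolding env_orbit_def
proof (rule cspan_minimal[OF _ assms(1)], safe)
  fix xs assume "set xs \<subseteq> X"
  then show "foldr act xs v \<in> M" by (induction xs) (auto simp: assms)
qed

lemma env_orbit_submodule: "v \<in> S \<Longrightarrow> submodule R (env_orbit R UNIV v)"
  by (simp add: submodule_def env_orbit_subspace env_orbit_in env_orbit_stable)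

lemma submodule_orbit: "submodule R M \<Longrightarrow> v \<in> M \<Longrightarrow> env_orbit R UNIV v \<subseteq> M"
  by (rule env_orbit_minimal) (auto simp: submodule_def)

text \<open>The sl(2) computation of commuting \<open>e_i\<close> through a power of
  \<open>f_i\<close>. At \<open>k = 0\<close> the truncated exponent \<open>k - 1\<close> is
  harmless, since the factor vanishes.\<close>

lemma sl2_e_f_pow:
  assumes v: "v \<in> weight_space D R \<gamma>" and "e i \<cdot> v = 0"
  shows "e i \<cdot> (act (f i) ^^ k) v = (of_nat k * (\<gamma> (co i) - of_nat k + 1)) *\<^sub>C (act (f i) ^^ (k - 1)) v"
proof (induction k)
  case 0
  then show ?case using assms by simp
next
  case (Suc k)
  let ?u = "(act (f i) ^^ k) v"
  have vS: "v \<in> S" using v weight_spaceD by blast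
  have u: "?u = foldr (\<lambda>j. act (f j)) (replicate k i) v"
    by (induction k) simp_all
  have "wt D (replicate k i) (co i) = 2 * of_nat k"
    by (induction k) (simp_all add: A_diag algebra_simps)
  then have 1: "cart (co i) \<cdot> ?u = (\<gamma> (co i) - 2 * of_nat k) *\<^sub>C ?u"
    unfolding u by (simp only: weight_spaceD(2)[OF weight_space_fword[OF v, of "replicate k i"], of "co i"])
  have 2: "f i \<cdot> e i \<cdot> ?u = (of_nat k * (\<gamma> (co i) - of_nat k + 1)) *\<^sub>C ?u"
    unfolding Suc.IH using vS by (cases k) (simp_all add: act_scale_right)
  have "e i \<cdot> (act (f i) ^^ Suc k) v = cart (co i) \<cdot> ?u + f i \<cdot> e i \<cdot> ?u"
    using act_br[of ?u "e i" "f i"] vS by (simp add: br_ef)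
  also have "\<dots> = ((\<gamma> (co i) - 2 * of_nat k) + of_nat k * (\<gamma> (co i) - of_nat k + 1)) *\<^sub>C ?u"
    unfolding 1 2 by (rule scaleC_add_left[symmetric])
  also have "(\<gamma> (co i) - 2 * of_nat k) + of_nat k * (\<gamma> (co i) - of_nat k + 1)
      = of_nat (Suc k) * (\<gamma> (co i) - of_nat (Suc k) + 1)"
    by (simp add: algebra_simps)
  finally show ?case by simp
qed

text \<open>At the least exponent \<open>n\<close> for which the power of \<open>f_i\<close> kills
  \<open>v\<close>, the sl(2) scalar must vanish, and this makes the weight on the coroot equal to
  \<open>n - 1\<close>.\<close>

lemma sl2_dominant:
  assumes v: "v \<in> weight_space D R \<gamma>" "v \<noteq> 0" "e i \<cdot> v = 0" and "(act (f i) ^^ k) v = 0"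
  obtains m :: nat where "\<gamma> (co i) = of_nat m" "(act (f i) ^^ (m + 1)) v = 0"
proof -
  define n where "n = (LEAST k. (act (f i) ^^ k) v = 0)"
  have n: "(act (f i) ^^ n) v = 0" unfolding n_def using assms(4) by (rule LeastI)
  have "n \<noteq> 0"
  proof
    assume "n = 0"
    with n v(2) show False by simp
  qed
  then have n1: "(act (f i) ^^ (n - 1)) v \<noteq> 0" using not_less_Least[of "n - 1" "\<lambda>k. (act (f i) ^^ k) v = 0"]
    by (simp add: n_def)
  have "(of_nat n * (\<gamma> (co i) - of_nat n + 1)) *\<^sub>C (act (f i) ^^ (n - 1)) v = 0"
    using sl2_e_f_pow[OF v(1,3), of n] by (simp add: n)
  then have "\<gamma> (co i) - of_nat n + 1 = 0" using n1 \<open>n \<noteq> 0\<close> by simp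
  then have "\<gamma> (co i) = of_nat n - 1" by (simp add: algebra_simps add_eq_0_iff)
  then have "\<gamma> (co i) = of_nat (n - 1)" using \<open>n \<noteq> 0\<close> by (simp add: of_nat_diff)
  with that[of "n - 1"] n \<open>n \<noteq> 0\<close> show ?thesis by simp
qed

lemma e_f_pow_neq:
  assumes "v \<in> S" "i \<noteq> j"
  shows "e j \<cdot> (act (f i) ^^ k) v = (act (f i) ^^ k) (e j \<cdot> v)"
proof (induction k)
  case (Suc k)
  have "e j \<cdot> f i \<cdot> (act (f i) ^^ k) v = f i \<cdot> e j \<cdot> (act (f i) ^^ k) v"
    using act_br[of "(act (f i) ^^ k) v" "e j" "f i"] assms by (simp add: br_ef)
  then show ?case by (simp add: Suc.IH)
qed simp

text \<open>Induction on \<open>p + q\<close> replaces the Leibniz formula.\<close>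

lemma nilpotent_act:
  "(br x ^^ p) y = 0 \<Longrightarrow> (act x ^^ q) v = 0 \<Longrightarrow> v \<in> S \<Longrightarrow> (act x ^^ (p + q)) (y \<cdot> v) = 0"
proof (induction "p + q" arbitrary: p q y v)
  case 0
  then show ?case by simp
next
  case (Suc n)
  show ?case
  proof (cases "p = 0 \<or> q = 0")
    case True
    then show ?thesis using Suc.prems by (auto simp: funpow_0)
  next
    case False
    then obtain p' q' where p: "p = Suc p'" and q: "q = Suc q'" by (metis not0_implies_Suc)
    have "x \<cdot> y \<cdot> v = br x y \<cdot> v + y \<cdot> x \<cdot> v" using Suc.prems by (simp add: act_br)
    then have "(act x ^^ (p + q)) (y \<cdot> v) = (act x ^^ (p' + q)) (br x y \<cdot> v) + (act x ^^ (p + q')) (y \<cdot> x \<cdot> v)"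
    proof -
      have "(act x ^^ (p + q)) (y \<cdot> v) = (act x ^^ (p' + q)) (x \<cdot> y \<cdot> v)"
        by (simp add: p funpow_Suc_right del: funpow.simps)
      also have "\<dots> = (act x ^^ (p' + q)) (br x y \<cdot> v) + (act x ^^ (p' + q)) (y \<cdot> x \<cdot> v)"
        unfolding \<open>x \<cdot> y \<cdot> v = _\<close> using Suc.prems by (intro funpow_add_right) simp_all
      finally show ?thesis by (simp add: p q)
    qed
    moreover have "(act x ^^ (p' + q)) (br x y \<cdot> v) = 0"
      using Suc.prems Suc.hyps(2) by (intro Suc.hyps(1)) (simp_all add: p funpow_Suc_right del: funpow.simps)
    moreover have "(act x ^^ (p + q')) (y \<cdot> x \<cdot> v) = 0"
      using Suc.prems Suc.hyps(2) by (intro Suc.hyps(1)) (simp_all add: q funpow_Suc_right del: funpow.simps)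
    ultimately show ?thesis by simp
  qed
qed

end

declare scaleC_complex [simp del]

lemma clinear_lin_ext_compose:
  fixes F :: "'b::complex_vector \<Rightarrow> 'c::complex_vector"
  assumes "clinear F"
  shows "F (lin_ext g c) = lin_ext (\<lambda>w. F (g w)) c"
  by (simp add: lin_ext_def clinear_sum[OF assms] clinear_scale[OF assms])

subsection \<open>Triangular decomposition\<close>

context g_rep begin

lemma weight_space_cspan_trivial:
  assumes "\<And>k. k \<in> K \<Longrightarrow> g k \<in> weight_space D R (W k)" "v \<in> cspan (g ` K)"
    "v \<in> weight_space D R \<gamma>" "\<And>k. k \<in> K \<Longrightarrow> W k \<noteq> \<gamma>"
  shows "v = 0"
proof -
  have "v \<in> cspan (g ` {k \<in> K. W k = \<gamma>})" by (rule weight_space_cspan) (use assms in auto)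
  moreover have "{k \<in> K. W k = \<gamma>} = {}" using assms(4) by auto
  ultimately have "v \<in> cspan {}" by (simp only: image_empty)
  then show ?thesis by simp
qed

lemma act_lin_ext: "(\<And>w. g w \<in> S) \<Longrightarrow> x \<cdot> lin_ext g c = lin_ext (\<lambda>w. x \<cdot> g w) c"
  by (simp add: lin_ext_def act_sum_right act_scale_right)

lemma lin_ext_in: "(\<And>w. g w \<in> S) \<Longrightarrow> lin_ext g c \<in> S"
  unfolding lin_ext_def by (rule S_sum) simp

end

text \<open>\<open>v\<close> may be zero: a Serre element is treated as a highest weight vector
  before it is known to vanish.\<close>

locale hw_vec = g_rep D R
  for D :: "('i::finite, 'h::complex_vector, 'g::complex_vector) km_data" and R :: "('g, 'v::complex_vector) rep" +
  fixes v :: 'v and l :: "'h \<Rightarrow> complex"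
  assumes v_weight: "v \<in> weight_space D R l" and e_v: "e i \<cdot> v = 0"
begin

abbreviation fw :: "'i list \<Rightarrow> 'v" where "fw w \<equiv> foldr (\<lambda>i. act (f i)) w v"

lemma v_in [simp]: "v \<in> S" using v_weight by (rule weight_spaceD)

text \<open>The homomorphism from the free Verma module of highest weight \<open>l\<close> onto the
  submodule generated by \<open>v\<close>.\<close>

definition ev :: "'i verma \<Rightarrow> 'v" where "ev = lin_ext fw"

lemma ev_linear: "clinear ev" unfolding ev_def by (rule clinear_lin_ext)

lemmas ev_add = clinear_add[OF ev_linear] and ev_scale = clinear_scale[OF ev_linear]
  and ev_diff = clinear_diff[OF ev_linear] and ev_0 = clinear_0[OF ev_linear]

lemma ev_single [simp]: "ev (vw w) = fw w" by (simp add: ev_def)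

lemma ev_Nil: "ev (vw []) = v" using ev_single[of "[]"] by simp

lemma ev_in [simp]: "ev c \<in> S" by (simp add: ev_def lin_ext_in)

lemma ev_f: "ev (verma_f i c) = f i \<cdot> ev c"
  by (simp add: verma_f_def clinear_lin_ext_compose[OF ev_linear]) (simp add: ev_def act_lin_ext)

lemma fw_weight: "fw w \<in> weight_space D R (\<lambda>h. l h - wt D w h)"
  by (rule weight_space_fword[OF v_weight])

lemma ev_h: "ev (verma_h D l h c) = cart h \<cdot> ev c"
proof -
  have "ev (verma_h D l h c) = lin_ext (\<lambda>w. (l h - wt D w h) *\<^sub>C fw w) c"
    by (simp add: verma_h_def clinear_lin_ext_compose[OF ev_linear] ev_scale)
  also have "\<dots> = lin_ext (\<lambda>w. cart h \<cdot> fw w) c"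
    by (simp add: weight_spaceD(2)[OF fw_weight])
  finally show ?thesis by (simp add: ev_def act_lin_ext)
qed

lemma ev_e_word: "ev (verma_e_word D l i w) = e i \<cdot> fw w"
proof (induction w)
  case Nil
  show ?case by (simp add: ev_0 e_v)
next
  case (Cons j w)
  have "e i \<cdot> f j \<cdot> fw w = br (e i) (f j) \<cdot> fw w + f j \<cdot> e i \<cdot> fw w"
    by (simp add: act_br)
  then show ?case
    using weight_spaceD(2)[OF fw_weight[of w], of "co j"]
    by (simp add: ev_add ev_scale ev_f Cons.IH br_ef ev_0)
qed

lemma ev_e: "ev (verma_e D l i c) = e i \<cdot> ev c"
  by (simp add: verma_e_def clinear_lin_ext_compose[OF ev_linear] ev_e_word) (simp add: ev_def act_lin_ext)

lemma ev_act: "ev (verma_act D l t c) = lie_eval D t \<cdot> ev c"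
proof (induction t arbitrary: c)
  case (TPlus s t)
  then show ?case by (simp add: ev_add act_add_left)
next
  case (TScale a t)
  then show ?case by (simp add: ev_scale act_scale_left)
next
  case (TBr s t)
  then show ?case by (simp add: ev_diff act_br)
qed (simp_all add: ev_e ev_f ev_h ev_0)

lemma range_ev: "range ev = cspan (range fw)"
proof (intro equalityI subsetI)
  fix x assume "x \<in> range ev"
  then show "x \<in> cspan (range fw)" by (auto simp: ev_def lin_ext_in_cspan)
next
  fix x assume "x \<in> cspan (range fw)"
  then show "x \<in> range ev" unfolding ev_def by (metis cspan_range_lin_ext rangeI)
qed

lemma act_range_ev: "x \<in> range ev \<Longrightarrow> y \<cdot> x \<in> range ev"
proof -
  assume "x \<in> range ev"
  then obtain c where "x = ev c" by blast
  moreover obtain t where "y = lie_eval D t" using surj_eval by (metis surj_def)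
  ultimately have "y \<cdot> x = ev (verma_act D l t c)" by (simp only: ev_act)
  then show ?thesis by blast
qed

text \<open>Every Lie term acts through the free Verma module, so the words in the
  \<open>f_i\<close> already span a stable space; this stands in for the Poincare--Birkhoff--Witt
  theorem.\<close>

lemma env_orbit_eq: "env_orbit R UNIV v = range ev"
proof
  show "env_orbit R UNIV v \<subseteq> range ev"
  proof (rule env_orbit_minimal)
    show "v \<in> range ev" using rangeI[of ev "vw []"] by (simp only: ev_Nil)
    show "csubspace (range ev)" by (simp add: range_ev)
  qed (rule act_range_ev)
  show "range ev \<subseteq> env_orbit R UNIV v"
    unfolding range_ev
  proof (rule cspan_minimal[OF _ env_orbit_subspace], safe)
    fix w show "fw w \<in> env_orbit R UNIV v"
      by (induction w) (auto simp: env_orbit_base env_orbit_stable)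
  qed
qed

lemma range_ev_weight:
  assumes "x \<in> range ev" "x \<in> weight_space D R \<gamma>"
  shows "x \<in> cspan (fw ` {w. (\<lambda>h. l h - wt D w h) = \<gamma>})"
  using weight_space_cspan[where K = UNIV and g = fw and W = "\<lambda>w h. l h - wt D w h" and v = x and \<gamma> = \<gamma>]
    assms fw_weight
  by (simp add: range_ev)

end

section \<open>Serre relations and the triangular decomposition of the algebra\<close>

context km_algebra begin

lemma adj_rep: "g_rep D (adj D)"
  by unfold_locales (simp add: is_rep_def br_add_left br_add_right br_jacobi)

text \<open>The Serre element is killed by every \<open>e_k\<close>, so the ideal it generates has
  only weights of negative height. That ideal contains no nonzero Cartan element and is therefore
  zero.\<close>

lemma serre:
  assumes "i \<noteq> j"
  shows "(br (f i) ^^ nat (1 - A i j)) (f j) = 0"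
proof -
  interpret ad: g_rep D "adj D" by (rule adj_rep)
  define N where "N = nat (1 - A i j)"
  have N: "of_nat N = (1 - of_int (A i j) :: complex)" "N \<noteq> 0"
    using A_offdiag[OF assms] by (simp_all add: N_def of_nat_nat)
  define \<theta> where "\<theta> = (br (f i) ^^ N) (f j)"
  have fj: "f j \<in> weight_space D (adj D) (\<lambda>h. - al j h)"
    by (simp add: weight_space_def)
  have \<theta>_fword: "\<theta> = foldr (\<lambda>k. br (f k)) (replicate N i) (f j)"
    unfolding \<theta>_def by (induction N) simp_all
  let ?l = "\<lambda>h. - al j h - wt D (replicate N i) h"
  have \<theta>_weight: "\<theta> \<in> weight_space D (adj D) ?l"
    using ad.weight_space_fword[OF fj, of "replicate N i"] unfolding \<theta>_fword by simp
  have e_\<theta>: "br (e k) \<theta> = 0" for k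
  proof (cases "k = i")
    case True
    \<comment> \<open>On the coroot of \<open>i\<close> the weight of \<open>f j\<close> is
      \<open>- A i j\<close>, so \<open>1 - A i j\<close> is exactly the exponent at which the sl(2)
      scalar vanishes.\<close>
    have "br (e i) (f j) = 0" using assms by (simp add: br_ef)
    then show ?thesis
      using ad.sl2_e_f_pow[OF fj, where i = i and k = N] N(1) True unfolding \<theta>_def by simp
  next
    case False
    then have 1: "br (e k) \<theta> = (br (f i) ^^ N) (br (e k) (f j))"
      unfolding \<theta>_def using ad.e_f_pow_neq[of "f j" i k N] by simp
    show ?thesis
    proof (cases "k = j")
      case True
      \<comment> \<open>\<open>e_j\<close> passes all the \<open>f_i\<close> and turns
        \<open>f_j\<close> into its coroot; one bracket with \<open>f_i\<close> gives a multiple of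
        \<open>f_i\<close>, a second gives 0. If \<open>A i j = 0\<close>, only one bracket is
        present, and the symmetry of the zeros of \<open>A\<close> makes that multiple 0.\<close>
      have f1: "br (f i) (cart (co j)) = of_int (A j i) *\<^sub>C f i"
        by (subst br_anti) simp
      show ?thesis
      proof (cases "A i j = 0")
        case True
        then have "A j i = 0" by (rule A_zero)
        then have "br (f i) (cart (co j)) = 0" using f1 by simp
        then have "(br (f i) ^^ N) (cart (co j)) = 0"
          using ad.funpow_mono_0[where k = 1 and n = N and x = "f i" and v = "cart (co j)"] N(2) by simp
        then show ?thesis using 1 \<open>k = j\<close> by (simp add: br_ef)
      next
        case False
        then have "2 \<le> N" using A_offdiag[OF assms] by (simp add: N_def)
        moreover have "(br (f i) ^^ 2) (cart (co j)) = 0" using f1 by (simp add: numeral_2_eq_2)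
        ultimately have "(br (f i) ^^ N) (cart (co j)) = 0"
          using ad.funpow_mono_0[where k = 2 and n = N and x = "f i" and v = "cart (co j)"] by simp
        then show ?thesis using 1 \<open>k = j\<close> by (simp add: br_ef)
      qed
    next
      case False
      then show ?thesis using 1 ad.funpow_0[where k = N and x = "f i"] by (simp add: br_ef)
    qed
  qed
  interpret hw: hw_vec D "adj D" \<theta> ?l
    by unfold_locales (simp_all add: \<theta>_weight e_\<theta>)
  have nz: "?l hgt - wt D w hgt \<noteq> 0" for w
  proof
    assume "?l hgt - wt D w hgt = 0"
    moreover have "of_nat (1 + N + length w) = - (?l hgt - wt D w hgt)" by simp
    ultimately have "of_nat (1 + N + length w) = (0 :: complex)" by (simp only: minus_zero)
    then show False by (simp only: of_nat_eq_0_iff)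
  qed
  have "\<theta> = 0"
  proof (rule ideal_trivial[of "range hw.ev"])
    show "csubspace (range hw.ev)" by (simp add: hw.range_ev)
    show "h = 0" if "cart h \<in> range hw.ev" for h
    proof -
      have "cart h = 0"
      proof (rule ad.weight_space_cspan_trivial[where K = UNIV and g = hw.fw and \<gamma> = "\<lambda>_. 0"])
        show "hw.fw w \<in> weight_space D (adj D) (\<lambda>h. ?l h - wt D w h)" for w
          by (rule hw.fw_weight)
        show "cart h \<in> cspan (range hw.fw)" using that by (simp add: hw.range_ev)
        show "cart h \<in> weight_space D (adj D) (\<lambda>_. 0)" by (simp add: weight_space_def)
        show "(\<lambda>h. ?l h - wt D w h) \<noteq> (\<lambda>_. 0)" for w
          using nz[of w] by metis
      qed
      then show ?thesis by (rule cart_inj)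
    qed
    show "\<theta> \<in> range hw.ev" using hw.env_orbit_eq ad.env_orbit_base by auto
  qed (use hw.act_range_ev in auto)
  then show ?thesis by (simp add: \<theta>_def N_def)
qed

lemma ad_f_nilpotent: "\<exists>p. (br (f i) ^^ p) (f j) = 0"
proof (cases "i = j")
  case True
  then show ?thesis by (intro exI[of _ 1]) simp
next
  case False
  then show ?thesis using serre by blast
qed

definition nm :: "'g set" where "nm = cspan (nest br f ` {w. w \<noteq> []})"
definition np :: "'g set" where "np = cspan (nest br e ` {w. w \<noteq> []})"

lemma nm_subspace: "csubspace nm" and np_subspace: "csubspace np"
  by (simp_all add: nm_def np_def)

lemma cspan_nest_br:
  assumes "x \<in> cspan (nest br g ` {w. w \<noteq> [] \<and> P w})" "\<And>w. P w \<Longrightarrow> Q (i # w)"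
  shows "br (g i) x \<in> cspan (nest br g ` {w. w \<noteq> [] \<and> Q w})"
  using assms(1)
proof (induction rule: complex_vector.span_induct_alt)
  case base
  show ?case by (simp add: complex_vector.span_zero)
next
  case (step c y z)
  then obtain w where w: "w \<noteq> []" "P w" "y = nest br g w" by auto
  then have "br (g i) y \<in> nest br g ` {w. w \<noteq> [] \<and> Q w}"
    using assms(2) by (intro image_eqI[of _ _ "i # w"]) (simp_all add: nest_Cons)
  then show ?case using step.IH
    by (auto simp: br_add_right intro: complex_vector.span_add complex_vector.span_scale cspan_base)
qed

lemma nm_br: "x \<in> nm \<Longrightarrow> br (f i) x \<in> nm" and np_br: "x \<in> np \<Longrightarrow> br (e i) x \<in> np"
  using cspan_nest_br[of x f "\<lambda>_. True" "\<lambda>_. True" i] cspan_nest_br[of x e "\<lambda>_. True" "\<lambda>_. True" i]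
  by (simp_all add: nm_def np_def)

lemma nm_f: "f i \<in> nm" and np_e: "e i \<in> np"
  unfolding nm_def np_def by (rule cspan_base; rule image_eqI[of _ _ "[i]"]; simp)+

lemma eval_half_f: "t \<in> half_terms D GenF \<Longrightarrow> lie_eval D t \<in> nm"
  by (induction rule: half_terms.induct)
    (simp_all add: eval_km_eq nm_subspace csubspace_0 csubspace_add csubspace_scale nm_f nm_br)

lemma eval_half_e: "t \<in> half_terms D GenE \<Longrightarrow> lie_eval D t \<in> np"
  by (induction rule: half_terms.induct)
    (simp_all add: eval_km_eq np_subspace csubspace_0 csubspace_add csubspace_scale np_e np_br)

text \<open>The Verma action does not factor through the algebra, so a decomposition in the algebra
  alone would say nothing about it. The same terms \<open>a\<close>, \<open>h\<close>,
  \<open>b\<close> are made to serve for the value in the algebra and for all Verma actions at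
  once.\<close>

lemma lie_term_split:
  "\<exists>a\<in>half_terms D GenF. \<exists>h. \<exists>b\<in>half_terms D GenE. lie_eval D t = lie_eval D a + cart h + lie_eval D b
    \<and> (\<forall>l p. clinear l \<longrightarrow> verma_act D l t p = verma_act D l a p + verma_h D l h p + verma_act D l b p)"
  using lie_term_in_tri_terms[of t D]
proof (induction rule: tri_terms.induct)
  case (cong t s)
  then show ?case using eval_km_eq[OF cong.hyps(2)] verma_act_km_eq[OF al_linear _ cong.hyps(2)] by metis
next
  case (minus t)
  have "verma_h D l 0 p = 0" if "clinear l" for l p
    using verma_h_add_scale(2)[OF al_linear that, where a = 0] by simp
  with minus show ?case
    by - (rule bexI[of _ t], rule exI[of _ 0], rule bexI[of _ TZero], simp_all add: half_terms.zero)
next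
  case (cartan h)
  show ?case
    by (rule bexI[of _ TZero], rule exI[of _ h], rule bexI[of _ TZero]) (simp_all add: half_terms.zero)
next
  case (plus t)
  have "verma_h D l 0 p = 0" if "clinear l" for l p
    using verma_h_add_scale(2)[OF al_linear that, where a = 0] by simp
  with plus show ?case
    by - (rule bexI[of _ TZero], rule exI[of _ 0], rule bexI[of _ t], simp_all add: half_terms.zero)
next
  case (add s t)
  then obtain a h b a' h' b' where *: "a \<in> half_terms D GenF" "b \<in> half_terms D GenE"
    "a' \<in> half_terms D GenF" "b' \<in> half_terms D GenE"
    "lie_eval D s = lie_eval D a + cart h + lie_eval D b"
    "lie_eval D t = lie_eval D a' + cart h' + lie_eval D b'"
    "\<And>l p. clinear l \<Longrightarrow> verma_act D l s p = verma_act D l a p + verma_h D l h p + verma_act D l b p"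
    "\<And>l p. clinear l \<Longrightarrow> verma_act D l t p = verma_act D l a' p + verma_h D l h' p + verma_act D l b' p"
    by metis
  then show ?case
    by - (rule bexI[of _ "TPlus a a'"], rule exI[of _ "h + h'"], rule bexI[of _ "TPlus b b'"],
      simp_all add: half_terms.plus cart_add verma_h_add_scale[OF al_linear])
next
  case (scale t r)
  then obtain a h b where *: "a \<in> half_terms D GenF" "b \<in> half_terms D GenE"
    "lie_eval D t = lie_eval D a + cart h + lie_eval D b"
    "\<And>l p. clinear l \<Longrightarrow> verma_act D l t p = verma_act D l a p + verma_h D l h p + verma_act D l b p"
    by metis
  then show ?case
    by - (rule bexI[of _ "TScale r a"], rule exI[of _ "r *\<^sub>C h"], rule bexI[of _ "TScale r b"],
      simp_all add: half_terms.scale scaleC_distribs verma_h_add_scale[OF al_linear])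
qed

lemma triangular_decomposition:
  obtains a h b where "a \<in> nm" "b \<in> np" "x = a + cart h + b"
proof -
  obtain t where "x = lie_eval D t" using surj_eval by (metis surj_def)
  with lie_term_split[of t] eval_half_f eval_half_e that show ?thesis by metis
qed

lemma nest_f_weight: "nest br f w \<in> weight_space D (adj D) (\<lambda>h. - wt D w h)"
proof -
  interpret ad: g_rep D "adj D" by (rule adj_rep)
  show ?thesis
  proof (induction w)
    case Nil
    then show ?case by (simp add: weight_space_def)
  next
    case (Cons i w)
    show ?case
    proof (cases "w = []")
      case True
      then show ?thesis by (simp add: weight_space_def)
    next
      case False
      have "(\<lambda>h. - wt D w h - al i h) = (\<lambda>h. - wt D (i # w) h)" by auto
      with False show ?thesis using ad.weight_space_f[OF Cons.IH, of i] by (simp only: nest_Cons[OF False] adj_simps)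
    qed
  qed
qed

lemma nest_e_weight: "nest br e w \<in> weight_space D (adj D) (wt D w)"
proof -
  interpret ad: g_rep D "adj D" by (rule adj_rep)
  show ?thesis
  proof (induction w)
    case Nil
    then show ?case by (simp add: weight_space_def)
  next
    case (Cons i w)
    show ?case
    proof (cases "w = []")
      case True
      then show ?thesis by (simp add: weight_space_def)
    next
      case False
      have "(\<lambda>h. wt D w h + al i h) = wt D (i # w)" by (auto simp: add.commute)
      with False show ?thesis using ad.weight_space_e[OF Cons.IH, of i] by (simp only: nest_Cons[OF False] adj_simps)
    qed
  qed
qed

lemma br_h_nest_f: "br (cart h) (nest br f w) = - (wt D w h *\<^sub>C nest br f w)"
  and br_h_nest_e: "br (cart h) (nest br e w) = wt D w h *\<^sub>C nest br e w"
  using nest_f_weight[of w] nest_e_weight[of w] by (simp_all add: weight_space_def)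

lemma of_nat_neg_ne: "n \<noteq> 0 \<Longrightarrow> - (of_nat n :: complex) \<noteq> of_nat m"
proof
  assume "n \<noteq> 0" "- (of_nat n :: complex) = of_nat m"
  then have "(of_nat (m + n) :: complex) = 0" by (simp add: neg_eq_iff_add_eq_0 add.commute)
  with \<open>n \<noteq> 0\<close> show False by (simp only: of_nat_eq_0_iff)
qed

text \<open>The weights of \<open>nm\<close> have negative height and those of \<open>np\<close>
  positive height, so every weight component of \<open>x\<close> vanishes.\<close>

lemma nm_np_disjoint: assumes "x \<in> nm" "x \<in> np" shows "x = 0"
proof -
  interpret ad: g_rep D "adj D" by (rule adj_rep)
  obtain \<Gamma> u where *: "finite \<Gamma>" "\<Gamma> \<subseteq> (\<lambda>w h. - wt D w h) ` {w. w \<noteq> []}"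
    "\<And>\<gamma>. u \<gamma> \<in> cspan (nest br f ` {k \<in> {w. w \<noteq> []}. (\<lambda>h. - wt D k h) = \<gamma>})" "x = (\<Sum>\<gamma>\<in>\<Gamma>. u \<gamma>)"
    by (rule ad.weight_decomposition[where K = "{w. w \<noteq> []}" and g = "nest br f" and W = "\<lambda>w h. - wt D w h" and v = x])
      (use nest_f_weight assms(1) in \<open>auto simp: nm_def\<close>)
  have uw: "u \<gamma> \<in> weight_space D (adj D) \<gamma>" for \<gamma>
    using *(3)[of \<gamma>] ad.cspan_weight_space[where K = "{w. w \<noteq> []}" and g = "nest br f" and W = "\<lambda>w h. - wt D w h" and \<gamma> = \<gamma>, OF nest_f_weight]
    by auto
  have "u \<gamma> = 0" if \<gamma>: "\<gamma> \<in> \<Gamma>" for \<gamma>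
  proof -
    have "br (cart h) y \<in> np" if "y \<in> np" for h y
      using that unfolding np_def
    proof (induction rule: complex_vector.span_induct_alt)
      case (step c y z)
      then obtain w where w: "w \<noteq> []" "y = nest br e w" by auto
      then have "br (cart h) y \<in> cspan (nest br e ` {w. w \<noteq> []})"
        unfolding w(2) br_h_nest_e by (intro complex_vector.span_scale cspan_base) auto
      with step.IH show ?case
        by (simp add: br_add_right complex_vector.span_add complex_vector.span_scale)
    qed (simp add: complex_vector.span_zero)
    then have "u \<gamma> \<in> np"
      using ad.weight_components[of np \<Gamma> u \<gamma>] np_subspace * uw assms(2) \<gamma> by auto
    obtain w where w: "w \<noteq> []" "\<gamma> = (\<lambda>h. - wt D w h)" using *(2) \<gamma> by auto
    have "wt D w' \<noteq> \<gamma>" for w'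
    proof
      assume "wt D w' = \<gamma>"
      then have "wt D w' hgt = \<gamma> hgt" by simp
      then show False using of_nat_neg_ne[of "length w" "length w'"] w by simp
    qed
    then show ?thesis
      using ad.weight_space_cspan_trivial[where K = "{w. w \<noteq> []}" and g = "nest br e" and W = "wt D" and v = "u \<gamma>" and \<gamma> = \<gamma>] nest_e_weight
        \<open>u \<gamma> \<in> np\<close> uw by (simp add: np_def)
  qed
  then show ?thesis using *(4) by simp
qed

text \<open>\<open>cart h\<close> has weight 0, which does not occur in the sum of the two halves;
  injectivity of \<open>cart\<close> then gives \<open>h = 0\<close>.\<close>

lemma triangular_unique:
  assumes "a \<in> nm" "b \<in> np" "a + cart h + b = 0"
  shows "a = 0" "h = 0" "b = 0"
proof -
  interpret ad: g_rep D "adj D" by (rule adj_rep)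
  let ?g = "\<lambda>(s, w). nest br (if s then f else e) w"
  let ?W = "\<lambda>(s, w) h. if s then - wt D w h else wt D w h"
  let ?K = "{k. snd k \<noteq> ([] :: 'i list)}"
  have "nest br f ` {w. w \<noteq> []} \<subseteq> ?g ` ?K"
    by (rule image_subsetI) (rule_tac x = "(True, x)" in image_eqI; simp)
  moreover have "nest br e ` {w. w \<noteq> []} \<subseteq> ?g ` ?K"
    by (rule image_subsetI) (rule_tac x = "(False, x)" in image_eqI; simp)
  ultimately have "nest br f ` {w. w \<noteq> []} \<subseteq> ?g ` ?K" "nest br e ` {w. w \<noteq> []} \<subseteq> ?g ` ?K" .
  from complex_vector.span_mono[OF this(1)] complex_vector.span_mono[OF this(2)]
  have sub: "nm \<subseteq> cspan (?g ` ?K)" "np \<subseteq> cspan (?g ` ?K)" by (simp_all add: nm_def np_def)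
  have "cart h = - (a + b)" using assms(3) by (simp add: eq_neg_iff_add_eq_0 algebra_simps)
  moreover have "- (a + b) \<in> cspan (?g ` ?K)"
    using sub assms(1,2) by (intro complex_vector.span_neg complex_vector.span_add) auto
  ultimately have "cart h \<in> cspan (?g ` ?K)" by simp
  then have "cart h = 0"
  proof (rule ad.weight_space_cspan_trivial[where K = ?K and g = ?g and W = ?W and \<gamma> = "\<lambda>_. 0", rotated])
    show "cart h \<in> weight_space D (adj D) (\<lambda>_. 0)" by (simp add: weight_space_def)
  next
    fix k :: "bool \<times> 'i list" assume "k \<in> ?K"
    then have "?W k hgt \<noteq> 0" by (auto split: prod.splits)
    then show "?W k \<noteq> (\<lambda>_. 0)" by (metis (no_types, lifting))
  next
    fix k :: "bool \<times> 'i list"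
    show "?g k \<in> weight_space D (adj D) (?W k)"
      using nest_f_weight[of "snd k"] nest_e_weight[of "snd k"] by (cases k) (auto simp: fun_eq_iff)
  qed
  then show "h = 0" by (rule cart_inj)
  then have "a = - b" using assms(3) by (simp add: eq_neg_iff_add_eq_0)
  moreover have "- b \<in> np" using assms(2) np_subspace by (rule csubspace_neg[rotated])
  ultimately show "a = 0" using nm_np_disjoint[of a] assms(1) by auto
  with \<open>a = - b\<close> show "b = 0" by simp
qed

end

section \<open>Local nilpotency in highest weight modules\<close>

context hw_vec begin

text \<open>By the Serre relations \<open>ad f_i\<close> is nilpotent on each \<open>f_j\<close>, so
  nilpotency of \<open>f_i\<close> spreads from \<open>v\<close> to all words.\<close>

lemma f_locally_nilpotent:
  assumes "(act (f i) ^^ k) v = 0" "x \<in> range ev"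
  shows "\<exists>n. (act (f i) ^^ n) x = 0"
proof -
  have fw_nil: "\<exists>n. (act (f i) ^^ n) (fw w) = 0" for w
  proof (induction w)
    case Nil
    then show ?case using assms(1) by auto
  next
    case (Cons j w)
    then obtain n where "(act (f i) ^^ n) (fw w) = 0" by blast
    moreover obtain p where "(br (f i) ^^ p) (f j) = 0" using ad_f_nilpotent by blast
    ultimately have "(act (f i) ^^ (p + n)) (f j \<cdot> fw w) = 0" by (intro nilpotent_act) simp_all
    then show ?case by auto
  qed
  have "cspan (range fw) \<subseteq> {x \<in> S. \<exists>n. (act (f i) ^^ n) x = 0}"
  proof (intro cspan_minimal csubspaceI)
    fix x y assume "x \<in> {x \<in> S. \<exists>n. (act (f i) ^^ n) x = 0}" "y \<in> {x \<in> S. \<exists>n. (act (f i) ^^ n) x = 0}"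
    then obtain m n where mn: "(act (f i) ^^ m) x = 0" "(act (f i) ^^ n) y = 0" and xy: "x \<in> S" "y \<in> S" by auto
    have "(act (f i) ^^ (max m n)) x = 0" "(act (f i) ^^ (max m n)) y = 0"
      using mn by (auto intro: funpow_mono_0)
    then have "(act (f i) ^^ (max m n)) (x + y) = 0" using xy by (simp add: funpow_add_right)
    then show "x + y \<in> {x \<in> S. \<exists>n. (act (f i) ^^ n) x = 0}" using xy by auto
  next
    fix c x assume "x \<in> {x \<in> S. \<exists>n. (act (f i) ^^ n) x = 0}"
    then show "c *\<^sub>C x \<in> {x \<in> S. \<exists>n. (act (f i) ^^ n) x = 0}"
      by (auto simp: funpow_scale_right)
  next
    show "0 \<in> {x \<in> S. \<exists>n. (act (f i) ^^ n) x = 0}" by (auto intro: exI[of _ 0])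
  qed (use fw_nil in auto)
  then show ?thesis using assms(2) by (auto simp: range_ev)
qed

end

subsection \<open>The invariant pairing of the two nilpotent halves\<close>


context km_algebra begin

text \<open>The given diagonal entries are only nonzero complex numbers. Absolute values may be
  taken because \<open>A i j\<close> and \<open>A j i\<close> are both nonpositive off the diagonal;
  positivity is what later makes the Casimir eigenvalues nonzero.\<close>

lemma symmetrizer_exists:
  assumes "symmetrizable A"
  shows "\<exists>\<epsilon> :: 'i \<Rightarrow> real. (\<forall>i. \<epsilon> i > 0) \<and> (\<forall>i j. of_int (A i j) * \<epsilon> j = of_int (A j i) * \<epsilon> i)"
proof -
  obtain d :: "'i \<Rightarrow> complex" and B where d: "\<And>i. d i \<noteq> 0" "\<And>i j. B i j = B j i"
    "\<And>i j. of_int (A i j) = d i * B i j"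
    using assms unfolding symmetrizable_def by blast
  have "real_of_int (A i j) * norm (d j) = real_of_int (A j i) * norm (d i)" for i j
  proof (cases "i = j")
    case False
    have "(of_int (A i j) :: complex) * d j = of_int (A j i) * d i"
      using d(2)[of i j] by (simp add: d(3))
    then have "norm ((of_int (A i j) :: complex) * d j) = norm ((of_int (A j i) :: complex) * d i)" by simp
    then have "\<bar>real_of_int (A i j)\<bar> * norm (d j) = \<bar>real_of_int (A j i)\<bar> * norm (d i)"
      by (simp add: norm_mult)
    moreover have "\<bar>real_of_int (A i j)\<bar> = - real_of_int (A i j)" "\<bar>real_of_int (A j i)\<bar> = - real_of_int (A j i)"
      using A_offdiag[OF False] A_offdiag[of j i] False by auto
    ultimately show ?thesis by simp
  qed simp
  then show ?thesis using d(1) by (intro exI[of _ "\<lambda>i. norm (d i)"]) simp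
qed

lemma functional_on_coroots: "\<exists>\<xi> :: 'h \<Rightarrow> complex. clinear \<xi> \<and> (\<forall>i. \<xi> (co i) = c i)"
proof -
  interpret vector_space_pair "scaleC :: complex \<Rightarrow> 'h \<Rightarrow> 'h" "scaleC :: complex \<Rightarrow> complex \<Rightarrow> complex" ..
  have inj: "inj co"
  proof (rule injI, rule ccontr)
    fix i j assume "co i = co j" "i \<noteq> j"
    let ?c = "\<lambda>k. if k = i then 1 else if k = j then - 1 else (0::complex)"
    have "(\<Sum>k\<in>UNIV. ?c k *\<^sub>C co k) = (\<Sum>k\<in>{i, j}. ?c k *\<^sub>C co k)"
      by (rule sum.mono_neutral_right) auto
    also have "\<dots> = 0" using \<open>co i = co j\<close> \<open>i \<noteq> j\<close> by simp
    finally have "?c i = 0" by (rule co_indep)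
    then show False by simp
  qed
  have "\<not> cdependent (range co)"
  proof
    assume "cdependent (range co)"
    then obtain u where u: "\<exists>v\<in>range co. u v \<noteq> 0" "(\<Sum>v\<in>range co. u v *\<^sub>C v) = 0"
      using complex_vector.dependent_finite[of "range co"] by auto
    have "(\<Sum>i\<in>UNIV. u (co i) *\<^sub>C co i) = 0" using u(2) by (simp add: sum.reindex[OF inj])
    then have "u (co i) = 0" for i by (rule co_indep)
    then show False using u(1) by auto
  qed
  then obtain g :: "'h \<Rightarrow> complex" where g: "\<forall>y\<in>range co. g y = c (inv co y)" "clinear g"
    using linear_independent_extend[of "range co" "\<lambda>y. c (inv co y)"] unfolding cdependent_def by blast
  then show ?thesis using inj by (intro exI[of _ g]) simp
qed

definition hpart :: "'g \<Rightarrow> 'h" where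
  "hpart x = (THE h. \<exists>a\<in>nm. \<exists>b\<in>np. x = a + cart h + b)"

lemma hpart_eq: assumes "a \<in> nm" "b \<in> np" shows "hpart (a + cart h + b) = h"
  unfolding hpart_def
proof (rule the_equality)
  show "\<exists>a'\<in>nm. \<exists>b'\<in>np. a + cart h + b = a' + cart h + b'" using assms by blast
  fix h' assume "\<exists>a'\<in>nm. \<exists>b'\<in>np. a + cart h + b = a' + cart h' + b'"
  then obtain a' b' where *: "a' \<in> nm" "b' \<in> np" "a + cart h + b = a' + cart h' + b'" by blast
  have "(a - a') + cart (h - h') + (b - b') = 0"
    using *(3) by (simp add: clinear_diff[OF cart_linear] algebra_simps)
  from triangular_unique(2)[OF _ _ this] show "h' = h"
    using assms * nm_subspace np_subspace by (simp add: csubspace_diff)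
qed

lemma hpart_linear: "clinear hpart"
proof (rule clinearI)
  fix x y
  obtain a h b a' h' b' where *: "a \<in> nm" "b \<in> np" "x = a + cart h + b" "a' \<in> nm" "b' \<in> np" "y = a' + cart h' + b'"
    using triangular_decomposition[of x] triangular_decomposition[of y] by metis
  have eq: "x + y = (a + a') + cart (h + h') + (b + b')" by (simp add: * cart_add)
  have "hpart (x + y) = h + h'"
    unfolding eq using * nm_subspace np_subspace by (intro hpart_eq csubspace_add)
  then show "hpart (x + y) = hpart x + hpart y"
    using * by (simp add: hpart_eq)
  fix c
  have eq: "c *\<^sub>C x = c *\<^sub>C a + cart (c *\<^sub>C h) + c *\<^sub>C b" by (simp add: * scaleC_distribs)
  have "hpart (c *\<^sub>C x) = c *\<^sub>C h"
    unfolding eq using * nm_subspace np_subspace by (intro hpart_eq csubspace_scale)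
  then show "hpart (c *\<^sub>C x) = c *\<^sub>C hpart x"
    using * by (simp add: hpart_eq)
qed

lemma hpart_nm: "a \<in> nm \<Longrightarrow> hpart a = 0" and hpart_np: "b \<in> np \<Longrightarrow> hpart b = 0"
  and hpart_cart: "hpart (cart h) = h"
  using hpart_eq[of a 0 0] hpart_eq[of 0 b 0] hpart_eq[of 0 0 h] nm_subspace np_subspace
  by (simp_all add: csubspace_0)

lemma nm_h: "a \<in> nm \<Longrightarrow> br (cart h) a \<in> nm"
  unfolding nm_def
proof (induction rule: complex_vector.span_induct_alt)
  case (step c y z)
  then obtain w where w: "w \<noteq> []" "y = nest br f w" by auto
  then have "br (cart h) y \<in> cspan (nest br f ` {w. w \<noteq> []})"
    unfolding w(2) br_h_nest_f by (intro complex_vector.span_neg complex_vector.span_scale cspan_base) auto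
  with step.IH show ?case
    by (simp add: br_add_right complex_vector.span_add complex_vector.span_scale)
qed (simp add: complex_vector.span_zero)

lemma np_h: "b \<in> np \<Longrightarrow> br (cart h) b \<in> np"
  unfolding np_def
proof (induction rule: complex_vector.span_induct_alt)
  case (step c y z)
  then obtain w where w: "w \<noteq> []" "y = nest br e w" by auto
  then have "br (cart h) y \<in> cspan (nest br e ` {w. w \<noteq> []})"
    unfolding w(2) br_h_nest_e by (intro complex_vector.span_scale cspan_base) auto
  with step.IH show ?case
    by (simp add: br_add_right complex_vector.span_add complex_vector.span_scale)
qed (simp add: complex_vector.span_zero)

lemma hpart_br_h: "hpart (br (cart h) y) = 0"
proof -
  obtain a h' b where *: "a \<in> nm" "b \<in> np" "y = a + cart h' + b" by (rule triangular_decomposition)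
  then have "br (cart h) y = br (cart h) a + br (cart h) b" by (simp add: br_add_right)
  then show ?thesis using * nm_h np_h by (simp add: clinear_add[OF hpart_linear] hpart_nm hpart_np)
qed

text \<open>The layers of height \<open>k\<close>, finite-dimensional because there are finitely
  many simple roots.\<close>

definition nmk :: "nat \<Rightarrow> 'g set" where "nmk k = cspan (nest br f ` {w. length w = k})"
definition npk :: "nat \<Rightarrow> 'g set" where "npk k = cspan (nest br e ` {w. length w = k})"

lemma nmk_subspace: "csubspace (nmk k)" and npk_subspace: "csubspace (npk k)"
  by (simp_all add: nmk_def npk_def)

lemma nest_in_nmk: "length w = k \<Longrightarrow> nest br f w \<in> nmk k"
  and nest_in_npk: "length w = k \<Longrightarrow> nest br e w \<in> npk k"
  by (auto simp: nmk_def npk_def intro: cspan_base)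

lemma nest_in_nm: "nest br f w \<in> nm" and nest_in_np: "nest br e w \<in> np"
  using csubspace_0[OF nm_subspace] csubspace_0[OF np_subspace]
  by (cases "w = []"; auto simp: nm_def np_def intro: cspan_base)+

lemma nmk_nm: "nmk k \<subseteq> nm" and npk_np: "npk k \<subseteq> np"
  unfolding nmk_def npk_def
  by (intro cspan_minimal image_subsetI nest_in_nm nm_subspace nest_in_np np_subspace)+

lemma nm_range: "nm = cspan (range (nest br f))" and np_range: "np = cspan (range (nest br e))"
proof -
  have "cspan (range (nest br f)) \<subseteq> nm"
    by (intro cspan_minimal image_subsetI nest_in_nm nm_subspace)
  moreover have "nm \<subseteq> cspan (range (nest br f))"
    unfolding nm_def by (rule complex_vector.span_mono) auto
  ultimately show "nm = cspan (range (nest br f))" by auto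
  have "cspan (range (nest br e)) \<subseteq> np"
    by (intro cspan_minimal image_subsetI nest_in_np np_subspace)
  moreover have "np \<subseteq> cspan (range (nest br e))"
    unfolding np_def by (rule complex_vector.span_mono) auto
  ultimately show "np = cspan (range (nest br e))" by auto
qed

lemma cspan_br_stable:
  assumes "x \<in> cspan G" "\<And>y. y \<in> G \<Longrightarrow> br z y \<in> M" "csubspace M"
  shows "br z x \<in> M"
proof -
  have "cspan G \<subseteq> {x. br z x \<in> M}"
    by (intro cspan_minimal csubspaceI) (use assms in \<open>auto simp: br_add_right csubspace_0 csubspace_add csubspace_scale\<close>)
  with assms(1) show ?thesis by auto
qed

lemma nmk_f:
  assumes "x \<in> nmk k" "1 \<le> k" shows "br (f i) x \<in> nmk (Suc k)"
proof (rule cspan_br_stable[OF assms(1)[unfolded nmk_def] _ nmk_subspace])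
  fix y assume "y \<in> nest br f ` {w. length w = k}"
  then obtain w where w: "length w = k" "y = nest br f w" by blast
  then have "br (f i) y = nest br f (i # w)" using assms(2) by (cases w) auto
  then show "br (f i) y \<in> nmk (Suc k)" using w by (simp only: nest_in_nmk length_Cons)
qed

lemma npk_e:
  assumes "x \<in> npk k" "1 \<le> k" shows "br (e i) x \<in> npk (Suc k)"
proof (rule cspan_br_stable[OF assms(1)[unfolded npk_def] _ npk_subspace])
  fix y assume "y \<in> nest br e ` {w. length w = k}"
  then obtain w where w: "length w = k" "y = nest br e w" by blast
  then have "br (e i) y = nest br e (i # w)" using assms(2) by (cases w) auto
  then show "br (e i) y \<in> npk (Suc k)" using w by (simp only: nest_in_npk length_Cons)
qed

text \<open>Lowering from height at least 2 stays in \<open>np\<close>; from height 1 it would land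
  in the Cartan subalgebra, hence \<open>1 \<le> k\<close>.\<close>

lemma nest_f_npk: "length w = Suc k \<Longrightarrow> 1 \<le> k \<Longrightarrow> br (f j) (nest br e w) \<in> npk k"
proof (induction w arbitrary: k)
  case (Cons i w)
  then have w: "w \<noteq> []" "length w = k" by auto
  have eq: "br (f j) (nest br e (i # w)) = br (br (f j) (e i)) (nest br e w) + br (e i) (br (f j) (nest br e w))"
    unfolding nest_Cons[OF w(1)] by (rule br_jacobi')
  have 1: "br (br (f j) (e i)) (nest br e w) \<in> npk k"
    using csubspace_neg[OF npk_subspace csubspace_scale[OF npk_subspace nest_in_npk[OF w(2)]]]
    by (auto simp: br_fe br_h_nest_e csubspace_0[OF npk_subspace])
  have 2: "br (e i) (br (f j) (nest br e w)) \<in> npk k"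
  proof (cases "k = 1")
    \<comment> \<open>Here the inner bracket is a Cartan element, so the induction hypothesis does
      not apply.\<close>
    case True
    then obtain i' where i': "w = [i']" using w by (cases w) auto
    have "br (e i) (cart h) = - (al i h *\<^sub>C e i)" for h by (subst br_anti) simp
    moreover have "e i \<in> npk 1" using nest_in_npk[of "[i]" 1] by simp
    ultimately show ?thesis
      using True csubspace_scale[OF npk_subspace] by (simp add: i' br_fe csubspace_0[OF npk_subspace])
  next
    case False
    then obtain k' where k': "k = Suc k'" "1 \<le> k'" using Cons.prems by (metis Suc_le_mono One_nat_def le_antisym not_less_eq_eq not0_implies_Suc le_zero_eq)
    then show ?thesis using Cons.IH[of k'] w npk_e[of _ k' i] by simp
  qed
  show ?case unfolding eq by (rule csubspace_add[OF npk_subspace 1 2])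
qed simp

lemma nest_e_nmk: "length w = Suc k \<Longrightarrow> 1 \<le> k \<Longrightarrow> br (e j) (nest br f w) \<in> nmk k"
proof (induction w arbitrary: k)
  case (Cons i w)
  then have w: "w \<noteq> []" "length w = k" by auto
  have eq: "br (e j) (nest br f (i # w)) = br (br (e j) (f i)) (nest br f w) + br (f i) (br (e j) (nest br f w))"
    unfolding nest_Cons[OF w(1)] by (rule br_jacobi')
  have 1: "br (br (e j) (f i)) (nest br f w) \<in> nmk k"
    using csubspace_neg[OF nmk_subspace csubspace_scale[OF nmk_subspace nest_in_nmk[OF w(2)]]]
    by (auto simp: br_ef br_h_nest_f csubspace_0[OF nmk_subspace])
  have 2: "br (f i) (br (e j) (nest br f w)) \<in> nmk k"
  proof (cases "k = 1")
    case True
    then obtain i' where i': "w = [i']" using w by (cases w) auto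
    have "br (f i) (cart h) = al i h *\<^sub>C f i" for h by (subst br_anti) simp
    moreover have "f i \<in> nmk 1" using nest_in_nmk[of "[i]" 1] by simp
    ultimately show ?thesis
      using True csubspace_scale[OF nmk_subspace] by (simp add: i' br_ef csubspace_0[OF nmk_subspace])
  next
    case False
    then obtain k' where k': "k = Suc k'" "1 \<le> k'" using Cons.prems by (metis Suc_le_mono One_nat_def le_antisym not_less_eq_eq not0_implies_Suc le_zero_eq)
    then show ?thesis using Cons.IH[of k'] w nmk_f[of _ k' i] by simp
  qed
  show ?case unfolding eq by (rule csubspace_add[OF nmk_subspace 1 2])
qed simp

end

section \<open>Construction of the invariant pairing\<close>

locale sym_km_algebra = km_algebra D for D :: "('i::finite, 'h::complex_vector, 'g::complex_vector) km_data" +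
  assumes symmetrizable: "symmetrizable (gcm D)"
begin

text \<open>The values \<open>(e_i | f_i)\<close> of the standard invariant form; the second
  condition is the symmetry of its matrix \<open>A i j * eps j\<close> on the coroots.\<close>

definition eps :: "'i \<Rightarrow> real" where
  "eps = (SOME \<epsilon>. (\<forall>i. \<epsilon> i > 0) \<and> (\<forall>i j. of_int (A i j) * \<epsilon> j = of_int (A j i) * \<epsilon> i))"

lemma eps_pos: "eps i > 0" and eps_sym: "real_of_int (A i j) * eps j = real_of_int (A j i) * eps i"
  using someI_ex[OF symmetrizer_exists[OF symmetrizable]] unfolding eps_def by blast+

lemma eps_nonzero [simp]: "eps i \<noteq> 0" using eps_pos[of i] by simp

lemma eps_sym_complex: "(of_int (A i j) :: complex) * of_real (eps j) = of_int (A j i) * of_real (eps i)"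
  using eps_sym[of i j] by (metis of_real_mult of_real_of_int_eq)

definition \<xi> :: "'h \<Rightarrow> complex" where
  "\<xi> = (SOME \<xi>. clinear \<xi> \<and> (\<forall>i. \<xi> (co i) = of_real (eps i)))"

lemma \<xi>_linear: "clinear \<xi>" and \<xi>_co [simp]: "\<xi> (co i) = of_real (eps i)"
  using someI_ex[OF functional_on_coroots[of "\<lambda>i. of_real (eps i)"]] unfolding \<xi>_def by blast+

text \<open>Provides the base case of the pairing: \<open>(e_i | y)\<close> is going to be the value
  of \<open>\<tau>\<close> at the bracket of \<open>e_i\<close> with \<open>y\<close>.\<close>

definition \<tau> :: "'g \<Rightarrow> complex" where "\<tau> x = \<xi> (hpart x)"

lemma \<tau>_linear: "clinear \<tau>"
  unfolding \<tau>_def by (rule clinear_compose[OF \<xi>_linear hpart_linear])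

lemma \<tau>_cart: "\<tau> (cart h) = \<xi> h"
  and \<tau>_br_h: "\<tau> (br (cart h) y) = 0"
  by (simp_all add: \<tau>_def hpart_cart hpart_br_h clinear_0[OF \<xi>_linear])

text \<open>
  The invariant pairing, read off from one argument written as an iterated bracket: moving the
  brackets to the other argument leads into the Cartan subalgebra, where \<open>\<tau>\<close> is given.
\<close>

fun be :: "'i list \<Rightarrow> 'g \<Rightarrow> complex" where
  "be [] y = - \<tau> y"
| "be (i # w) y = - be w (br (e i) y)"

fun bf :: "'i list \<Rightarrow> 'g \<Rightarrow> complex" where
  "bf [] x = \<tau> x"
| "bf (j # w) x = - bf w (br (f j) x)"

lemma be_linear: "clinear (be w)" and bf_linear: "clinear (bf w)"
  by (induction w) (auto simp: clinear_iff \<tau>_linear clinear_add[OF \<tau>_linear] clinear_scale[OF \<tau>_linear] br_add_right)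

lemmas be_add = clinear_add[OF be_linear] and be_scale = clinear_scale[OF be_linear]
  and be_sum = clinear_sum[OF be_linear] and be_0 [simp] = clinear_0[OF be_linear]
  and be_minus = clinear_minus[OF be_linear]
  and bf_add = clinear_add[OF bf_linear] and bf_scale = clinear_scale[OF bf_linear]
  and bf_sum = clinear_sum[OF bf_linear] and bf_0 [simp] = clinear_0[OF bf_linear]
  and bf_minus = clinear_minus[OF bf_linear]

text \<open>\<open>\<tau>\<close> kills every bracket with the Cartan subalgebra, so the pairing
  sees only opposite weights.\<close>

lemma be_weight: "(\<And>h. br (cart h) y = - (\<omega> h *\<^sub>C y)) \<Longrightarrow> be w y \<noteq> 0 \<Longrightarrow> wt D w h = \<omega> h"
proof (induction w arbitrary: y \<omega>)
  case Nil
  have "\<omega> h *\<^sub>C \<tau> y = 0"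
    using \<tau>_br_h[of h y] Nil.prems(1)[of h] by (simp add: clinear_minus[OF \<tau>_linear] clinear_scale[OF \<tau>_linear])
  then show ?case using Nil.prems(2) by simp
next
  case (Cons i w)
  have "br (cart h) (br (e i) y) = - ((\<omega> h - al i h) *\<^sub>C br (e i) y)" for h
    unfolding br_jacobi'[of "cart h"] by (simp add: Cons.prems(1) scaleC_diff_left)
  from Cons.IH[OF this] Cons.prems(2) have "wt D w h = \<omega> h - al i h" by simp
  then show ?case by simp
qed

lemma bf_weight: "(\<And>h. br (cart h) x = \<omega> h *\<^sub>C x) \<Longrightarrow> bf w x \<noteq> 0 \<Longrightarrow> wt D w h = \<omega> h"
proof (induction w arbitrary: x \<omega>)
  case Nil
  have "\<omega> h *\<^sub>C \<tau> x = 0"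
    using \<tau>_br_h[of h x] Nil.prems(1)[of h] by (simp add: clinear_scale[OF \<tau>_linear])
  then show ?case using Nil.prems(2) by simp
next
  case (Cons i w)
  have "br (cart h) (br (f i) x) = (\<omega> h - al i h) *\<^sub>C br (f i) x" for h
    unfolding br_jacobi'[of "cart h"] by (simp add: Cons.prems(1) scaleC_diff_left)
  from Cons.IH[OF this] Cons.prems(2) have "wt D w h = \<omega> h - al i h" by simp
  then show ?case by simp
qed

lemma be_nest_weight: "be w (nest br f w') \<noteq> 0 \<Longrightarrow> wt D w = wt D w'"
  using be_weight[of "nest br f w'" "wt D w'" w] br_h_nest_f by blast

lemma bf_nest_weight: "bf w (nest br e w') \<noteq> 0 \<Longrightarrow> wt D w = wt D w'"
  using bf_weight[of "nest br e w'" "wt D w'" w] br_h_nest_e by blast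

text \<open>Agreement of the two readings is what makes the pairing independent of the expressions
  as iterated brackets. At height 2 the symmetrized matrix enters. From height 3 on, the brackets of
  \<open>e_i\<close> and \<open>f_j\<close> with the inner words stay in layers of positive height,
  and the induction hypothesis is applied twice.\<close>

lemma be_eq_bf_length: "length W = k \<Longrightarrow> length F = k \<Longrightarrow> be W (nest br f F) = bf F (nest br e W)"
proof (induction k arbitrary: W F rule: less_induct)
  case (less k)
  consider "k = 0" | "k = 1" | "k = 2" | "3 \<le> k" by linarith
  then show ?case
  proof cases
    case 1
    then show ?thesis using less.prems by simp
  next
    case 2
    then obtain i j where "W = [i]" "F = [j]" using less.prems by (metis length_0_conv length_Suc_conv One_nat_def)
    then show ?thesis
      by (simp add: br_ef br_fe \<tau>_cart clinear_minus[OF \<tau>_linear] clinear_minus[OF \<xi>_linear] clinear_0[OF \<tau>_linear])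
  next
    case 3
    then obtain i k' j l where W: "W = [i, k']" and F: "F = [j, l]"
      using less.prems by (auto simp: length_Suc_conv numeral_2_eq_2)
    have 1: "br (e i) (br (f j) (f l))
      = (if i = j then - (of_int (A i l) *\<^sub>C f l) else 0) + (if i = l then of_int (A i j) *\<^sub>C f j else 0)"
      unfolding br_jacobi'[of "e i" "f j" "f l"] by (auto simp: br_ef br_anti[of "f j" "cart _"])
    have 2: "br (f j) (br (e i) (e k'))
      = (if i = j then - (of_int (A i k') *\<^sub>C e k') else 0) + (if k' = j then of_int (A j i) *\<^sub>C e i else 0)"
      unfolding br_jacobi'[of "f j" "e i" "e k'"] by (auto simp: br_fe br_anti[of "e i" "cart _"])
    have bek: "be [p] (f m) = (if p = m then of_real (eps p) else 0)" for p m
      by (simp add: br_ef \<tau>_cart clinear_0[OF \<tau>_linear])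
    have bfl: "bf [p] (e m) = (if m = p then of_real (eps p) else 0)" for p m
      by (simp add: br_fe \<tau>_cart clinear_0[OF \<tau>_linear] clinear_minus[OF \<tau>_linear])
    have be_simp: "be W (nest br f F) = - be [k'] (br (e i) (br (f j) (f l)))" by (simp add: W F)
    have bf_simp: "bf F (nest br e W) = - bf [l] (br (f j) (br (e i) (e k')))" by (simp add: W F)
    show ?thesis
      unfolding be_simp bf_simp 1 2 be_add bf_add
      using eps_sym_complex[of i j]
      by (auto simp: be_scale bf_scale be_minus bf_minus bek bfl scaleC_complex simp del: be.simps bf.simps)
  next
    case 4
    then obtain i W' j F' where W: "W = i # W'" and F: "F = j # F'" and len: "length W' = k - 1" "length F' = k - 1"
      using less.prems by (cases W; cases F) auto
    have ne: "W' \<noteq> []" "F' \<noteq> []" using len 4 by auto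
    define X where "X = nest br e W'"
    define Y where "Y = nest br f F'"
    have XY: "br (e i) Y \<in> nmk (k - 2)" "br (f j) X \<in> npk (k - 2)"
      unfolding X_def Y_def using len 4 by (auto intro!: nest_f_npk nest_e_nmk)
    \<comment> \<open>Both inner brackets are expanded in words of length \<open>k - 2\<close>. The
      hypothesis at \<open>k - 1\<close> carries a word to the other side, the one at
      \<open>k - 2\<close> identifies the resulting double sums.\<close>
    obtain \<G> c where G: "finite \<G>" "\<G> \<subseteq> {w. length w = k - 2}" "br (e i) Y = (\<Sum>w\<in>\<G>. c w *\<^sub>C nest br f w)"
      by (rule cspan_image_sum[OF XY(1)[unfolded nmk_def]])
    obtain \<W> d where W'': "finite \<W>" "\<W> \<subseteq> {w. length w = k - 2}" "br (f j) X = (\<Sum>w\<in>\<W>. d w *\<^sub>C nest br e w)"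
      by (rule cspan_image_sum[OF XY(2)[unfolded npk_def]])
    have neG: "G \<noteq> []" if "G \<in> \<G>" for G using G(2) that 4 by auto
    have neW: "w \<noteq> []" if "w \<in> \<W>" for w using W''(2) that 4 by auto
    have IH1: "be V (nest br f U) = bf U (nest br e V)" if "length V = k - 1" "length U = k - 1" for V U
      using less.IH[of "k - 1"] that 4 by auto
    have IH2: "be V (nest br f U) = bf U (nest br e V)" if "length V = k - 2" "length U = k - 2" for V U
      using less.IH[of "k - 2"] that 4 by auto
    have 1: "br (e i) (br (f j) Y) = (if i = j then - (wt D F' (co i) *\<^sub>C Y) else 0) + br (f j) (br (e i) Y)"
      unfolding br_jacobi'[of "e i" "f j" Y] by (simp add: br_ef Y_def br_h_nest_f)
    have 2: "br (f j) (br (e i) X) = (if i = j then - (wt D W' (co i) *\<^sub>C X) else 0) + br (e i) (br (f j) X)"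
      unfolding br_jacobi'[of "f j" "e i" X] by (simp add: br_fe X_def br_h_nest_e)
    have "be W' (br (f j) (br (e i) Y)) = (\<Sum>G\<in>\<G>. c G * be W' (nest br f (j # G)))"
      unfolding G(3) br_sum_right be_sum by (rule sum.cong) (simp_all add: be_scale scaleC_complex nest_Cons neG)
    also have "\<dots> = (\<Sum>G\<in>\<G>. c G * bf (j # G) X)"
      unfolding X_def by (rule sum.cong) (use G(2) 4 len IH1 in auto)
    also have "\<dots> = - (\<Sum>G\<in>\<G>. \<Sum>w\<in>\<W>. c G * (d w * bf G (nest br e w)))"
      by (simp add: W''(3) bf_sum bf_scale scaleC_complex sum_negf sum_distrib_left)
    finally have 3: "be W' (br (f j) (br (e i) Y)) = - (\<Sum>G\<in>\<G>. \<Sum>w\<in>\<W>. c G * (d w * bf G (nest br e w)))" .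
    have "bf F' (br (e i) (br (f j) X)) = (\<Sum>w\<in>\<W>. d w * bf F' (nest br e (i # w)))"
      unfolding W''(3) br_sum_right bf_sum by (rule sum.cong) (simp_all add: bf_scale scaleC_complex nest_Cons neW)
    also have "\<dots> = (\<Sum>w\<in>\<W>. d w * be (i # w) Y)"
    proof -
      have "be (i # w) (nest br f F') = bf F' (nest br e (i # w))" if "w \<in> \<W>" for w
        by (rule IH1) (use W''(2) 4 len that in auto)
      then show ?thesis unfolding Y_def by (intro sum.cong) (simp_all del: be.simps)
    qed
    also have "\<dots> = - (\<Sum>w\<in>\<W>. \<Sum>G\<in>\<G>. c G * (d w * be w (nest br f G)))"
      by (simp add: G(3) be_sum be_scale scaleC_complex sum_negf sum_distrib_left mult.left_commute)
    also have "\<dots> = - (\<Sum>w\<in>\<W>. \<Sum>G\<in>\<G>. c G * (d w * bf G (nest br e w)))"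
    proof -
      have "be w (nest br f G) = bf G (nest br e w)" if "w \<in> \<W>" "G \<in> \<G>" for w G
        using IH2 that G(2) W''(2) by auto
      then show ?thesis by simp
    qed
    also have "\<dots> = - (\<Sum>G\<in>\<G>. \<Sum>w\<in>\<W>. c G * (d w * bf G (nest br e w)))"
      by (subst sum.swap) simp
    finally have 5: "bf F' (br (e i) (br (f j) X)) = be W' (br (f j) (br (e i) Y))" using 3 by simp
    \<comment> \<open>The Cartan terms agree: either both pairings vanish or the two words have
      equal weight.\<close>
    have 6: "wt D F' (co i) * be W' Y = wt D W' (co i) * bf F' X"
    proof (cases "be W' Y = 0")
      case True
      then show ?thesis using IH1[OF len] by (simp add: X_def Y_def)
    next
      case False
      then have "wt D W' = wt D F'" unfolding Y_def by (rule be_nest_weight)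
      then show ?thesis using IH1[OF len] by (simp add: X_def Y_def)
    qed
    have "be W (nest br f F) = - be W' (br (e i) (br (f j) Y))"
      by (simp add: W F Y_def nest_Cons[OF ne(2)])
    also have "\<dots> = (if i = j then wt D F' (co i) * be W' Y else 0) - be W' (br (f j) (br (e i) Y))"
      unfolding 1 by (simp add: be_add be_scale be_minus scaleC_complex)
    also have "\<dots> = (if i = j then wt D W' (co i) * bf F' X else 0) - bf F' (br (e i) (br (f j) X))"
      unfolding 5 6 ..
    also have "\<dots> = - bf F' (br (f j) (br (e i) X))"
      unfolding 2 by (simp add: bf_add bf_scale bf_minus scaleC_complex)
    also have "\<dots> = bf F (nest br e W)"
      by (simp add: W F X_def nest_Cons[OF ne(1)])
    finally show ?thesis .
  qed
qed

lemma be_eq_bf: "be W (nest br f F) = bf F (nest br e W)"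
proof (cases "length W = length F")
  case True
  then show ?thesis using be_eq_bf_length by auto
next
  case False
  then have "wt D W \<noteq> wt D F" "wt D F \<noteq> wt D W" using wt_eq_length by metis+
  then show ?thesis using be_nest_weight[of W F] bf_nest_weight[of F W] by metis
qed

text \<open>For \<open>x\<close> in \<open>np\<close> the chosen expression does not matter on
  \<open>nm\<close>, since on iterated brackets of the \<open>f_i\<close> the value is
  \<open>bf w x\<close>.\<close>

definition pr :: "'g \<Rightarrow> 'g \<Rightarrow> complex" where
  "pr x y = lin_ext (\<lambda>w. be w y) (SOME c. lin_ext (nest br e) c = x)"

lemma pr_linear_right: "clinear (pr x)"
  by (rule clinearI) (simp_all add: pr_def lin_ext_def be_add be_scale scaleC_distribs sum.distrib
      scaleC_sum_right mult.commute)

lemma np_lin_ext: "x \<in> np \<Longrightarrow> lin_ext (nest br e) (SOME c. lin_ext (nest br e) c = x) = x"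
  unfolding np_range by (rule someI_ex) (metis cspan_range_lin_ext)

lemma pr_nest_right: "x \<in> np \<Longrightarrow> pr x (nest br f w) = bf w x"
proof -
  assume "x \<in> np"
  have "pr x (nest br f w) = lin_ext (\<lambda>u. bf w (nest br e u)) (SOME c. lin_ext (nest br e) c = x)"
    unfolding pr_def be_eq_bf ..
  also have "\<dots> = bf w x"
    unfolding clinear_lin_ext_compose[OF bf_linear, symmetric] np_lin_ext[OF \<open>x \<in> np\<close>] ..
  finally show ?thesis .
qed

lemma nm_lin_ext: assumes "y \<in> nm" obtains c where "y = lin_ext (nest br f) c"
  using assms unfolding nm_range by (rule cspan_range_lin_ext)

lemma pr_lin_ext_right: "x \<in> np \<Longrightarrow> pr x (lin_ext (nest br f) c) = lin_ext (\<lambda>w. bf w x) c"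
  by (simp add: clinear_lin_ext_compose[OF pr_linear_right] pr_nest_right)

lemma pr_add_left: "\<lbrakk>x \<in> np; x' \<in> np; y \<in> nm\<rbrakk> \<Longrightarrow> pr (x + x') y = pr x y + pr x' y"
  and pr_scale_left: "\<lbrakk>x \<in> np; y \<in> nm\<rbrakk> \<Longrightarrow> pr (a *\<^sub>C x) y = a * pr x y"
  by (auto elim!: nm_lin_ext simp: pr_lin_ext_right csubspace_add[OF np_subspace] csubspace_scale[OF np_subspace])
    (simp_all add: lin_ext_def bf_add bf_scale scaleC_complex sum.distrib sum_distrib_left algebra_simps)

lemma pr_sum_left: "\<lbrakk>\<And>a. a \<in> K \<Longrightarrow> g a \<in> np; y \<in> nm\<rbrakk> \<Longrightarrow> pr (sum g K) y = (\<Sum>a\<in>K. pr (g a) y)"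
proof (induction K rule: infinite_finite_induct)
  case (insert a K)
  then show ?case by (simp add: pr_add_left csubspace_sum[OF np_subspace])
qed (use pr_scale_left[of 0 _ 0] csubspace_0[OF np_subspace] in simp_all)

lemma pr_nest_left: "y \<in> nm \<Longrightarrow> pr (nest br e w) y = be w y"
  by (elim nm_lin_ext) (simp add: clinear_lin_ext_compose[OF pr_linear_right] clinear_lin_ext_compose[OF be_linear]
      pr_nest_right nest_in_np be_eq_bf)

lemma pr_length: "x \<in> npk k \<Longrightarrow> length w \<noteq> k \<Longrightarrow> pr x (nest br f w) = 0"
proof -
  assume x: "x \<in> npk k" and w: "length w \<noteq> k"
  have "bf w (nest br e u) = 0" if "length u = k" for u
    using bf_nest_weight[of w u] wt_eq_length[of w u] that w by auto
  moreover have "pr x (nest br f w) = bf w x" using pr_nest_right x npk_np by blast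
  ultimately show ?thesis
    using clinear_eq_on_cspan[OF bf_linear[of w] clinearI[of "\<lambda>_. 0"], of "nest br e ` {u. length u = k}" x] x
    by (auto simp: npk_def)
qed

lemma pr_length': "y \<in> nmk k \<Longrightarrow> length w \<noteq> k \<Longrightarrow> pr (nest br e w) y = 0"
proof -
  assume y: "y \<in> nmk k" and w: "length w \<noteq> k"
  have "be w (nest br f u) = 0" if "length u = k" for u
    using be_nest_weight[of w u] wt_eq_length[of w u] that w by auto
  moreover have "pr (nest br e w) y = be w y" using pr_nest_left y nmk_nm by blast
  ultimately show ?thesis
    using clinear_eq_on_cspan[OF be_linear[of w] clinearI[of "\<lambda>_. 0"], of "nest br f ` {u. length u = k}" y] y
    by (auto simp: nmk_def)
qed

text \<open>The premise on the bracket excludes a Cartan component, on which \<open>pr\<close> has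
  no intended meaning.\<close>

lemma pr_f_invariant: "\<lbrakk>x \<in> np; br (f i) x \<in> np; y \<in> nm\<rbrakk> \<Longrightarrow> pr (br (f i) x) y = - pr x (br (f i) y)"
proof -
  assume *: "x \<in> np" "br (f i) x \<in> np" "y \<in> nm"
  have "nm \<subseteq> {y. pr (br (f i) x) y + pr x (br (f i) y) = 0}"
    unfolding nm_def
  proof (intro cspan_minimal csubspace_Collect_linear_eq0)
    show "clinear (\<lambda>y. pr (br (f i) x) y + pr x (br (f i) y))"
      by (simp add: clinear_iff br_add_right clinear_add[OF pr_linear_right] clinear_scale[OF pr_linear_right] scaleC_distribs)
    show "nest br f ` {w. w \<noteq> []} \<subseteq> {y. pr (br (f i) x) y + pr x (br (f i) y) = 0}"
      using * by (auto simp: nest_Cons[symmetric] pr_nest_right)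
  qed
  with * show ?thesis by (auto simp: eq_neg_iff_add_eq_0)
qed

lemma pr_e_invariant: "\<lbrakk>x \<in> np; br (e i) y \<in> nm; y \<in> nm\<rbrakk> \<Longrightarrow> pr (br (e i) x) y = - pr x (br (e i) y)"
proof -
  assume *: "x \<in> np" "br (e i) y \<in> nm" "y \<in> nm"
  let ?M = "{x \<in> np. pr (br (e i) x) y + pr x (br (e i) y) = 0}"
  have "csubspace ?M"
  proof (rule csubspaceI)
    show "0 \<in> ?M"
      using * pr_scale_left[of 0 _ 0] csubspace_0[OF np_subspace] by simp
  next
    fix x x' assume x: "x \<in> ?M" "x' \<in> ?M"
    then have "x \<in> np" "x' \<in> np" by auto
    then have "pr (br (e i) (x + x')) y + pr (x + x') (br (e i) y)
      = (pr (br (e i) x) y + pr x (br (e i) y)) + (pr (br (e i) x') y + pr x' (br (e i) y))"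
      using * np_br by (simp add: br_add_right pr_add_left algebra_simps)
    then show "x + x' \<in> ?M" using x csubspace_add[OF np_subspace] by simp
  next
    fix c x assume x: "x \<in> ?M"
    then have "x \<in> np" by auto
    then have "pr (br (e i) (c *\<^sub>C x)) y + pr (c *\<^sub>C x) (br (e i) y)
      = c * (pr (br (e i) x) y + pr x (br (e i) y))"
      using * np_br by (simp add: pr_scale_left distrib_left)
    then show "c *\<^sub>C x \<in> ?M" using x csubspace_scale[OF np_subspace] by simp
  qed
  then have "cspan (nest br e ` {w. w \<noteq> []}) \<subseteq> ?M"
    using * by (intro cspan_minimal) (auto simp: nest_Cons[symmetric] pr_nest_left nest_in_np)
  with * show ?thesis by (auto simp: eq_neg_iff_add_eq_0 np_def)
qed

end

section \<open>Nondegeneracy of the pairing and dual bases\<close>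

context sym_km_algebra begin

lemma pr_eq_0_right: "(\<And>w. w \<noteq> [] \<Longrightarrow> pr x (nest br f w) = 0) \<Longrightarrow> y \<in> nm \<Longrightarrow> pr x y = 0"
  unfolding nm_def using clinear_eq_on_cspan[OF pr_linear_right[of x] clinearI[of "\<lambda>_. 0"], of "nest br f ` {w. w \<noteq> []}" y]
  by auto

lemma pr_eq_0_left: 
  assumes "\<And>w. w \<noteq> [] \<Longrightarrow> pr (nest br e w) y = 0" "x \<in> np" "y \<in> nm"
  shows "pr x y = 0"
proof -
  have "cspan (nest br e ` {w. w \<noteq> []}) \<subseteq> {x \<in> np. pr x y = 0}"
    using assms pr_scale_left[of 0 y 0] csubspace_0[OF np_subspace]
    by (intro cspan_minimal csubspaceI) (auto simp: nest_in_np csubspace_add[OF np_subspace]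
        csubspace_scale[OF np_subspace] pr_add_left pr_scale_left)
  with assms(2) show ?thesis by (auto simp: np_def)
qed

lemma cspan_first_layer:
  assumes "x \<in> cspan (nest br g ` {w. w \<noteq> []})"
  shows "\<exists>c :: 'i \<Rightarrow> complex. x - (\<Sum>i\<in>UNIV. c i *\<^sub>C g i) \<in> cspan (nest br g ` {w. 2 \<le> length w})"
  using assms
proof (induction rule: complex_vector.span_induct_alt)
  case base
  show ?case by (intro exI[of _ "\<lambda>_. 0"]) (simp add: complex_vector.span_zero)
next
  case (step a y z)
  then obtain w c where w: "w \<noteq> []" "y = nest br g w"
    and c: "z - (\<Sum>i\<in>UNIV. c i *\<^sub>C g i) \<in> cspan (nest br g ` {w. 2 \<le> length w})" by auto
  show ?case
  proof (cases "2 \<le> length w")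
    case True
    then have "y \<in> cspan (nest br g ` {w. 2 \<le> length w})" using w by (auto intro: cspan_base)
    then have "a *\<^sub>C y + (z - (\<Sum>i\<in>UNIV. c i *\<^sub>C g i)) \<in> cspan (nest br g ` {w. 2 \<le> length w})"
      using c by (intro complex_vector.span_add complex_vector.span_scale)
    then show ?thesis by (intro exI[of _ c]) (simp add: algebra_simps)
  next
    case False
    then obtain j where "w = [j]" using w(1) by (cases w; cases "tl w") auto
    then have y: "y = g j" using w(2) by simp
    have "(\<Sum>i\<in>UNIV. (c i + (if i = j then a else 0)) *\<^sub>C g i)
        = (\<Sum>i\<in>UNIV. c i *\<^sub>C g i) + (\<Sum>i\<in>UNIV. if i = j then a *\<^sub>C g i else 0)"
      unfolding sum.distrib[symmetric] by (rule sum.cong) (auto simp: scaleC_add_left)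
    also have "(\<Sum>i\<in>UNIV. if i = j then a *\<^sub>C g i else 0) = a *\<^sub>C y"
      by (simp add: y)
    finally have eq: "a *\<^sub>C y + z - (\<Sum>i\<in>UNIV. (c i + (if i = j then a else 0)) *\<^sub>C g i)
        = z - (\<Sum>i\<in>UNIV. c i *\<^sub>C g i)" by simp
    show ?thesis
      by (rule exI[of _ "\<lambda>i. c i + (if i = j then a else 0)"]) (simp only: eq c)
  qed
qed

lemma cspan_ge2: "cspan (nest br g ` {w :: 'i list. 2 \<le> length w}) \<subseteq> cspan (nest br g ` {w. w \<noteq> []})"
  by (intro complex_vector.span_mono image_mono) auto

lemma npk_ge2_pr: "x \<in> cspan (nest br e ` {w. 2 \<le> length w}) \<Longrightarrow> pr x (f j) = 0"
proof -
  assume x: "x \<in> cspan (nest br e ` {w. 2 \<le> length w})"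
  have "bf [j] (nest br e w) = 0" if "2 \<le> length w" for w
    using bf_nest_weight[of "[j]" w] wt_eq_length[of "[j]" w] that by fastforce
  then have "bf [j] x = 0"
    using clinear_eq_on_cspan[OF bf_linear[of "[j]"] clinearI[of "\<lambda>_. 0"] _ x] by auto
  moreover have "x \<in> np"
    using x cspan_ge2[of e]
    by (auto simp: np_def)
  ultimately show ?thesis using pr_nest_right[of x "[j]"] by simp
qed

lemma nmk_ge2_pr: "y \<in> cspan (nest br f ` {w. 2 \<le> length w}) \<Longrightarrow> pr (e j) y = 0"
proof -
  assume y: "y \<in> cspan (nest br f ` {w. 2 \<le> length w})"
  have "be [j] (nest br f w) = 0" if "2 \<le> length w" for w
    using be_nest_weight[of "[j]" w] wt_eq_length[of "[j]" w] that by fastforce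
  then have "be [j] y = 0"
    using clinear_eq_on_cspan[OF be_linear[of "[j]"] clinearI[of "\<lambda>_. 0"] _ y] by auto
  moreover have "y \<in> nm"
    using y cspan_ge2[of f]
    by (auto simp: nm_def)
  ultimately show ?thesis using pr_nest_left[of y "[j]"] by simp
qed

lemma pr_e_f: "pr (e i) (f j) = (if i = j then of_real (eps i) else 0)"
  using pr_nest_left[of "f j" "[i]"] nm_f[of j] by (simp add: br_ef \<tau>_cart clinear_0[OF \<tau>_linear])

lemma f_ge2_np: "x \<in> cspan (nest br e ` {w. 2 \<le> length w}) \<Longrightarrow> br (f j) x \<in> np"
proof (erule cspan_br_stable[OF _ _ np_subspace])
  fix y assume "y \<in> nest br e ` {w. 2 \<le> length w}"
  then obtain w where "2 \<le> length w" "y = nest br e w" by auto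
  moreover from this obtain k where "length w = Suc k" "1 \<le> k" by (cases "length w") auto
  ultimately show "br (f j) y \<in> np" using nest_f_npk[of w k j] npk_np by blast
qed

lemma e_ge2_nm: "y \<in> cspan (nest br f ` {w. 2 \<le> length w}) \<Longrightarrow> br (e j) y \<in> nm"
proof (erule cspan_br_stable[OF _ _ nm_subspace])
  fix y assume "y \<in> nest br f ` {w. 2 \<le> length w}"
  then obtain w where "2 \<le> length w" "y = nest br f w" by auto
  moreover from this obtain k where "length w = Suc k" "1 \<le> k" by (cases "length w") auto
  ultimately show "br (e j) y \<in> nm" using nest_e_nmk[of w k j] nmk_nm by blast
qed

text \<open>Since \<open>(e_i | f_i)\<close> is nonzero, a vector of the radical has no component of
  height 1. Its brackets with the \<open>f_j\<close> then remain in \<open>np\<close>.\<close>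

lemma np_orth_ge2:
  assumes "x \<in> np" "\<And>y. y \<in> nm \<Longrightarrow> pr x y = 0"
  shows "x \<in> cspan (nest br e ` {w. 2 \<le> length w})"
proof -
  obtain c where c: "x - (\<Sum>i\<in>UNIV. c i *\<^sub>C e i) \<in> cspan (nest br e ` {w. 2 \<le> length w})"
    using cspan_first_layer[of x e] assms(1) by (auto simp: np_def)
  define x2 where "x2 = x - (\<Sum>i\<in>UNIV. c i *\<^sub>C e i)"
  have s: "(\<Sum>i\<in>UNIV. c i *\<^sub>C e i) \<in> np"
    by (intro csubspace_sum[OF np_subspace] csubspace_scale[OF np_subspace] np_e)
  have "c j = 0" for j
  proof -
    have x2: "x2 \<in> np" unfolding x2_def using assms(1) s by (intro csubspace_diff[OF np_subspace])
    have "x = (\<Sum>i\<in>UNIV. c i *\<^sub>C e i) + x2" by (simp add: x2_def)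
    then have "pr x (f j) = pr (\<Sum>i\<in>UNIV. c i *\<^sub>C e i) (f j) + pr x2 (f j)"
      using pr_add_left[OF s x2 nm_f] by simp
    also have "pr x2 (f j) = 0" using npk_ge2_pr c x2_def by simp
    also have "pr (\<Sum>i\<in>UNIV. c i *\<^sub>C e i) (f j) = (\<Sum>i\<in>UNIV. c i * pr (e i) (f j))"
      by (subst pr_sum_left) (auto simp: csubspace_scale[OF np_subspace] np_e nm_f pr_scale_left)
    also have "\<dots> = (\<Sum>i\<in>UNIV. if i = j then c j * of_real (eps j) else 0)"
      by (rule sum.cong) (auto simp: pr_e_f)
    finally show "c j = 0" using assms(2)[OF nm_f[of j]] by simp
  qed
  then show ?thesis using c by simp
qed

lemma nm_orth_ge2:
  assumes "y \<in> nm" "\<And>x. x \<in> np \<Longrightarrow> pr x y = 0"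
  shows "y \<in> cspan (nest br f ` {w. 2 \<le> length w})"
proof -
  obtain c where c: "y - (\<Sum>i\<in>UNIV. c i *\<^sub>C f i) \<in> cspan (nest br f ` {w. 2 \<le> length w})"
    using cspan_first_layer[of y f] assms(1) by (auto simp: nm_def)
  have "c j = 0" for j
  proof -
    have "pr (e j) (y - (\<Sum>i\<in>UNIV. c i *\<^sub>C f i)) = pr (e j) y - (\<Sum>i\<in>UNIV. c i * pr (e j) (f i))"
      by (simp add: clinear_diff[OF pr_linear_right] clinear_sum[OF pr_linear_right]
          clinear_scale[OF pr_linear_right] scaleC_complex)
    also have "(\<Sum>i\<in>UNIV. c i * pr (e j) (f i)) = (\<Sum>i\<in>UNIV. if i = j then c j * of_real (eps j) else 0)"
      by (rule sum.cong) (auto simp: pr_e_f)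
    finally show "c j = 0" using assms(2)[OF np_e[of j]] nmk_ge2_pr[OF c, of j] by simp
  qed
  then show ?thesis using c by simp
qed

text \<open>By invariance the radical of the pairing is an ideal, and as a part of \<open>np\<close>
  it meets the Cartan subalgebra only in 0.\<close>

lemma pr_nondegenerate_left:
  assumes "x \<in> np" "\<And>y. y \<in> nm \<Longrightarrow> pr x y = 0"
  shows "x = 0"
proof (rule ideal_trivial[of "{x \<in> np. \<forall>y\<in>nm. pr x y = 0}"])
  let ?J = "{x \<in> np. \<forall>y\<in>nm. pr x y = 0}"
  show "csubspace ?J"
    using pr_scale_left[of 0 _ 0] csubspace_0[OF np_subspace]
    by (intro csubspaceI) (auto simp: csubspace_add[OF np_subspace]
        csubspace_scale[OF np_subspace] pr_add_left pr_scale_left)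
  fix z assume z: "z \<in> ?J"
  then have z2: "z \<in> cspan (nest br e ` {w. 2 \<le> length w})" by (auto intro: np_orth_ge2)
  show "br (e i) z \<in> ?J" for i
  proof -
    have "pr (br (e i) z) (nest br f w) = 0" if w: "w \<noteq> []" for w
    proof (cases "2 \<le> length w")
      case True
      then have "br (e i) (nest br f w) \<in> nm" by (intro e_ge2_nm cspan_base) auto
      then show ?thesis using pr_e_invariant[of z i "nest br f w"] z nest_in_nm by auto
    next
      case False
      then obtain j where j: "w = [j]" using w(1) by (cases w; cases "tl w") auto
      have "br (e i) z \<in> cspan (nest br e ` {w. w \<noteq> [] \<and> 2 \<le> length w})"
        by (rule cspan_nest_br[where P = "\<lambda>w. w \<noteq> []"]) (use z in \<open>auto simp: np_def Suc_le_eq\<close>)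
      also have "{w. w \<noteq> [] \<and> 2 \<le> length w} = {w :: 'i list. 2 \<le> length w}" by auto
      finally show ?thesis using npk_ge2_pr by (simp add: j)
    qed
    then show ?thesis using pr_eq_0_right np_br z by auto
  qed
  show "br (f i) z \<in> ?J" for i
    using z2 z f_ge2_np[OF z2, of i] pr_f_invariant[of z i] nm_br by auto
  show "br (cart h) z \<in> ?J" for h
  proof -
    have "bf w (br (cart h) z) = wt D w h * bf w z" for w
    proof (rule clinear_eq_on_cspan[of "\<lambda>z. bf w (br (cart h) z)" "\<lambda>z. wt D w h * bf w z"])
      show "z \<in> cspan (range (nest br e))" using z by (simp add: np_range)
      fix x assume "x \<in> range (nest br e)"
      then obtain u where "x = nest br e u" by auto
      then show "bf w (br (cart h) x) = wt D w h * bf w x"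
        using bf_nest_weight[of w u] by (cases "bf w x = 0") (auto simp: br_h_nest_e bf_scale scaleC_complex)
    qed (auto simp: clinear_iff br_add_right bf_add bf_scale scaleC_complex distrib_left)
    moreover have "bf w z = 0" for w using pr_nest_right[of z w] nest_in_nm z by auto
    ultimately have "pr (br (cart h) z) (nest br f w) = 0" for w
      using pr_nest_right[OF np_h, of z h w] z by simp
    then show ?thesis using pr_eq_0_right np_h z by auto
  qed
next
  fix h assume "cart h \<in> {x \<in> np. \<forall>y\<in>nm. pr x y = 0}"
  then show "h = 0"
    using triangular_unique(2)[of 0 "- cart h" h] csubspace_0[OF nm_subspace] csubspace_neg[OF np_subspace] by simp
qed (use assms in auto)

lemma pr_nondegenerate_right:
  assumes "y \<in> nm" "\<And>x. x \<in> np \<Longrightarrow> pr x y = 0"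
  shows "y = 0"
proof (rule ideal_trivial[of "{y \<in> nm. \<forall>x\<in>np. pr x y = 0}"])
  let ?J = "{y \<in> nm. \<forall>x\<in>np. pr x y = 0}"
  show "csubspace ?J"
    by (intro csubspaceI) (auto simp: csubspace_add[OF nm_subspace] csubspace_0[OF nm_subspace]
        csubspace_scale[OF nm_subspace] clinear_0[OF pr_linear_right] clinear_add[OF pr_linear_right]
        clinear_scale[OF pr_linear_right])
  fix z assume z: "z \<in> ?J"
  then have z2: "z \<in> cspan (nest br f ` {w. 2 \<le> length w})" by (auto intro: nm_orth_ge2)
  show "br (f i) z \<in> ?J" for i
  proof -
    have "pr (nest br e w) (br (f i) z) = 0" if w: "w \<noteq> []" for w
    proof (cases "2 \<le> length w")
      case True
      then have "br (f i) (nest br e w) \<in> np" by (intro f_ge2_np cspan_base) auto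
      then show ?thesis using pr_f_invariant[of "nest br e w" i z] z nest_in_np by auto
    next
      case False
      then obtain j where j: "w = [j]" using w(1) by (cases w; cases "tl w") auto
      have "br (f i) z \<in> cspan (nest br f ` {w. w \<noteq> [] \<and> 2 \<le> length w})"
        by (rule cspan_nest_br[where P = "\<lambda>w. w \<noteq> []"]) (use z in \<open>auto simp: nm_def Suc_le_eq\<close>)
      also have "{w. w \<noteq> [] \<and> 2 \<le> length w} = {w :: 'i list. 2 \<le> length w}" by auto
      finally show ?thesis using nmk_ge2_pr by (simp add: j)
    qed
    then show ?thesis using pr_eq_0_left nm_br z by auto
  qed
  show "br (e i) z \<in> ?J" for i
    using z2 z e_ge2_nm[OF z2, of i] pr_e_invariant[of _ i z] np_br by fastforce
  show "br (cart h) z \<in> ?J" for h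
  proof -
    have "be w (br (cart h) z) = - (wt D w h * be w z)" for w
    proof (rule clinear_eq_on_cspan[of "\<lambda>z. be w (br (cart h) z)" "\<lambda>z. - (wt D w h * be w z)"])
      show "z \<in> cspan (range (nest br f))" using z by (simp add: nm_range)
      fix x assume "x \<in> range (nest br f)"
      then obtain u where "x = nest br f u" by auto
      then show "be w (br (cart h) x) = - (wt D w h * be w x)"
        using be_nest_weight[of w u] by (cases "be w x = 0") (auto simp: br_h_nest_f be_scale be_minus scaleC_complex)
    qed (auto simp: clinear_iff br_add_right be_add be_scale scaleC_complex distrib_left)
    moreover have "be w z = 0" for w using pr_nest_left[of z w] nest_in_np z by auto
    ultimately have "pr (nest br e w) (br (cart h) z) = 0" for w
      using pr_nest_left[OF nm_h[of z h], of w] z by simp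
    then show ?thesis using pr_eq_0_left nm_h z by auto
  qed
next
  fix h assume "cart h \<in> {y \<in> nm. \<forall>x\<in>np. pr x y = 0}"
  then show "h = 0"
    using triangular_unique(2)[of "- cart h" 0 h] csubspace_0[OF np_subspace] csubspace_neg[OF nm_subspace] by simp
qed (use assms in auto)

lemma pr_nondegenerate_left_graded:
  assumes "x \<in> npk k" "\<And>y. y \<in> nmk k \<Longrightarrow> pr x y = 0" shows "x = 0"
proof (rule pr_nondegenerate_left)
  show "x \<in> np" using assms(1) npk_np by auto
  show "pr x y = 0" if "y \<in> nm" for y
    by (rule pr_eq_0_right[OF _ that]) (metis assms pr_length nest_in_nmk)
qed

lemma pr_nondegenerate_right_graded:
  assumes "y \<in> nmk k" "\<And>x. x \<in> npk k \<Longrightarrow> pr x y = 0" shows "y = 0"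
proof (rule pr_nondegenerate_right)
  show "y \<in> nm" using assms(1) nmk_nm by auto
  then show "pr x y = 0" if "x \<in> np" for x
    by (intro pr_eq_0_left[OF _ that]) (metis assms pr_length' nest_in_npk)
qed

text \<open>\<open>X\<close> is a basis of the layer and \<open>b\<close> its dual family. That
  \<open>b\<close> spans the opposite layer uses nondegeneracy on the other side: the defect of the
  expansion is orthogonal to \<open>X\<close>.\<close>

lemma dual_bases_exist:
  "\<exists>X b. finite X \<and> X \<subseteq> npk k \<and> b ` X \<subseteq> nmk k
    \<and> (\<forall>x\<in>npk k. x = (\<Sum>s\<in>X. pr x (b s) *\<^sub>C s)) \<and> (\<forall>y\<in>nmk k. y = (\<Sum>s\<in>X. pr s y *\<^sub>C b s))"
proof -
  have "finite {w :: 'i list. length w = k}" using finite_lists_length_eq[of "UNIV :: 'i set" k] by simp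
  then have "fin_dim (npk k)" unfolding fin_dim_def npk_def by (intro exI[of _ "nest br e ` {w. length w = k}"]) auto
  then obtain X where X: "finite X" "X \<subseteq> npk k" "\<not> cdependent X" "cspan X = npk k"
    by (rule fin_dim_basis[OF npk_subspace])
  have Xnp: "s \<in> np" if "s \<in> X" for s using that X(2) npk_np by auto
  have "\<exists>b. \<forall>j\<in>X. b j \<in> nmk k \<and> (\<forall>i\<in>X. pr i (b j) = (if i = j then 1 else 0))"
  proof (rule dual_family_exists[OF X(1) nmk_subspace pr_linear_right])
    fix c i assume c: "\<And>y. y \<in> nmk k \<Longrightarrow> (\<Sum>i\<in>X. c i * pr i y) = 0" and "i \<in> X"
    have "(\<Sum>i\<in>X. c i *\<^sub>C i) = 0"
    proof (rule pr_nondegenerate_left_graded)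
      show "(\<Sum>i\<in>X. c i *\<^sub>C i) \<in> npk k"
        using X(2) by (intro csubspace_sum[OF npk_subspace] csubspace_scale[OF npk_subspace]) auto
      fix y assume y: "y \<in> nmk k"
      then have "y \<in> nm" using nmk_nm by auto
      then have "pr (\<Sum>i\<in>X. c i *\<^sub>C i) y = (\<Sum>i\<in>X. c i * pr i y)"
        using Xnp by (subst pr_sum_left) (auto simp: csubspace_scale[OF np_subspace] pr_scale_left)
      then show "pr (\<Sum>i\<in>X. c i *\<^sub>C i) y = 0" using c[OF y] by simp
    qed
    then show "c i = 0" using complex_vector.independentD[OF X(3) X(1) subset_refl, of c i] \<open>i \<in> X\<close> by simp
  qed
  then obtain b where b: "\<And>j. j \<in> X \<Longrightarrow> b j \<in> nmk k"
    "\<And>i j. i \<in> X \<Longrightarrow> j \<in> X \<Longrightarrow> pr i (b j) = (if i = j then 1 else 0)" by blast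
  have bnm: "b s \<in> nm" if "s \<in> X" for s using that b(1) nmk_nm by auto
  have left: "x = (\<Sum>s\<in>X. pr x (b s) *\<^sub>C s)" if x: "x \<in> npk k" for x
  proof -
    have "x \<in> cspan X" using x X(4) by simp
    then obtain c where c: "x = (\<Sum>s\<in>X. c s *\<^sub>C s)"
      using X(1) by (auto simp: complex_vector.span_finite)
    have "pr x (b t) = c t" if "t \<in> X" for t
    proof -
      have "pr x (b t) = (\<Sum>s\<in>X. c s * pr s (b t))"
        unfolding c using Xnp bnm[OF that] by (subst pr_sum_left) (auto simp: csubspace_scale[OF np_subspace] pr_scale_left)
      also have "\<dots> = (\<Sum>s\<in>X. if s = t then c t else 0)" by (rule sum.cong) (use b(2) that in auto)
      finally show ?thesis using that X(1) by simp
    qed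
    then show ?thesis by (simp add: c)
  qed
  have right: "y = (\<Sum>s\<in>X. pr s y *\<^sub>C b s)" if y: "y \<in> nmk k" for y
  proof -
    define z where "z = y - (\<Sum>s\<in>X. pr s y *\<^sub>C b s)"
    have z: "z \<in> nmk k" unfolding z_def using y b(1)
      by (intro csubspace_diff[OF nmk_subspace] csubspace_sum[OF nmk_subspace] csubspace_scale[OF nmk_subspace])
    have zX: "pr t z = 0" if "t \<in> X" for t
    proof -
      have "pr t z = pr t y - (\<Sum>s\<in>X. pr s y * pr t (b s))"
        by (simp add: z_def clinear_diff[OF pr_linear_right] clinear_sum[OF pr_linear_right]
          clinear_scale[OF pr_linear_right] scaleC_complex)
      also have "(\<Sum>s\<in>X. pr s y * pr t (b s)) = (\<Sum>s\<in>X. if s = t then pr t y else 0)"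
        by (rule sum.cong) (use b(2) that in auto)
      finally show ?thesis using that X(1) by simp
    qed
    have "pr x z = 0" if "x \<in> npk k" for x
    proof -
      have "x \<in> cspan X" using that X(4) by simp
      then obtain c where c: "x = (\<Sum>s\<in>X. c s *\<^sub>C s)"
        using X(1) by (auto simp: complex_vector.span_finite)
      have "z \<in> nm" using z nmk_nm by auto
      then have "pr x z = (\<Sum>s\<in>X. c s * pr s z)"
        unfolding c using Xnp by (subst pr_sum_left) (auto simp: csubspace_scale[OF np_subspace] pr_scale_left)
      then show ?thesis using zX by simp
    qed
    then have "z = 0" by (rule pr_nondegenerate_right_graded[OF z])
    then show ?thesis by (simp add: z_def)
  qed
  show ?thesis using X b left right by (intro exI[of _ X] exI[of _ b]) blast
qed

definition dX :: "nat \<Rightarrow> 'g set" where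
  "dX k = (SOME X. \<exists>b. finite X \<and> X \<subseteq> npk k \<and> b ` X \<subseteq> nmk k
    \<and> (\<forall>x\<in>npk k. x = (\<Sum>s\<in>X. pr x (b s) *\<^sub>C s)) \<and> (\<forall>y\<in>nmk k. y = (\<Sum>s\<in>X. pr s y *\<^sub>C b s)))"

definition db :: "nat \<Rightarrow> 'g \<Rightarrow> 'g" where
  "db k = (SOME b. finite (dX k) \<and> dX k \<subseteq> npk k \<and> b ` dX k \<subseteq> nmk k
    \<and> (\<forall>x\<in>npk k. x = (\<Sum>s\<in>dX k. pr x (b s) *\<^sub>C s)) \<and> (\<forall>y\<in>nmk k. y = (\<Sum>s\<in>dX k. pr s y *\<^sub>C b s)))"

lemma dual_bases:
  shows dX_finite: "finite (dX k)" and dX_npk: "s \<in> dX k \<Longrightarrow> s \<in> npk k" and db_nmk: "s \<in> dX k \<Longrightarrow> db k s \<in> nmk k"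
    and dX_expand: "x \<in> npk k \<Longrightarrow> x = (\<Sum>s\<in>dX k. pr x (db k s) *\<^sub>C s)"
    and db_expand: "y \<in> nmk k \<Longrightarrow> y = (\<Sum>s\<in>dX k. pr s y *\<^sub>C db k s)"
proof -
  have "\<exists>b. finite (dX k) \<and> dX k \<subseteq> npk k \<and> b ` dX k \<subseteq> nmk k
    \<and> (\<forall>x\<in>npk k. x = (\<Sum>s\<in>dX k. pr x (b s) *\<^sub>C s)) \<and> (\<forall>y\<in>nmk k. y = (\<Sum>s\<in>dX k. pr s y *\<^sub>C b s))"
    unfolding dX_def by (rule someI_ex[OF dual_bases_exist])
  from someI_ex[OF this]
  have *: "finite (dX k) \<and> dX k \<subseteq> npk k \<and> db k ` dX k \<subseteq> nmk k
    \<and> (\<forall>x\<in>npk k. x = (\<Sum>s\<in>dX k. pr x (db k s) *\<^sub>C s)) \<and> (\<forall>y\<in>nmk k. y = (\<Sum>s\<in>dX k. pr s y *\<^sub>C db k s))"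
    unfolding db_def .
  then show "finite (dX k)" "s \<in> dX k \<Longrightarrow> s \<in> npk k" "s \<in> dX k \<Longrightarrow> db k s \<in> nmk k" by auto
  show "x \<in> npk k \<Longrightarrow> x = (\<Sum>s\<in>dX k. pr x (db k s) *\<^sub>C s)" "y \<in> nmk k \<Longrightarrow> y = (\<Sum>s\<in>dX k. pr s y *\<^sub>C db k s)"
    using * by blast+
qed

end

subsection \<open>The Casimir operator\<close>

locale sym_rep = sym_km_algebra D + g_rep D R
  for D :: "('i::finite, 'h::complex_vector, 'g::complex_vector) km_data" and R :: "('g, 'v::complex_vector) rep"
begin

text \<open>The root part of the Casimir operator, truncated at height \<open>K\<close>: on words of
  length at most \<open>K\<close> the omitted layers act as 0. The Cartan part, a scalar on each
  weight space, is left out.\<close>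

definition casimir :: "nat \<Rightarrow> 'v \<Rightarrow> 'v" where
  "casimir K x = (\<Sum>k=1..K. \<Sum>s\<in>dX k. db k s \<cdot> s \<cdot> x)"

lemma casimir_Suc: "casimir (Suc K) x = casimir K x + (\<Sum>s\<in>dX (Suc K). db (Suc K) s \<cdot> s \<cdot> x)"
  by (simp add: casimir_def)

lemma casimir_in [simp]: "x \<in> S \<Longrightarrow> casimir K x \<in> S"
  unfolding casimir_def by (intro S_sum) simp

lemma casimir_add: "x \<in> S \<Longrightarrow> y \<in> S \<Longrightarrow> casimir K (x + y) = casimir K x + casimir K y"
  by (simp add: casimir_def act_add_right sum.distrib)

lemma casimir_scale: "x \<in> S \<Longrightarrow> casimir K (c *\<^sub>C x) = c *\<^sub>C casimir K x"
  by (simp add: casimir_def act_scale_right scaleC_sum_right)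

lemma casimir_sum: "(\<And>a. a \<in> G \<Longrightarrow> g a \<in> S) \<Longrightarrow> casimir K (sum g G) = (\<Sum>a\<in>G. casimir K (g a))"
proof (induction G rule: infinite_finite_induct)
  case (insert a G)
  then show ?case by (simp add: casimir_add S_sum)
qed (simp_all add: casimir_def)

text \<open>Invariance of the pairing expressed in dual bases: moving \<open>ad f_i\<close> from one
  factor to the other shifts the layer by one and changes the sign.\<close>

lemma dual_telescope:
  assumes "1 \<le> k" "x \<in> S"
  shows "(\<Sum>s\<in>dX (Suc k). db (Suc k) s \<cdot> br (f i) s \<cdot> x) = - (\<Sum>t\<in>dX k. br (f i) (db k t) \<cdot> t \<cdot> x)"
proof -
  have inner: "br (f i) s = (\<Sum>t\<in>dX k. - pr s (br (f i) (db k t)) *\<^sub>C t)" if s: "s \<in> dX (Suc k)" for s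
  proof -
    have np: "br (f i) s \<in> npk k"
      using dX_npk[OF s] unfolding npk_def[of "Suc k"]
      by (rule cspan_br_stable[OF _ _ npk_subspace]) (use assms(1) nest_f_npk in auto)
    have "pr (br (f i) s) (db k t) = - pr s (br (f i) (db k t))" if "t \<in> dX k" for t
      using dX_npk[OF s] np db_nmk[OF that] npk_np nmk_nm by (intro pr_f_invariant) auto
    then show ?thesis by (subst dX_expand[OF np]) simp
  qed
  have "(\<Sum>s\<in>dX (Suc k). db (Suc k) s \<cdot> br (f i) s \<cdot> x)
    = (\<Sum>s\<in>dX (Suc k). \<Sum>t\<in>dX k. - pr s (br (f i) (db k t)) *\<^sub>C db (Suc k) s \<cdot> t \<cdot> x)"
    by (rule sum.cong[OF HOL.refl])
      (simp add: inner act_sum_left act_sum_right act_scale_left act_scale_right act_minus_left act_minus_right assms(2))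
  also have "\<dots> = (\<Sum>t\<in>dX k. - (\<Sum>s\<in>dX (Suc k). pr s (br (f i) (db k t)) *\<^sub>C db (Suc k) s \<cdot> t \<cdot> x))"
    by (subst sum.swap) (simp add: sum_negf)
  also have "\<dots> = (\<Sum>t\<in>dX k. - (br (f i) (db k t) \<cdot> t \<cdot> x))"
  proof (rule sum.cong[OF HOL.refl])
    fix t assume t: "t \<in> dX k"
    have "br (f i) (db k t) = (\<Sum>s\<in>dX (Suc k). pr s (br (f i) (db k t)) *\<^sub>C db (Suc k) s)"
      by (rule db_expand) (use t assms(1) db_nmk nmk_f in auto)
    then have "br (f i) (db k t) \<cdot> t \<cdot> x = (\<Sum>s\<in>dX (Suc k). pr s (br (f i) (db k t)) *\<^sub>C db (Suc k) s) \<cdot> t \<cdot> x"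
      by simp
    also have "\<dots> = (\<Sum>s\<in>dX (Suc k). pr s (br (f i) (db k t)) *\<^sub>C db (Suc k) s \<cdot> t \<cdot> x)"
      using assms(2) by (simp add: act_sum_left act_scale_left)
    finally show "- (\<Sum>s\<in>dX (Suc k). pr s (br (f i) (db k t)) *\<^sub>C db (Suc k) s \<cdot> t \<cdot> x) = - (br (f i) (db k t) \<cdot> t \<cdot> x)"
      by simp
  qed
  finally show ?thesis by (simp add: sum_negf)
qed

text \<open>From height 1 the bracket with \<open>f_i\<close> lands in the Cartan subalgebra; this
  end of the telescope contributes the coroot term of which the eigenvalues are made.\<close>

lemma dual_telescope_1:
  assumes "x \<in> S"
  shows "(\<Sum>s\<in>dX 1. db 1 s \<cdot> br (f i) s \<cdot> x) = - ((1 / of_real (eps i)) *\<^sub>C f i \<cdot> cart (co i) \<cdot> x)"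
proof -
  have inner: "br (f i) s = - (pr s (f i) / of_real (eps i)) *\<^sub>C cart (co i)" if s: "s \<in> dX 1" for s
  proof -
    have "npk 1 \<subseteq> {s. br (f i) s = - (pr s (f i) / of_real (eps i)) *\<^sub>C cart (co i)}"
    proof -
      have np1: "npk 1 \<subseteq> np" by (rule npk_np)
      have "cspan (nest br e ` {w. length w = 1})
        \<subseteq> {s \<in> np. br (f i) s = - (pr s (f i) / of_real (eps i)) *\<^sub>C cart (co i)}"
      proof (intro cspan_minimal csubspaceI image_subsetI)
        fix w :: "'i list" assume "w \<in> {w. length w = 1}"
        then obtain j where "w = [j]" by (auto simp: length_Suc_conv)
        then show "nest br e w \<in> {s \<in> np. br (f i) s = - (pr s (f i) / of_real (eps i)) *\<^sub>C cart (co i)}"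
          by (auto simp: np_e br_fe pr_e_f)
      qed (use pr_scale_left[of 0 "f i" 0] nm_f[of i] csubspace_0[OF np_subspace] in \<open>auto simp: csubspace_add[OF np_subspace] csubspace_scale[OF np_subspace]
          br_add_right pr_add_left pr_scale_left scaleC_distribs add_divide_distrib diff_divide_distrib\<close>)
      then show ?thesis by (auto simp: npk_def)
    qed
    then show ?thesis using dX_npk[OF s] by auto
  qed
  have fi: "f i \<in> nmk 1" using nest_in_nmk[of "[i]" 1] by simp
  have "(\<Sum>s\<in>dX 1. db 1 s \<cdot> br (f i) s \<cdot> x)
    = (\<Sum>s\<in>dX 1. - (1 / of_real (eps i)) *\<^sub>C (pr s (f i) *\<^sub>C db 1 s \<cdot> cart (co i) \<cdot> x))"
    by (rule sum.cong[OF HOL.refl]) (simp add: inner act_scale_left act_scale_right act_minus_left act_minus_right assms)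
  also have "\<dots> = - (1 / of_real (eps i)) *\<^sub>C (\<Sum>s\<in>dX 1. pr s (f i) *\<^sub>C db 1 s) \<cdot> cart (co i) \<cdot> x"
    using assms by (simp add: scaleC_sum_right act_sum_left act_scale_left sum_negf)
  also have "(\<Sum>s\<in>dX 1. pr s (f i) *\<^sub>C db 1 s) = f i" by (rule db_expand[OF fi, symmetric])
  finally show ?thesis by simp
qed

text \<open>The commutator with \<open>f_i\<close> telescopes over the layers; only the coroot term
  from height 1 and a boundary term at height \<open>K\<close> survive, and the latter vanishes on
  short words.\<close>

lemma casimir_f:
  assumes "x \<in> S" "1 \<le> K"
  shows "casimir K (f i \<cdot> x) = f i \<cdot> casimir K x + (1 / of_real (eps i)) *\<^sub>C f i \<cdot> cart (co i) \<cdot> x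
    - (\<Sum>s\<in>dX K. br (f i) (db K s) \<cdot> s \<cdot> x)"
proof -
  have comm: "(\<Sum>s\<in>dX k. db k s \<cdot> s \<cdot> f i \<cdot> x) = (\<Sum>s\<in>dX k. f i \<cdot> db k s \<cdot> s \<cdot> x)
    - (\<Sum>s\<in>dX k. db k s \<cdot> br (f i) s \<cdot> x) - (\<Sum>s\<in>dX k. br (f i) (db k s) \<cdot> s \<cdot> x)" for k
    unfolding sum_subtractf[symmetric] by (rule sum.cong[OF HOL.refl]) (simp add: act_br act_diff_right assms)
  have fsum: "f i \<cdot> (\<Sum>s\<in>dX k. db k s \<cdot> s \<cdot> x) = (\<Sum>s\<in>dX k. f i \<cdot> db k s \<cdot> s \<cdot> x)" for k
    by (rule act_sum_right) (simp add: assms)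
  show ?thesis
    using assms(2)
  proof (induction K rule: dec_induct)
    case base
    have "casimir 1 y = (\<Sum>s\<in>dX 1. db 1 s \<cdot> s \<cdot> y)" for y by (simp add: casimir_def)
    then show ?case by (simp only: comm fsum dual_telescope_1[OF assms(1)]) simp
  next
    case (step K)
    have S: "(\<Sum>s\<in>dX (Suc K). db (Suc K) s \<cdot> s \<cdot> x) \<in> S" by (rule S_sum) (simp add: assms)
    show ?case
      unfolding casimir_Suc comm act_add_right[OF casimir_in[OF assms(1)] S] fsum step.IH
        dual_telescope[OF step.hyps(1) assms(1)]
      by (simp add: algebra_simps)
  qed
qed

lemma np_singular: "\<lbrakk>\<And>i. e i \<cdot> u = 0; u \<in> S; b \<in> np\<rbrakk> \<Longrightarrow> b \<cdot> u = 0"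
proof -
  assume u: "\<And>i. e i \<cdot> u = 0" "u \<in> S" and b: "b \<in> np"
  have nest: "nest br e w \<cdot> u = 0" for w
  proof (induction w)
    case (Cons i w)
    then show ?case by (cases "w = []") (simp_all add: nest_Cons u act_br)
  qed (simp add: u)
  have "np \<subseteq> {b. b \<cdot> u = 0}"
    unfolding np_range by (intro cspan_minimal csubspaceI) (auto simp: nest u act_add_left act_scale_left)
  with b show ?thesis by auto
qed

end

subsection \<open>Integrable highest weight modules are irreducible\<close>

lemma (in g_rep) weight_space_act:
  assumes "x \<in> weight_space D (adj D) \<beta>" "u \<in> weight_space D R \<gamma>"
  shows "x \<cdot> u \<in> weight_space D R (\<lambda>h. \<gamma> h + \<beta> h)"
proof -
  have u: "u \<in> S" using assms(2) by (rule weight_spaceD)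
  have "cart h \<cdot> x \<cdot> u = br (cart h) x \<cdot> u + x \<cdot> cart h \<cdot> u" for h
    using u by (simp add: act_br)
  moreover have "br (cart h) x = \<beta> h *\<^sub>C x" for h using assms(1) by (simp add: weight_space_def)
  ultimately show ?thesis
    using u weight_spaceD(2)[OF assms(2)]
    by (simp add: weight_space_def act_scale_left act_scale_right scaleC_add_left add.commute)
qed

locale sym_hw = sym_rep D R + hw_vec D R v l
  for D :: "('i::finite, 'h::complex_vector, 'g::complex_vector) km_data"
    and R :: "('g, 'v::complex_vector) rep" and v l
begin

text \<open>Half of \<open>|\<lambda> + \<rho>|^2 - |\<lambda>' + \<rho>|^2\<close>, with \<lambda>
  the weight \<open>l\<close> and \<lambda>' the weight of the word, collected letter by letter as
  the \<open>f_i\<close> are moved past the Casimir operator.\<close>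

fun cas :: "'i list \<Rightarrow> complex" where
  "cas [] = 0"
| "cas (i # w) = cas w + (l (co i) - wt D w (co i)) / of_real (eps i)"

text \<open>A raising element of height \<open>K\<close> would move so short a word above the
  highest weight.\<close>

lemma npk_fw: assumes "s \<in> npk K" "length w < K" shows "s \<cdot> fw w = 0"
proof -
  have "nest br e u \<cdot> fw w = 0" if u: "length u = K" for u
  proof (rule weight_space_cspan_trivial[where K = UNIV and g = fw and W = "\<lambda>w h. l h - wt D w h"])
    show "nest br e u \<cdot> fw w \<in> weight_space D R (\<lambda>h. (l h - wt D w h) + wt D u h)"
      by (rule weight_space_act[OF nest_e_weight fw_weight])
    have "fw w \<in> range ev" unfolding range_ev by (rule cspan_base) simp
    then show "nest br e u \<cdot> fw w \<in> cspan (range fw)" using act_range_ev by (simp add: range_ev)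
    fix k
    show "(\<lambda>h. l h - wt D k h) \<noteq> (\<lambda>h. (l h - wt D w h) + wt D u h)"
    proof
      assume "(\<lambda>h. l h - wt D k h) = (\<lambda>h. (l h - wt D w h) + wt D u h)"
      then have "l hgt - wt D k hgt = (l hgt - wt D w hgt) + wt D u hgt" by metis
      then have "of_nat (length w) = (of_nat (length u + length k) :: complex)" by (simp add: algebra_simps)
      then have "length w = length u + length k" by (simp only: of_nat_eq_iff)
      with u assms(2) show False by simp
    qed
  qed (rule fw_weight)
  then have "npk K \<subseteq> {s. s \<cdot> fw w = 0}"
    unfolding npk_def by (intro cspan_minimal csubspaceI) (auto simp: act_add_left act_scale_left)
  with assms(1) show ?thesis by auto
qed

lemma casimir_fw: "length w \<le> K \<Longrightarrow> 1 \<le> K \<Longrightarrow> casimir K (fw w) = cas w *\<^sub>C fw w"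
proof (induction w)
  case Nil
  have "s \<cdot> v = 0" if "s \<in> dX k" for s k
    using np_singular[OF e_v v_in] dX_npk[OF that] npk_np by blast
  then show ?case by (simp add: casimir_def)
next
  case (Cons i w)
  have "s \<cdot> fw w = 0" if "s \<in> dX K" for s using npk_fw[OF dX_npk[OF that]] Cons.prems by simp
  then have "(\<Sum>s\<in>dX K. br (f i) (db K s) \<cdot> s \<cdot> fw w) = 0" by (intro sum.neutral) simp
  moreover have "casimir K (fw w) = cas w *\<^sub>C fw w" using Cons by simp
  moreover have "cart (co i) \<cdot> fw w = (l (co i) - wt D w (co i)) *\<^sub>C fw w"
    by (rule weight_spaceD(2)[OF fw_weight])
  ultimately show ?case
    using casimir_f[of "fw w" K i] Cons.prems by (simp add: act_scale_right scaleC_add_left)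
qed

lemma sum_al_co: "(\<Sum>a\<leftarrow>w. al i (co a) / of_real (eps a)) = wt D w (co i) / of_real (eps i)"
proof (induction w)
  case (Cons a w)
  have "al i (co a) / of_real (eps a) = al a (co i) / (of_real (eps i) :: complex)"
    using eps_sym_complex[of a i] by (simp add: field_simps)
  then show ?case using Cons.IH by (simp add: add_divide_distrib)
qed simp

text \<open>Doubling turns the recursive sum into one that ignores the order of the letters, with
  the 2 standing for the value of \<open>2\<rho>\<close> on a coroot. Exchanging root and coroot in
  \<open>sum_al_co\<close> is the symmetry of the symmetrized matrix.\<close>

lemma two_cas: "2 * cas w = (\<Sum>a\<leftarrow>w. (l (co a) + (l (co a) - wt D w (co a)) + 2) / of_real (eps a))"
proof (induction w)
  case (Cons i w)
  have "(\<Sum>a\<leftarrow>w. (l (co a) + (l (co a) - wt D (i # w) (co a)) + 2) / of_real (eps a))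
      = (\<Sum>a\<leftarrow>w. (l (co a) + (l (co a) - wt D w (co a)) + 2) / of_real (eps a) - al i (co a) / of_real (eps a))"
    by (intro arg_cong[where f = sum_list] map_cong HOL.refl) (simp add: field_simps)
  also have "\<dots> = 2 * cas w - wt D w (co i) / of_real (eps i)"
    unfolding sum_list_subtractf Cons.IH sum_al_co ..
  finally show ?case
    by (simp add: A_diag add_divide_distrib diff_divide_distrib algebra_simps)
qed simp

lemma sum_list_count: "(\<Sum>a\<leftarrow>w. g a) = (\<Sum>j\<in>UNIV. of_nat (count_list w j) * (g j :: complex))" for w :: "'i list"
proof (induction w)
  case (Cons i w)
  have "(\<Sum>j\<in>UNIV. of_nat (count_list (i # w) j) * g j)
      = (\<Sum>j\<in>UNIV. of_nat (count_list w j) * g j + (if j = i then g i else 0))"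
    by (rule sum.cong) (auto simp: algebra_simps)
  then show ?case using Cons.IH by (simp add: sum.distrib)
qed simp

lemma cas_cong: assumes "wt D w = wt D w'" shows "cas w = cas w'"
proof -
  have "count_list w = count_list w'"
    using wt_coweight[of w] wt_coweight[of w'] assms by (metis ext of_nat_eq_iff)
  then have "2 * cas w = 2 * cas w'" unfolding two_cas sum_list_count assms by simp
  then show ?thesis by simp
qed

text \<open>Each letter contributes a positive real number: both weights are nonnegative on the
  coroots and the shift by 2 is strictly positive.\<close>

lemma cas_nonzero:
  assumes "\<And>i. l (co i) \<in> \<nat>" "\<And>i. l (co i) - wt D w (co i) \<in> \<nat>" "w \<noteq> []"
  shows "cas w \<noteq> 0"
proof -
  have "\<exists>r::real. r > 0 \<and> (l (co a) + (l (co a) - wt D w (co a)) + 2) / of_real (eps a) = of_real r" for a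
  proof -
    obtain m n :: nat where mn: "l (co a) = of_nat m" "l (co a) - wt D w (co a) = of_nat n"
      using assms(1,2) Nats_cases by metis
    show ?thesis
      unfolding mn(2) unfolding mn(1)
      by (rule exI[of _ "(real m + real n + 2) / eps a"]) (auto intro!: divide_pos_pos eps_pos)
  qed
  then obtain r :: "'i \<Rightarrow> real" where r: "\<And>a. r a > 0"
    "\<And>a. (l (co a) + (l (co a) - wt D w (co a)) + 2) / of_real (eps a) = of_real (r a)" by metis
  have "2 * cas w = (\<Sum>a\<leftarrow>w. of_real (r a))" unfolding two_cas r(2) ..
  also have "\<dots> = of_real (\<Sum>a\<leftarrow>w. r a)" by (induction w) simp_all
  finally have "2 * cas w = of_real (\<Sum>a\<leftarrow>w. r a)" .
  moreover have "(\<Sum>a\<leftarrow>w. r a) > 0"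
  proof -
    obtain i w' where "w = i # w'" using assms(3) by (cases w) auto
    moreover have "(\<Sum>a\<leftarrow>w'. r a) \<ge> 0" by (rule sum_list_nonneg) (use r(1) in \<open>auto intro: less_imp_le\<close>)
    ultimately show ?thesis using r(1)[of i] by simp
  qed
  ultimately show ?thesis by auto
qed

text \<open>The Casimir operator kills a singular vector and also acts on it by
  \<open>cas w0\<close>. Its weight is dominant by local nilpotency of the \<open>f_i\<close>, so
  the eigenvalue can vanish only for the empty word.\<close>

lemma singular_multiple:
  assumes integ: "\<And>i. l (co i) \<in> \<nat>" "\<And>i. \<exists>k. (act (f i) ^^ k) v = 0"
    and s: "s \<in> range ev" "s \<in> weight_space D R \<gamma>" "\<And>i. e i \<cdot> s = 0" "s \<noteq> 0"
  shows "s \<in> cspan {v}"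
proof -
  have span: "s \<in> cspan (fw ` {w. (\<lambda>h. l h - wt D w h) = \<gamma>})" by (rule range_ev_weight[OF s(1,2)])
  obtain F c where F: "finite F" "F \<subseteq> {w. (\<lambda>h. l h - wt D w h) = \<gamma>}" "s = (\<Sum>w\<in>F. c w *\<^sub>C fw w)"
    using span by (rule cspan_image_sum)
  then obtain w0 where w0: "w0 \<in> F" using s(4) by (metis all_not_in_conv sum.empty)
  have wt: "wt D w = wt D w0" if "w \<in> F" for w
  proof
    fix h
    have "l h - wt D w h = \<gamma> h" "l h - wt D w0 h = \<gamma> h" using F(2) that w0 by auto
    then have "l h - wt D w h = l h - wt D w0 h" by simp
    then show "wt D w h = wt D w0 h" by simp
  qed
  have \<gamma>: "\<gamma> h = l h - wt D w0 h" for h using F(2) w0 by auto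
  \<comment> \<open>At least 1, and large enough for every word of \<open>F\<close>, since all of
    them have the length of \<open>w0\<close>.\<close>
  define K where "K = Suc (length w0)"
  have sS: "s \<in> S" using s(2) by (rule weight_spaceD)
  have "x \<cdot> s = 0" if "x \<in> dX k" for x k
    using np_singular[OF s(3) sS] dX_npk[OF that] npk_np by blast
  then have "casimir K s = 0" by (simp add: casimir_def)
  moreover have "casimir K s = cas w0 *\<^sub>C s"
  proof -
    have "casimir K s = (\<Sum>w\<in>F. c w *\<^sub>C casimir K (fw w))"
      by (simp add: F(3) casimir_sum casimir_scale)
    also have "\<dots> = (\<Sum>w\<in>F. cas w0 *\<^sub>C c w *\<^sub>C fw w)"
    proof (rule sum.cong[OF HOL.refl])
      fix w assume "w \<in> F"
      then have "casimir K (fw w) = cas w0 *\<^sub>C fw w"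
        using casimir_fw[of w K] cas_cong[OF wt] wt_eq_length[OF wt] by (simp add: K_def)
      then show "c w *\<^sub>C casimir K (fw w) = cas w0 *\<^sub>C c w *\<^sub>C fw w" by (simp add: mult.commute)
    qed
    finally show ?thesis by (simp add: F(3) scaleC_sum_right)
  qed
  ultimately have "cas w0 = 0" using s(4) by simp
  moreover have "l (co i) - wt D w0 (co i) \<in> \<nat>" for i
  proof -
    obtain k where "(act (f i) ^^ k) v = 0" using integ(2) by blast
    from f_locally_nilpotent[OF this s(1)] obtain n where "(act (f i) ^^ n) s = 0" by blast
    from sl2_dominant[OF s(2,4,3) this] \<gamma> show ?thesis by (metis of_nat_in_Nats)
  qed
  ultimately have "w0 = []" using cas_nonzero[OF integ(1)] by blast
  then have "w = []" if "w \<in> F" for w using wt_eq_length[OF wt[OF that]] by simp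
  then have "F = {[]}" using w0 by blast
  then have "s = c [] *\<^sub>C v" using F(3) by simp
  then show ?thesis by (auto simp: complex_vector.span_singleton)
qed

text \<open>A nonzero weight vector of least height in a submodule is singular.\<close>

lemma submodule_trivial:
  assumes integ: "\<And>i. l (co i) \<in> \<nat>" "\<And>i. \<exists>k. (act (f i) ^^ k) v = 0"
    and N: "submodule R N" "N \<subseteq> range ev" "v \<notin> N" and "x \<in> N"
  shows "x = 0"
proof (rule ccontr)
  assume "x \<noteq> 0"
  have NS: "csubspace N" and Nact: "\<And>y u. u \<in> N \<Longrightarrow> y \<cdot> u \<in> N" using N(1) by (auto simp: submodule_def)
  define P where "P n \<longleftrightarrow> (\<exists>w u. length w = n \<and> u \<in> N \<and> u \<noteq> 0 \<and> u \<in> weight_space D R (\<lambda>h. l h - wt D w h))" for n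
  have "\<exists>n. P n"
  proof -
    have "x \<in> cspan (fw ` UNIV)" using assms(6) N(2) by (auto simp: range_ev)
    then obtain \<Gamma> u where *: "finite \<Gamma>" "\<Gamma> \<subseteq> (\<lambda>w h. l h - wt D w h) ` UNIV"
      "\<And>\<gamma>. u \<gamma> \<in> cspan (fw ` {k \<in> UNIV. (\<lambda>h. l h - wt D k h) = \<gamma>})" "x = (\<Sum>\<gamma>\<in>\<Gamma>. u \<gamma>)"
      by (rule weight_decomposition[where K = UNIV and g = fw and W = "\<lambda>w h. l h - wt D w h", OF fw_weight]) blast
    have uw: "u \<gamma> \<in> weight_space D R \<gamma>" for \<gamma>
      using *(3)[of \<gamma>] cspan_weight_space[where K = UNIV and g = fw and W = "\<lambda>w h. l h - wt D w h" and \<gamma> = \<gamma>, OF fw_weight]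
      by auto
    obtain \<gamma> where \<gamma>: "\<gamma> \<in> \<Gamma>" "u \<gamma> \<noteq> 0" using \<open>x \<noteq> 0\<close> *(4) by (metis sum.neutral)
    moreover have "u \<gamma> \<in> N" using weight_components[of N \<Gamma> u \<gamma>] NS Nact * uw assms(6) \<gamma> by auto
    moreover obtain w where "\<gamma> = (\<lambda>h. l h - wt D w h)" using *(2) \<gamma> by auto
    ultimately show ?thesis unfolding P_def using uw by metis
  qed
  define n where "n = (LEAST n. P n)"
  have "P n" unfolding n_def using \<open>\<exists>n. P n\<close> by (metis LeastI)
  then obtain w u where u: "length w = n" "u \<in> N" "u \<noteq> 0" "u \<in> weight_space D R (\<lambda>h. l h - wt D w h)"
    unfolding P_def by blast
  have "e i \<cdot> u = 0" for i
  proof (rule ccontr)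
    assume nz: "e i \<cdot> u \<noteq> 0"
    let ?\<gamma> = "\<lambda>h. (l h - wt D w h) + al i h"
    have ew: "e i \<cdot> u \<in> weight_space D R ?\<gamma>" by (rule weight_space_e[OF u(4)])
    have eN: "e i \<cdot> u \<in> N" using Nact u(2) by blast
    define W where "W = {w'. (\<lambda>h. l h - wt D w' h) = ?\<gamma>}"
    have "e i \<cdot> u \<in> cspan (fw ` W)"
      unfolding W_def by (rule range_ev_weight[OF _ ew]) (use eN N(2) in blast)
    then have "W \<noteq> {}" using nz by (cases "W = {}") simp_all
    then obtain w' where w': "(\<lambda>h. l h - wt D w' h) = ?\<gamma>" by (auto simp: W_def)
    then have "l hgt - wt D w' hgt = (l hgt - wt D w hgt) + al i hgt" by metis
    then have "of_nat (length w) = (of_nat (Suc (length w')) :: complex)" by (simp add: algebra_simps)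
    then have "length w = Suc (length w')" by (simp only: of_nat_eq_iff)
    moreover have "P (length w')" unfolding P_def using ew eN nz w' by metis
    then have "n \<le> length w'" unfolding n_def by (rule Least_le)
    ultimately show False using u(1) by simp
  qed
  then have "u \<in> cspan {v}" using singular_multiple[OF integ] u N(2) by blast
  then obtain c where c: "u = c *\<^sub>C v" by (auto simp: complex_vector.span_singleton)
  then have "(1 / c) *\<^sub>C u = v" using u(3) by auto
  then have "v \<in> N" using csubspace_scale[OF NS u(2)] by metis
  then show False using N(3) by simp
qed

end

subsection \<open>The annihilator of a highest weight vector\<close>

text \<open>
  \<open>eta c z\<close> transports the word \<open>c\<close> in the letters \<open>f_i\<close> to the argument \<open>z\<close> of a functional
  \<open>\<beta>\<close>, by the antipode.
\<close>

fun eta_word :: "('i, 'h, 'g) km_data \<Rightarrow> ('g, 'v) rep \<Rightarrow> ('v \<Rightarrow> complex) \<Rightarrow> 'i list \<Rightarrow> 'v \<Rightarrow> complex" where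
  "eta_word D Q \<beta> [] z = \<beta> z"
| "eta_word D Q \<beta> (i # w) z = - eta_word D Q \<beta> w (rep_act Q (chev_f D i) z)"

definition eta :: "('i, 'h, 'g) km_data \<Rightarrow> ('g, 'v) rep \<Rightarrow> ('v \<Rightarrow> complex) \<Rightarrow> 'i verma \<Rightarrow> 'v \<Rightarrow> complex" where
  "eta D Q \<beta> c z = lin_ext (\<lambda>w. eta_word D Q \<beta> w z) c"

lemma eta_linear: "clinear (\<lambda>c. eta D Q \<beta> c z)"
  unfolding eta_def by (rule clinear_lin_ext)

lemmas eta_add = clinear_add[OF eta_linear] and eta_scale = clinear_scale[OF eta_linear]
  and eta_diff = clinear_diff[OF eta_linear] and eta_0 = clinear_0[OF eta_linear]

lemma eta_single [simp]: "eta D Q \<beta> (vw w) z = eta_word D Q \<beta> w z"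
  by (simp add: eta_def)

lemma eta_f: "eta D Q \<beta> (verma_f i c) z = - eta D Q \<beta> c (rep_act Q (chev_f D i) z)"
proof -
  have "(\<lambda>c. eta D Q \<beta> (verma_f i c) z) = (\<lambda>c. - eta D Q \<beta> c (rep_act Q (chev_f D i) z))"
    by (rule clinear_poly_mapping_eqI) (auto simp: clinear_iff eta_add eta_scale verma_linear)
  then show ?thesis by (rule fun_cong)
qed

text \<open>\<open>\<beta>\<close> stands for the product with a vector killed by the powers
  \<open>e_i^(m i + 1)\<close>; contravariance turns that condition into \<open>\<beta>_pow\<close>.
  The aim is that \<open>\<eta> c z\<close> depends only on \<open>ev c\<close>.\<close>

locale hw_functional = sym_hw D R v l + Q: g_rep D Q
  for D :: "('i::finite, 'h::complex_vector, 'g::complex_vector) km_data"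
    and R :: "('g, 'v::complex_vector) rep" and v l and Q :: "('g, 'u::complex_vector) rep" +
  fixes \<beta> :: "'u \<Rightarrow> complex" and m :: "'i \<Rightarrow> nat"
  assumes l_linear: "clinear l" and v_nonzero: "v \<noteq> 0"
    and l_co: "l (co i) = of_nat (m i)" and f_pow_v: "(rep_act R (f i) ^^ (m i + 1)) v = 0"
    and \<beta>_add: "z \<in> Q.S \<Longrightarrow> z' \<in> Q.S \<Longrightarrow> \<beta> (z + z') = \<beta> z + \<beta> z'"
    and \<beta>_scale: "z \<in> Q.S \<Longrightarrow> \<beta> (a *\<^sub>C z) = a * \<beta> z"
    and \<beta>_pow: "z \<in> Q.S \<Longrightarrow> \<beta> ((rep_act Q (f i) ^^ (m i + 1)) z) = 0"
begin

abbreviation "\<eta> \<equiv> eta D Q \<beta>"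
abbreviation "va \<equiv> verma_act D l"

lemmas va_add = clinear_add[OF clinear_verma_act] and va_scale = clinear_scale[OF clinear_verma_act]
  and va_diff = clinear_diff[OF clinear_verma_act] and va_0 = clinear_0[OF clinear_verma_act]

lemma eta_word_add: "z \<in> Q.S \<Longrightarrow> z' \<in> Q.S \<Longrightarrow> eta_word D Q \<beta> w (z + z') = eta_word D Q \<beta> w z + eta_word D Q \<beta> w z'"
  and eta_word_scale: "z \<in> Q.S \<Longrightarrow> eta_word D Q \<beta> w (a *\<^sub>C z) = a * eta_word D Q \<beta> w z"
  by (induction w arbitrary: z z') (simp_all add: \<beta>_add \<beta>_scale Q.act_add_right Q.act_scale_right)

lemma \<eta>_add_right: "z \<in> Q.S \<Longrightarrow> z' \<in> Q.S \<Longrightarrow> \<eta> c (z + z') = \<eta> c z + \<eta> c z'"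
  and \<eta>_scale_right: "z \<in> Q.S \<Longrightarrow> \<eta> c (a *\<^sub>C z) = a * \<eta> c z"
  by (simp_all add: eta_def lin_ext_def eta_word_add eta_word_scale distrib_left sum.distrib scaleC_complex
      sum_distrib_left mult.left_commute)

lemma \<eta>_0_right [simp]: "\<eta> c 0 = 0"
  using \<eta>_scale_right[of 0 c 0] by simp

lemma \<eta>_minus_right: "z \<in> Q.S \<Longrightarrow> \<eta> c (- z) = - \<eta> c z"
  using \<eta>_scale_right[of z c "- 1"] by simp

lemma \<eta>_diff_right: "z \<in> Q.S \<Longrightarrow> z' \<in> Q.S \<Longrightarrow> \<eta> c (z - z') = \<eta> c z - \<eta> c z'"
  using \<eta>_add_right[of z "- z'" c] by (simp add: \<eta>_minus_right)

lemma \<eta>_half_f: "t \<in> half_terms D GenF \<Longrightarrow> z \<in> Q.S \<Longrightarrow> \<eta> (va t c) z = - \<eta> c (rep_act Q (lie_eval D t) z)"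
proof (induction arbitrary: c z rule: half_terms.induct)
  case (cong t s)
  then show ?case
    using verma_act_km_eq[OF al_linear l_linear cong.hyps(2)] eval_km_eq[OF cong.hyps(2)] by metis
next
  case (plus s t)
  then show ?case by (simp add: eta_add Q.act_add_left \<eta>_add_right)
next
  case (scale t a)
  then show ?case by (simp add: eta_scale Q.act_scale_left \<eta>_scale_right scaleC_complex)
next
  case (br t i)
  then show ?case by (simp add: eta_diff eta_f Q.act_br \<eta>_diff_right)
qed (simp_all add: eta_0 eta_f)

lemma va_half_e: "t \<in> half_terms D GenE \<Longrightarrow> va t (vw []) = 0"
proof (induction rule: half_terms.induct)
  case (cong t s)
  then show ?case using verma_act_km_eq[OF al_linear l_linear cong.hyps(2)] by metis
qed (simp_all add: va_0 verma_linear)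

text \<open>On the highest weight vector only the part of \<open>t\<close> in the lower half
  matters, and that part evaluates to 0 by uniqueness of the triangular decomposition. Longer words
  follow by commuting \<open>t\<close> past a letter, which produces another term evaluating to
  0.\<close>

lemma \<eta>_radical_word: "lie_eval D t = 0 \<Longrightarrow> z \<in> Q.S \<Longrightarrow> \<eta> (va t (vw w)) z = 0"
proof (induction w arbitrary: t z)
  case Nil
  obtain a h b where *: "a \<in> half_terms D GenF" "b \<in> half_terms D GenE"
    "lie_eval D t = lie_eval D a + cart h + lie_eval D b"
    "\<And>p. va t p = va a p + verma_h D l h p + va b p"
    using lie_term_split[of t] l_linear by metis
  then have "lie_eval D a = 0" "h = 0"
    using triangular_unique(1,2)[OF eval_half_f eval_half_e, of a b h] Nil.prems(1) by auto
  moreover have "l 0 = 0" by (rule clinear_0[OF l_linear])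
  ultimately show ?case
    using *(4)[of "vw []"] va_half_e[OF *(2)] \<eta>_half_f[OF *(1) Nil.prems(2)] Nil.prems(2) by simp
next
  case (Cons i w)
  have "va (TBr t (GenF i)) (vw w) = va t (vw (i # w)) - verma_f i (va t (vw w))" by simp
  then have "\<eta> (va t (vw (i # w))) z = \<eta> (va (TBr t (GenF i)) (vw w)) z + \<eta> (verma_f i (va t (vw w))) z"
    by (simp add: eta_diff)
  also have "\<eta> (verma_f i (va t (vw w))) z = 0"
    unfolding eta_f using Cons.IH[OF Cons.prems(1), of "rep_act Q (f i) z"] Cons.prems(2) by simp
  also have "\<eta> (va (TBr t (GenF i)) (vw w)) z = 0"
    by (rule Cons.IH) (simp_all add: Cons.prems)
  finally show ?case by simp
qed

lemma \<eta>_radical: assumes "lie_eval D t = 0" "z \<in> Q.S" shows "\<eta> (va t c) z = 0"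
proof -
  have "(\<lambda>c. \<eta> (va t c) z) = (\<lambda>c. 0)"
    by (rule clinear_poly_mapping_eqI)
      (auto simp: clinear_iff eta_add eta_scale va_add va_scale \<eta>_radical_word[OF assms])
  then show ?thesis by (rule fun_cong)
qed

text \<open>The intersection of the kernel of \<open>ev\<close> with the largest submodule on which
  \<open>\<eta>\<close> vanishes. The first lets \<open>ev\<close> factor through the quotient, the
  second lets \<open>\<eta>\<close> do so.\<close>

definition N :: "'i verma set" where
  "N = {c. ev c = 0 \<and> (\<forall>us. \<forall>z\<in>Q.S. \<eta> (foldr va us c) z = 0)}"

lemma foldr_va_linear: "clinear (foldr va us)"
  by (induction us) (simp_all add: clinear_iff va_add va_scale)

lemma N_subspace: "csubspace N"
  by (rule csubspaceI) (simp_all add: N_def ev_0 ev_add ev_scale eta_0 eta_add eta_scale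
      clinear_0[OF foldr_va_linear] clinear_add[OF foldr_va_linear] clinear_scale[OF foldr_va_linear])

lemma N_va: "c \<in> N \<Longrightarrow> va t c \<in> N"
proof -
  assume c: "c \<in> N"
  have "\<eta> (foldr va us (va t c)) z = 0" if "z \<in> Q.S" for us z
  proof -
    have "foldr va us (va t c) = foldr va (us @ [t]) c" by simp
    then show ?thesis using c that unfolding N_def by (simp del: foldr_append)
  qed
  then show ?thesis using c by (simp add: N_def ev_act)
qed

text \<open>Commutators with radical terms are again radical, so their images span a submodule
  \<open>Z\<close>, and \<open>ev\<close> and \<open>\<eta>\<close> both kill it. Hence the quotient
  by \<open>N\<close> is a module of the algebra itself.\<close>

lemma N_radical: assumes "lie_eval D t = 0" shows "va t c \<in> N"
proof -
  define Z where "Z = cspan {va t c |t c. lie_eval D t = 0}"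
  have Z_va: "va u x \<in> Z" if "x \<in> Z" for u x
  proof -
    have "{va t c |t c. lie_eval D t = 0} \<subseteq> {x. va u x \<in> Z}"
    proof safe
      fix t c assume t: "lie_eval D t = 0"
      have "va u (va t c) = va t (va u c) + va (TBr u t) c" by simp
      moreover have "va t (va u c) \<in> Z" unfolding Z_def using t by (intro cspan_base) blast
      moreover have "lie_eval D (TBr u t) = 0" using t by simp
      then have "va (TBr u t) c \<in> Z" unfolding Z_def by (intro cspan_base) blast
      ultimately show "va u (va t c) \<in> Z" unfolding Z_def by (simp only: complex_vector.span_add)
    qed
    then have "Z \<subseteq> {x. va u x \<in> Z}"
      unfolding Z_def by (intro cspan_minimal csubspaceI)
        (auto simp: va_0 va_add va_scale complex_vector.span_zero complex_vector.span_add complex_vector.span_scale)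
    then show ?thesis using that by auto
  qed
  have Z_foldr: "foldr va us x \<in> Z" if "x \<in> Z" for us x
    using that by (induction us) (simp_all add: Z_va)
  have Z_\<eta>: "\<eta> x z = 0" if "x \<in> Z" "z \<in> Q.S" for x z
  proof -
    have "Z \<subseteq> {x. \<eta> x z = 0}"
      unfolding Z_def by (intro cspan_minimal csubspace_Collect_linear_eq0 eta_linear)
        (use \<eta>_radical that(2) in auto)
    then show ?thesis using that by auto
  qed
  have "va t c \<in> Z" unfolding Z_def using assms by (intro cspan_base) blast
  then show ?thesis using Z_foldr Z_\<eta> by (simp add: N_def ev_act assms)
qed

text \<open>The scalar vanishes at \<open>k = m i\<close>: the vector \<open>f_i^(m i + 1)\<close>
  is singular already in the free Verma module.\<close>

lemma verma_e_word_replicate_same: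
  "verma_e_word D l i (replicate (Suc k) i) = (of_nat (Suc k) * (l (co i) - of_nat k)) *\<^sub>C vw (replicate k i)"
proof (induction k)
  case 0
  show ?case by (simp add: verma_linear)
next
  case (Suc k)
  have wt: "wt D (replicate k i) (co i) = 2 * of_nat k" for k
    by (induction k) (simp_all add: A_diag algebra_simps)
  have "verma_e_word D l i (replicate (Suc (Suc k)) i)
     = (l (co i) - wt D (replicate (Suc k) i) (co i)) *\<^sub>C vw (replicate (Suc k) i)
       + verma_f i (verma_e_word D l i (replicate (Suc k) i))" by simp
  also have "\<dots> = ((l (co i) - 2 * of_nat (Suc k)) + of_nat (Suc k) * (l (co i) - of_nat k)) *\<^sub>C vw (replicate (Suc k) i)"
    unfolding Suc.IH wt by (simp add: verma_linear scaleC_add_left)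
  also have "(l (co i) - 2 * of_nat (Suc k)) + of_nat (Suc k) * (l (co i) - of_nat k)
      = of_nat (Suc (Suc k)) * (l (co i) - of_nat (Suc k))" by (simp add: algebra_simps)
  finally show ?case .
qed

lemma verma_e_word_replicate_other: "i \<noteq> j \<Longrightarrow> verma_e_word D l j (replicate k i) = 0"
  by (induction k) (simp_all add: verma_linear)

text \<open>\<open>eta_word\<close> applies the letters to \<open>z\<close> from left to right, so a
  power of \<open>f_i\<close> at the end of the word meets \<open>\<beta>\<close> directly.\<close>

lemma eta_word_append_replicate: "z \<in> Q.S \<Longrightarrow> eta_word D Q \<beta> (w @ replicate (m i + 1) i) z = 0"
proof (induction w arbitrary: z)
  case Nil
  have "eta_word D Q \<beta> (replicate k i) z = (- 1) ^ k * \<beta> ((rep_act Q (f i) ^^ k) z)" for k z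
    by (induction k arbitrary: z) (simp_all add: funpow_Suc_right del: funpow.simps)
  then show ?case using \<beta>_pow[OF Nil] by (simp del: funpow.simps replicate.simps)
qed (simp del: replicate.simps)

text \<open>The words ending in \<open>f_i^(m i + 1)\<close> span a submodule \<open>Z\<close>,
  since that power is singular, and \<open>\<eta>\<close> vanishes on it. This makes the quotient by
  \<open>N\<close> integrable.\<close>

lemma N_f_pow: "vw (replicate (m i + 1) i) \<in> N"
proof -
  define Z where "Z = cspan (range (\<lambda>w. vw (w @ replicate (m i + 1) i)))"
  have base: "vw (w @ replicate (m i + 1) i) \<in> Z" for w unfolding Z_def by (rule cspan_base) blast
  have sub: "csubspace Z" by (simp add: Z_def)
  have lin: "F x \<in> Z" if "clinear F" "\<And>w. F (vw (w @ replicate (m i + 1) i)) \<in> Z" "x \<in> Z" for F x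
  proof -
    have "Z \<subseteq> {x. F x \<in> Z}"
      unfolding Z_def[of ] by (intro cspan_minimal csubspaceI; unfold Z_def[symmetric])
        (use that sub in \<open>auto simp: clinear_0 clinear_add clinear_scale csubspace_0 csubspace_add csubspace_scale\<close>)
    then show ?thesis using that(3) by auto
  qed
  have Zf: "verma_f j x \<in> Z" if "x \<in> Z" for j x
    by (rule lin[OF clinear_verma_f _ that]) (use base[of "j # _"] in simp)
  have Zh: "verma_h D l h x \<in> Z" if "x \<in> Z" for h x
    by (rule lin[OF clinear_verma_h _ that]) (simp only: verma_h_single csubspace_scale[OF sub base])
  have Ze_word: "verma_e_word D l j (w @ replicate (m i + 1) i) \<in> Z" for j w
  proof (induction w)
    case Nil
    have "verma_e_word D l j (replicate (m i + 1) i) = 0"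
      using verma_e_word_replicate_same[of i "m i"] verma_e_word_replicate_other[of i j "m i + 1"] l_co[of i]
      by (cases "j = i") (simp_all del: replicate.simps verma_e_word.simps)
    then show ?case by (simp add: csubspace_0[OF sub] del: replicate.simps)
  next
    case (Cons j' w)
    have "verma_f j' (verma_e_word D l j (w @ replicate (m i + 1) i)) \<in> Z" by (rule Zf[OF Cons])
    moreover have "(if j = j' then (l (co j) - wt D (w @ replicate (m i + 1) i) (co j)) *\<^sub>C
        vw (w @ replicate (m i + 1) i) else 0) \<in> Z"
      using csubspace_scale[OF sub base[of w]] csubspace_0[OF sub] by simp
    ultimately show ?case by (simp only: append_Cons verma_e_word.simps csubspace_add[OF sub])
  qed
  have Ze: "verma_e D l j x \<in> Z" if "x \<in> Z" for j x
    by (rule lin[OF clinear_verma_e _ that]) (simp only: verma_e_single Ze_word)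
  have Zva: "va t x \<in> Z" if "x \<in> Z" for t x
    using that by (induction t arbitrary: x)
      (simp_all add: Ze Zf Zh csubspace_0[OF sub] csubspace_add[OF sub] csubspace_scale[OF sub] csubspace_diff[OF sub])
  have Z_foldr: "foldr va us x \<in> Z" if "x \<in> Z" for us x
    using that by (induction us) (simp_all add: Zva)
  have Z_\<eta>: "\<eta> x z = 0" if "x \<in> Z" "z \<in> Q.S" for x z
  proof -
    have "Z \<subseteq> {x. \<eta> x z = 0}"
      unfolding Z_def by (intro cspan_minimal csubspace_Collect_linear_eq0 eta_linear)
        (use eta_word_append_replicate[OF that(2)] in auto)
    then show ?thesis using that by auto
  qed
  have "vw (replicate (m i + 1) i) \<in> Z" using base[of "[]"] by simp
  moreover have "ev (vw (replicate (m i + 1) i)) = 0"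
  proof -
    have "foldr (\<lambda>j. act (f j)) (replicate k i) v = (act (f i) ^^ k) v" for k
      by (induction k) simp_all
    then show ?thesis using f_pow_v[of i] by (simp only: ev_single)
  qed
  ultimately show ?thesis using Z_foldr Z_\<eta> by (simp add: N_def del: replicate.simps)
qed

end

section \<open>Vanishing of \<open>\<eta>\<close> on the annihilator of the highest weight
  vector\<close>

context hw_functional begin

text \<open>Cosets of \<open>N\<close> are represented in a complement: \<open>p\<close> is a
  projection with kernel \<open>N\<close>, so \<open>p c\<close> represents the coset of
  \<open>c\<close>.\<close>

definition p :: "'i verma \<Rightarrow> 'i verma" where
  "p = (SOME p. clinear p \<and> (\<forall>c. p c = 0 \<longleftrightarrow> c \<in> N) \<and> (\<forall>c. c - p c \<in> N))"

lemma p_linear: "clinear p" and p_eq_0: "p c = 0 \<longleftrightarrow> c \<in> N" and p_diff: "c - p c \<in> N"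
proof -
  obtain q :: "'i verma \<Rightarrow> 'i verma" where q: "clinear q" "\<And>c. q c \<in> N" "\<And>c. c \<in> N \<Longrightarrow> q c = c"
    using csubspace_projection[OF N_subspace] by blast
  have "clinear (\<lambda>c. c - q c)" using q(1) by (simp add: clinear_iff scaleC_diff_right)
  moreover have "c - q c = 0 \<longleftrightarrow> c \<in> N" for c using q(2)[of c] q(3)[of c] by auto
  moreover have "c - (c - q c) \<in> N" for c using q(2) by simp
  ultimately have "\<exists>p. clinear p \<and> (\<forall>c. p c = 0 \<longleftrightarrow> c \<in> N) \<and> (\<forall>c. c - p c \<in> N)"
    by (intro exI[of _ "\<lambda>c. c - q c"]) blast
  from someI_ex[OF this] show "clinear p" "p c = 0 \<longleftrightarrow> c \<in> N" "c - p c \<in> N"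
    unfolding p_def by blast+
qed

lemmas p_add = clinear_add[OF p_linear] and p_scale = clinear_scale[OF p_linear]
  and p_sub = clinear_diff[OF p_linear] and p_0 = clinear_0[OF p_linear]

lemma p_eq_iff: "p c = p d \<longleftrightarrow> c - d \<in> N"
  using p_eq_0[of "c - d"] by (simp add: p_sub)

lemma p_va_p [simp]: "p (va t (p c)) = p (va t c)"
proof -
  have "va t (c - p c) \<in> N" by (rule N_va[OF p_diff])
  then have "p (va t c) = p (va t (p c))" by (simp add: p_eq_iff va_diff)
  then show ?thesis ..
qed

definition term_of :: "'g \<Rightarrow> ('i, 'h) lie_term" where "term_of x = (SOME t. lie_eval D t = x)"

lemma eval_term_of [simp]: "lie_eval D (term_of x) = x"
  unfolding term_of_def by (rule someI_ex) (metis surj_eval surj_def)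

text \<open>The quotient of the free Verma module by \<open>N\<close>, on a complement of \<open>N\<close>.\<close>

definition M :: "('g, 'i verma) rep" where
  "M = \<lparr> rep_space = range p, rep_act = (\<lambda>x c. p (va (term_of x) c)) \<rparr>"

lemma M_space: "rep_space M = range p" by (simp add: M_def)

lemma M_act: "lie_eval D t = x \<Longrightarrow> rep_act M x c = p (va t c)"
proof -
  assume "lie_eval D t = x"
  then have "va (TPlus (term_of x) (TScale (- 1) t)) c \<in> N" by (intro N_radical) simp
  then show ?thesis by (simp add: M_def p_eq_iff)
qed

lemma M_rep: "is_rep br M"
  unfolding is_rep_def
proof (intro conjI allI ballI)
  show "csubspace (rep_space M)"
    unfolding M_space
  proof (rule csubspaceI)
    show "0 \<in> range p" by (rule range_eqI[of _ _ 0]) (simp add: p_0)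
    show "x + y \<in> range p" if "x \<in> range p" "y \<in> range p" for x y
      using that by (auto simp: p_add[symmetric])
    show "c *\<^sub>C x \<in> range p" if "x \<in> range p" for c x
      using that by (auto simp: p_scale[symmetric])
  qed
  show "rep_act M x c \<in> rep_space M" for x c by (simp add: M_def)
  show "rep_act M x (c + d) = rep_act M x c + rep_act M x d" for x c d by (simp add: M_def va_add p_add)
  show "rep_act M x (a *\<^sub>C c) = a *\<^sub>C rep_act M x c" for x a c by (simp add: M_def va_scale p_scale)
  show "rep_act M (x + y) c = rep_act M x c + rep_act M y c" for x y c
    using M_act[of "TPlus (term_of x) (term_of y)" "x + y" c] by (simp add: M_def p_add)
  show "rep_act M (a *\<^sub>C x) c = a *\<^sub>C rep_act M x c" for a x c
    using M_act[of "TScale a (term_of x)" "a *\<^sub>C x" c] by (simp add: M_def p_scale)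
  show "rep_act M (br x y) c = rep_act M x (rep_act M y c) - rep_act M y (rep_act M x c)" for x y c
    using M_act[of "TBr (term_of x) (term_of y)" "br x y" c] by (simp add: M_def p_sub)
qed

lemma M_e: "rep_act M (e i) c = p (verma_e D l i c)"
  and M_f: "rep_act M (f i) c = p (verma_f i c)"
  and M_h: "rep_act M (cart h) c = p (verma_h D l h c)"
  using M_act[of "GenE i" _ c] M_act[of "GenF i" _ c] M_act[of "GenH h" _ c] by simp_all

text \<open>
  The submodule of \<open>M\<close> formed by the images of the annihilator of \<open>v\<close> misses the highest weight
  vector of an integrable module, so it vanishes.
\<close>

theorem annihilator_eta:
  assumes "ev c = 0" "z \<in> Q.S"
  shows "\<eta> c z = 0"
proof -
  interpret M: g_rep D M by unfold_locales (rule M_rep)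
  have p_in: "p c \<in> rep_space M" for c by (simp add: M_space)
  interpret M: sym_hw D M "p (vw [])" l
  proof unfold_locales
    have "rep_act M (cart h) (p (vw [])) = l h *\<^sub>C p (vw [])" for h
      using p_va_p[of "GenH h" "vw []"] by (simp add: M_h p_scale)
    then show "p (vw []) \<in> weight_space D M l" by (simp add: weight_space_def p_in)
    show "rep_act M (e i) (p (vw [])) = 0" for i
      using p_va_p[of "GenE i" "vw []"] by (simp add: M_e p_0)
  qed
  have fw: "M.fw w = p (vw w)" for w
  proof (induction w)
    case (Cons i w)
    then show ?case using p_va_p[of "GenF i" "vw w"] by (simp add: M_f)
  qed simp
  have ev_p: "M.ev c = p c" for c
    using clinear_poly_mapping_eqI[OF M.ev_linear p_linear] by (metis M.ev_single fw)
  have pow: "(rep_act M (f i) ^^ k) (p (vw [])) = p (vw (replicate k i))" for i k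
  proof -
    have "(rep_act M (f i) ^^ k) (p (vw [])) = M.fw (replicate k i)" by (induction k) simp_all
    then show ?thesis by (simp only: fw)
  qed
  have nat: "l (co i) \<in> \<nat>" for i by (simp add: l_co)
  have nil: "\<exists>k. (rep_act M (f i) ^^ k) (p (vw [])) = 0" for i
    using pow[where i = i and k = "m i + 1"] N_f_pow[of i] p_eq_0 by metis
  let ?J = "p ` {c. ev c = 0}"
  have J: "submodule M ?J"
    unfolding submodule_def
  proof (intro conjI allI ballI)
    show "csubspace ?J"
    proof (rule csubspaceI)
      show "0 \<in> ?J" by (rule image_eqI[of _ _ 0]) (simp_all add: p_0 ev_0)
      show "x + y \<in> ?J" if xy: "x \<in> ?J" "y \<in> ?J" for x y
      proof -
        obtain c d where "x = p c" "y = p d" "ev c = 0" "ev d = 0" using xy by auto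
        then show ?thesis by (intro image_eqI[of _ _ "c + d"]) (simp_all add: p_add ev_add)
      qed
      show "a *\<^sub>C x \<in> ?J" if x: "x \<in> ?J" for a x
      proof -
        obtain c where "x = p c" "ev c = 0" using x by auto
        then show ?thesis by (intro image_eqI[of _ _ "a *\<^sub>C c"]) (simp_all add: p_scale ev_scale)
      qed
    qed
    show "?J \<subseteq> rep_space M" by (auto simp: M_space)
    show "rep_act M x c \<in> ?J" if c: "c \<in> ?J" for x c
    proof -
      obtain d where d: "c = p d" "ev d = 0" using c by auto
      then have "rep_act M x c = p (va (term_of x) d)" by (simp add: M_def)
      moreover have "ev (va (term_of x) d) = 0" by (simp add: ev_act d)
      ultimately show ?thesis by blast
    qed
  qed
  have "p c = 0"
  proof (rule M.submodule_trivial[OF nat nil J])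
    show "?J \<subseteq> range M.ev" by (auto simp: ev_p)
    show "p (vw []) \<notin> ?J"
    proof
      assume "p (vw []) \<in> ?J"
      then obtain d where "p (vw []) = p d" "ev d = 0" by auto
      then have "ev (vw [] - d) = 0" by (simp add: p_eq_iff N_def)
      then show False using \<open>ev d = 0\<close> v_nonzero by (simp add: ev_diff)
    qed
    show "p c \<in> ?J" using assms(1) by blast
  qed
  then have "c \<in> N" by (simp add: p_eq_0)
  then have "\<eta> (foldr va [] c) z = 0" unfolding N_def using assms(2) by blast
  then show ?thesis by simp
qed

end

subsection \<open>Tensor products\<close>

lemma pure_tensor_add_left: "pure_tensor (v + v') w = pure_tensor v w + pure_tensor v' w"
  by transfer (rule tensor_rel.add_left)

lemma pure_tensor_add_right: "pure_tensor v (w + w') = pure_tensor v w + pure_tensor v w'"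
  by transfer (rule tensor_rel.add_right)

lemma pure_tensor_scale_left: "pure_tensor (a *\<^sub>C v) w = a *\<^sub>C pure_tensor v w"
  by transfer (simp add: free_scale_single, metis mult.right_neutral tensor_rel.scale_left)

lemma pure_tensor_scale_right: "pure_tensor v (a *\<^sub>C w) = a *\<^sub>C pure_tensor v w"
  by transfer (simp add: free_scale_single, metis mult.right_neutral tensor_rel.scale_right)

lemma pure_tensor_0_left [simp]: "pure_tensor 0 w = 0" and pure_tensor_0_right [simp]: "pure_tensor v 0 = 0"
  using pure_tensor_scale_left[of 0 0 w] pure_tensor_scale_right[of v 0 0] by simp_all

lemma pure_tensor_minus_left: "pure_tensor (- v) w = - pure_tensor v w"
  and pure_tensor_minus_right: "pure_tensor v (- w) = - pure_tensor v w"
  using pure_tensor_scale_left[of "- 1" v w] pure_tensor_scale_right[of v "- 1" w] by simp_all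

lemma pure_tensor_diff_left: "pure_tensor (v - v') w = pure_tensor v w - pure_tensor v' w"
  and pure_tensor_diff_right: "pure_tensor v (w - w') = pure_tensor v w - pure_tensor v w'"
  using pure_tensor_add_left[of v "- v'" w] pure_tensor_add_right[of v w "- w'"]
  by (simp_all add: pure_tensor_minus_left pure_tensor_minus_right)

lemma pure_tensor_sum_left: "pure_tensor (sum g A) w = (\<Sum>a\<in>A. pure_tensor (g a) w)"
  and pure_tensor_sum_right: "pure_tensor v (sum h A) = (\<Sum>a\<in>A. pure_tensor v (h a))"
  by (induction A rule: infinite_finite_induct) (simp_all add: pure_tensor_add_left pure_tensor_add_right)

text \<open>The linear extension to the free space kills the tensor relations, so it is constant on
  their classes.\<close>

lemma tensor_lift_exists:
  fixes \<beta> :: "'v::complex_vector \<Rightarrow> 'w::complex_vector \<Rightarrow> 'c::complex_vector"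
  assumes "\<And>v v' w. \<beta> (v + v') w = \<beta> v w + \<beta> v' w" "\<And>v w w'. \<beta> v (w + w') = \<beta> v w + \<beta> v w'"
    and "\<And>a v w. \<beta> (a *\<^sub>C v) w = a *\<^sub>C \<beta> v w" "\<And>a v w. \<beta> v (a *\<^sub>C w) = a *\<^sub>C \<beta> v w"
  obtains L where "clinear L" "\<And>v w. L (pure_tensor v w) = \<beta> v w"
proof -
  let ?F = "lin_ext (\<lambda>(v, w). \<beta> v w)"
  have rel: "?F p = 0" if "p \<in> tensor_rel" for p
    using that by (induction rule: tensor_rel.induct) (simp_all add: assms mult.commute scaleC_add_right)
  have F_eq: "?F p = ?F q" if "p - q \<in> tensor_rel" for p q
    using rel[OF that] by simp
  have F_abs: "?F (rep_tensor (abs_tensor p)) = ?F p" for p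
  proof (rule F_eq)
    show "rep_tensor (abs_tensor p) - p \<in> tensor_rel"
      using Quotient3_rep_abs[OF Quotient3_tensor, of p] by (simp add: tensor_rel.zero)
  qed
  have abs_rep: "abs_tensor (rep_tensor t) = t" for t
    by (rule Quotient3_abs_rep[OF Quotient3_tensor])
  define L where "L t = ?F (rep_tensor t)" for t
  have "clinear L"
  proof (rule clinearI)
    fix s t :: "('v, 'w) tensor" and a
    have "s + t = abs_tensor (rep_tensor s + rep_tensor t)"
      using plus_tensor.abs_eq[of "rep_tensor s" "rep_tensor t"] by (simp add: abs_rep)
    then show "L (s + t) = L s + L t" unfolding L_def using F_abs by (metis lin_ext_add)
    have "a *\<^sub>C s = abs_tensor (free_scale a (rep_tensor s))"
      using scaleC_tensor.abs_eq[of a "rep_tensor s"] by (simp add: abs_rep)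
    moreover have "free_scale a (rep_tensor s) = a *\<^sub>C rep_tensor s"
      by (rule poly_mapping_eqI) (simp add: lookup_free_scale scaleC_complex)
    ultimately show "L (a *\<^sub>C s) = a *\<^sub>C L s" unfolding L_def using F_abs by (metis lin_ext_scale)
  qed
  moreover have "L (pure_tensor v w) = \<beta> v w" for v w
    unfolding L_def pure_tensor.abs_eq F_abs by simp
  ultimately show ?thesis using that by blast
qed

text \<open>Bilinearity is available only on the two subspaces, so the map is first composed with
  projections onto them.\<close>

lemma tensor_lift_on:
  fixes \<beta> :: "'v::complex_vector \<Rightarrow> 'w::complex_vector \<Rightarrow> 'c::complex_vector"
  assumes "csubspace A" "csubspace B"
    and "\<And>v v' w. v \<in> A \<Longrightarrow> v' \<in> A \<Longrightarrow> w \<in> B \<Longrightarrow> \<beta> (v + v') w = \<beta> v w + \<beta> v' w"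
    and "\<And>v w w'. v \<in> A \<Longrightarrow> w \<in> B \<Longrightarrow> w' \<in> B \<Longrightarrow> \<beta> v (w + w') = \<beta> v w + \<beta> v w'"
    and "\<And>a v w. v \<in> A \<Longrightarrow> w \<in> B \<Longrightarrow> \<beta> (a *\<^sub>C v) w = a *\<^sub>C \<beta> v w"
    and "\<And>a v w. v \<in> A \<Longrightarrow> w \<in> B \<Longrightarrow> \<beta> v (a *\<^sub>C w) = a *\<^sub>C \<beta> v w"
  obtains L where "clinear L" "\<And>v w. v \<in> A \<Longrightarrow> w \<in> B \<Longrightarrow> L (pure_tensor v w) = \<beta> v w"
proof -
  obtain p :: "'v \<Rightarrow> 'v" where p: "clinear p" "\<And>v. p v \<in> A" "\<And>v. v \<in> A \<Longrightarrow> p v = v"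
    by (rule csubspace_projection[OF assms(1)]) blast
  obtain q :: "'w \<Rightarrow> 'w" where q: "clinear q" "\<And>v. q v \<in> B" "\<And>v. v \<in> B \<Longrightarrow> q v = v"
    by (rule csubspace_projection[OF assms(2)]) blast
  obtain L where "clinear L" "\<And>v w. L (pure_tensor v w) = \<beta> (p v) (q w)"
    by (rule tensor_lift_exists[of "\<lambda>v w. \<beta> (p v) (q w)"])
      (simp_all add: assms(3-) p q clinear_add[OF p(1)] clinear_add[OF q(1)] clinear_scale[OF p(1)] clinear_scale[OF q(1)])
  with that[of L] p q show ?thesis by simp
qed

definition tensor_space :: "'v::complex_vector set \<Rightarrow> 'w::complex_vector set \<Rightarrow> ('v, 'w) tensor set" where
  "tensor_space A B = cspan {pure_tensor v w | v w. v \<in> A \<and> w \<in> B}"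

lemma tensor_space_pure: "v \<in> A \<Longrightarrow> w \<in> B \<Longrightarrow> pure_tensor v w \<in> tensor_space A B"
  unfolding tensor_space_def by (rule cspan_base) blast

lemma tensor_space_subspace: "csubspace (tensor_space A B)"
  by (simp add: tensor_space_def)

lemma tensor_space_induct [consumes 1, case_names pure zero add scale]:
  assumes "t \<in> tensor_space A B" "\<And>v w. v \<in> A \<Longrightarrow> w \<in> B \<Longrightarrow> P (pure_tensor v w)" "P 0"
    "\<And>s t. s \<in> tensor_space A B \<Longrightarrow> t \<in> tensor_space A B \<Longrightarrow> P s \<Longrightarrow> P t \<Longrightarrow> P (s + t)"
    "\<And>a s. s \<in> tensor_space A B \<Longrightarrow> P s \<Longrightarrow> P (a *\<^sub>C s)"
  shows "P t"
proof -
  have "{pure_tensor v w |v w. v \<in> A \<and> w \<in> B} \<subseteq> {t \<in> tensor_space A B. P t}"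
    using assms(2) by (auto simp: tensor_space_pure)
  moreover have "csubspace {t \<in> tensor_space A B. P t}"
    by (rule csubspaceI) (simp_all add: assms(3-5) csubspace_0[OF tensor_space_subspace]
        csubspace_add[OF tensor_space_subspace] csubspace_scale[OF tensor_space_subspace])
  ultimately have "cspan {pure_tensor v w |v w. v \<in> A \<and> w \<in> B} \<subseteq> {t \<in> tensor_space A B. P t}"
    by (rule cspan_minimal)
  from subsetD[OF this] assms(1) show ?thesis by (simp add: tensor_space_def)
qed

lemma tensor_space_eqI:
  fixes F G :: "('v::complex_vector, 'w::complex_vector) tensor \<Rightarrow> 'c::complex_vector"
  assumes "clinear F" "clinear G" "\<And>v w. v \<in> A \<Longrightarrow> w \<in> B \<Longrightarrow> F (pure_tensor v w) = G (pure_tensor v w)"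
    "t \<in> tensor_space A B"
  shows "F t = G t"
  by (rule clinear_eq_on_cspan[OF assms(1,2) _ assms(4)[unfolded tensor_space_def]]) (use assms(3) in blast)

text \<open>Scalars are absorbed into the first factor, which leaves the plain sums of pure tensors
  that \<open>tensor_rep\<close> refers to.\<close>

lemma tensor_space_list:
  assumes "csubspace A" "t \<in> tensor_space A B"
  obtains ps where "set ps \<subseteq> A \<times> B" "t = (\<Sum>(v, w)\<leftarrow>ps. pure_tensor v w)"
proof -
  have "\<exists>ps. set ps \<subseteq> A \<times> B \<and> t = (\<Sum>(v, w)\<leftarrow>ps. pure_tensor v w)"
    using assms(2) unfolding tensor_space_def
  proof (induction rule: complex_vector.span_induct_alt)
    case base
    show ?case by (rule exI[of _ "[]"]) simp
  next
    case (step a y z)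
    then obtain v w ps where "y = pure_tensor v w" "v \<in> A" "w \<in> B" "set ps \<subseteq> A \<times> B"
      "z = (\<Sum>(v, w)\<leftarrow>ps. pure_tensor v w)" by blast
    then show ?case
      by (intro exI[of _ "(a *\<^sub>C v, w) # ps"]) (simp add: pure_tensor_scale_left csubspace_scale[OF assms(1)])
  qed
  with that show ?thesis by blast
qed

lemma tensor_space_in_cspan:
  assumes "A \<subseteq> cspan (g ` I)" "B \<subseteq> cspan (h ` J)"
  shows "tensor_space A B \<subseteq> cspan ((\<lambda>(i, j). pure_tensor (g i) (h j)) ` (I \<times> J))" (is "_ \<subseteq> cspan ?G")
proof -
  have "pure_tensor v w \<in> cspan ?G" if vw: "v \<in> A" "w \<in> B" for v w
  proof -
    obtain F c where F: "F \<subseteq> I" "v = (\<Sum>i\<in>F. c i *\<^sub>C g i)" using assms(1) vw(1) by (metis cspan_image_sum subsetD)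
    obtain F' c' where F': "F' \<subseteq> J" "w = (\<Sum>j\<in>F'. c' j *\<^sub>C h j)" using assms(2) vw(2) by (metis cspan_image_sum subsetD)
    have "pure_tensor v w = (\<Sum>j\<in>F'. \<Sum>i\<in>F. c' j *\<^sub>C c i *\<^sub>C pure_tensor (g i) (h j))"
      by (simp add: F(2) F'(2) pure_tensor_sum_left pure_tensor_sum_right pure_tensor_scale_left
          pure_tensor_scale_right scaleC_sum_right mult.commute)
    also have "\<dots> \<in> cspan ?G"
      using F(1) F'(1) by (intro complex_vector.span_sum complex_vector.span_scale cspan_base) auto
    finally show ?thesis .
  qed
  then have "{pure_tensor v w |v w. v \<in> A \<and> w \<in> B} \<subseteq> cspan ?G" by blast
  then show ?thesis unfolding tensor_space_def by (rule cspan_minimal[OF _ csubspace_cspan])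
qed

lemma tensor_rep_space [simp]: "rep_space (tensor_rep R S) = tensor_space (rep_space R) (rep_space S)"
  by (simp add: tensor_rep_def tensor_space_def)

section \<open>The diagonal action on a tensor product\<close>

locale tensor_km = km_algebra D + R1: g_rep D R1 + R2: g_rep D R2
  for D :: "('i::finite, 'h::complex_vector, 'g::complex_vector) km_data"
    and R1 :: "('g, 'v::complex_vector) rep" and R2 :: "('g, 'w::complex_vector) rep"
begin

abbreviation "T \<equiv> tensor_rep R1 R2"
abbreviation "TS \<equiv> tensor_space R1.S R2.S"

lemma TS_0: "0 \<in> TS" and TS_add: "s \<in> TS \<Longrightarrow> t \<in> TS \<Longrightarrow> s + t \<in> TS"
  and TS_scale: "s \<in> TS \<Longrightarrow> a *\<^sub>C s \<in> TS"
  by (simp_all add: csubspace_0[OF tensor_space_subspace] csubspace_add[OF tensor_space_subspace]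
      csubspace_scale[OF tensor_space_subspace])

text \<open>The universal property yields one linear map that computes the value from every
  expression of the argument; this gives the uniqueness required by the definite description in
  \<open>tensor_rep\<close>.\<close>

lemma tensor_action:
  obtains L where "clinear L"
    "\<And>v w. v \<in> R1.S \<Longrightarrow> w \<in> R2.S \<Longrightarrow> L (pure_tensor v w) = pure_tensor (rep_act R1 x v) w + pure_tensor v (rep_act R2 x w)"
    "\<And>t. t \<in> TS \<Longrightarrow> rep_act T x t = L t"
proof -
  obtain L where L: "clinear L"
    "\<And>v w. v \<in> R1.S \<Longrightarrow> w \<in> R2.S \<Longrightarrow> L (pure_tensor v w) = pure_tensor (rep_act R1 x v) w + pure_tensor v (rep_act R2 x w)"
    by (rule tensor_lift_on[OF R1.S R2.S, of "\<lambda>v w. pure_tensor (rep_act R1 x v) w + pure_tensor v (rep_act R2 x w)"])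
      (simp_all add: R1.act_add_right R2.act_add_right R1.act_scale_right R2.act_scale_right
        pure_tensor_add_left pure_tensor_add_right pure_tensor_scale_left pure_tensor_scale_right scaleC_add_right)
  have sum: "(\<Sum>(v, w)\<leftarrow>ps. pure_tensor (rep_act R1 x v) w + pure_tensor v (rep_act R2 x w)) = L (\<Sum>(v, w)\<leftarrow>ps. pure_tensor v w)"
    if "set ps \<subseteq> R1.S \<times> R2.S" for ps
    using that by (induction ps) (auto simp: clinear_0[OF L(1)] clinear_add[OF L(1)] L(2))
  have "rep_act T x t = L t" if t: "t \<in> TS" for t
    unfolding tensor_rep_def rep.simps
  proof (rule the_equality)
    obtain ps where ps: "set ps \<subseteq> R1.S \<times> R2.S" "t = (\<Sum>(v, w)\<leftarrow>ps. pure_tensor v w)"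
      using t by (rule tensor_space_list[OF R1.S])
    show "\<exists>ps. set ps \<subseteq> R1.S \<times> R2.S \<and> t = (\<Sum>(v, w)\<leftarrow>ps. pure_tensor v w)
      \<and> L t = (\<Sum>(v, w)\<leftarrow>ps. pure_tensor (rep_act R1 x v) w + pure_tensor v (rep_act R2 x w))"
      by (rule exI[of _ ps]) (simp only: ps sum[OF ps(1)] simp_thms)
  next
    fix u assume "\<exists>ps. set ps \<subseteq> R1.S \<times> R2.S \<and> t = (\<Sum>(v, w)\<leftarrow>ps. pure_tensor v w)
      \<and> u = (\<Sum>(v, w)\<leftarrow>ps. pure_tensor (rep_act R1 x v) w + pure_tensor v (rep_act R2 x w))"
    then obtain ps where ps: "set ps \<subseteq> R1.S \<times> R2.S" "t = (\<Sum>(v, w)\<leftarrow>ps. pure_tensor v w)"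
      "u = (\<Sum>(v, w)\<leftarrow>ps. pure_tensor (rep_act R1 x v) w + pure_tensor v (rep_act R2 x w))" by blast
    show "u = L t" unfolding ps(2,3) by (rule sum[OF ps(1)])
  qed
  with L that show ?thesis by blast
qed

lemma tensor_act_pure: "v \<in> R1.S \<Longrightarrow> w \<in> R2.S \<Longrightarrow>
    rep_act T x (pure_tensor v w) = pure_tensor (rep_act R1 x v) w + pure_tensor v (rep_act R2 x w)"
  by (rule tensor_action[of x]) (simp add: tensor_space_pure)

lemma tensor_act_add: "s \<in> TS \<Longrightarrow> t \<in> TS \<Longrightarrow> rep_act T x (s + t) = rep_act T x s + rep_act T x t"
  and tensor_act_scale: "s \<in> TS \<Longrightarrow> rep_act T x (a *\<^sub>C s) = a *\<^sub>C rep_act T x s"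
proof -
  obtain L where L: "clinear L" "\<And>t. t \<in> TS \<Longrightarrow> rep_act T x t = L t" by (rule tensor_action[of x]) blast
  show "s \<in> TS \<Longrightarrow> t \<in> TS \<Longrightarrow> rep_act T x (s + t) = rep_act T x s + rep_act T x t"
    using L TS_add by (simp add: clinear_add)
  show "s \<in> TS \<Longrightarrow> rep_act T x (a *\<^sub>C s) = a *\<^sub>C rep_act T x s"
    using L TS_scale by (simp add: clinear_scale)
qed

lemma tensor_act_0: "rep_act T x 0 = 0"
  using tensor_act_scale[of 0 x 0] TS_0 by simp

lemma tensor_act_in: "t \<in> TS \<Longrightarrow> rep_act T x t \<in> TS"
proof (induction rule: tensor_space_induct)
  case (pure v w)
  then show ?case by (simp add: tensor_act_pure tensor_space_pure TS_add)
qed (simp_all add: tensor_act_0 tensor_act_add tensor_act_scale TS_0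
    TS_add TS_scale)

lemma tensor_is_rep: "is_rep br T"
  unfolding is_rep_def tensor_rep_space
proof (intro conjI allI ballI)
  fix x y a t s assume t: "t \<in> TS"
  show "rep_act T x t \<in> TS" by (rule tensor_act_in[OF t])
  show "rep_act T x (a *\<^sub>C t) = a *\<^sub>C rep_act T x t" by (rule tensor_act_scale[OF t])
  show "rep_act T (x + y) t = rep_act T x t + rep_act T y t"
    using t by (induction rule: tensor_space_induct) (simp_all add: tensor_act_0 tensor_act_add tensor_act_scale tensor_act_pure
        R1.act_add_left R2.act_add_left pure_tensor_add_left pure_tensor_add_right scaleC_add_right)
  show "rep_act T (a *\<^sub>C x) t = a *\<^sub>C rep_act T x t"
    using t by (induction rule: tensor_space_induct) (simp_all add: tensor_act_0 tensor_act_add tensor_act_scale tensor_act_pure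
        R1.act_scale_left R2.act_scale_left pure_tensor_scale_left pure_tensor_scale_right scaleC_add_right mult.commute)
  show "rep_act T (br x y) t = rep_act T x (rep_act T y t) - rep_act T y (rep_act T x t)"
    using t by (induction rule: tensor_space_induct) (simp_all add: tensor_act_0 tensor_act_add tensor_act_scale tensor_act_pure
        tensor_act_in tensor_space_pure R1.act_br R2.act_br pure_tensor_diff_left pure_tensor_diff_right scaleC_diff_right)
  assume "s \<in> TS"
  then show "rep_act T x (t + s) = rep_act T x t + rep_act T x s" by (rule tensor_act_add[OF t])
qed (rule tensor_space_subspace)

lemma tensor_g_rep: "g_rep D T"
  by unfold_locales (rule tensor_is_rep)

lemma tensor_weight:
  assumes "v \<in> weight_space D R1 \<gamma>" "w \<in> weight_space D R2 \<delta>"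
  shows "pure_tensor v w \<in> weight_space D T (\<lambda>h. \<gamma> h + \<delta> h)"
  using R1.weight_spaceD[OF assms(1)] R2.weight_spaceD[OF assms(2)]
  by (simp add: weight_space_def tensor_space_pure tensor_act_pure pure_tensor_scale_left pure_tensor_scale_right scaleC_add_left)

end

subsection \<open>Contravariant forms\<close>

locale contra_rep = g_rep D R + hermitian "rep_space R" B
  for D :: "('i::finite, 'h::complex_vector, 'g::complex_vector) km_data"
    and R :: "('g, 'v::complex_vector) rep" and B :: "'v \<Rightarrow> 'v \<Rightarrow> complex" +
  assumes B_e: "\<lbrakk>u \<in> rep_space R; v \<in> rep_space R\<rbrakk> \<Longrightarrow> B (rep_act R (e i) u) v = B u (rep_act R (f i) v)"
    and B_h: "\<lbrakk>h \<in> real_form D; u \<in> rep_space R; v \<in> rep_space R\<rbrakk>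
      \<Longrightarrow> B (rep_act R (cart h) u) v = B u (rep_act R (cart h) v)"

lemma (in km_algebra) shapovalov_contra:
  assumes "is_rep br R" "shapovalov_form D R B"
  shows "contra_rep D R B"
proof -
  interpret g_rep D R by unfold_locales (rule assms(1))
  note * = assms(2)[unfolded shapovalov_form_def]
  note A = *[THEN conjunct1, rule_format] *[THEN conjunct2, THEN conjunct1, rule_format]
    *[THEN conjunct2, THEN conjunct2, THEN conjunct1, rule_format]
    *[THEN conjunct2, THEN conjunct2, THEN conjunct2, THEN conjunct1, rule_format]
    *[THEN conjunct2, THEN conjunct2, THEN conjunct2, THEN conjunct2, THEN conjunct1, rule_format]
    *[THEN conjunct2, THEN conjunct2, THEN conjunct2, THEN conjunct2, THEN conjunct2, rule_format]
  show ?thesis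
    by unfold_locales (fact S | rule A; assumption)+
qed

context km_algebra begin

text \<open>The forms are contravariant only for the real form of the Cartan subalgebra. These
  functionals are real there and determined by their values there, so conjugation does not disturb
  the orthogonality of weight spaces.\<close>

definition real_weight :: "('h \<Rightarrow> complex) \<Rightarrow> bool" where
  "real_weight \<gamma> \<longleftrightarrow> clinear \<gamma> \<and> (\<forall>h\<in>real_form D. \<gamma> h \<in> \<real>)"

lemma real_weight_wt: "real_weight \<gamma> \<Longrightarrow> real_weight (\<lambda>h. \<gamma> h - wt D w h)"
  unfolding real_weight_def
  by (auto simp: clinear_iff scaleC_complex wt_real right_diff_distrib intro: Reals_diff)

lemma real_weight_differ:
  assumes "real_weight \<gamma>" "real_weight \<delta>" "\<gamma> \<noteq> \<delta>"
  obtains h where "h \<in> real_form D" "\<gamma> h \<noteq> \<delta> h"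
proof -
  obtain h where h: "\<gamma> h \<noteq> \<delta> h" using assms(3) by blast
  obtain a b where ab: "a \<in> real_form D" "b \<in> real_form D" "h = a + \<i> *\<^sub>C b" by (rule real_form_decomp)
  have "\<gamma> h = \<gamma> a + \<i> * \<gamma> b" "\<delta> h = \<delta> a + \<i> * \<delta> b"
    using assms(1,2) by (simp_all add: ab(3) real_weight_def clinear_add clinear_scale scaleC_complex)
  then have "\<gamma> a \<noteq> \<delta> a \<or> \<gamma> b \<noteq> \<delta> b" using h by auto
  then show ?thesis using ab that by blast
qed

end

context contra_rep begin

lemma B_f: "\<lbrakk>u \<in> S; v \<in> S\<rbrakk> \<Longrightarrow> B (f i \<cdot> u) v = B u (e i \<cdot> v)"
  using B_e[of v u i] cnj_sym[of "f i \<cdot> u" v] cnj_sym[of u "e i \<cdot> v"]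
  by (metis act_in cnj_sym)

text \<open>Splitting \<open>h\<close> along the real form makes the orthogonal complement of a
  stable space stable under the whole Cartan subalgebra.\<close>

lemma B_h_complex:
  assumes "u \<in> S" "v \<in> S" "\<And>h. B u (cart h \<cdot> v) = 0"
  shows "B (cart h \<cdot> u) v = 0"
proof -
  obtain a b where ab: "a \<in> real_form D" "b \<in> real_form D" "h = a + \<i> *\<^sub>C b" by (rule real_form_decomp)
  have "cart h \<cdot> u = cart a \<cdot> u + \<i> *\<^sub>C cart b \<cdot> u"
    using assms(1) by (simp add: ab(3) cart_add act_add_left act_scale_left)
  then show ?thesis using assms ab by (simp add: add_left scale_left B_h)
qed

lemma weight_orth:
  assumes "u \<in> weight_space D R \<gamma>" "v \<in> weight_space D R \<delta>" "real_weight \<gamma>" "real_weight \<delta>" "\<gamma> \<noteq> \<delta>"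
  shows "B u v = 0"
proof -
  obtain h where h: "h \<in> real_form D" "\<gamma> h \<noteq> \<delta> h" by (rule real_weight_differ[OF assms(3-5)])
  have uv: "u \<in> S" "v \<in> S" using assms(1,2) weight_spaceD by auto
  have "\<delta> h \<in> \<real>" using assms(4) h(1) by (simp add: real_weight_def)
  then have "cnj (\<delta> h) = \<delta> h" by (rule Reals_cnj_iff[THEN iffD1])
  have "\<gamma> h * B u v = B (cart h \<cdot> u) v"
    using weight_spaceD(2)[OF assms(1)] uv by (simp add: scale_left)
  also have "\<dots> = B u (cart h \<cdot> v)" by (rule B_h[OF h(1) uv])
  also have "\<dots> = \<delta> h * B u v"
    using weight_spaceD(2)[OF assms(2)] uv \<open>cnj (\<delta> h) = \<delta> h\<close> by (simp add: scale_right)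
  finally show ?thesis using h(2) by simp
qed

lemma singular_orth_f: "\<lbrakk>e i \<cdot> s = 0; s \<in> S; x \<in> S\<rbrakk> \<Longrightarrow> B s (f i \<cdot> x) = 0"
  using B_e[of s x i] by (simp add: zero_left)

end

subsection \<open>Highest weight vectors in a module with a contravariant form\<close>

fun ew :: "('i, 'h, 'g) km_data \<Rightarrow> ('h \<Rightarrow> complex) \<Rightarrow> 'i list \<Rightarrow> 'i verma \<Rightarrow> 'i verma" where
  "ew D l [] c = c"
| "ew D l (i # w) c = ew D l w (verma_e D l i c)"

locale contra_hw = contra_rep D R B + hw_vec D R v l
  for D :: "('i::finite, 'h::complex_vector, 'g::complex_vector) km_data"
    and R :: "('g, 'v::complex_vector) rep" and B v l
begin

lemma B_fw_v: "w \<noteq> [] \<Longrightarrow> B (fw w) v = 0"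
  by (cases w) (simp_all add: B_f e_v zero_right)

lemma B_ev_v: "B (ev c) v = Poly_Mapping.lookup c [] * B v v"
proof -
  have "B (ev c) v = (\<Sum>w\<in>Poly_Mapping.keys c. Poly_Mapping.lookup c w * B (fw w) v)"
    by (simp add: ev_def lin_ext_def sum_left scale_left)
  also have "\<dots> = (\<Sum>w\<in>Poly_Mapping.keys c. if w = [] then Poly_Mapping.lookup c [] * B v v else 0)"
    by (rule sum.cong) (auto simp: B_fw_v)
  finally show ?thesis by (simp add: in_keys_iff)
qed

text \<open>Moved to the other side, the letters \<open>f_i\<close> become \<open>e_i\<close>, and
  the product with \<open>v\<close> reads off the coefficient of the empty word. The module enters
  only through the number \<open>B v v\<close>.\<close>

lemma B_ev_fw: "B (ev c) (fw w) = Poly_Mapping.lookup (ew D l w c) [] * B v v"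
proof (induction w arbitrary: c)
  case (Cons i w)
  have "B (ev c) (fw (i # w)) = B (ev (verma_e D l i c)) (fw w)"
    by (simp add: B_e ev_e)
  then show ?case using Cons.IH by simp
qed (simp add: B_ev_v)

lemma orth_fw: "\<lbrakk>u \<in> S; x \<in> range ev; \<And>w. B u (fw w) = 0\<rbrakk> \<Longrightarrow> B u x = 0"
  by (rule orth_cspan[of "range fw"]) (auto simp: range_ev)

text \<open>The kernel of \<open>ev\<close> does not depend on the module.\<close>

lemma ev_eq_0_iff:
  assumes "v \<noteq> 0"
  shows "ev c = 0 \<longleftrightarrow> (\<forall>w. Poly_Mapping.lookup (ew D l w c) [] = 0)"
proof
  assume "ev c = 0"
  then have "Poly_Mapping.lookup (ew D l w c) [] * B v v = 0" for w
    using B_ev_fw[of c w] by (simp add: zero_left)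
  moreover have "B v v \<noteq> 0" using definite[OF v_in] assms by blast
  ultimately show "\<forall>w. Poly_Mapping.lookup (ew D l w c) [] = 0" by simp
next
  assume "\<forall>w. Poly_Mapping.lookup (ew D l w c) [] = 0"
  then have "B (ev c) (fw w) = 0" for w by (simp add: B_ev_fw)
  then have "B (ev c) (ev c) = 0" by (rule orth_fw[OF ev_in rangeI])
  then show "ev c = 0" by (rule definite[OF ev_in])
qed

text \<open>A singular vector is orthogonal to the image of every \<open>f_i\<close>; if it is also
  orthogonal to \<open>v\<close>, it is orthogonal to the whole orbit and hence to itself.\<close>

lemma singular_in_orbit:
  assumes "u \<in> range ev" "\<And>i. e i \<cdot> u = 0" "u \<in> weight_space D R \<gamma>" "u \<noteq> 0" "real_weight \<gamma>" "real_weight l"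
    and "v \<noteq> 0"
  shows "\<gamma> = l" "u \<in> cspan {v}"
proof -
  have uS: "u \<in> S" using assms(3) by (rule weight_spaceD)
  have orth: "B x y = 0" if "x \<in> range ev" "\<And>i. e i \<cdot> x = 0" "y \<in> range ev" "B x v = 0" for x y
  proof (rule orth_fw[OF _ that(3)])
    show "x \<in> S" using that(1) by auto
    show "B x (fw w) = 0" for w
      using that \<open>x \<in> S\<close> by (cases w) (simp_all add: singular_orth_f)
  qed
  have "B u v \<noteq> 0" using orth[OF assms(1,2,1)] definite[OF uS] assms(4) by blast
  then show "\<gamma> = l" using weight_orth[OF assms(3) v_weight assms(5,6)] by blast
  define c where "c = B u v / B v v"
  have vv: "B v v \<noteq> 0" using definite[OF v_in] assms(7) by blast
  have v_range: "v \<in> range ev" using rangeI[of ev "vw []"] by (simp only: ev_Nil)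
  have x_range: "u - c *\<^sub>C v \<in> range ev"
    using assms(1) v_range unfolding range_ev
    by (intro complex_vector.span_diff complex_vector.span_scale)
  have "B (u - c *\<^sub>C v) (u - c *\<^sub>C v) = 0"
  proof (rule orth[OF x_range _ x_range])
    show "e i \<cdot> (u - c *\<^sub>C v) = 0" for i
      using assms(2) uS by (simp add: act_diff_right act_scale_right e_v)
    show "B (u - c *\<^sub>C v) v = 0" using uS vv by (simp add: diff_left scale_left c_def)
  qed
  from definite[OF _ this] have "u - c *\<^sub>C v = 0" using uS by simp
  then show "u \<in> cspan {v}" by (auto simp: complex_vector.span_singleton)
qed

end

lemma rep_update: "rep_space (R \<lparr> rep_space := X \<rparr>) = X" "rep_act (R \<lparr> rep_space := X \<rparr>) = rep_act R"
  by simp_all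

context km_algebra begin

text \<open>Both orbits are quotients of one free Verma module by the same kernel, so sending
  \<open>one.ev c\<close> to \<open>two.ev c\<close> is well defined and injective.\<close>

lemma hw_iso:
  assumes "contra_hw D R1 B1 v1 l" "contra_hw D R2 B2 v2 l" "v1 \<noteq> 0" "v2 \<noteq> 0"
    and "env_orbit R2 UNIV v2 = rep_space R2"
  shows "rep_iso (R1 \<lparr> rep_space := env_orbit R1 UNIV v1 \<rparr>) R2"
proof -
  interpret one: contra_hw D R1 B1 v1 l by (rule assms(1))
  interpret two: contra_hw D R2 B2 v2 l by (rule assms(2))
  have ker: "one.ev c = 0 \<longleftrightarrow> two.ev c = 0" for c
    using one.ev_eq_0_iff[OF assms(3)] two.ev_eq_0_iff[OF assms(4)] by simp
  have eq: "one.ev c = one.ev d \<longleftrightarrow> two.ev c = two.ev d" for c d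
    using ker[of "c - d"] by (simp add: one.ev_diff two.ev_diff)
  define \<phi> where "\<phi> x = two.ev (SOME c. one.ev c = x)" for x
  have \<phi>_ev: "\<phi> (one.ev c) = two.ev c" for c
  proof -
    have "one.ev (SOME d. one.ev d = one.ev c) = one.ev c" by (rule someI) (rule HOL.refl)
    then show ?thesis unfolding \<phi>_def by (simp only: eq)
  qed
  have range2: "range two.ev = rep_space R2" using two.env_orbit_eq assms(5) by simp
  show ?thesis
    unfolding rep_iso_def rep_update one.env_orbit_eq
  proof (intro exI[of _ \<phi>] conjI allI ballI)
    show "bij_betw \<phi> (range one.ev) (rep_space R2)"
      unfolding bij_betw_def
    proof
      show "inj_on \<phi> (range one.ev)" by (auto simp: inj_on_def \<phi>_ev eq)
      show "\<phi> ` range one.ev = rep_space R2" by (auto simp: image_image \<phi>_ev range2)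
    qed
    fix x y assume "x \<in> range one.ev" "y \<in> range one.ev"
    then obtain c d where "x = one.ev c" "y = one.ev d" by blast
    then show "\<phi> (x + y) = \<phi> x + \<phi> y"
      by (simp add: \<phi>_ev one.ev_add[symmetric] two.ev_add[symmetric])
  next
    fix a x assume "x \<in> range one.ev"
    then obtain c where "x = one.ev c" by blast
    then show "\<phi> (a *\<^sub>C x) = a *\<^sub>C \<phi> x"
      by (simp add: \<phi>_ev one.ev_scale[symmetric] two.ev_scale[symmetric])
  next
    fix x u assume "u \<in> range one.ev"
    then obtain c where c: "u = one.ev c" by blast
    obtain t where "x = lie_eval D t" using surj_eval by (metis surj_def)
    then show "\<phi> (rep_act R1 x u) = rep_act R2 x (\<phi> u)"
      by (simp add: c \<phi>_ev one.ev_act[symmetric] two.ev_act[symmetric])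
  qed
qed

end

subsection \<open>Complete reducibility\<close>

definition sing :: "('i, 'h, 'g) km_data \<Rightarrow> ('g, 'v::complex_vector) rep \<Rightarrow> 'v set \<Rightarrow> ('h \<Rightarrow> complex) \<Rightarrow> 'v set" where
  "sing D R X \<gamma> = {x \<in> X. x \<in> weight_space D R \<gamma> \<and> (\<forall>i. rep_act R (chev_e D i) x = 0)}"

text \<open>The relevant features of category O: spanning weight vectors below a fixed weight,
  finitely many at each height, and local nilpotency of the \<open>f_i\<close>. \<open>wd k\<close>
  lists the simple roots subtracted from \<open>\<Lambda>\<close>; the free index type admits pairs
  of words for tensor products.\<close>

locale cat_rep = contra_rep D R B
  for D :: "('i::finite, 'h::complex_vector, 'g::complex_vector) km_data"
    and R :: "('g, 'v::complex_vector) rep" and B +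
  fixes g :: "'k \<Rightarrow> 'v" and wd :: "'k \<Rightarrow> 'i list" and \<Lambda> :: "'h \<Rightarrow> complex"
  assumes g_weight: "g k \<in> weight_space D R (\<lambda>h. \<Lambda> h - wt D (wd k) h)"
    and S_span: "rep_space R \<subseteq> cspan (range g)"
    and finite_height: "finite {k. length (wd k) = n}"
    and \<Lambda>_real: "real_weight \<Lambda>" and \<Lambda>_int: "\<Lambda> (co i) \<in> \<int>"
    and f_nil: "x \<in> rep_space R \<Longrightarrow> \<exists>n. (rep_act R (f i) ^^ n) x = 0"
begin

abbreviation "W \<equiv> \<lambda>k h. \<Lambda> h - wt D (wd k) h"

lemma weight_in_cspan: "x \<in> weight_space D R \<gamma> \<Longrightarrow> x \<in> cspan (g ` {k. W k = \<gamma>})"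
  using weight_space_cspan[where K = UNIV and g = g and W = W and v = x and \<gamma> = \<gamma>, OF g_weight] S_span weight_spaceD(1)
  by auto

lemma weight_exists:
  assumes "x \<in> weight_space D R \<gamma>" "x \<noteq> 0"
  obtains k where "W k = \<gamma>"
proof -
  define K where "K = {k. W k = \<gamma>}"
  have "x \<in> cspan (g ` K)" unfolding K_def by (rule weight_in_cspan[OF assms(1)])
  then have "K \<noteq> {}" using assms(2) by (cases "K = {}") simp_all
  then show ?thesis using that by (auto simp: K_def)
qed

lemma weight_real: "x \<in> weight_space D R \<gamma> \<Longrightarrow> x \<noteq> 0 \<Longrightarrow> real_weight \<gamma>"
  by (erule weight_exists) (auto intro: real_weight_wt[OF \<Lambda>_real])

text \<open>All spanning vectors of weight \<open>\<gamma>\<close> have the same height, and only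
  finitely many have that height.\<close>

lemma weight_fin_dim: "fin_dim (weight_space D R \<gamma>)"
proof (cases "\<exists>k. W k = \<gamma>")
  case True
  then obtain k0 where k0: "W k0 = \<gamma>" by blast
  have "length (wd k) = length (wd k0)" if "W k = \<gamma>" for k
  proof -
    have "W k hgt = W k0 hgt" using that k0 by metis
    then show ?thesis by simp
  qed
  then have "{k. W k = \<gamma>} \<subseteq> {k. length (wd k) = length (wd k0)}" by blast
  then have "finite {k. W k = \<gamma>}" by (rule finite_subset[OF _ finite_height])
  then show ?thesis unfolding fin_dim_def using weight_in_cspan by (intro exI[of _ "g ` {k. W k = \<gamma>}"]) auto
next
  case False
  then have "weight_space D R \<gamma> \<subseteq> {0}" using weight_exists by blast
  then show ?thesis unfolding fin_dim_def by (intro exI[of _ "{}"]) simp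
qed

lemma weight_decomp:
  assumes "x \<in> S"
  obtains \<Gamma> u where "finite \<Gamma>" "\<Gamma> \<subseteq> range W" "\<And>\<gamma>. u \<gamma> \<in> weight_space D R \<gamma>" "x = (\<Sum>\<gamma>\<in>\<Gamma>. u \<gamma>)"
proof -
  have "x \<in> cspan (g ` UNIV)" using assms S_span by auto
  then obtain \<Gamma> u where *: "finite \<Gamma>" "\<Gamma> \<subseteq> W ` UNIV"
    "\<And>\<gamma>. u \<gamma> \<in> cspan (g ` {k \<in> UNIV. W k = \<gamma>})" "x = (\<Sum>\<gamma>\<in>\<Gamma>. u \<gamma>)"
    by (rule weight_decomposition[where K = UNIV and g = g and W = W, OF g_weight]) blast
  moreover have "u \<gamma> \<in> weight_space D R \<gamma>" for \<gamma>
    using *(3)[of \<gamma>] cspan_weight_space[where K = UNIV and g = g and W = W and \<gamma> = \<gamma>, OF g_weight] by blast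
  ultimately show ?thesis using that by blast
qed

text \<open>\<open>X\<close> may be infinite-dimensional, but different weight spaces are
  orthogonal, so projecting onto the finite-dimensional weight space of \<open>X\<close> is
  enough.\<close>

lemma orth_decomp:
  assumes X: "csubspace X" "X \<subseteq> S" "\<And>h x. x \<in> X \<Longrightarrow> cart h \<cdot> x \<in> X" and x: "x \<in> weight_space D R \<gamma>"
  obtains u where "u \<in> X" "u \<in> weight_space D R \<gamma>" "\<And>s. s \<in> X \<Longrightarrow> B (x - u) s = 0"
proof -
  define F where "F = X \<inter> weight_space D R \<gamma>"
  have xS: "x \<in> S" using x by (rule weight_spaceD)
  have FS: "csubspace F" "F \<subseteq> S"
    unfolding F_def using X weight_space_subspace by (auto intro: complex_vector.subspace_inter)
  have "fin_dim F" by (rule fin_dim_subset[OF weight_fin_dim]) (auto simp: F_def)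
  then obtain u where u: "u \<in> F" "\<And>s. s \<in> F \<Longrightarrow> B (x - u) s = 0"
    by (rule orth_complement_exists[OF FS(1) _ FS(2) xS]) blast
  have xu: "x - u \<in> weight_space D R \<gamma>" using x u(1) weight_space_subspace by (auto simp: F_def intro: csubspace_diff)
  have "B (x - u) s = 0" if s: "s \<in> X" for s
  proof (cases "x - u = 0")
    case True
    have "s \<in> S" using s X(2) by blast
    then show ?thesis by (simp only: True zero_left)
  next
    case False
    obtain \<Gamma> t where *: "finite \<Gamma>" "\<And>\<gamma>. t \<gamma> \<in> weight_space D R \<gamma>" "s = (\<Sum>\<gamma>\<in>\<Gamma>. t \<gamma>)"
      by (rule weight_decomp[OF subsetD[OF X(2) s]]) blast
    have "B (x - u) (t \<delta>) = 0" if \<delta>: "\<delta> \<in> \<Gamma>" for \<delta>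
    proof -
      have tX: "t \<delta> \<in> X"
        by (rule weight_components[of X \<Gamma> t]) (use X * s \<delta> in auto)
      show ?thesis
      proof (cases "\<delta> = \<gamma> \<or> t \<delta> = 0")
        case True
        then show ?thesis
        proof
          assume "\<delta> = \<gamma>"
          then have "t \<delta> \<in> F" using tX *(2) by (simp add: F_def)
          then show ?thesis by (rule u(2))
        next
          assume "t \<delta> = 0"
          then show ?thesis using weight_spaceD(1)[OF xu] by (simp add: zero_right)
        qed
      next
        case False
        then show ?thesis
          using weight_orth[OF xu *(2) weight_real[OF xu \<open>x - u \<noteq> 0\<close>] weight_real[OF *(2)]] by blast
      qed
    qed
    moreover have "t \<delta> \<in> S" for \<delta> using *(2) weight_spaceD by blast
    ultimately show ?thesis unfolding *(3) using weight_spaceD(1)[OF xu] by (simp add: sum_right)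
  qed
  with u that show ?thesis by (auto simp: F_def)
qed

text \<open>A nonzero weight vector of \<open>X\<close> of least height below
  \<open>\<Lambda>\<close> is killed by every \<open>e_i\<close>, because the \<open>e_i\<close>
  reduce that height.\<close>

lemma singular_exists:
  assumes X: "csubspace X" "X \<subseteq> S" "\<And>h x. x \<in> X \<Longrightarrow> cart h \<cdot> x \<in> X" "\<And>i x. x \<in> X \<Longrightarrow> e i \<cdot> x \<in> X"
    and "x \<in> X" "x \<noteq> 0"
  obtains s \<gamma> where "s \<in> sing D R X \<gamma>" "s \<noteq> 0"
proof -
  define P where "P n \<longleftrightarrow> (\<exists>k u. length (wd k) = n \<and> u \<in> X \<and> u \<noteq> 0 \<and> u \<in> weight_space D R (W k))" for n
  have "\<exists>n. P n"
  proof -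
    obtain \<Gamma> u where *: "finite \<Gamma>" "\<Gamma> \<subseteq> range W" "\<And>\<gamma>. u \<gamma> \<in> weight_space D R \<gamma>" "x = (\<Sum>\<gamma>\<in>\<Gamma>. u \<gamma>)"
      by (rule weight_decomp[OF subsetD[OF assms(2,5)]]) blast
    obtain \<gamma> where \<gamma>: "\<gamma> \<in> \<Gamma>" "u \<gamma> \<noteq> 0" using assms(6) *(4) by (metis sum.neutral)
    moreover have "u \<gamma> \<in> X" by (rule weight_components[of X \<Gamma> u]) (use X * assms(5) \<gamma> in auto)
    moreover obtain k where "\<gamma> = W k" using *(2) \<gamma> by auto
    ultimately show ?thesis unfolding P_def using *(3) by metis
  qed
  define n where "n = (LEAST n. P n)"
  have "P n" unfolding n_def using \<open>\<exists>n. P n\<close> by (metis LeastI)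
  then obtain k u where u: "length (wd k) = n" "u \<in> X" "u \<noteq> 0" "u \<in> weight_space D R (W k)"
    unfolding P_def by blast
  have "e i \<cdot> u = 0" for i
  proof (rule ccontr)
    assume nz: "e i \<cdot> u \<noteq> 0"
    have ew: "e i \<cdot> u \<in> weight_space D R (\<lambda>h. W k h + al i h)" by (rule weight_space_e[OF u(4)])
    then obtain k' where k': "W k' = (\<lambda>h. W k h + al i h)" using nz by (rule weight_exists)
    then have "W k' hgt = W k hgt + al i hgt" by metis
    then have "of_nat (length (wd k)) = (of_nat (Suc (length (wd k'))) :: complex)" by (simp add: algebra_simps)
    then have "length (wd k) = Suc (length (wd k'))" by (simp only: of_nat_eq_iff)
    moreover have "P (length (wd k'))"
      unfolding P_def using ew nz k' X(4)[OF u(2)] by (intro exI[of _ k'] exI[of _ "e i \<cdot> u"]) (simp only: simp_thms)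
    then have "n \<le> length (wd k')" unfolding n_def by (rule Least_le)
    ultimately show False using u(1) by simp
  qed
  with u that show ?thesis by (auto simp: sing_def)
qed

lemma singular_dominant:
  assumes "s \<in> sing D R X \<gamma>" "s \<noteq> 0"
  shows "\<gamma> \<in> dominant_weights D"
proof -
  have s: "s \<in> weight_space D R \<gamma>" "\<And>i. e i \<cdot> s = 0" using assms(1) by (auto simp: sing_def)
  have "\<exists>m::nat. \<gamma> (co i) = of_nat m" for i
  proof -
    obtain n where "(act (f i) ^^ n) s = 0" using f_nil weight_spaceD(1)[OF s(1)] by blast
    then show ?thesis using sl2_dominant[OF s(1) assms(2) s(2)] by metis
  qed
  then have "\<gamma> (co i) \<in> \<int> \<and> 0 \<le> Re (\<gamma> (co i))" for i
  proof -
    obtain m :: nat where "\<gamma> (co i) = of_nat m" using \<open>\<And>i. \<exists>m::nat. \<gamma> (co i) = of_nat m\<close> by blast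
    then show ?thesis by simp
  qed
  then show ?thesis
    using weight_real[OF s(1) assms(2)] by (simp add: dominant_weights_def weight_lattice_def real_weight_def)
qed

lemma contra_hw_sing: "s \<in> sing D R X \<gamma> \<Longrightarrow> contra_hw D R B s \<gamma>"
  by unfold_locales (auto simp: sing_def)

text \<open>A singular vector is orthogonal to the image of each \<open>f_i\<close>; the letters on
  the other side move across as \<open>e_i\<close>, which preserve the second orbit.\<close>

lemma orbit_orth_singular:
  assumes "b \<in> sing D R X \<gamma>" "b' \<in> sing D R X' \<gamma>'" "B b b' = 0" "x \<in> env_orbit R UNIV b" "x' \<in> env_orbit R UNIV b'"
  shows "B x x' = 0"
proof -
  interpret one: contra_hw D R B b \<gamma> by (rule contra_hw_sing[OF assms(1)])
  interpret two: contra_hw D R B b' \<gamma>' by (rule contra_hw_sing[OF assms(2)])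
  have 1: "B b y = 0" if "y \<in> range two.ev" for y
  proof (rule two.orth_fw[OF one.v_in that])
    show "B b (two.fw w) = 0" for w
      using assms(3) by (cases w) (simp_all add: singular_orth_f one.e_v)
  qed
  have 2: "B (one.fw w) y = 0" if "y \<in> range two.ev" for w y
    using that
  proof (induction w arbitrary: y)
    case (Cons i w)
    have "y \<in> S" using Cons.prems by auto
    then show ?case using Cons.IH[OF two.act_range_ev[OF Cons.prems, of "e i"]] by (simp add: B_f)
  qed (simp add: 1)
  have x: "x \<in> range one.ev" "x' \<in> range two.ev"
    using assms(4,5) by (simp_all add: one.env_orbit_eq two.env_orbit_eq)
  have S: "x \<in> S" "x' \<in> S" using x by auto
  have "B x' x = 0"
  proof (rule one.orth_fw[OF S(2) x(1)])
    show "B x' (one.fw w) = 0" for w using 2[OF x(2)] orth_sym[OF S(2), of "one.fw w"] by simp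
  qed
  then show ?thesis using orth_sym[OF S] by simp
qed

end

section \<open>Internal direct sums\<close>

lemma cspan_Union_sum:
  assumes "\<And>M. M \<in> \<S> \<Longrightarrow> csubspace M" "x \<in> cspan (\<Union>\<S>)"
  obtains F u where "finite F" "F \<subseteq> \<S>" "\<And>M. M \<in> F \<Longrightarrow> u M \<in> M" "x = (\<Sum>M\<in>F. u M)"
proof -
  have "\<exists>F u. finite F \<and> F \<subseteq> \<S> \<and> (\<forall>M\<in>F. u M \<in> M) \<and> x = (\<Sum>M\<in>F. u M)"
    using assms(2)
  proof (induction rule: complex_vector.span_induct_alt)
    case base
    show ?case by (rule exI[of _ "{}"]) simp
  next
    case (step c y z)
    then obtain M F u where M: "M \<in> \<S>" "y \<in> M" and F: "finite F" "F \<subseteq> \<S>" "\<forall>M\<in>F. u M \<in> M" "z = (\<Sum>M\<in>F. u M)"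
      by blast
    let ?u = "\<lambda>N. (if N = M then c *\<^sub>C y else 0) + (if N \<in> F then u N else 0)"
    have "(\<Sum>N\<in>insert M F. ?u N) = (\<Sum>N\<in>insert M F. if N = M then c *\<^sub>C y else 0) + (\<Sum>N\<in>insert M F. if N \<in> F then u N else 0)"
      by (rule sum.distrib)
    also have "(\<Sum>N\<in>insert M F. if N = M then c *\<^sub>C y else 0) = c *\<^sub>C y"
      using F(1) by (simp add: sum.delta)
    also have "(\<Sum>N\<in>insert M F. if N \<in> F then u N else 0) = z"
      unfolding F(4) by (rule sum.mono_neutral_cong_right) (use F(1) in auto)
    finally have "c *\<^sub>C y + z = (\<Sum>N\<in>insert M F. ?u N)" ..
    moreover have "?u N \<in> N" if "N \<in> insert M F" for N
    proof -
      have N: "csubspace N" using that M F(2) assms(1) by auto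
      show ?thesis
        using that M F(3) csubspace_0[OF N] csubspace_scale[OF N] csubspace_add[OF N] by auto
    qed
    ultimately show ?case using F(1,2) M(1) by (intro exI[of _ "insert M F"] exI[of _ ?u]) blast
  qed
  with that show ?thesis by blast
qed

lemma direct_sum_unique:
  assumes "\<And>M. M \<in> \<S> \<Longrightarrow> csubspace M" "\<And>M. M \<in> \<S> \<Longrightarrow> M \<inter> cspan (\<Union>(\<S> - {M})) = {0}"
    and "finite F" "F \<subseteq> \<S>" "\<And>M. M \<in> F \<Longrightarrow> u M \<in> M" "(\<Sum>M\<in>F. u M) = 0" "M \<in> F"
  shows "u M = 0"
proof -
  have "u M + (\<Sum>N\<in>F - {M}. u N) = 0" using assms(3,6,7) by (simp add: sum.remove)
  then have "u M = - (\<Sum>N\<in>F - {M}. u N)" by (simp add: eq_neg_iff_add_eq_0)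
  moreover have "- (\<Sum>N\<in>F - {M}. u N) \<in> cspan (\<Union>(\<S> - {M}))"
    using assms(4,5) by (intro complex_vector.span_neg complex_vector.span_sum cspan_base) blast
  ultimately have "u M \<in> cspan (\<Union>(\<S> - {M}))" by (simp only:)
  with assms(5)[OF assms(7)] have "u M \<in> M \<inter> cspan (\<Union>(\<S> - {M}))" by blast
  then show ?thesis using assms(2,4,7) by blast
qed

context km_algebra begin

lemma n_plus_subspace: "csubspace (n_plus D)"
  unfolding n_plus_def lie_generated_def by (rule complex_vector.subspace_Inter) blast

lemma e_n_plus: "e i \<in> n_plus D"
  unfolding n_plus_def lie_generated_def by blast

lemma hw_model:
  assumes "irr_integrable_hw D \<gamma> R" "shapovalov_form D R B"
  obtains v where "v \<noteq> 0" "contra_hw D R B v \<gamma>" "env_orbit R UNIV v = rep_space R"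
    "\<And>x. x \<in> n_plus D \<Longrightarrow> rep_act R x v = 0"
proof -
  have R: "is_rep br R" "highest_weight_rep D \<gamma> R" using assms(1) by (auto simp: irr_integrable_hw_def)
  then obtain v where v: "v \<in> weight_space D R \<gamma>" "v \<noteq> 0" "\<forall>x\<in>n_plus D. rep_act R x v = 0"
    "env_orbit R UNIV v = rep_space R"
    by (auto simp: highest_weight_rep_def)
  interpret contra_rep D R B by (rule shapovalov_contra[OF R(1) assms(2)])
  have "contra_hw D R B v \<gamma>" by unfold_locales (use v e_n_plus in auto)
  with v that show ?thesis by blast
qed

end

section \<open>Decomposition into irreducible modules and multiplicities\<close>

locale cat_models = cat_rep D R B g wd \<Lambda>
  for D :: "('i::finite, 'h::complex_vector, 'g::complex_vector) km_data"
    and R :: "('g, 'v::complex_vector) rep" and B and g :: "'k \<Rightarrow> 'v" and wd \<Lambda> +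
  fixes V :: "('h \<Rightarrow> complex) \<Rightarrow> ('g, 'u::complex_vector) rep" and shap :: "('h \<Rightarrow> complex) \<Rightarrow> 'u \<Rightarrow> 'u \<Rightarrow> complex"
    and X :: "'v set"
  assumes V: "\<gamma> \<in> dominant_weights D \<Longrightarrow> irr_integrable_hw D \<gamma> (V \<gamma>)"
    and shap: "\<gamma> \<in> dominant_weights D \<Longrightarrow> shapovalov_form D (V \<gamma>) (shap \<gamma>)"
    and X: "submodule R X"
begin

abbreviation "RX \<equiv> R \<lparr> rep_space := X \<rparr>"

lemma X_subspace: "csubspace X" and X_S: "X \<subseteq> S" and X_act: "x \<in> X \<Longrightarrow> y \<cdot> x \<in> X"
  using X by (auto simp: submodule_def)

lemma submodule_RX: "submodule RX M \<longleftrightarrow> submodule R M \<and> M \<subseteq> X"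
  using X_S by (auto simp: submodule_def)

lemma RX_update: "RX \<lparr> rep_space := M \<rparr> = R \<lparr> rep_space := M \<rparr>" by simp

lemma sing_in: "s \<in> sing D R Y \<gamma> \<Longrightarrow> s \<in> Y" "s \<in> sing D R Y \<gamma> \<Longrightarrow> s \<in> weight_space D R \<gamma>"
  "s \<in> sing D R Y \<gamma> \<Longrightarrow> e i \<cdot> s = 0"
  by (auto simp: sing_def)

lemma orbit_iso:
  assumes "s \<in> sing D R X \<gamma>" "s \<noteq> 0"
  shows "\<gamma> \<in> dominant_weights D" "rep_iso (R \<lparr> rep_space := env_orbit R UNIV s \<rparr>) (V \<gamma>)"
proof -
  show d: "\<gamma> \<in> dominant_weights D" by (rule singular_dominant[OF assms])
  obtain v where "v \<noteq> 0" "contra_hw D (V \<gamma>) (shap \<gamma>) v \<gamma>" "env_orbit (V \<gamma>) UNIV v = rep_space (V \<gamma>)"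
    by (rule hw_model[OF V[OF d] shap[OF d]])
  then show "rep_iso (R \<lparr> rep_space := env_orbit R UNIV s \<rparr>) (V \<gamma>)"
    using hw_iso[OF contra_hw_sing[OF assms(1)] _ assms(2)] by blast
qed

text \<open>A maximal orthogonal set of singular vectors, from Zorn's lemma, generates everything:
  otherwise the orthogonal complement in \<open>X\<close>, which is stable under the Cartan
  subalgebra and the \<open>e_i\<close>, contains a further singular vector.\<close>

lemma decomposition_exists: "\<exists>\<S>. hw_decomposition D V RX \<S>"
proof -
  define sg where "sg = {b. b \<noteq> 0 \<and> (\<exists>\<gamma>. b \<in> sing D R X \<gamma>)}"
  define \<A> where "\<A> = {\<B>. \<B> \<subseteq> sg \<and> (\<forall>b\<in>\<B>. \<forall>b'\<in>\<B>. b \<noteq> b' \<longrightarrow> B b b' = 0)}"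
  have "\<exists>\<B>\<in>\<A>. \<forall>\<B>'\<in>\<A>. \<B> \<subseteq> \<B>' \<longrightarrow> \<B>' = \<B>"
  proof (rule subset_Zorn')
    fix C assume C: "subset.chain \<A> C"
    have CA: "C \<subseteq> \<A>" and lin: "\<And>P Q. P \<in> C \<Longrightarrow> Q \<in> C \<Longrightarrow> P \<subseteq> Q \<or> Q \<subseteq> P"
      using C by (auto simp: subset_chain_def)
    have "B b b' = 0" if bb: "b \<in> \<Union>C" "b' \<in> \<Union>C" "b \<noteq> b'" for b b'
    proof -
      obtain P Q where "P \<in> C" "b \<in> P" "Q \<in> C" "b' \<in> Q" using bb(1,2) by blast
      then obtain P' where "P' \<in> C" "b \<in> P'" "b' \<in> P'" using lin[of P Q] by blast
      then show ?thesis using CA bb(3) by (auto simp: \<A>_def)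
    qed
    then show "\<Union>C \<in> \<A>" using CA by (auto simp: \<A>_def)
  qed
  then obtain \<B> where \<B>: "\<B> \<in> \<A>" and max: "\<And>\<B>'. \<B>' \<in> \<A> \<Longrightarrow> \<B> \<subseteq> \<B>' \<Longrightarrow> \<B>' = \<B>" by blast
  have sgB: "b \<in> sg" if "b \<in> \<B>" for b using \<B> that by (auto simp: \<A>_def)
  have orthB: "B b b' = 0" if "b \<in> \<B>" "b' \<in> \<B>" "b \<noteq> b'" for b b' using \<B> that by (auto simp: \<A>_def)
  let ?O = "env_orbit R UNIV"
  define \<S> where "\<S> = ?O ` \<B>"
  have bX: "b \<in> X" if "b \<in> \<B>" for b using sgB[OF that] sing_in(1) by (auto simp: sg_def)
  have OX: "?O b \<subseteq> X" if "b \<in> \<B>" for b by (rule submodule_orbit[OF X bX[OF that]])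
  have O_orth: "B x x' = 0" if bb: "b \<in> \<B>" "b' \<in> \<B>" "b \<noteq> b'" "x \<in> ?O b" "x' \<in> ?O b'" for b b' x x'
  proof -
    obtain \<gamma> \<gamma>' where "b \<in> sing D R X \<gamma>" "b' \<in> sing D R X \<gamma>'"
      using sgB[OF bb(1)] sgB[OF bb(2)] by (auto simp: sg_def)
    then show ?thesis by (rule orbit_orth_singular[OF _ _ orthB[OF bb(1-3)] bb(4,5)])
  qed
  define Y where "Y = cspan (\<Union>\<S>)"
  have YX: "Y \<subseteq> X" unfolding Y_def \<S>_def using OX X_subspace by (intro cspan_minimal) auto
  have YS: "Y \<subseteq> S" using YX X_S by blast
  have Y_act: "y \<cdot> x \<in> Y" if "x \<in> Y" for y x
  proof -
    have "y \<cdot> u \<in> Y" if u: "u \<in> \<Union>\<S>" for u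
    proof -
      obtain b where b: "b \<in> \<B>" "u \<in> ?O b" using u by (auto simp: \<S>_def)
      then have "b \<in> S" using bX X_S by blast
      from env_orbit_stable[OF this UNIV_I b(2)] have "y \<cdot> u \<in> \<Union>\<S>" using b(1) by (auto simp: \<S>_def)
      then show ?thesis unfolding Y_def by (rule cspan_base)
    qed
    moreover have "\<Union>\<S> \<subseteq> Y" unfolding Y_def by (rule complex_vector.span_superset)
    ultimately have "\<Union>\<S> \<subseteq> {u \<in> S. y \<cdot> u \<in> Y}" using YS by blast
    moreover have "csubspace {u \<in> S. y \<cdot> u \<in> Y}"
      by (rule csubspaceI) (simp_all add: act_add_right act_scale_right Y_def complex_vector.span_zero
          complex_vector.span_add complex_vector.span_scale)
    ultimately have "Y \<subseteq> {u \<in> S. y \<cdot> u \<in> Y}" using cspan_minimal[of "\<Union>\<S>"] by (simp add: Y_def)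
    then show ?thesis using that by blast
  qed
  have "Y = X"
  proof (rule ccontr)
    assume "Y \<noteq> X"
    then obtain x where x: "x \<in> X" "x \<notin> Y" using YX by blast
    obtain \<Gamma> u where *: "finite \<Gamma>" "\<And>\<gamma>. u \<gamma> \<in> weight_space D R \<gamma>" "x = (\<Sum>\<gamma>\<in>\<Gamma>. u \<gamma>)"
      by (rule weight_decomp[OF subsetD[OF X_S x(1)]]) blast
    have uX: "u \<gamma> \<in> X" if "\<gamma> \<in> \<Gamma>" for \<gamma>
      by (rule weight_components[of X \<Gamma> u]) (use X_subspace X_act x(1) * that in auto)
    \<comment> \<open>Projection onto \<open>Y\<close> is available for weight vectors, so a weight
      component of \<open>x\<close> outside \<open>Y\<close> is taken.\<close>
    obtain \<gamma> where \<gamma>: "\<gamma> \<in> \<Gamma>" "u \<gamma> \<notin> Y"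
      using x(2) *(3) by (metis Y_def complex_vector.span_sum)
    obtain y where y: "y \<in> Y" "\<And>s. s \<in> Y \<Longrightarrow> B (u \<gamma> - y) s = 0"
      by (rule orth_decomp[OF _ YS Y_act *(2)[of \<gamma>]]) (simp_all add: Y_def)
    define Z where "Z = {z \<in> X. \<forall>s\<in>Y. B z s = 0}"
    have sS: "s \<in> S" if "s \<in> Y" for s using that YS by blast
    have zS: "z \<in> S" if "z \<in> Z" for z using that X_S by (auto simp: Z_def)
    have Z1: "csubspace Z"
      unfolding Z_def using X_subspace X_S YS
      by (intro csubspaceI) (auto simp: csubspace_0 csubspace_add csubspace_scale zero_left add_left scale_left subset_iff)
    have Z2: "Z \<subseteq> S" using zS by blast
    have Z3: "cart h \<cdot> z \<in> Z" if z: "z \<in> Z" for h z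
    proof -
      have "B (cart h \<cdot> z) s = 0" if s: "s \<in> Y" for s
        by (rule B_h_complex[OF zS[OF z] sS[OF s]]) (use z Y_act[OF s] in \<open>auto simp: Z_def\<close>)
      then show ?thesis using z X_act by (auto simp: Z_def)
    qed
    have Z4: "e i \<cdot> z \<in> Z" if z: "z \<in> Z" for i z
    proof -
      have "B (e i \<cdot> z) s = 0" if s: "s \<in> Y" for s
        using B_e[OF zS[OF z] sS[OF s], of i] z Y_act[OF s] by (auto simp: Z_def)
      then show ?thesis using z X_act by (auto simp: Z_def)
    qed
    have Z5: "u \<gamma> - y \<in> Z"
      using uX[OF \<gamma>(1)] y YX csubspace_diff[OF X_subspace] by (auto simp: Z_def)
    have nz: "u \<gamma> - y \<noteq> 0" using \<gamma>(2) y(1) by auto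
    obtain s \<delta> where s: "s \<in> sing D R Z \<delta>" "s \<noteq> 0"
      by (rule singular_exists[OF Z1 Z2 _ _ Z5 nz], erule Z3, erule Z4, blast)
    have sZ: "s \<in> Z" using s(1) by (rule sing_in)
    have BY: "b \<in> Y" if "b \<in> \<B>" for b
      unfolding Y_def \<S>_def using that env_orbit_base by (intro cspan_base) blast
    have sb: "B s b = 0" "B b s = 0" if "b \<in> \<B>" for b
      using sZ BY[OF that] orth_sym[OF zS[OF sZ] sS[OF BY[OF that]]] by (auto simp: Z_def)
    have "s \<in> sg" using s sZ by (auto simp: sg_def sing_def Z_def)
    then have "insert s \<B> \<in> \<A>" using sgB orthB sb by (auto simp: \<A>_def)
    then have "s \<in> \<B>" using max[of "insert s \<B>"] by blast
    then have "B s s = 0" by (rule sb)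
    then show False using definite[OF zS[OF sZ]] s(2) by blast
  qed
  moreover have "M \<inter> cspan (\<Union>(\<S> - {M})) = {0}" if M: "M \<in> \<S>" for M
  proof -
    obtain b where b: "b \<in> \<B>" "M = ?O b" using M by (auto simp: \<S>_def)
    have "x = 0" if x: "x \<in> M" "x \<in> cspan (\<Union>(\<S> - {M}))" for x
    proof -
      have xS: "x \<in> S" using x(1) b OX X_S by blast
      have "B x x = 0"
      proof (rule orth_cspan[OF _ xS _ x(2)])
        show "\<Union>(\<S> - {M}) \<subseteq> S" using OX X_S by (auto simp: \<S>_def)
        fix y assume "y \<in> \<Union>(\<S> - {M})"
        then obtain b' where "b' \<in> \<B>" "?O b' \<noteq> M" "y \<in> ?O b'" by (auto simp: \<S>_def)
        then show "B x y = 0" using O_orth[OF b(1)] x(1) b(2) by blast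
      qed
      then show "x = 0" by (rule definite[OF xS])
    qed
    moreover have "0 \<in> M" using env_orbit_subspace[of UNIV b] b(2) csubspace_0 by blast
    ultimately show ?thesis using complex_vector.span_zero by blast
  qed
  moreover have "submodule RX M \<and> (\<exists>\<gamma>\<in>dominant_weights D. rep_iso (RX \<lparr> rep_space := M \<rparr>) (V \<gamma>))" if M: "M \<in> \<S>" for M
  proof -
    obtain b where b: "b \<in> \<B>" "M = ?O b" using M by (auto simp: \<S>_def)
    obtain \<gamma> where \<gamma>: "b \<in> sing D R X \<gamma>" "b \<noteq> 0" using sgB[OF b(1)] by (auto simp: sg_def)
    have "b \<in> S" using bX[OF b(1)] X_S by blast
    then show ?thesis
      unfolding submodule_RX RX_update b(2) using env_orbit_submodule OX[OF b(1)] orbit_iso[OF \<gamma>] by blast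
  qed
  ultimately have "hw_decomposition D V RX \<S>"
    unfolding hw_decomposition_def by (simp add: Y_def)
  then show ?thesis ..
qed

lemma sing_subspace: "csubspace (sing D R X \<nu>)"
  using csubspace_0[OF weight_space_subspace[of \<nu>]] csubspace_add[OF weight_space_subspace[of \<nu>]]
    csubspace_scale[OF weight_space_subspace[of \<nu>]] X_subspace weight_spaceD(1)
  by (intro csubspaceI) (auto simp: sing_def csubspace_0 csubspace_add csubspace_scale act_add_right act_scale_right)

lemma sing_fin_dim: "fin_dim (sing D R X \<nu>)"
  by (rule fin_dim_subset[OF weight_fin_dim[of \<nu>]]) (auto simp: sing_def)

text \<open>A summand isomorphic to \<open>V \<nu>\<close> contains exactly one line of singular
  vectors of weight \<open>\<nu>\<close>, any other summand none. A singular vector of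
  \<open>X\<close> has singular components, so one vector from each such line gives a basis.\<close>

lemma decomposition_count:
  assumes dec: "hw_decomposition D V RX \<S>" and \<nu>: "\<nu> \<in> dominant_weights D"
  shows "finite {M \<in> \<S>. rep_iso (RX \<lparr> rep_space := M \<rparr>) (V \<nu>)}"
    and "card {M \<in> \<S>. rep_iso (RX \<lparr> rep_space := M \<rparr>) (V \<nu>)} = cdim (sing D R X \<nu>)"
proof -
  define I where "I = {M \<in> \<S>. rep_iso (RX \<lparr> rep_space := M \<rparr>) (V \<nu>)}"
  have sub: "submodule R M" "M \<subseteq> X" if "M \<in> \<S>" for M
    using dec that unfolding hw_decomposition_def submodule_RX by blast+
  have M_subspace: "csubspace M" if "M \<in> \<S>" for M using sub(1)[OF that] by (simp add: submodule_def)
  have M_act: "y \<cdot> x \<in> M" if "M \<in> \<S>" "x \<in> M" for M x y using sub(1)[OF that(1)] that(2) by (simp add: submodule_def)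
  have M_S: "x \<in> S" if "M \<in> \<S>" "x \<in> M" for M x using sub that X_S by blast
  have span: "cspan (\<Union>\<S>) = X" using dec by (simp add: hw_decomposition_def)
  have indep: "M \<inter> cspan (\<Union>(\<S> - {M})) = {0}" if "M \<in> \<S>" for M using dec that by (simp add: hw_decomposition_def)
  obtain v\<nu> where v\<nu>: "v\<nu> \<noteq> 0" "contra_hw D (V \<nu>) (shap \<nu>) v\<nu> \<nu>" "env_orbit (V \<nu>) UNIV v\<nu> = rep_space (V \<nu>)"
    by (rule hw_model[OF V[OF \<nu>] shap[OF \<nu>]])
  interpret N: contra_hw D "V \<nu>" "shap \<nu>" v\<nu> \<nu> by (rule v\<nu>(2))
  have rw: "real_weight \<gamma>" if "\<gamma> \<in> dominant_weights D" for \<gamma>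
    using that by (simp add: dominant_weights_def weight_lattice_def real_weight_def)
  have one_dim: "\<exists>s. s \<in> sing D R M \<nu> \<and> s \<noteq> 0 \<and> (\<forall>x\<in>sing D R M \<nu>. \<exists>c. x = c *\<^sub>C s)" if M: "M \<in> I" for M
  proof -
    have MS: "M \<in> \<S>" using M by (simp add: I_def)
    obtain \<phi> where \<phi>: "bij_betw \<phi> M (rep_space (V \<nu>))"
      "\<And>v v'. v \<in> M \<Longrightarrow> v' \<in> M \<Longrightarrow> \<phi> (v + v') = \<phi> v + \<phi> v'" "\<And>a v. v \<in> M \<Longrightarrow> \<phi> (a *\<^sub>C v) = a *\<^sub>C \<phi> v"
      "\<And>x v. v \<in> M \<Longrightarrow> \<phi> (x \<cdot> v) = rep_act (V \<nu>) x (\<phi> v)"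
      using M unfolding I_def rep_iso_def RX_update rep_update by blast
    have inj: "x = y" if "x \<in> M" "y \<in> M" "\<phi> x = \<phi> y" for x y
      using \<phi>(1) that by (auto simp: bij_betw_def inj_on_def)
    have \<phi>0: "\<phi> 0 = 0" using \<phi>(3)[of 0 0] csubspace_0[OF M_subspace[OF MS]] by simp
    have "v\<nu> \<in> \<phi> ` M" using \<phi>(1) N.v_in by (simp add: bij_betw_def)
    then obtain s where s: "s \<in> M" "\<phi> s = v\<nu>" by blast
    have "s \<in> sing D R M \<nu>"
      unfolding sing_def weight_space_def
    proof (intro CollectI conjI allI)
      show "cart h \<cdot> s = \<nu> h *\<^sub>C s" for h
        by (rule inj) (use s M_act[OF MS] csubspace_scale[OF M_subspace[OF MS]] N.weight_spaceD(2)[OF N.v_weight] \<phi>(3,4) in auto)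
      show "e i \<cdot> s = 0" for i
        by (rule inj) (use s M_act[OF MS] csubspace_0[OF M_subspace[OF MS]] N.e_v \<phi>(4) \<phi>0 in auto)
    qed (use s M_S[OF MS] in auto)
    moreover have "s \<noteq> 0" using s(2) \<phi>0 v\<nu>(1) by auto
    moreover have "\<exists>c. x = c *\<^sub>C s" if x: "x \<in> sing D R M \<nu>" for x
    proof (cases "x = 0")
      case True
      then show ?thesis by (intro exI[of _ 0]) simp
    next
      case False
      have xM: "x \<in> M" using x by (rule sing_in)
      have \<phi>x: "\<phi> x \<noteq> 0" using inj[OF xM csubspace_0[OF M_subspace[OF MS]]] \<phi>0 False by auto
      have \<phi>xS: "\<phi> x \<in> rep_space (V \<nu>)" using \<phi>(1) xM by (auto simp: bij_betw_def)
      have "\<phi> x \<in> cspan {v\<nu>}"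
      proof (rule N.singular_in_orbit(2))
        show "\<phi> x \<in> range N.ev" using \<phi>xS v\<nu>(3) N.env_orbit_eq by simp
        show "rep_act (V \<nu>) (e i) (\<phi> x) = 0" for i using \<phi>(4)[OF xM, of "e i"] sing_in(3)[OF x] \<phi>0 by simp
        have "rep_act (V \<nu>) (cart h) (\<phi> x) = \<nu> h *\<^sub>C \<phi> x" for h
          by (simp only: \<phi>(4)[OF xM, symmetric] weight_spaceD(2)[OF sing_in(2)[OF x]] \<phi>(3)[OF xM])
        then show "\<phi> x \<in> weight_space D (V \<nu>) \<nu>" using \<phi>xS by (simp add: weight_space_def)
      qed (use \<phi>x rw[OF \<nu>] v\<nu>(1) in auto)
      then obtain c where "\<phi> x = c *\<^sub>C v\<nu>" by (auto simp: complex_vector.span_singleton)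
      then have "x = c *\<^sub>C s"
        by (intro inj) (use s \<phi>(3) xM csubspace_scale[OF M_subspace[OF MS]] in auto)
      then show ?thesis ..
    qed
    ultimately show ?thesis by blast
  qed
  have no_sing: "x = 0" if M: "M \<in> \<S>" "M \<notin> I" and x: "x \<in> sing D R M \<nu>" for M x
  proof (rule ccontr)
    assume "x \<noteq> 0"
    obtain \<gamma> where \<gamma>: "\<gamma> \<in> dominant_weights D" "rep_iso (RX \<lparr> rep_space := M \<rparr>) (V \<gamma>)"
      using dec M(1) unfolding hw_decomposition_def by blast
    obtain \<phi> where \<phi>: "bij_betw \<phi> M (rep_space (V \<gamma>))"
      "\<And>v v'. v \<in> M \<Longrightarrow> v' \<in> M \<Longrightarrow> \<phi> (v + v') = \<phi> v + \<phi> v'" "\<And>a v. v \<in> M \<Longrightarrow> \<phi> (a *\<^sub>C v) = a *\<^sub>C \<phi> v"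
      "\<And>x v. v \<in> M \<Longrightarrow> \<phi> (x \<cdot> v) = rep_act (V \<gamma>) x (\<phi> v)"
      using \<gamma>(2) unfolding rep_iso_def RX_update rep_update by blast
    obtain v\<gamma> where v\<gamma>: "v\<gamma> \<noteq> 0" "contra_hw D (V \<gamma>) (shap \<gamma>) v\<gamma> \<gamma>" "env_orbit (V \<gamma>) UNIV v\<gamma> = rep_space (V \<gamma>)"
      by (rule hw_model[OF V[OF \<gamma>(1)] shap[OF \<gamma>(1)]])
    interpret G: contra_hw D "V \<gamma>" "shap \<gamma>" v\<gamma> \<gamma> by (rule v\<gamma>(2))
    have xM: "x \<in> M" using x by (rule sing_in)
    have M0: "0 \<in> M" by (rule csubspace_0[OF M_subspace[OF M(1)]])
    have \<phi>0: "\<phi> 0 = 0" using \<phi>(3)[of 0 0] M0 by simp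
    have \<phi>x: "\<phi> x \<noteq> 0" using \<phi>(1) \<phi>0 \<open>x \<noteq> 0\<close> xM M0 by (auto simp: bij_betw_def inj_on_def)
    have \<phi>xS: "\<phi> x \<in> rep_space (V \<gamma>)" using \<phi>(1) xM by (auto simp: bij_betw_def)
    have "\<nu> = \<gamma>"
    proof (rule G.singular_in_orbit(1))
      show "\<phi> x \<in> range G.ev" using \<phi>xS v\<gamma>(3) G.env_orbit_eq by simp
      show "rep_act (V \<gamma>) (e i) (\<phi> x) = 0" for i using \<phi>(4)[OF xM, of "e i"] sing_in(3)[OF x] \<phi>0 by simp
        have "rep_act (V \<gamma>) (cart h) (\<phi> x) = \<nu> h *\<^sub>C \<phi> x" for h
          by (simp only: \<phi>(4)[OF xM, symmetric] weight_spaceD(2)[OF sing_in(2)[OF x]] \<phi>(3)[OF xM])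
        then show "\<phi> x \<in> weight_space D (V \<gamma>) \<nu>" using \<phi>xS by (simp add: weight_space_def)
    qed (use \<phi>x rw[OF \<nu>] rw[OF \<gamma>(1)] v\<gamma>(1) in auto)
    then show False using M \<gamma>(2) by (simp add: I_def)
  qed
  obtain s where s: "\<And>M. M \<in> I \<Longrightarrow> s M \<in> sing D R M \<nu>" "\<And>M. M \<in> I \<Longrightarrow> s M \<noteq> 0"
    "\<And>M x. M \<in> I \<Longrightarrow> x \<in> sing D R M \<nu> \<Longrightarrow> \<exists>c. x = c *\<^sub>C s M"
    using one_dim by metis
  have IS: "M \<in> \<S>" if "M \<in> I" for M using that by (simp add: I_def)
  have sM: "s M \<in> M" if "M \<in> I" for M using s(1)[OF that] by (rule sing_in)
  have s_inj: "inj_on s I"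
  proof (rule inj_onI, rule ccontr)
    fix M M' assume M: "M \<in> I" "M' \<in> I" "s M = s M'" "M \<noteq> M'"
    have "s M \<in> cspan (\<Union>(\<S> - {M}))"
      using M sM[OF M(2)] IS by (intro cspan_base) auto
    then have "s M = 0" using indep[OF IS[OF M(1)]] sM[OF M(1)] by blast
    then show False using s(2) M(1) by blast
  qed
  have s_indep: "\<not> cdependent (s ` I)"
    unfolding complex_vector.independent_explicit_module
  proof (intro allI impI)
    fix t u v assume t: "finite t" "t \<subseteq> s ` I" "(\<Sum>v\<in>t. u v *\<^sub>C v) = 0" "v \<in> t"
    define F where "F = {M \<in> I. s M \<in> t}"
    have F: "F \<subseteq> I" "s ` F = t" using t(2) by (auto simp: F_def)
    have "inj_on s F" using s_inj F(1) by (rule inj_on_subset)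
    then have "finite F" using t(1) F(2) finite_image_iff by blast
    have "(\<Sum>M\<in>F. u (s M) *\<^sub>C s M) = 0"
      using t(3) unfolding F(2)[symmetric] sum.reindex[OF \<open>inj_on s F\<close>] by simp
    moreover obtain M where M: "M \<in> F" "v = s M" using t(4) F(2) by blast
    ultimately have "u (s M) *\<^sub>C s M = 0"
      using F(1) IS sM csubspace_scale[OF M_subspace]
      by (intro direct_sum_unique[OF M_subspace indep \<open>finite F\<close>, of "\<lambda>M. u (s M) *\<^sub>C s M"]) auto
    then show "u v = 0" using s(2) M F(1) by auto
  qed
  have s_sing: "s ` I \<subseteq> sing D R X \<nu>"
    using s(1) sub(2) IS by (auto simp: sing_def)
  have s_span: "sing D R X \<nu> \<subseteq> cspan (s ` I)"
  proof
    fix x assume x: "x \<in> sing D R X \<nu>"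
    then have xc: "x \<in> cspan (\<Union>\<S>)" using sing_in(1) span by blast
    obtain F u where F: "finite F" "F \<subseteq> \<S>" "\<And>M. M \<in> F \<Longrightarrow> u M \<in> M" "x = (\<Sum>M\<in>F. u M)"
      by (rule cspan_Union_sum[OF _ xc], erule M_subspace, blast)
    have uS: "u M \<in> S" if "M \<in> F" for M using that F(2,3) M_S by blast
    have "u M \<in> cspan (s ` I)" if M: "M \<in> F" for M
    proof -
      have MS: "M \<in> \<S>" using M F(2) by blast
      have "e i \<cdot> u M = 0" for i
      proof (rule direct_sum_unique[OF M_subspace indep F(1,2) _ _ M, of "\<lambda>M. e i \<cdot> u M"])
        show "(\<Sum>M\<in>F. e i \<cdot> u M) = 0"
          using sing_in(3)[OF x, of i] uS by (simp add: F(4) act_sum_right)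
      qed (use F(2,3) M_act in auto)
      moreover have "cart h \<cdot> u M - \<nu> h *\<^sub>C u M = 0" for h
      proof (rule direct_sum_unique[OF M_subspace indep F(1,2) _ _ M, of "\<lambda>M. cart h \<cdot> u M - \<nu> h *\<^sub>C u M"])
        show "(\<Sum>M\<in>F. cart h \<cdot> u M - \<nu> h *\<^sub>C u M) = 0"
          using weight_spaceD(2)[OF sing_in(2)[OF x], of h] uS
          by (simp add: F(4) act_sum_right sum_subtractf scaleC_sum_right)
        show "cart h \<cdot> u M' - \<nu> h *\<^sub>C u M' \<in> M'" if "M' \<in> F" for M'
          using that F(2,3) M_act M_subspace by (intro csubspace_diff csubspace_scale) auto
      qed
      ultimately have "u M \<in> sing D R M \<nu>"
        using F(3)[OF M] uS[OF M] by (simp add: sing_def weight_space_def)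
      then show ?thesis
        using s(3)[of M "u M"] no_sing[OF MS, of "u M"] complex_vector.span_zero
          complex_vector.span_scale[OF cspan_base, of "s M" "s ` I"] by (cases "M \<in> I") auto
    qed
    then show "x \<in> cspan (s ` I)" unfolding F(4) by (rule complex_vector.span_sum)
  qed
  have "finite (s ` I)"
  proof -
    obtain C where "finite C" "sing D R X \<nu> \<subseteq> cspan C" using sing_fin_dim unfolding fin_dim_def by blast
    then show ?thesis using complex_vector.independent_span_bound[of C "s ` I"] s_indep s_sing by blast
  qed
  then show "finite {M \<in> \<S>. rep_iso (RX \<lparr> rep_space := M \<rparr>) (V \<nu>)}"
    unfolding I_def[symmetric] using finite_image_iff[OF s_inj] by blast
  have "card I = card (s ` I)" using card_image[OF s_inj] by simp
  also have "\<dots> = cdim (sing D R X \<nu>)"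
    by (rule complex_vector.basis_card_eq_dim[OF s_sing s_span s_indep])
  finally show "card {M \<in> \<S>. rep_iso (RX \<lparr> rep_space := M \<rparr>) (V \<nu>)} = cdim (sing D R X \<nu>)"
    by (simp only: I_def)
qed

theorem multiplicity_eq: "\<nu> \<in> dominant_weights D \<Longrightarrow> rep_multiplicity D V RX \<nu> = cdim (sing D R X \<nu>)"
  unfolding rep_multiplicity_def
proof (rule the_equality)
  assume \<nu>: "\<nu> \<in> dominant_weights D"
  obtain \<S> where "hw_decomposition D V RX \<S>" using decomposition_exists by blast
  with decomposition_count[OF this \<nu>]
  show "\<exists>\<S>. hw_decomposition D V RX \<S> \<and> finite {M \<in> \<S>. rep_iso (RX \<lparr> rep_space := M \<rparr>) (V \<nu>)}
    \<and> card {M \<in> \<S>. rep_iso (RX \<lparr> rep_space := M \<rparr>) (V \<nu>)} = cdim (sing D R X \<nu>)" by blast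
  fix c assume "\<exists>\<S>. hw_decomposition D V RX \<S> \<and> finite {M \<in> \<S>. rep_iso (RX \<lparr> rep_space := M \<rparr>) (V \<nu>)}
    \<and> card {M \<in> \<S>. rep_iso (RX \<lparr> rep_space := M \<rparr>) (V \<nu>)} = c"
  then show "c = cdim (sing D R X \<nu>)" using decomposition_count(2)[OF _ \<nu>] by auto
qed

end

subsection \<open>The product form on a tensor product\<close>

text \<open>Gram--Schmidt keeping the orthogonal vectors themselves; 0 is excluded so that each of
  them has positive norm.\<close>

lemma (in hermitian) orthogonal_spanning_set:
  assumes "finite X" "X \<subseteq> S"
  shows "\<exists>Y. finite Y \<and> Y \<subseteq> S \<and> 0 \<notin> Y \<and> (\<forall>y\<in>Y. \<forall>y'\<in>Y. y \<noteq> y' \<longrightarrow> B y y' = 0) \<and> X \<subseteq> cspan Y"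
  using assms
proof (induction X)
  case empty
  show ?case by (rule exI[of _ "{}"]) simp
next
  case (insert a X)
  then obtain Y where Y: "finite Y" "Y \<subseteq> S" "0 \<notin> Y" "\<forall>y\<in>Y. \<forall>y'\<in>Y. y \<noteq> y' \<longrightarrow> B y y' = 0" "X \<subseteq> cspan Y" by auto
  obtain u where u: "u \<in> cspan Y" "\<forall>s\<in>cspan Y. B (a - u) s = 0"
    using orth_complement_exists_cspan[OF Y(1,2), of a] insert.prems by auto
  have YS: "cspan Y \<subseteq> S" using Y(2) S by (intro cspan_minimal) auto
  define c where "c = a - u"
  have cS: "c \<in> S" unfolding c_def using insert.prems u(1) YS by (intro csubspace_diff[OF S]) auto
  show ?case
  proof (cases "c = 0")
    case True
    then show ?thesis using Y u(1) by (intro exI[of _ Y]) (auto simp: c_def)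
  next
    case False
    have cy: "B c y = 0" "B y c = 0" if "y \<in> Y" for y
      using u(2) that Y(2) orth_sym[OF cS, of y] by (auto simp: c_def cspan_base)
    have sub: "cspan Y \<subseteq> cspan (insert c Y)" by (rule complex_vector.span_mono) auto
    have "c + u \<in> cspan (insert c Y)"
      using u(1) sub by (intro complex_vector.span_add) (auto intro: cspan_base)
    then have "a \<in> cspan (insert c Y)" by (simp add: c_def)
    moreover have "\<forall>y\<in>insert c Y. \<forall>y'\<in>insert c Y. y \<noteq> y' \<longrightarrow> B y y' = 0"
      using Y(4) cy by blast
    ultimately show ?thesis
      using Y cS False sub by (intro exI[of _ "insert c Y"]) auto
  qed
qed

text \<open>\<open>X\<close> is fixed before \<open>Y\<close>, so that an orthogonal
  \<open>Y\<close> spanning \<open>X\<close> can be chosen afterwards; positivity of the product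
  form depends on this order.\<close>

lemma tensor_space_expand:
  assumes "csubspace B" "t \<in> tensor_space A B"
  obtains X where "finite X" "X \<subseteq> A"
    "\<And>Y. finite Y \<Longrightarrow> X \<subseteq> cspan Y \<Longrightarrow> \<exists>w. (\<forall>y\<in>Y. w y \<in> B) \<and> t = (\<Sum>y\<in>Y. pure_tensor y (w y))"
proof -
  have "\<exists>X. finite X \<and> X \<subseteq> A \<and> (\<forall>Y. finite Y \<longrightarrow> X \<subseteq> cspan Y
      \<longrightarrow> (\<exists>w. (\<forall>y\<in>Y. w y \<in> B) \<and> t = (\<Sum>y\<in>Y. pure_tensor y (w y))))"
    using assms(2)
  proof (induction rule: tensor_space_induct)
    case (pure v u)
    show ?case
    proof (intro exI[of _ "{v}"] conjI allI impI)
      fix Y assume Y: "finite Y" "{v} \<subseteq> cspan Y"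
      then obtain c where c: "v = (\<Sum>y\<in>Y. c y *\<^sub>C y)" by (auto simp: complex_vector.span_finite)
      have "pure_tensor v u = (\<Sum>y\<in>Y. pure_tensor y (c y *\<^sub>C u))"
        by (simp add: c pure_tensor_sum_left pure_tensor_scale_left pure_tensor_scale_right)
      then show "\<exists>w. (\<forall>y\<in>Y. w y \<in> B) \<and> pure_tensor v u = (\<Sum>y\<in>Y. pure_tensor y (w y))"
        using csubspace_scale[OF assms(1) pure(2)] by (intro exI[of _ "\<lambda>y. c y *\<^sub>C u"]) blast
    qed (use pure in auto)
  next
    case zero
    show ?case by (intro exI[of _ "{}"] conjI allI impI exI[of _ "\<lambda>_. 0"]) (simp_all add: csubspace_0[OF assms(1)])
  next
    case (add s t)
    then obtain X X' where X: "finite X" "X \<subseteq> A" "\<And>Y. finite Y \<Longrightarrow> X \<subseteq> cspan Y \<Longrightarrow> \<exists>w. (\<forall>y\<in>Y. w y \<in> B) \<and> s = (\<Sum>y\<in>Y. pure_tensor y (w y))"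
      and X': "finite X'" "X' \<subseteq> A" "\<And>Y. finite Y \<Longrightarrow> X' \<subseteq> cspan Y \<Longrightarrow> \<exists>w. (\<forall>y\<in>Y. w y \<in> B) \<and> t = (\<Sum>y\<in>Y. pure_tensor y (w y))"
      by blast
    show ?case
    proof (intro exI[of _ "X \<union> X'"] conjI allI impI)
      fix Y assume Y: "finite Y" "X \<union> X' \<subseteq> cspan Y"
      obtain w w' where w: "\<forall>y\<in>Y. w y \<in> B" "s = (\<Sum>y\<in>Y. pure_tensor y (w y))"
        "\<forall>y\<in>Y. w' y \<in> B" "t = (\<Sum>y\<in>Y. pure_tensor y (w' y))"
        using X(3)[of Y] X'(3)[of Y] Y by auto
      then show "\<exists>w. (\<forall>y\<in>Y. w y \<in> B) \<and> s + t = (\<Sum>y\<in>Y. pure_tensor y (w y))"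
        by (intro exI[of _ "\<lambda>y. w y + w' y"]) (simp add: pure_tensor_add_right sum.distrib csubspace_add[OF assms(1)])
    qed (use X X' in auto)
  next
    case (scale a s)
    then obtain X where X: "finite X" "X \<subseteq> A" "\<And>Y. finite Y \<Longrightarrow> X \<subseteq> cspan Y \<Longrightarrow> \<exists>w. (\<forall>y\<in>Y. w y \<in> B) \<and> s = (\<Sum>y\<in>Y. pure_tensor y (w y))"
      by blast
    show ?case
    proof (intro exI[of _ X] conjI allI impI)
      fix Y assume Y: "finite Y" "X \<subseteq> cspan Y"
      obtain w where w: "\<forall>y\<in>Y. w y \<in> B" "s = (\<Sum>y\<in>Y. pure_tensor y (w y))" using X(3)[OF Y] by blast
      then show "\<exists>w. (\<forall>y\<in>Y. w y \<in> B) \<and> a *\<^sub>C s = (\<Sum>y\<in>Y. pure_tensor y (w y))"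
        by (intro exI[of _ "\<lambda>y. a *\<^sub>C w y"]) (simp add: pure_tensor_scale_right scaleC_sum_right csubspace_scale[OF assms(1)])
    qed (use X in auto)
  qed
  with that show ?thesis by blast
qed

lemma (in hermitian) B_real: "v \<in> S \<Longrightarrow> B v v = of_real (Re (B v v))"
  using cnj_sym[of v v] by (simp add: complex_eq_iff)

text \<open>The universal property is applied to one argument at a time, with conjugations because
  it lifts only bilinear maps. Definiteness follows by expanding along an orthogonal family in the
  first factor.\<close>

lemma hermitian_tensor:
  assumes "hermitian A1 B1" "hermitian A2 B2"
  shows "\<exists>BT. hermitian (tensor_space A1 A2) BT \<and> (\<forall>v\<in>A1. \<forall>w\<in>A2. \<forall>v'\<in>A1. \<forall>w'\<in>A2.
    BT (pure_tensor v w) (pure_tensor v' w') = B1 v v' * B2 w w')"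
proof -
  interpret one: hermitian A1 B1 by (rule assms(1))
  interpret two: hermitian A2 B2 by (rule assms(2))
  let ?T = "tensor_space A1 A2"
  have T0: "0 \<in> ?T" and Tadd: "\<And>s t. s \<in> ?T \<Longrightarrow> t \<in> ?T \<Longrightarrow> s + t \<in> ?T"
    and Tscale: "\<And>a s. s \<in> ?T \<Longrightarrow> a *\<^sub>C s \<in> ?T"
    using tensor_space_subspace[of A1 A2] by (auto simp: csubspace_0 csubspace_add csubspace_scale)
  have "\<exists>L. clinear L \<and> (\<forall>v\<in>A1. \<forall>w\<in>A2. L (pure_tensor v w) = B1 v v' * B2 w w')"
    if vw: "v' \<in> A1" "w' \<in> A2" for v' w'
  proof -
    obtain L where "clinear L" "\<And>v w. v \<in> A1 \<Longrightarrow> w \<in> A2 \<Longrightarrow> L (pure_tensor v w) = B1 v v' * B2 w w'"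
      by (rule tensor_lift_on[OF one.S two.S, of "\<lambda>v w. B1 v v' * B2 w w'"])
        (simp_all add: vw one.add_left two.add_left one.scale_left two.scale_left scaleC_complex algebra_simps)
    then show ?thesis by blast
  qed
  then obtain L where L: "\<And>v' w'. v' \<in> A1 \<Longrightarrow> w' \<in> A2 \<Longrightarrow> clinear (L v' w')"
    "\<And>v w v' w'. v' \<in> A1 \<Longrightarrow> w' \<in> A2 \<Longrightarrow> v \<in> A1 \<Longrightarrow> w \<in> A2 \<Longrightarrow> L v' w' (pure_tensor v w) = B1 v v' * B2 w w'"
    by metis
  have L_add1: "L (v + v') w t = L v w t + L v' w t" if "v \<in> A1" "v' \<in> A1" "w \<in> A2" "t \<in> ?T" for v v' w t
    using that(4) by (rule tensor_space_eqI[rotated -1])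
      (use that L in \<open>auto simp: clinear_iff csubspace_add[OF one.S] one.add_right scaleC_complex algebra_simps\<close>)
  have L_add2: "L v (w + w') t = L v w t + L v w' t" if "v \<in> A1" "w \<in> A2" "w' \<in> A2" "t \<in> ?T" for v w w' t
    using that(4) by (rule tensor_space_eqI[rotated -1])
      (use that L in \<open>auto simp: clinear_iff csubspace_add[OF two.S] two.add_right scaleC_complex algebra_simps\<close>)
  have L_scale1: "L (a *\<^sub>C v) w t = cnj a * L v w t" if "v \<in> A1" "w \<in> A2" "t \<in> ?T" for a v w t
    using that(3) by (rule tensor_space_eqI[rotated -1])
      (use that L in \<open>auto simp: clinear_iff csubspace_scale[OF one.S] one.scale_right scaleC_complex algebra_simps\<close>)
  have L_scale2: "L v (a *\<^sub>C w) t = cnj a * L v w t" if "v \<in> A1" "w \<in> A2" "t \<in> ?T" for a v w t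
    using that(3) by (rule tensor_space_eqI[rotated -1])
      (use that L in \<open>auto simp: clinear_iff csubspace_scale[OF two.S] two.scale_right scaleC_complex algebra_simps\<close>)
  have "\<exists>G. clinear G \<and> (\<forall>v\<in>A1. \<forall>w\<in>A2. G (pure_tensor v w) = cnj (L v w t))" if t: "t \<in> ?T" for t
  proof -
    obtain G where "clinear G" "\<And>v w. v \<in> A1 \<Longrightarrow> w \<in> A2 \<Longrightarrow> G (pure_tensor v w) = cnj (L v w t)"
      by (rule tensor_lift_on[OF one.S two.S, of "\<lambda>v w. cnj (L v w t)"])
        (simp_all add: t L_add1 L_add2 L_scale1 L_scale2 scaleC_complex)
    then show ?thesis by blast
  qed
  then obtain G where G: "\<And>t. t \<in> ?T \<Longrightarrow> clinear (G t)"
    "\<And>v w t. t \<in> ?T \<Longrightarrow> v \<in> A1 \<Longrightarrow> w \<in> A2 \<Longrightarrow> G t (pure_tensor v w) = cnj (L v w t)" by metis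
  \<comment> \<open>\<open>G s\<close> is linear, whereas the form has to be conjugate linear in its
    second argument.\<close>
  define BT where "BT s t = cnj (G s t)" for s t
  have BT_pure: "BT (pure_tensor v w) (pure_tensor v' w') = B1 v v' * B2 w w'"
    if "v \<in> A1" "w \<in> A2" "v' \<in> A1" "w' \<in> A2" for v w v' w'
    using that by (simp add: BT_def G(2) L(2) tensor_space_pure)
  have G_add: "G (s + s') t = G s t + G s' t" if "s \<in> ?T" "s' \<in> ?T" "t \<in> ?T" for s s' t
    using that(3) by (rule tensor_space_eqI[rotated -1])
      (use that G L(1) Tadd in \<open>auto simp: clinear_iff scaleC_complex algebra_simps\<close>)
  have G_scale: "G (a *\<^sub>C s) t = cnj a * G s t" if "s \<in> ?T" "t \<in> ?T" for a s t
    using that(2) by (rule tensor_space_eqI[rotated -1])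
      (use that G L(1) Tscale in \<open>auto simp: clinear_iff scaleC_complex algebra_simps\<close>)
  have G_pure_left: "G (pure_tensor v w) t = L v w t" if "v \<in> A1" "w \<in> A2" "t \<in> ?T" for v w t
    using that(3)
  proof (rule tensor_space_eqI[rotated -1])
    fix v' w' assume "v' \<in> A1" "w' \<in> A2"
    then show "G (pure_tensor v w) (pure_tensor v' w') = L v w (pure_tensor v' w')"
      using that one.cnj_sym[of v v'] two.cnj_sym[of w w'] by (simp add: G(2) L(2) tensor_space_pure)
  qed (rule G(1)[OF tensor_space_pure[OF that(1,2)]], rule L(1)[OF that(1,2)])
  have sym: "G s t = cnj (G t s)" if "s \<in> ?T" "t \<in> ?T" for s t
    using that(1)
  proof (induction rule: tensor_space_induct)
    case (pure v w)
    then show ?case using that(2) by (simp add: G_pure_left G(2))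
  next
    case zero
    show ?case using G_scale[OF T0 that(2), of 0] by (simp add: clinear_0[OF G(1)[OF that(2)]])
  next
    case (add s s')
    then show ?case using that(2) by (simp add: G_add clinear_add[OF G(1)])
  next
    case (scale a s)
    then show ?case using that(2) by (simp add: G_scale clinear_scale[OF G(1)] scaleC_complex)
  qed
  have BT_sum_left: "BT (sum g I) t = (\<Sum>i\<in>I. BT (g i) t)" if "\<And>i. i \<in> I \<Longrightarrow> g i \<in> ?T" "t \<in> ?T" "finite I" for g I t
    using that(3,1)
  proof (induction I)
    case empty
    show ?case using G_scale[OF T0 that(2), of 0] by (simp add: BT_def)
  next
    case (insert i I)
    then show ?case using that(2)
      by (simp add: BT_def G_add csubspace_sum[OF tensor_space_subspace])
  qed
  have pos: "0 < Re (BT t t)" if t: "t \<in> ?T" "t \<noteq> 0" for t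
  proof -
    obtain X where X: "finite X" "X \<subseteq> A1"
      "\<And>Y. finite Y \<Longrightarrow> X \<subseteq> cspan Y \<Longrightarrow> \<exists>w. (\<forall>y\<in>Y. w y \<in> A2) \<and> t = (\<Sum>y\<in>Y. pure_tensor y (w y))"
      by (rule tensor_space_expand[OF two.S t(1)]) blast
    obtain Y where Y: "finite Y" "Y \<subseteq> A1" "0 \<notin> Y" "\<forall>y\<in>Y. \<forall>y'\<in>Y. y \<noteq> y' \<longrightarrow> B1 y y' = 0" "X \<subseteq> cspan Y"
      using one.orthogonal_spanning_set[OF X(1,2)] by blast
    obtain w where w: "\<And>y. y \<in> Y \<Longrightarrow> w y \<in> A2" "t = (\<Sum>y\<in>Y. pure_tensor y (w y))"
      using X(3)[OF Y(1,5)] by blast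
    have pT: "pure_tensor y (w y) \<in> ?T" if "y \<in> Y" for y using that w(1) Y(2) by (auto intro: tensor_space_pure)
    have YA: "y \<in> A1" if "y \<in> Y" for y using that Y(2) by blast
    have "BT t t = (\<Sum>y\<in>Y. BT (pure_tensor y (w y)) t)"
      by (subst (1) w(2)) (rule BT_sum_left[OF pT t(1) Y(1)])
    also have "\<dots> = (\<Sum>y\<in>Y. cnj (\<Sum>y'\<in>Y. G (pure_tensor y (w y)) (pure_tensor y' (w y'))))"
      by (rule sum.cong[OF HOL.refl]) (simp add: BT_def w(2) clinear_sum[OF G(1)[OF pT]])
    also have "\<dots> = (\<Sum>y\<in>Y. \<Sum>y'\<in>Y. if y' = y then B1 y y * B2 (w y) (w y) else 0)"
    proof (rule sum.cong[OF HOL.refl])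
      fix y assume y: "y \<in> Y"
      have "cnj (G (pure_tensor y (w y)) (pure_tensor y' (w y'))) = (if y' = y then B1 y y * B2 (w y) (w y) else 0)"
        if "y' \<in> Y" for y'
        using BT_pure[of y "w y" y' "w y'"] y that w(1) YA Y(4) by (auto simp: BT_def)
      then show "cnj (\<Sum>y'\<in>Y. G (pure_tensor y (w y)) (pure_tensor y' (w y')))
          = (\<Sum>y'\<in>Y. if y' = y then B1 y y * B2 (w y) (w y) else 0)"
        unfolding cnj_sum by (rule sum.cong[OF HOL.refl])
    qed
    also have "\<dots> = (\<Sum>y\<in>Y. B1 y y * B2 (w y) (w y))" using Y(1) by simp
    also have "\<dots> = (\<Sum>y\<in>Y. of_real (Re (B1 y y) * Re (B2 (w y) (w y))))"
      by (rule sum.cong[OF HOL.refl]) (use one.B_real[OF YA] two.B_real[OF w(1)] in \<open>metis of_real_mult\<close>)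
    finally have "Re (BT t t) = (\<Sum>y\<in>Y. Re (B1 y y) * Re (B2 (w y) (w y)))" by simp
    moreover have "(\<Sum>y\<in>Y. Re (B1 y y) * Re (B2 (w y) (w y))) > 0"
    proof -
      obtain y0 where y0: "y0 \<in> Y" "w y0 \<noteq> 0" using t(2) w(2) by (metis (no_types, lifting) pure_tensor_0_right sum.neutral)
      have p1: "Re (B1 y y) > 0" if "y \<in> Y" for y using one.pos[OF YA[OF that]] Y(3) that by auto
      have p2: "Re (B2 (w y) (w y)) \<ge> 0" if "y \<in> Y" for y
        using two.pos[OF w(1)[OF that]] two.zero_left[OF w(1)[OF that]] by (cases "w y = 0") auto
      have "Re (B1 y0 y0) * Re (B2 (w y0) (w y0)) > 0"
        using p1[OF y0(1)] two.pos[OF w(1)[OF y0(1)] y0(2)] by simp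
      then show ?thesis
        using p1 p2 y0(1) Y(1) by (intro sum_pos2[of Y y0]) (auto intro: mult_nonneg_nonneg less_imp_le)
    qed
    ultimately show ?thesis by simp
  qed
  have "hermitian ?T BT"
  proof
    show "csubspace ?T" by (rule tensor_space_subspace)
    show "BT (u + v) v' = BT u v' + BT v v'" if "u \<in> ?T" "v \<in> ?T" "v' \<in> ?T" for u v v'
      using that by (simp add: BT_def G_add)
    show "BT (a *\<^sub>C v) v' = a * BT v v'" if "v \<in> ?T" "v' \<in> ?T" for a v v'
      using that by (simp add: BT_def G_scale)
    show "BT v' v = cnj (BT v v')" if "v \<in> ?T" "v' \<in> ?T" for v v'
      using sym[OF that(2,1)] by (simp add: BT_def)
  qed (rule pos)
  with BT_pure show ?thesis by blast
qed

lemma (in tensor_km) tensor_contra: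
  assumes "contra_rep D R1 B1" "contra_rep D R2 B2" "hermitian TS BT"
    and pure: "\<And>v w v' w'. v \<in> R1.S \<Longrightarrow> w \<in> R2.S \<Longrightarrow> v' \<in> R1.S \<Longrightarrow> w' \<in> R2.S \<Longrightarrow>
      BT (pure_tensor v w) (pure_tensor v' w') = B1 v v' * B2 w w'"
  shows "contra_rep D T BT"
proof -
  interpret T: g_rep D T by (rule tensor_g_rep)
  interpret one: contra_rep D R1 B1 by (rule assms(1))
  interpret two: contra_rep D R2 B2 by (rule assms(2))
  interpret BT: hermitian TS BT by (rule assms(3))
  have adjoint: "BT (rep_act T x s) t = BT s (rep_act T y t)"
    if x: "\<And>u v. u \<in> R1.S \<Longrightarrow> v \<in> R1.S \<Longrightarrow> B1 (rep_act R1 x u) v = B1 u (rep_act R1 y v)"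
      "\<And>u v. u \<in> R2.S \<Longrightarrow> v \<in> R2.S \<Longrightarrow> B2 (rep_act R2 x u) v = B2 u (rep_act R2 y v)"
      and s: "s \<in> TS" and t: "t \<in> TS" for x y s t
    using s
  proof (induction rule: tensor_space_induct)
    case (pure v w)
    show ?case using t
    proof (induction rule: tensor_space_induct)
      case (pure v' w')
      then show ?case using \<open>v \<in> R1.S\<close> \<open>w \<in> R2.S\<close>
        by (simp add: tensor_act_pure BT.add_left BT.add_right tensor_space_pure assms(4) x)
    qed (use pure in \<open>simp_all add: tensor_act_0 tensor_act_add tensor_act_scale tensor_act_in tensor_space_pure
          BT.zero_right BT.add_right BT.scale_right\<close>)
  qed (use t in \<open>simp_all add: tensor_act_0 tensor_act_add tensor_act_scale tensor_act_in
        BT.zero_left BT.add_left BT.scale_left\<close>)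
  show ?thesis
  proof
    show "csubspace (rep_space T)" by (simp add: tensor_space_subspace)
  qed (simp_all add: BT.add_left BT.scale_left BT.pos adjoint one.B_e two.B_e one.B_h two.B_h flip: BT.cnj_sym)
qed

text \<open>Induction on \<open>p + q\<close> replaces the binomial expansion of a power of
  \<open>x\<close> on the tensor product.\<close>

lemma (in tensor_km) tensor_nilpotent:
  "(rep_act R1 x ^^ p) v = 0 \<Longrightarrow> (rep_act R2 x ^^ q) w = 0 \<Longrightarrow> v \<in> R1.S \<Longrightarrow> w \<in> R2.S
    \<Longrightarrow> (rep_act T x ^^ (p + q)) (pure_tensor v w) = 0"
proof (induction "p + q" arbitrary: p q v w)
  case 0
  then show ?case by simp
next
  case (Suc n)
  interpret T: g_rep D T by (rule tensor_g_rep)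
  show ?case
  proof (cases "p = 0 \<or> q = 0")
    case True
    then show ?thesis using Suc.prems by (auto simp: T.funpow_0)
  next
    case False
    then obtain p' q' where p: "p = Suc p'" and q: "q = Suc q'" by (metis not0_implies_Suc)
    have "(rep_act T x ^^ (p + q)) (pure_tensor v w)
        = (rep_act T x ^^ (p' + q)) (pure_tensor (rep_act R1 x v) w + pure_tensor v (rep_act R2 x w))"
      using Suc.prems by (simp add: p funpow_Suc_right tensor_act_pure del: funpow.simps)
    also have "\<dots> = (rep_act T x ^^ (p' + q)) (pure_tensor (rep_act R1 x v) w) + (rep_act T x ^^ (p + q')) (pure_tensor v (rep_act R2 x w))"
      using Suc.prems by (subst T.funpow_add_right) (simp_all add: tensor_space_pure p q)
    also have "(rep_act T x ^^ (p' + q)) (pure_tensor (rep_act R1 x v) w) = 0"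
      using Suc.prems Suc.hyps(2) by (intro Suc.hyps(1)) (simp_all add: p funpow_Suc_right del: funpow.simps)
    also have "(rep_act T x ^^ (p + q')) (pure_tensor v (rep_act R2 x w)) = 0"
      using Suc.prems Suc.hyps(2) by (intro Suc.hyps(1)) (simp_all add: q funpow_Suc_right del: funpow.simps)
    finally show ?thesis by simp
  qed
qed

text \<open>No conjugate appears: the weight is real on the real form, and both sides are complex
  linear in \<open>h\<close>.\<close>

lemma (in contra_hw) B_h_v:
  assumes "real_weight l" "x \<in> S"
  shows "B (cart h \<cdot> x) v = l h * B x v"
proof -
  have real: "B (cart a \<cdot> x) v = l a * B x v" if a: "a \<in> real_form D" for a
  proof -
    have "cnj (l a) = l a" using assms(1) a by (simp add: real_weight_def Reals_cnj_iff)
    then show ?thesis using assms(2) a weight_spaceD(2)[OF v_weight] by (simp add: B_h scale_right)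
  qed
  obtain a b where ab: "a \<in> real_form D" "b \<in> real_form D" "h = a + \<i> *\<^sub>C b" by (rule real_form_decomp)
  have "l h = l a + \<i> * l b"
    using assms(1) by (simp add: ab(3) real_weight_def clinear_add clinear_scale scaleC_complex)
  then show ?thesis
    using assms(2) ab by (simp add: cart_add act_add_left act_scale_left add_left scale_left real algebra_simps)
qed

text \<open>A substitute for \<open>U(g) = U(n-) U(b)\<close>: the \<open>e_j\<close> and
  \<open>cart h\<close> can be commuted to the right through the letters \<open>f_i\<close> until
  they reach \<open>C\<close>, which they preserve.\<close>

lemma (in g_rep) orbit_subset_fwords:
  assumes "csubspace C" "C \<subseteq> S" "\<And>i x. x \<in> C \<Longrightarrow> e i \<cdot> x \<in> C" "\<And>h x. x \<in> C \<Longrightarrow> cart h \<cdot> x \<in> C" "a \<in> C"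
  shows "env_orbit R UNIV a \<subseteq> cspan {foldr (\<lambda>i. act (f i)) w x |w x. x \<in> C}" (is "_ \<subseteq> cspan ?G")
proof -
  have GS: "?G \<subseteq> S" using assms(2) by auto
  have stable: "y \<cdot> u \<in> cspan ?G" if "\<And>u. u \<in> ?G \<Longrightarrow> y \<cdot> u \<in> cspan ?G" "u \<in> cspan ?G" for y u
  proof -
    have "?G \<subseteq> {u \<in> S. y \<cdot> u \<in> cspan ?G}" using that(1) GS by blast
    moreover have "csubspace {u \<in> S. y \<cdot> u \<in> cspan ?G}"
      by (rule csubspaceI) (simp_all add: act_add_right act_scale_right complex_vector.span_zero
          complex_vector.span_add complex_vector.span_scale)
    ultimately have "cspan ?G \<subseteq> {u \<in> S. y \<cdot> u \<in> cspan ?G}" by (rule cspan_minimal)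
    then show ?thesis using that(2) by blast
  qed
  have f: "f i \<cdot> u \<in> cspan ?G" if u: "u \<in> cspan ?G" for i u
  proof (rule stable[OF _ u])
    fix u assume "u \<in> ?G"
    then obtain w x where "u = foldr (\<lambda>i. act (f i)) w x" "x \<in> C" by blast
    then have "f i \<cdot> u \<in> ?G" by (intro CollectI exI[of _ "i # w"] exI[of _ x]) simp
    then show "f i \<cdot> u \<in> cspan ?G" by (rule cspan_base)
  qed
  have base: "x \<in> cspan ?G" if "x \<in> C" for x
    using that by (intro cspan_base CollectI exI[of _ "[]"] exI[of _ x]) simp
  have h_word: "cart h \<cdot> foldr (\<lambda>i. act (f i)) w x \<in> cspan ?G" if x: "x \<in> C" for h w x
  proof (induction w)
    case Nil
    then show ?case using base assms(4)[OF x] by simp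
  next
    case (Cons i w)
    let ?u = "foldr (\<lambda>i. act (f i)) w x"
    have uS: "?u \<in> S" using x assms(2) by auto
    have u: "?u \<in> cspan ?G" using x by (intro cspan_base) blast
    have "cart h \<cdot> f i \<cdot> ?u = br (cart h) (f i) \<cdot> ?u + f i \<cdot> cart h \<cdot> ?u" using act_br[OF uS, of "cart h" "f i"] by (simp del: br_hf)
    also have "\<dots> = - (al i h *\<^sub>C f i \<cdot> ?u) + f i \<cdot> cart h \<cdot> ?u"
      using uS by (simp add: act_minus_left act_scale_left)
    also have "\<dots> \<in> cspan ?G"
      by (intro complex_vector.span_add complex_vector.span_neg complex_vector.span_scale f u Cons.IH)
    finally show ?case by simp
  qed
  have e_word: "e j \<cdot> foldr (\<lambda>i. act (f i)) w x \<in> cspan ?G" if x: "x \<in> C" for j w x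
  proof (induction w)
    case Nil
    then show ?case using base assms(3)[OF x] by simp
  next
    case (Cons i w)
    let ?u = "foldr (\<lambda>i. act (f i)) w x"
    have uS: "?u \<in> S" using x assms(2) by auto
    have "e j \<cdot> f i \<cdot> ?u = br (e j) (f i) \<cdot> ?u + f i \<cdot> e j \<cdot> ?u"
      using act_br[OF uS, of "e j" "f i"] by simp
    moreover have "br (e j) (f i) \<cdot> ?u \<in> cspan ?G"
      using h_word[OF x] uS by (simp add: br_ef complex_vector.span_zero)
    ultimately show ?case using f[OF Cons.IH] by (simp add: complex_vector.span_add)
  qed
  have "submodule R (cspan ?G)"
  proof (rule submoduleI)
    show "cspan ?G \<subseteq> S" using GS S by (rule cspan_minimal)
    show "e i \<cdot> u \<in> cspan ?G" if "u \<in> cspan ?G" for i u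
      using e_word by (intro stable[OF _ that]) blast
    show "cart h \<cdot> u \<in> cspan ?G" if "u \<in> cspan ?G" for h u
      using h_word by (intro stable[OF _ that]) blast
  qed (use f in auto)
  then show ?thesis using base[OF assms(5)] by (rule submodule_orbit)
qed

lemma image_dim_eq:
  fixes \<psi> :: "'a::complex_vector \<Rightarrow> 'b::complex_vector"
  assumes A: "csubspace A" "fin_dim A"
    and add: "\<And>x y. x \<in> A \<Longrightarrow> y \<in> A \<Longrightarrow> \<psi> (x + y) = \<psi> x + \<psi> y"
    and scale: "\<And>c x. x \<in> A \<Longrightarrow> \<psi> (c *\<^sub>C x) = c *\<^sub>C \<psi> x"
    and ker: "\<And>x. x \<in> A \<Longrightarrow> \<psi> x = 0 \<Longrightarrow> x = 0"
  shows "fin_dim (\<psi> ` A)" "cdim (\<psi> ` A) = cdim A"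
proof -
  obtain p :: "'a \<Rightarrow> 'a" where p: "clinear p" "\<And>v. p v \<in> A" "\<And>v. v \<in> A \<Longrightarrow> p v = v"
    by (rule csubspace_projection[OF A(1)]) blast
  define F where "F x = \<psi> (p x)" for x
  have F: "clinear F"
    by (rule clinearI) (simp_all add: F_def clinear_add[OF p(1)] clinear_scale[OF p(1)] add scale p(2))
  interpret F: Vector_Spaces.linear "scaleC :: complex \<Rightarrow> 'a \<Rightarrow> 'a" "scaleC :: complex \<Rightarrow> 'b \<Rightarrow> 'b" F by (rule F)
  have F_A: "F ` Y = \<psi> ` Y" if "Y \<subseteq> A" for Y
    by (rule image_cong[OF HOL.refl]) (use that p(3) in \<open>auto simp: F_def\<close>)
  obtain X where X: "finite X" "X \<subseteq> A" "\<not> cdependent X" "cspan X = A" by (rule fin_dim_basis[OF A])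
  have inj: "inj_on F A"
  proof (rule inj_onI)
    fix x y assume xy: "x \<in> A" "y \<in> A" "F x = F y"
    have "\<psi> (x - y) = F (x - y)" using xy csubspace_diff[OF A(1)] p(3) by (simp add: F_def)
    then have "\<psi> (x - y) = 0" using xy(3) by (simp add: clinear_diff[OF F])
    then show "x = y" using ker[of "x - y"] csubspace_diff[OF A(1)] xy by auto
  qed
  have span: "cspan (F ` X) = F ` A"
    using F.span_image[of X] X(4) by (simp add: cspan_def)
  have indep: "\<not> cdependent (F ` X)"
    using F.independent_injective_image[of X] X(3,4) inj by (simp add: cspan_def cdependent_def)
  have eq: "F ` A = \<psi> ` A" by (rule F_A) simp
  show "fin_dim (\<psi> ` A)" unfolding fin_dim_def using X(1) span eq by (intro exI[of _ "F ` X"]) auto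
  have "cdim (\<psi> ` A) = card (F ` X)"
    using complex_vector.basis_card_eq_dim[of "F ` X" "\<psi> ` A"] span eq indep complex_vector.span_superset[of "F ` X"] by simp
  also have "\<dots> = card X" using card_image[OF inj_on_subset[OF inj X(2)]] .
  also have "\<dots> = cdim A" using complex_vector.basis_card_eq_dim[OF X(2) _ X(3)] X(4) by simp
  finally show "cdim (\<psi> ` A) = cdim A" .
qed

lemma (in contra_rep) B_f_pow: "u \<in> S \<Longrightarrow> v \<in> S \<Longrightarrow> B ((act (f i) ^^ k) u) v = B u ((act (e i) ^^ k) v)"
proof (induction k arbitrary: v)
  case (Suc k)
  have "B ((act (f i) ^^ Suc k) u) v = B ((act (f i) ^^ k) u) (e i \<cdot> v)" using Suc.prems by (simp add: B_f)
  also have "\<dots> = B u ((act (e i) ^^ Suc k) v)"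
    using Suc.IH[of "e i \<cdot> v"] Suc.prems by (simp add: funpow_Suc_right del: funpow.simps)
  finally show ?case .
qed simp

subsection \<open>The tensor product of two highest weight modules\<close>

locale hw_tensor = tensor_km D R1 R2 + sym_km_algebra D + one: contra_hw D R1 B1 v1 lam + two: contra_hw D R2 B2 v2 mu
  for D :: "('i::finite, 'h::complex_vector, 'g::complex_vector) km_data"
    and R1 :: "('g, 'v::complex_vector) rep" and R2 :: "('g, 'w::complex_vector) rep"
    and B1 v1 lam B2 v2 mu +
  fixes m :: "'i \<Rightarrow> nat" and BT
  assumes v1_nonzero: "v1 \<noteq> 0"
    and orbit1: "env_orbit R1 UNIV v1 = rep_space R1" and orbit2: "env_orbit R2 UNIV v2 = rep_space R2"
    and n_plus_v1: "a \<in> n_plus D \<Longrightarrow> rep_act R1 a v1 = 0"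
    and lam_real: "real_weight lam" and mu_real: "real_weight mu"
    and lam_co: "lam (co i) = of_nat (m i)" and mu_int: "mu (co i) \<in> \<int>"
    and f_nil1: "x \<in> rep_space R1 \<Longrightarrow> \<exists>n. (rep_act R1 (f i) ^^ n) x = 0"
    and f_nil2: "y \<in> rep_space R2 \<Longrightarrow> \<exists>n. (rep_act R2 (f i) ^^ n) y = 0"
    and BT: "hermitian (tensor_space (rep_space R1) (rep_space R2)) BT"
    and BT_pure: "\<lbrakk>x \<in> rep_space R1; y \<in> rep_space R2; x' \<in> rep_space R1; y' \<in> rep_space R2\<rbrakk>
      \<Longrightarrow> BT (pure_tensor x y) (pure_tensor x' y') = B1 x x' * B2 y y'"
begin

lemma S1: "R1.S = cspan (range one.fw)" and S2: "R2.S = cspan (range two.fw)"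
  using orbit1 orbit2 one.env_orbit_eq two.env_orbit_eq one.range_ev two.range_ev by simp_all

sublocale T: contra_rep D T BT
  by (rule tensor_contra[OF one.contra_rep_axioms two.contra_rep_axioms BT BT_pure])

sublocale C2: cat_rep D R2 B2 two.fw "\<lambda>w. w" mu
proof unfold_locales
  show "finite {w :: 'i list. length w = n}" for n
    using finite_lists_length_eq[of "UNIV :: 'i set" n] by simp
qed (simp_all add: two.fw_weight S2 mu_real mu_int f_nil2)

sublocale CT: cat_rep D T BT "\<lambda>(w1, w2). pure_tensor (one.fw w1) (two.fw w2)" "\<lambda>(w1, w2). w1 @ w2" "\<lambda>h. lam h + mu h"
proof unfold_locales
  fix k :: "'i list \<times> 'i list" and n x i
  obtain w1 w2 where k: "k = (w1, w2)" by fastforce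
  have "wt D (w1 @ w2) h = wt D w1 h + wt D w2 h" for h by (induction w1) simp_all
  then show "(case k of (w1, w2) \<Rightarrow> pure_tensor (one.fw w1) (two.fw w2))
      \<in> weight_space D T (\<lambda>h. lam h + mu h - wt D (case k of (w1, w2) \<Rightarrow> w1 @ w2) h)"
    using tensor_weight[OF one.fw_weight[of w1] two.fw_weight[of w2]] by (simp add: k algebra_simps)
  show "rep_space T \<subseteq> cspan (range (\<lambda>(w1, w2). pure_tensor (one.fw w1) (two.fw w2)))"
    using tensor_space_in_cspan[of R1.S one.fw UNIV R2.S two.fw UNIV] S1 S2 by simp
  have "finite {w :: 'i list. length w \<le> n}"
    using finite_lists_length_le[of "UNIV :: 'i set" n] by simp
  then have "finite ({w :: 'i list. length w \<le> n} \<times> {w :: 'i list. length w \<le> n})" by simp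
  then show "finite {k :: 'i list \<times> 'i list. length (case k of (w1, w2) \<Rightarrow> w1 @ w2) = n}"
    by (rule rev_finite_subset) auto
  show "real_weight (\<lambda>h. lam h + mu h)"
    using lam_real mu_real by (auto simp: real_weight_def clinear_iff scaleC_complex algebra_simps)
  show "lam (co i) + mu (co i) \<in> \<int>" using mu_int by (simp add: lam_co)
  assume "x \<in> rep_space T"
  then have "x \<in> TS" by simp
  then show "\<exists>n. (rep_act T (f i) ^^ n) x = 0"
  proof (induction rule: tensor_space_induct)
    case (pure x y)
    then show ?case using f_nil1[OF pure(1)] f_nil2[OF pure(2)] tensor_nilpotent pure by blast
  next
    case zero
    show ?case by (rule exI[of _ 0]) simp
  next
    case (add s t)
    then obtain p q where pq: "(rep_act T (f i) ^^ p) s = 0" "(rep_act T (f i) ^^ q) t = 0" by blast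
    have "(rep_act T (f i) ^^ (max p q)) (s + t) = 0"
      using T.funpow_mono_0[OF pq(1), of "max p q"] T.funpow_mono_0[OF pq(2), of "max p q"] add
      by (simp add: T.funpow_add_right)
    then show ?case ..
  next
    case (scale a s)
    then obtain p where p: "(rep_act T (f i) ^^ p) s = 0" by blast
    have "(rep_act T (f i) ^^ p) (a *\<^sub>C s) = 0" using p scale by (simp add: T.funpow_scale_right)
    then show ?case ..
  qed
qed

section \<open>Contraction with the highest weight vector\<close>

definition \<phi> :: "('v, 'w) tensor \<Rightarrow> 'w" where
  "\<phi> = (SOME L. clinear L \<and> (\<forall>x\<in>R1.S. \<forall>y\<in>R2.S. L (pure_tensor x y) = B1 x v1 *\<^sub>C y))"

lemma \<phi>_linear: "clinear \<phi>" and \<phi>_pure: "x \<in> R1.S \<Longrightarrow> y \<in> R2.S \<Longrightarrow> \<phi> (pure_tensor x y) = B1 x v1 *\<^sub>C y"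
proof -
  obtain L where "clinear L" "\<And>x y. x \<in> R1.S \<Longrightarrow> y \<in> R2.S \<Longrightarrow> L (pure_tensor x y) = B1 x v1 *\<^sub>C y"
    by (rule tensor_lift_on[OF R1.S R2.S, of "\<lambda>x y. B1 x v1 *\<^sub>C y"])
      (simp_all add: one.add_left one.scale_left scaleC_add_left scaleC_add_right mult.commute)
  then have "\<exists>L. clinear L \<and> (\<forall>x\<in>R1.S. \<forall>y\<in>R2.S. L (pure_tensor x y) = B1 x v1 *\<^sub>C y)" by blast
  from someI_ex[OF this] show "clinear \<phi>" "x \<in> R1.S \<Longrightarrow> y \<in> R2.S \<Longrightarrow> \<phi> (pure_tensor x y) = B1 x v1 *\<^sub>C y"
    unfolding \<phi>_def by blast+
qed

lemmas \<phi>_add = clinear_add[OF \<phi>_linear] and \<phi>_scale = clinear_scale[OF \<phi>_linear]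
  and \<phi>_diff = clinear_diff[OF \<phi>_linear] and \<phi>_0 = clinear_0[OF \<phi>_linear]

lemma \<phi>_in [simp]: "t \<in> TS \<Longrightarrow> \<phi> t \<in> R2.S"
  by (induction rule: tensor_space_induct) (simp_all add: \<phi>_pure \<phi>_add \<phi>_scale \<phi>_0)

lemma B2_\<phi>: "t \<in> TS \<Longrightarrow> z \<in> R2.S \<Longrightarrow> B2 (\<phi> t) z = BT t (pure_tensor v1 z)"
  by (induction rule: tensor_space_induct)
    (simp_all add: \<phi>_pure \<phi>_add \<phi>_scale \<phi>_0 two.scale_left two.add_left two.zero_left BT_pure
      T.add_left T.scale_left T.zero_left tensor_space_pure)

lemma \<phi>_h: "t \<in> TS \<Longrightarrow> \<phi> (rep_act T (cart h) t) = lam h *\<^sub>C \<phi> t + rep_act R2 (cart h) (\<phi> t)"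
  by (induction rule: tensor_space_induct)
    (simp_all add: tensor_act_pure tensor_act_0 tensor_act_add tensor_act_scale \<phi>_pure \<phi>_add \<phi>_scale \<phi>_0
      one.B_h_v[OF lam_real] R2.act_scale_right R2.act_add_right scaleC_add_right scaleC_add_left mult.commute)

lemma \<phi>_weight: "t \<in> weight_space D T \<gamma> \<Longrightarrow> \<phi> t \<in> weight_space D R2 (\<lambda>h. \<gamma> h - lam h)"
proof -
  assume t: "t \<in> weight_space D T \<gamma>"
  have tS: "t \<in> TS" using t by (simp add: weight_space_def)
  have "rep_act R2 (cart h) (\<phi> t) = (\<gamma> h - lam h) *\<^sub>C \<phi> t" for h
  proof -
    have "\<gamma> h *\<^sub>C \<phi> t = lam h *\<^sub>C \<phi> t + rep_act R2 (cart h) (\<phi> t)"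
      using \<phi>_h[OF tS, of h] T.weight_spaceD(2)[OF t, of h] by (simp add: \<phi>_scale)
    then show ?thesis by (simp add: scaleC_diff_left)
  qed
  then show ?thesis using tS by (simp add: weight_space_def)
qed

text \<open>A singular vector is orthogonal to the image of \<open>f_i\<close>, and this lets
  \<open>f_i\<close> change factors at the cost of a sign.\<close>

lemma singular_transport:
  assumes "\<And>i. rep_act T (e i) s = 0" "s \<in> TS" "x \<in> R1.S" "z \<in> R2.S"
  shows "BT s (pure_tensor x (rep_act R2 (f i) z)) = - BT s (pure_tensor (rep_act R1 (f i) x) z)"
proof -
  have "0 = BT s (rep_act T (f i) (pure_tensor x z))"
    using T.singular_orth_f[of i s "pure_tensor x z"] assms by (simp add: tensor_space_pure)
  also have "\<dots> = BT s (pure_tensor (rep_act R1 (f i) x) z) + BT s (pure_tensor x (rep_act R2 (f i) z))"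
    using assms by (simp add: tensor_act_pure T.add_right tensor_space_pure)
  finally show ?thesis by (simp add: eq_neg_iff_add_eq_0 add.commute)
qed

lemma singular_transport_pow:
  assumes "\<And>i. rep_act T (e i) s = 0" "s \<in> TS" "x \<in> R1.S" "z \<in> R2.S"
  shows "BT s (pure_tensor x ((rep_act R2 (f i) ^^ k) z)) = (- 1) ^ k * BT s (pure_tensor ((rep_act R1 (f i) ^^ k) x) z)"
  using assms(3)
proof (induction k arbitrary: x)
  case (Suc k)
  have "BT s (pure_tensor x ((rep_act R2 (f i) ^^ Suc k) z))
      = - BT s (pure_tensor (rep_act R1 (f i) x) ((rep_act R2 (f i) ^^ k) z))"
    using singular_transport[OF assms(1,2) Suc.prems, where z = "(rep_act R2 (f i) ^^ k) z" and i = i] assms(4) by simp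
  also have "\<dots> = - ((- 1) ^ k * BT s (pure_tensor ((rep_act R1 (f i) ^^ k) (rep_act R1 (f i) x)) z))"
    using Suc.IH[of "rep_act R1 (f i) x"] Suc.prems by simp
  finally show ?case by (simp add: funpow_Suc_right del: funpow.simps)
qed simp

lemma f_pow_v1: "(rep_act R1 (f i) ^^ (m i + 1)) v1 = 0"
proof -
  obtain k where "(rep_act R1 (f i) ^^ k) v1 = 0" using f_nil1[OF one.v_in] by blast
  then obtain n :: nat where "lam (co i) = of_nat n" "(rep_act R1 (f i) ^^ (n + 1)) v1 = 0"
    by (rule R1.sl2_dominant[OF one.v_weight v1_nonzero one.e_v])
  then show ?thesis using lam_co[of i] by (metis of_nat_eq_iff)
qed

lemma singD: "s \<in> sing D T X \<gamma> \<Longrightarrow> s \<in> TS" "s \<in> sing D T X \<gamma> \<Longrightarrow> rep_act T (e i) s = 0"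
  "s \<in> sing D T X \<gamma> \<Longrightarrow> s \<in> weight_space D T \<gamma>" "s \<in> sing D T X \<gamma> \<Longrightarrow> s \<in> X"
  by (auto simp: sing_def weight_space_def)

text \<open>Contravariance, adjunction and transport turn the square norm of
  \<open>e_i^(n + 1)\<close> applied to \<open>\<phi> s\<close> into a product with
  \<open>f_i^(n + 1)\<close> applied to \<open>v1\<close>, which is 0.\<close>

lemma \<phi>_sing:
  assumes s: "s \<in> sing D T X nu"
  shows "\<phi> s \<in> D_space D R2 lam nu"
  unfolding D_space_def
proof (intro CollectI conjI allI impI)
  show "\<phi> s \<in> weight_space D R2 (\<lambda>h. nu h - lam h)" by (rule \<phi>_weight[OF singD(3)[OF s]])
  fix i and n :: nat assume "lam (co i) = of_nat n"
  then have n: "n = m i" using lam_co[of i] by (metis of_nat_eq_iff)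
  note sS = singD(1)[OF s]
  let ?E = "(rep_act R2 (e i) ^^ (n + 1)) (\<phi> s)" and ?F = "\<lambda>z. (rep_act R2 (f i) ^^ (n + 1)) z"
  have E: "?E \<in> R2.S" using sS by (intro R2.funpow_in \<phi>_in)
  have "B2 (?F ?E) (\<phi> s) = B2 ?E ?E" using two.B_f_pow[OF E \<phi>_in[OF sS]] .
  moreover have "B2 (\<phi> s) (?F ?E) = 0"
  proof -
    have "B2 (\<phi> s) (?F ?E) = BT s (pure_tensor v1 (?F ?E))" by (rule B2_\<phi>[OF sS R2.funpow_in[OF E]])
    also have "\<dots> = (- 1) ^ (n + 1) * BT s (pure_tensor ((rep_act R1 (f i) ^^ (n + 1)) v1) ?E)"
      by (rule singular_transport_pow[OF singD(2)[OF s] sS one.v_in E])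
    also have "(rep_act R1 (f i) ^^ (n + 1)) v1 = 0" unfolding n by (rule f_pow_v1)
    finally show ?thesis by (simp only: pure_tensor_0_left T.zero_right[unfolded tensor_rep_space, OF sS] mult_zero_right)
  qed
  ultimately have "B2 ?E ?E = 0"
    using two.orth_sym[OF \<phi>_in[OF sS] R2.funpow_in[OF E]] by metis
  then show "?E = 0" by (rule two.definite[OF E])
qed

lemma \<phi>_surjective:
  assumes y: "y \<in> D_space D R2 lam nu"
  shows "\<exists>s\<in>sing D T TS nu. \<phi> s = y"
proof -
  have yw: "y \<in> weight_space D R2 (\<lambda>h. nu h - lam h)" using y by (simp add: D_space_def)
  have yS: "y \<in> R2.S" using yw by (rule R2.weight_spaceD)
  have e_pow: "(rep_act R2 (e i) ^^ (m i + 1)) y = 0" for i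
    using y lam_co[of i] by (simp add: D_space_def del: funpow.simps)
  interpret H: hw_functional D R1 v1 lam R2 "\<lambda>z. B2 z y" m
  proof (intro hw_functional.intro hw_functional_axioms.intro)
    show "sym_hw D R1 v1 lam" "g_rep D R2" by unfold_locales
    show "clinear lam" using lam_real by (simp add: real_weight_def)
    show "B2 ((rep_act R2 (f i) ^^ (m i + 1)) z) y = 0" if "z \<in> R2.S" for i z
      unfolding two.B_f_pow[OF that yS] e_pow by (rule two.zero_right[OF that])
    show "(rep_act R1 (f i) ^^ (m i + 1)) v1 = 0" for i by (rule f_pow_v1)
  qed (simp_all add: v1_nonzero lam_co two.add_left two.scale_left yS)
  \<comment> \<open>Some combination of words producing \<open>x\<close> is chosen;
    \<open>annihilator_eta\<close> makes the value independent of the choice.\<close>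
  define \<Lambda> where "\<Lambda> x z = H.\<eta> (SOME c. one.ev c = x) z" for x z
  have \<Lambda>_ev: "\<Lambda> (one.ev c) z = H.\<eta> c z" if "z \<in> R2.S" for c z
  proof -
    have "one.ev (SOME c'. one.ev c' = one.ev c) = one.ev c" by (rule someI[of _ c]) (rule HOL.refl)
    then have "one.ev ((SOME c'. one.ev c' = one.ev c) - c) = 0" by (simp add: one.ev_diff)
    from H.annihilator_eta[OF this that] show ?thesis by (simp add: \<Lambda>_def eta_diff)
  qed
  have ev: "\<exists>c. x = one.ev c" if "x \<in> R1.S" for x
    using that orbit1 one.env_orbit_eq by auto
  obtain L where L: "clinear L" "\<And>x z. x \<in> R1.S \<Longrightarrow> z \<in> R2.S \<Longrightarrow> L (pure_tensor x z) = \<Lambda> x z"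
  proof (rule tensor_lift_on[OF R1.S R2.S, of \<Lambda>])
    fix x x' z assume xz: "x \<in> R1.S" "x' \<in> R1.S" "z \<in> R2.S"
    obtain c c' where "x = one.ev c" "x' = one.ev c'" using ev xz by metis
    then show "\<Lambda> (x + x') z = \<Lambda> x z + \<Lambda> x' z"
      using \<Lambda>_ev[OF xz(3)] by (simp add: eta_add flip: one.ev_add)
  next
    fix x z z' assume xz: "x \<in> R1.S" "z \<in> R2.S" "z' \<in> R2.S"
    obtain c where "x = one.ev c" using ev xz by metis
    then show "\<Lambda> x (z + z') = \<Lambda> x z + \<Lambda> x z'" using xz by (simp add: \<Lambda>_ev H.\<eta>_add_right)
  next
    fix a x z assume xz: "x \<in> R1.S" "z \<in> R2.S"
    obtain c where c: "x = one.ev c" using ev xz by metis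
    show "\<Lambda> (a *\<^sub>C x) z = a *\<^sub>C \<Lambda> x z"
      using \<Lambda>_ev[OF xz(2)] by (simp add: c eta_scale flip: one.ev_scale)
    show "\<Lambda> x (a *\<^sub>C z) = a *\<^sub>C \<Lambda> x z" using xz by (simp add: c \<Lambda>_ev H.\<eta>_scale_right scaleC_complex)
  qed blast
  have L_f: "L (rep_act T (f i) t) = 0" if "t \<in> TS" for i t
    using that
  proof (induction rule: tensor_space_induct)
    case (pure x z)
    obtain c where c: "x = one.ev c" using ev pure by metis
    have "\<Lambda> (rep_act R1 (f i) x) z = - H.\<eta> c (rep_act R2 (f i) z)"
      unfolding c one.ev_f[symmetric] \<Lambda>_ev[OF pure(2)] eta_f ..
    moreover have "\<Lambda> x (rep_act R2 (f i) z) = H.\<eta> c (rep_act R2 (f i) z)"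
      unfolding c by (rule \<Lambda>_ev) (simp add: pure)
    ultimately show ?case using pure by (simp add: tensor_act_pure clinear_add[OF L(1)] L(2))
  qed (simp_all add: tensor_act_0 tensor_act_add tensor_act_scale clinear_0[OF L(1)] clinear_add[OF L(1)]
      clinear_scale[OF L(1)])
  have WT: "weight_space D T nu \<subseteq> rep_space T" by (auto simp: weight_space_def)
  \<comment> \<open>The functional is represented on the finite-dimensional weight space of
    \<open>nu\<close>. Since \<open>f_i e_i s\<close> stays in that space, this suffices to see that
    \<open>e_i s\<close> has norm 0.\<close>
  obtain s where s: "s \<in> weight_space D T nu" "\<And>t. t \<in> weight_space D T nu \<Longrightarrow> L t = BT t s"
    by (rule T.represent_functional[OF T.weight_space_subspace CT.weight_fin_dim WT L(1)]) blast
  have sS: "s \<in> rep_space T" using s(1) WT by blast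
  have "rep_act T (e i) s = 0" for i
  proof (rule T.definite)
    show eS: "rep_act T (e i) s \<in> rep_space T" by (rule T.act_in[OF sS])
    have "rep_act T (f i) (rep_act T (e i) s) \<in> weight_space D T nu"
      using T.weight_space_f[OF T.weight_space_e[OF s(1), of i], of i] by simp
    then have "BT (rep_act T (f i) (rep_act T (e i) s)) s = 0"
      using s(2) L_f[of "rep_act T (e i) s" i] eS by simp
    then show "BT (rep_act T (e i) s) (rep_act T (e i) s) = 0" unfolding T.B_f[OF eS sS] .
  qed
  then have sing: "s \<in> sing D T TS nu" using s(1) sS by (simp add: sing_def)
  \<comment> \<open>Testing against vectors of the weight of \<open>y\<close> is enough, because
    \<open>\<phi> s - y\<close> is itself one of them.\<close>
  have test: "B2 z (\<phi> s) = B2 z y" if z: "z \<in> weight_space D R2 (\<lambda>h. nu h - lam h)" for z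
  proof -
    have zS: "z \<in> R2.S" using z by (rule R2.weight_spaceD)
    have pT: "pure_tensor v1 z \<in> rep_space T" using zS by (simp add: tensor_space_pure)
    have "B2 z (\<phi> s) = cnj (B2 (\<phi> s) z)" using two.cnj_sym[of "\<phi> s" z] sS zS by simp
    also have "\<dots> = cnj (BT s (pure_tensor v1 z))" using B2_\<phi>[of s z] sS zS by simp
    also have "\<dots> = BT (pure_tensor v1 z) s" using T.cnj_sym[OF sS pT] by simp
    also have "\<dots> = L (pure_tensor v1 z)"
      using s(2)[of "pure_tensor v1 z"] tensor_weight[OF one.v_weight z] by simp
    also have "\<dots> = \<Lambda> (one.ev (vw [])) z" using zS by (simp add: L(2))
    also have "\<dots> = B2 z y" using zS by (simp only: \<Lambda>_ev) simp
    finally show ?thesis .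
  qed
  have d: "\<phi> s - y \<in> weight_space D R2 (\<lambda>h. nu h - lam h)"
    using \<phi>_weight[OF s(1)] yw by (rule csubspace_diff[OF R2.weight_space_subspace])
  have "B2 (\<phi> s - y) (\<phi> s - y) = 0"
    using test[OF d] two.diff_right[of "\<phi> s" y "\<phi> s - y"] sS yS by simp
  then have "\<phi> s - y = 0" by (rule two.definite[OF R2.weight_spaceD(1)[OF d]])
  then show ?thesis using sing by auto
qed

end

section \<open>The Kostant--Kumar module against the Demazure module\<close>

context hw_tensor begin

context
  fixes u \<delta>
  assumes u: "u \<in> weight_space D R2 \<delta>"
begin

abbreviation "K \<equiv> env_orbit T UNIV (pure_tensor v1 u)"
abbreviation "Dz \<equiv> demazure D R2 u"
abbreviation "\<pi> \<equiv> orth_proj B2 Dz"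

lemma u_in: "u \<in> R2.S" using u by (rule R2.weight_spaceD)

lemma K_submodule: "submodule T K"
  by (rule T.env_orbit_submodule) (simp add: tensor_space_pure u_in)

lemma K_subspace: "csubspace K" and K_S: "K \<subseteq> rep_space T" and K_act: "t \<in> K \<Longrightarrow> rep_act T x t \<in> K"
  using K_submodule by (auto simp: submodule_def)

lemma Dz_subspace: "csubspace Dz" and Dz_S: "Dz \<subseteq> R2.S" and u_Dz: "u \<in> Dz"
  unfolding demazure_def by (rule R2.env_orbit_subspace R2.env_orbit_in R2.env_orbit_base u_in)+

lemma Dz_borel: "x \<in> borel_sub D \<Longrightarrow> z \<in> Dz \<Longrightarrow> rep_act R2 x z \<in> Dz"
  unfolding demazure_def by (rule R2.env_orbit_stable[OF u_in])

lemma e_borel: "e i \<in> borel_sub D" and h_borel: "cart h \<in> borel_sub D"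
proof -
  have "cart 0 + e i \<in> borel_sub D" "cart h + 0 \<in> borel_sub D"
    unfolding borel_sub_def using e_n_plus csubspace_0[OF n_plus_subspace] by blast+
  then show "e i \<in> borel_sub D" "cart h \<in> borel_sub D" by (simp_all add: cart_0)
qed

text \<open>\<open>v1\<close> is an eigenvector of the Borel subalgebra, so acting on
  \<open>v1 \<otimes> z\<close> and subtracting a multiple amounts to acting on \<open>z\<close>
  alone.\<close>

lemma pure_in_K: "z \<in> Dz \<Longrightarrow> pure_tensor v1 z \<in> K"
proof -
  let ?M = "{z \<in> R2.S. pure_tensor v1 z \<in> K}"
  have "Dz \<subseteq> ?M"
    unfolding demazure_def
  proof (rule R2.env_orbit_minimal)
    show "csubspace ?M"
      by (rule csubspaceI) (simp_all add: csubspace_0[OF K_subspace] csubspace_add[OF K_subspace]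
          csubspace_scale[OF K_subspace] pure_tensor_add_right pure_tensor_scale_right)
    show "u \<in> ?M" by (simp add: u_in T.env_orbit_base)
    fix x z assume x: "x \<in> borel_sub D" and z: "z \<in> ?M"
    obtain h a where x': "x = cart h + a" "a \<in> n_plus D" using x by (auto simp: borel_sub_def)
    have "rep_act R1 x v1 = lam h *\<^sub>C v1"
      using R1.weight_spaceD(2)[OF one.v_weight, of h] n_plus_v1[OF x'(2)] by (simp add: x'(1) R1.act_add_left)
    then have "pure_tensor v1 (rep_act R2 x z) = rep_act T x (pure_tensor v1 z) - lam h *\<^sub>C pure_tensor v1 z"
      using z by (simp add: tensor_act_pure pure_tensor_scale_left)
    also have "\<dots> \<in> K" using z by (intro csubspace_diff[OF K_subspace] csubspace_scale[OF K_subspace] K_act) auto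
    finally show "rep_act R2 x z \<in> ?M" using z by simp
  qed
  then show "z \<in> Dz \<Longrightarrow> pure_tensor v1 z \<in> K" by blast
qed

text \<open>Nonempty words in the \<open>f_i\<close> are orthogonal to the singular vector
  \<open>s\<close>; the empty word gives the product of \<open>\<phi> s\<close> with an element of
  the Demazure module.\<close>

lemma orth_K:
  assumes s: "s \<in> TS" "\<And>i. rep_act T (e i) s = 0" "\<And>z. z \<in> Dz \<Longrightarrow> B2 (\<phi> s) z = 0" and k: "k \<in> K"
  shows "BT s k = 0"
proof -
  let ?C = "pure_tensor v1 ` Dz"
  have sT: "s \<in> rep_space T" using s(1) by simp
  have CS: "?C \<subseteq> rep_space T" using Dz_S by (auto intro: tensor_space_pure)
  have sub: "K \<subseteq> cspan {foldr (\<lambda>i. rep_act T (f i)) w x |w x. x \<in> ?C}"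
  proof (rule T.orbit_subset_fwords[OF _ CS])
    show "csubspace ?C"
    proof (rule csubspaceI)
      show "0 \<in> ?C" using csubspace_0[OF Dz_subspace] by (intro image_eqI[of _ _ 0]) simp_all
      show "a + b \<in> ?C" if "a \<in> ?C" "b \<in> ?C" for a b
        using that csubspace_add[OF Dz_subspace] by (auto simp: pure_tensor_add_right[symmetric])
      show "c *\<^sub>C a \<in> ?C" if "a \<in> ?C" for c a
        using that csubspace_scale[OF Dz_subspace] by (auto simp: pure_tensor_scale_right[symmetric])
    qed
    show "rep_act T (e i) x \<in> ?C" if "x \<in> ?C" for i x
      using that Dz_S Dz_borel[OF e_borel] by (auto simp: tensor_act_pure one.e_v)
    show "rep_act T (cart h) x \<in> ?C" if x: "x \<in> ?C" for h x
    proof -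
      obtain z where z: "z \<in> Dz" "x = pure_tensor v1 z" using x by blast
      have "rep_act T (cart h) x = pure_tensor v1 (lam h *\<^sub>C z + rep_act R2 (cart h) z)"
        using z Dz_S R1.weight_spaceD(2)[OF one.v_weight, of h]
        by (auto simp: tensor_act_pure pure_tensor_add_right pure_tensor_scale_right pure_tensor_scale_left)
      moreover have "lam h *\<^sub>C z + rep_act R2 (cart h) z \<in> Dz"
        using z Dz_borel[OF h_borel] by (intro csubspace_add[OF Dz_subspace] csubspace_scale[OF Dz_subspace])
      ultimately show ?thesis by blast
    qed
    show "pure_tensor v1 u \<in> ?C" using u_Dz by blast
  qed
  have orth: "BT s x = 0" if x: "x \<in> {foldr (\<lambda>i. rep_act T (f i)) w x |w x. x \<in> ?C}" for x
  proof -
    obtain w z where z: "z \<in> Dz" "x = foldr (\<lambda>i. rep_act T (f i)) w (pure_tensor v1 z)" using x by blast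
    have pz: "pure_tensor v1 z \<in> rep_space T" using CS z(1) by blast
    show ?thesis
    proof (cases w)
      case Nil
      then show ?thesis using B2_\<phi>[OF s(1), of z] s(3)[OF z(1)] z Dz_S by auto
    next
      case (Cons i w')
      then show ?thesis using T.singular_orth_f[OF s(2) sT T.foldr_in[OF pz]] by (simp add: z(2))
    qed
  qed
  have S: "{foldr (\<lambda>i. rep_act T (f i)) w x |w x. x \<in> ?C} \<subseteq> rep_space T"
    using CS T.foldr_in by blast
  show ?thesis by (rule T.orth_cspan[OF S sT orth subsetD[OF sub k]])
qed

text \<open>The projection is constructed for weight vectors, by way of finite-dimensional weight
  spaces; additivity of \<open>\<pi>\<close> is accordingly stated within one weight space.\<close>

lemma \<pi>_props:
  assumes "y \<in> weight_space D R2 \<gamma>"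
  shows "\<pi> y \<in> Dz" "z \<in> Dz \<Longrightarrow> B2 (y - \<pi> y) z = 0"
proof -
  have yS: "y \<in> R2.S" using assms by (rule R2.weight_spaceD)
  obtain t where t: "t \<in> Dz" "\<And>s. s \<in> Dz \<Longrightarrow> B2 (y - t) s = 0"
    by (rule C2.orth_decomp[OF Dz_subspace Dz_S _ assms]) (use Dz_borel[OF h_borel] in auto)
  then have "\<pi> y = t" by (intro two.orth_proj_eqI[OF Dz_subspace Dz_S yS])
  with t show "\<pi> y \<in> Dz" "z \<in> Dz \<Longrightarrow> B2 (y - \<pi> y) z = 0" by auto
qed

lemma \<pi>_eqI:
  assumes "y \<in> R2.S" "y' \<in> weight_space D R2 \<gamma>" "\<And>z. z \<in> Dz \<Longrightarrow> B2 (y - y') z = 0"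
  shows "\<pi> y = \<pi> y'"
proof (rule two.orth_proj_eqI[OF Dz_subspace Dz_S assms(1) \<pi>_props(1)[OF assms(2)]])
  fix z assume z: "z \<in> Dz"
  have S: "y' \<in> R2.S" "\<pi> y' \<in> R2.S" "z \<in> R2.S"
    using R2.weight_spaceD(1)[OF assms(2)] \<pi>_props(1)[OF assms(2)] z Dz_S by auto
  have "B2 (y - \<pi> y') z = B2 (y - y') z + B2 (y' - \<pi> y') z"
    using assms(1) S by (simp add: two.diff_left)
  then show "B2 (y - \<pi> y') z = 0" using assms(3)[OF z] \<pi>_props(2)[OF assms(2) z] by simp
qed

lemma \<pi>_add:
  assumes "y \<in> weight_space D R2 \<gamma>" "y' \<in> weight_space D R2 \<gamma>"
  shows "\<pi> (y + y') = \<pi> y + \<pi> y'"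
proof (rule two.orth_proj_eqI[OF Dz_subspace Dz_S])
  show "\<pi> y + \<pi> y' \<in> Dz" using assms by (intro csubspace_add[OF Dz_subspace] \<pi>_props(1))
  have S: "y \<in> R2.S" "y' \<in> R2.S" "\<pi> y \<in> R2.S" "\<pi> y' \<in> R2.S"
    using R2.weight_spaceD(1) assms \<pi>_props(1) Dz_S by blast+
  then show "y + y' \<in> R2.S" by simp
  fix z assume z: "z \<in> Dz"
  then have zS: "z \<in> R2.S" using Dz_S by blast
  have "B2 (y + y' - (\<pi> y + \<pi> y')) z = B2 (y - \<pi> y) z + B2 (y' - \<pi> y') z"
    using S zS by (simp add: two.diff_left two.add_left)
  then show "B2 (y + y' - (\<pi> y + \<pi> y')) z = 0" using \<pi>_props(2)[OF assms(1) z] \<pi>_props(2)[OF assms(2) z] by simp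
qed

lemma \<pi>_scale:
  assumes "y \<in> weight_space D R2 \<gamma>"
  shows "\<pi> (a *\<^sub>C y) = a *\<^sub>C \<pi> y"
proof (rule two.orth_proj_eqI[OF Dz_subspace Dz_S])
  show "a *\<^sub>C \<pi> y \<in> Dz" using assms by (intro csubspace_scale[OF Dz_subspace] \<pi>_props(1))
  have S: "y \<in> R2.S" "\<pi> y \<in> R2.S"
    using R2.weight_spaceD(1) assms \<pi>_props(1) Dz_S by blast+
  then show "a *\<^sub>C y \<in> R2.S" by simp
  fix z assume z: "z \<in> Dz"
  then have zS: "z \<in> R2.S" using Dz_S by blast
  have "B2 (a *\<^sub>C y - a *\<^sub>C \<pi> y) z = a * B2 (y - \<pi> y) z"
    using S zS by (simp add: two.scale_left flip: scaleC_diff_right)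
  then show "B2 (a *\<^sub>C y - a *\<^sub>C \<pi> y) z = 0" using \<pi>_props(2)[OF assms z] by simp
qed

text \<open>For the component \<open>k\<close> in \<open>K\<close>, the square norm of
  \<open>e_i k\<close> is minus the product of \<open>s - k\<close> with \<open>f_i e_i k\<close>;
  the latter lies in \<open>K\<close>, so the norm is 0.\<close>

lemma sing_component:
  assumes s: "s \<in> sing D T TS nu"
  obtains k where "k \<in> sing D T K nu" "\<And>t. t \<in> K \<Longrightarrow> BT (s - k) t = 0"
proof -
  have "\<exists>k. k \<in> K \<and> k \<in> weight_space D T nu \<and> (\<forall>t\<in>K. BT (s - k) t = 0)"
    by (rule CT.orth_decomp[OF K_subspace K_S K_act singD(3)[OF s]]) auto
  then obtain k where k: "k \<in> K" "k \<in> weight_space D T nu" "\<And>t. t \<in> K \<Longrightarrow> BT (s - k) t = 0"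
    by blast
  have S: "s \<in> rep_space T" "k \<in> rep_space T" using singD(1)[OF s] k(1) K_S by auto
  have "rep_act T (e i) k = 0" for i
  proof (rule T.definite)
    let ?x = "rep_act T (e i) k"
    show x: "?x \<in> rep_space T" by (rule T.act_in[OF S(2)])
    have "rep_act T (e i) (s - k) = - ?x"
      using singD(2)[OF s] S by (simp only: T.act_diff_right diff_0)
    then have "BT (- ?x) ?x = BT (s - k) (rep_act T (f i) ?x)"
      using T.B_e[OF T.S_diff[OF S] x, of i] by simp
    also have "\<dots> = 0" by (intro k(3) K_act k(1))
    finally show "BT ?x ?x = 0" using T.diff_left[OF T.S_0 x x] T.zero_left[OF x] by simp
  qed
  then have "k \<in> sing D T K nu" using k by (simp add: sing_def)
  with k(3) that show ?thesis by blast
qed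

text \<open>Replacing a singular preimage by its component in \<open>K\<close> does not change the
  projection, since \<open>\<phi>\<close> of the difference is orthogonal to the Demazure
  module.\<close>

lemma D_space_w_eq: "D_space_w D R2 B2 u lam nu = (\<lambda>s. \<pi> (\<phi> s)) ` sing D T K nu"
  unfolding D_space_w_def
proof (intro equalityI subsetI)
  fix x assume "x \<in> \<pi> ` D_space D R2 lam nu"
  then obtain y where y: "y \<in> D_space D R2 lam nu" "x = \<pi> y" by blast
  obtain s where s: "s \<in> sing D T TS nu" "\<phi> s = y" using \<phi>_surjective[OF y(1)] by blast
  obtain k where k: "k \<in> sing D T K nu" "\<And>t. t \<in> K \<Longrightarrow> BT (s - k) t = 0" by (rule sing_component[OF s(1)]) blast
  have S: "s \<in> TS" "k \<in> TS" using singD(1) s(1) k(1) by blast+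
  have "\<pi> (\<phi> s) = \<pi> (\<phi> k)"
  proof (rule \<pi>_eqI[OF \<phi>_in[OF S(1)] \<phi>_weight[OF singD(3)[OF k(1)]]])
    fix z assume z: "z \<in> Dz"
    then have "z \<in> R2.S" using Dz_S by blast
    then have "B2 (\<phi> (s - k)) z = BT (s - k) (pure_tensor v1 z)"
      using S csubspace_diff[OF tensor_space_subspace] by (intro B2_\<phi>) blast+
    then show "B2 (\<phi> s - \<phi> k) z = 0" using k(2)[OF pure_in_K[OF z]] by (simp add: \<phi>_diff)
  qed
  then show "x \<in> (\<lambda>s. \<pi> (\<phi> s)) ` sing D T K nu" using k(1) by (intro image_eqI[of _ _ k]) (simp_all add: y(2) s(2)[symmetric])
next
  fix x assume "x \<in> (\<lambda>s. \<pi> (\<phi> s)) ` sing D T K nu"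
  then show "x \<in> \<pi> ` D_space D R2 lam nu" using \<phi>_sing by blast
qed

text \<open>A vector in the kernel is orthogonal to \<open>K\<close> and lies in it, so it is
  orthogonal to itself.\<close>

lemma dim_D_space_w:
  assumes A: "csubspace (sing D T K nu)" "fin_dim (sing D T K nu)"
  shows "fin_dim (D_space_w D R2 B2 u lam nu)" "cdim (D_space_w D R2 B2 u lam nu) = cdim (sing D T K nu)"
proof -
  have ker: "s = 0" if s: "s \<in> sing D T K nu" "\<pi> (\<phi> s) = 0" for s
  proof (rule T.definite)
    show "s \<in> rep_space T" using singD(1)[OF s(1)] by simp
    show "BT s s = 0"
      using \<pi>_props(2)[OF \<phi>_weight[OF singD(3)[OF s(1)]]] s(2)
      by (intro orth_K[OF singD(1)[OF s(1)] singD(2)[OF s(1)] _ singD(4)[OF s(1)]]) simp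
  qed
  have w: "\<phi> s \<in> weight_space D R2 (\<lambda>h. nu h - lam h)" if "s \<in> sing D T K nu" for s
    using \<phi>_weight[OF singD(3)[OF that]] .
  have add: "\<pi> (\<phi> (s + t)) = \<pi> (\<phi> s) + \<pi> (\<phi> t)" if "s \<in> sing D T K nu" "t \<in> sing D T K nu" for s t
    unfolding \<phi>_add by (rule \<pi>_add[OF w[OF that(1)] w[OF that(2)]])
  have scale: "\<pi> (\<phi> (a *\<^sub>C s)) = a *\<^sub>C \<pi> (\<phi> s)" if "s \<in> sing D T K nu" for a s
    unfolding \<phi>_scale by (rule \<pi>_scale[OF w[OF that]])
  note * = image_dim_eq[where \<psi> = "\<lambda>s. \<pi> (\<phi> s)", OF A add scale ker]
  show "fin_dim (D_space_w D R2 B2 u lam nu)" "cdim (D_space_w D R2 B2 u lam nu) = cdim (sing D T K nu)"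
    unfolding D_space_w_eq using * by blast+
qed

end

end

section \<open>Reduction to the given models of the irreducible modules\<close>

lemma (in km_algebra) dominant_real_weight: "\<gamma> \<in> dominant_weights D \<Longrightarrow> real_weight \<gamma>"
  and dominant_int: "\<gamma> \<in> dominant_weights D \<Longrightarrow> \<gamma> (co i) \<in> \<int>"
  by (auto simp: dominant_weights_def weight_lattice_def real_weight_def)

lemma (in km_algebra) dominant_nat:
  assumes "\<gamma> \<in> dominant_weights D"
  obtains m :: nat where "\<gamma> (co i) = of_nat m"
proof -
  obtain z :: int where z: "\<gamma> (co i) = of_int z" using dominant_int[OF assms, of i] by (auto elim: Ints_cases)
  moreover have "0 \<le> Re (\<gamma> (co i))" using assms by (simp add: dominant_weights_def)
  ultimately have "z \<ge> 0" by simp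
  then have "\<gamma> (co i) = of_nat (nat z)" by (simp add: z)
  then show ?thesis by (rule that)
qed

text \<open>Only the empty word has weight \<open>\<gamma>\<close>, so \<open>x\<close> is a nonzero
  multiple of a generating highest weight vector and inherits its properties.\<close>

lemma (in km_algebra) hw_model_at:
  assumes "irr_integrable_hw D \<gamma> R" "shapovalov_form D R B" "x \<in> weight_space D R \<gamma>" "x \<noteq> 0"
  shows "contra_hw D R B x \<gamma>" "env_orbit R UNIV x = rep_space R" "a \<in> n_plus D \<Longrightarrow> rep_act R a x = 0"
proof -
  obtain v where v: "v \<noteq> 0" "contra_hw D R B v \<gamma>" "env_orbit R UNIV v = rep_space R"
    "\<And>x. x \<in> n_plus D \<Longrightarrow> rep_act R x v = 0"
    by (rule hw_model[OF assms(1,2)]) blast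
  interpret V: contra_hw D R B v \<gamma> by (rule v(2))
  have "x \<in> range V.ev" using V.weight_spaceD(1)[OF assms(3)] v(3) V.env_orbit_eq by simp
  then have "x \<in> cspan (V.fw ` UNIV)" by (simp add: V.range_ev)
  then have "x \<in> cspan (V.fw ` {w \<in> UNIV. (\<lambda>h. \<gamma> h - wt D w h) = \<gamma>})"
    by (rule V.weight_space_cspan[OF V.fw_weight _ assms(3)])
  moreover have "{w \<in> UNIV. (\<lambda>h. \<gamma> h - wt D w h) = \<gamma>} = {[]}"
  proof -
    have "w = []" if "(\<lambda>h. \<gamma> h - wt D w h) = \<gamma>" for w
      using fun_cong[OF that, of hgt] by simp
    then show ?thesis by auto
  qed
  ultimately obtain c where c: "x = c *\<^sub>C v" by (auto simp: complex_vector.span_singleton)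
  show n: "rep_act R a x = 0" if "a \<in> n_plus D" for a
    using v(4)[OF that] by (simp add: c V.act_scale_right)
  show "contra_hw D R B x \<gamma>" by unfold_locales (use assms(3) n e_n_plus in auto)
  have "c \<noteq> 0" using assms(4) c by auto
  then have "v = (1 / c) *\<^sub>C x" by (simp add: c)
  then have "v \<in> env_orbit R UNIV x"
    using V.env_orbit_base csubspace_scale[OF V.env_orbit_subspace] by metis
  then show "env_orbit R UNIV x = rep_space R"
    using V.submodule_orbit[OF V.env_orbit_submodule] V.env_orbit_in V.weight_spaceD(1)[OF assms(3)] v(3) by blast
qed

theorem theorem3p8:
  fixes D :: "('i::finite, 'h::complex_vector, 'g::complex_vector) km_data"
    and V :: "('h \<Rightarrow> complex) \<Rightarrow> ('g, 'v::complex_vector) rep"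
    and shap :: "('h \<Rightarrow> complex) \<Rightarrow> 'v \<Rightarrow> 'v \<Rightarrow> complex"
    and lam mu nu :: "'h \<Rightarrow> complex"
    and w :: "('h \<Rightarrow> complex) \<Rightarrow> ('h \<Rightarrow> complex)"
    and v_lam v_wmu :: 'v
  assumes "kac_moody D" and "symmetrizable (gcm D)"
    and "\<forall>\<gamma>\<in>dominant_weights D. irr_integrable_hw D \<gamma> (V \<gamma>)"
    and "\<forall>\<gamma>\<in>dominant_weights D. shapovalov_form D (V \<gamma>) (shap \<gamma>)"
    and "lam \<in> dominant_weights D" and "mu \<in> dominant_weights D" and "nu \<in> dominant_weights D"
    and "w \<in> weyl_group D"
    and "v_lam \<in> weight_space D (V lam) lam" and "v_lam \<noteq> 0"
    and "v_wmu \<in> weight_space D (V mu) (w mu)" and "v_wmu \<noteq> 0"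
  shows "fin_dim (D_space_w D (V mu) (shap mu) v_wmu lam nu)
    \<and> cdim (D_space_w D (V mu) (shap mu) v_wmu lam nu)
        = rep_multiplicity D V (kostant_kumar (V lam) (V mu) v_lam v_wmu) nu"
proof -
  interpret sym_km_algebra D by unfold_locales (rule assms(1,2))+
  have V: "irr_integrable_hw D \<gamma> (V \<gamma>)" "shapovalov_form D (V \<gamma>) (shap \<gamma>)" if "\<gamma> \<in> dominant_weights D" for \<gamma>
    using assms(3,4) that by auto
  note V_lam = V[OF assms(5)] and V_mu = V[OF assms(6)]
  note one = hw_model_at[OF V_lam assms(9,10)]
  obtain v_mu where v_mu: "v_mu \<noteq> 0" "contra_hw D (V mu) (shap mu) v_mu mu" "env_orbit (V mu) UNIV v_mu = rep_space (V mu)"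
    by (rule hw_model[OF V_mu])
  interpret one: contra_hw D "V lam" "shap lam" v_lam lam by (rule one(1))
  interpret two: contra_hw D "V mu" "shap mu" v_mu mu by (rule v_mu(2))
  have "\<exists>n::nat. lam (co i) = of_nat n" for i using dominant_nat[OF assms(5), of i] by blast
  then obtain m where m: "\<And>i. lam (co i) = of_nat (m i)" by metis
  obtain BT where BT: "hermitian (tensor_space one.S two.S) BT" "\<forall>x\<in>one.S. \<forall>y\<in>two.S. \<forall>x'\<in>one.S. \<forall>y'\<in>two.S.
      BT (pure_tensor x y) (pure_tensor x' y') = shap lam x x' * shap mu y y'"
    using hermitian_tensor[OF one.hermitian_axioms two.hermitian_axioms] by blast
  interpret hw_tensor D "V lam" "V mu" "shap lam" v_lam lam "shap mu" v_mu mu m BT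
  proof (intro hw_tensor.intro hw_tensor_axioms.intro)
    show "tensor_km D (V lam) (V mu)" "sym_km_algebra D" by unfold_locales
    show "\<exists>n. (rep_act (V lam) (f i) ^^ n) x = 0" if "x \<in> rep_space (V lam)" for x i
      using V_lam(1) that by (simp add: irr_integrable_hw_def integrable_rep_def)
    show "\<exists>n. (rep_act (V mu) (f i) ^^ n) x = 0" if "x \<in> rep_space (V mu)" for x i
      using V_mu(1) that by (simp add: irr_integrable_hw_def integrable_rep_def)
  qed (use assms(10) one v_mu m BT dominant_real_weight[OF assms(5)] dominant_real_weight[OF assms(6)]
      dominant_int[OF assms(6)] in auto)
  have K: "kostant_kumar (V lam) (V mu) v_lam v_wmu = T \<lparr> rep_space := K v_wmu \<rparr>"
    by (simp add: kostant_kumar_def)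
  interpret M: cat_models D T BT "\<lambda>(w1, w2). pure_tensor (one.fw w1) (two.fw w2)" "\<lambda>(w1, w2). w1 @ w2"
    "\<lambda>h. lam h + mu h" V shap "K v_wmu"
    by unfold_locales (use V K_submodule[OF assms(11)] in auto)
  show ?thesis
    unfolding K M.multiplicity_eq[OF assms(7)]
    using dim_D_space_w[OF assms(11) M.sing_subspace M.sing_fin_dim] by simp
qed

end
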